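(* Let $n>1$. There is a bijection between one-parameter families of isomorphism classes of quaternionic skew-Hermitian transvection involutive Lie algebras $(\mathfrak{g},\sigma,Q_o,e^{2t}\omega_o)$, $t\in\mathbb{R}$ (with $\mathfrak{m}$ of quaternionic dimension $n$), and $\mathsf{SO}^*(2n+4)$-conjugacy classes of 1-dimensional subalgebras $\mathfrak{t}\subset\mathfrak{so}^*(2n+4)$ represented by (i.e. spanned, up to conjugation, by) elements of the form $$\tau=\begin{pmatrix}a&0&d\\ 0&A&0\\ 1&0&a\end{pmatrix}$$ such that $a\in\mathfrak{sp}(1)$, $A\in\mathfrak{so}^*(2n)$ and $d\in\mathbb{R}$ satisfy the matrix equation $$Xd+2AXa-Xa^2-A^2X=0\qquad\text{for all }X\in\mathbb{H}^n.$$ For such a representative $\tau$, the reductive complement $\mathfrak{m}$ in the canonical decomposition $\mathfrak{g}=\mathfrak{l}\oplus\mathfrak{m}$ of $\mathfrak{g}$ is given by $$\mathfrak{m}=\left\{\begin{pmatrix}0&(AX-Xa)^*\mathbb{j}&0\\ X&0&AX-Xa\\ 0&-X^*\mathbb{j}&0\end{pmatrix}:X\in\mathbb{H}^n\right\}.$$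
   Context: **qs-H tiLas.** A transvection involutive Lie algebra (tiLa) is a pair $(\mathfrak{g},\sigma)$ of a finite-dimensional real Lie algebra $\mathfrak{g}$ and an involutive automorphism $\sigma$ with $\pm1$-eigenspaces $\mathfrak{l}$, $\mathfrak{m}$ (canonical decomposition $\mathfrak{g}=\mathfrak{l}\oplus\mathfrak{m}$) such that $\mathfrak{l}=[\mathfrak{m},\mathfrak{m}]$ and no non-zero ideal of $\mathfrak{g}$ is contained in $\mathfrak{l}$. A quaternionic skew-Hermitian tiLa (qs-H tiLa) is a quadruple $(\mathfrak{g},\sigma,Q_0,\omega_0)$ where $(\mathfrak{g},\sigma)$ is a tiLa, $Q_0\subset\mathrm{End}(\mathfrak{m})$ is a linear quaternionic structure (a 3-dimensional subspace spanned by $J_1,J_2,J_3$ with $J_a^2=-\mathrm{Id}$, $J_1J_2=J_3=-J_2J_1$), $\omega_0$ is a non-degenerate 2-form on $\mathfrak{m}$ with $\omega_0(JX,JY)=\omega_0(X,Y)$ for all $J\in Q_0$ with $J^2=-\mathrm{Id}$, and both $Q_0$ and $\omega_0$ are invariant under the adjoint action of $\mathfrak{l}$ on $\mathfrak{m}$. Here $\dim_{\mathbb{R}}\mathfrak{m}=4n$. Two qs-H tiLas $(\mathfrak{g}_i,\sigma_i,Q_i,\omega_i)$ are isomorphic if there is a Lie algebra isomorphism $\varphi:\mathfrak{g}_1\to\mathfrak{g}_2$ with $\varphi\circ\sigma_1=\sigma_2\circ\varphi$, $\varphi^*Q_2=Q_1$, $\varphi^*\omega_2=\omega_1$. The one-parameter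 family of $(\mathfrak{g},\sigma,Q_o,\omega_o)$ consists of the isomorphism classes of $(\mathfrak{g},\sigma,Q_o,e^{2t}\omega_o)$, $t\in\mathbb{R}$. **Matrix model.** $\mathbb{j}\in\mathrm{Mat}_n(\mathbb{H})$ is a fixed non-degenerate skew-Hermitian matrix (the matrix of the scalar 2-form on $\mathbb{H}^n$), $*$ is conjugate transpose, $\mathfrak{sp}(1)=\mathrm{Im}\,\mathbb{H}$, and $\mathfrak{so}^*(2n)=\{A\in\mathrm{Mat}_n(\mathbb{H}):A^*\mathbb{j}+\mathbb{j}A=0\}$. The Lie algebra $\mathfrak{so}^*(2n+4)$ consists of the quaternionic $(n+2)\times(n+2)$ matrices $$\begin{pmatrix}a&Y^*\mathbb{j}&d\\ X&A&Y\\ c&-X^*\mathbb{j}&-a^*\end{pmatrix},\quad a\in\mathbb{H},\ X,Y\in\mathbb{H}^n,\ c,d\in\mathbb{R},\ A\in\mathfrak{so}^*(2n),$$ and $\mathsf{SO}^*(2n+4)=\{g:g^*Fg=F\}$ with $F=\begin{pmatrix}0&0&1\\ 0&\mathbb{j}&0\\ -1&0&0\end{pmatrix}$ is the corresponding group. **The correspondence.** For $\mathfrak{t}=\mathbb{R}\tau$ as in the claim, the displayed space $\mathfrak{m}$ lies in the centralizer $Z(\mathfrak{t})$ of $\mathfrak{t}$ in $\mathfrak{so}^*(2n+4)$ and is regarded as a subspace of the Lie algebra $Z(\mathfrak{t})/\mathfrak{t}$. The associated qs-H tiLas have $\mathfrak{g}=\mathfrak{m}\oplus[\mathfrak{m},\mathfrak{m}]\subset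 Z(\mathfrak{t})/\mathfrak{t}$ (brackets in $Z(\mathfrak{t})/\mathfrak{t}$), $\sigma=-\mathrm{id}$ on $\mathfrak{m}$ and $\mathrm{id}$ on $[\mathfrak{m},\mathfrak{m}]$, $Q_o$ spanned by right multiplications by imaginary quaternions on $\mathfrak{m}\cong\mathbb{H}^n$ (via the parameter $X$), and $\omega_o$, up to positive scale, the bottom-left entry of the $\mathfrak{so}^*(2n+4)$-commutator of two elements of $\mathfrak{m}$.
   Formalization: The bijection is with conjugacy classes of 1-dimensional subalgebras t=Rτ together with the ray of positive multiples of τ (oriented lines). With bare subalgebras the claim fails, e.g. for n=3: there are 8 one-parameter families but only 7 conjugacy classes. *)

theory Defs
  imports "HOL-Analysis.Analysis" "HOL-Algebra.AbelCoset" "Jordan_Normal_Form.Missing_VectorSpace"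
begin

section \<open>Quaternions and quaternionic matrices\<close>

datatype quat = Quat (qRe: real) (qI: real) (qJ: real) (qK: real)

instantiation quat :: real_algebra_1
begin

definition "0 = Quat 0 0 0 0"
definition "1 = Quat 1 0 0 0"
definition "x + y = Quat (qRe x + qRe y) (qI x + qI y) (qJ x + qJ y) (qK x + qK y)"
definition "- x = Quat (- qRe x) (- qI x) (- qJ x) (- qK x)"
definition "x - y = Quat (qRe x - qRe y) (qI x - qI y) (qJ x - qJ y) (qK x - qK y)"
definition "r *\<^sub>R x = Quat (r * qRe x) (r * qI x) (r * qJ x) (r * qK x)"
definition "x * y = Quat
  (qRe x * qRe y - qI x * qI y - qJ x * qJ y - qK x * qK y)
  (qRe x * qI y + qI x * qRe y + qJ x * qK y - qK x * qJ y)
  (qRe x * qJ y - qI x * qK y + qJ x * qRe y + qK x * qI y)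
  (qRe x * qK y + qI x * qJ y - qJ x * qI y + qK x * qRe y)"

instance
  by standard
    (simp_all add: zero_quat_def one_quat_def plus_quat_def uminus_quat_def minus_quat_def
      scaleR_quat_def times_quat_def algebra_simps)

end

definition qcnj :: "quat \<Rightarrow> quat" where
  "qcnj x = Quat (qRe x) (- qI x) (- qJ x) (- qK x)"

definition sp1 :: "quat set" where
  "sp1 = {q. qRe q = 0}"

definition adj :: "quat^'n^'m \<Rightarrow> quat^'m^'n" where
  "adj M = (\<chi> i k. qcnj (M $ k $ i))"

(* The space H^n is a right H-module: scalars multiply on the right, matrices act on the left. *)
definition vscale :: "quat^'n \<Rightarrow> quat \<Rightarrow> quat^'n"  (infixl \<open>\<cdot>\<close> 75) where
  "X \<cdot> q = (\<chi> i. X $ i * q)"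

(* the row vector Y^* M *)
definition star_row :: "quat^'n \<Rightarrow> quat^'n^'n \<Rightarrow> quat^'n" where
  "star_row Y M = (\<chi> k. \<Sum>i\<in>UNIV. qcnj (Y $ i) * M $ i $ k)"

definition so_star :: "quat^'n^'n \<Rightarrow> (quat^'n^'n) set" where
  "so_star j = {A. adj A ** j + j ** A = 0}"

section \<open>The algebra \<open>so*(2n+4)\<close> in block form\<close>

(* row and column indices of (n+2) x (n+2) matrices *)
datatype 'n ext = First | Mid 'n | Last

instance ext :: (finite) finite
proof
  have "(UNIV :: 'a ext set) = insert First (insert Last (range Mid))"
    using ext.exhaust by auto
  then show "finite (UNIV :: 'a ext set)" by (metis finite finite_imageI finite_insert)
qed

(* The second and the eighth argument are row vectors, the fourth and the sixth are columns. *)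
definition block :: "quat \<Rightarrow> quat^'n \<Rightarrow> quat \<Rightarrow> quat^'n \<Rightarrow> quat^'n^'n \<Rightarrow> quat^'n
    \<Rightarrow> quat \<Rightarrow> quat^'n \<Rightarrow> quat \<Rightarrow> quat^('n ext)^('n ext)" where
  "block a r d X A Y c s e = (\<chi> p q. case p of
       First \<Rightarrow> (case q of First \<Rightarrow> a | Mid k \<Rightarrow> r $ k | Last \<Rightarrow> d)
     | Mid i \<Rightarrow> (case q of First \<Rightarrow> X $ i | Mid k \<Rightarrow> A $ i $ k | Last \<Rightarrow> Y $ i)
     | Last \<Rightarrow> (case q of First \<Rightarrow> c | Mid k \<Rightarrow> s $ k | Last \<Rightarrow> e))"

definition so_star_ext :: "quat^'n^'n \<Rightarrow> (quat^('n ext)^('n ext)) set" where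
  "so_star_ext j = {block a (star_row Y j) (of_real d) X A Y (of_real c) (- star_row X j) (- qcnj a)
     | a X Y c d A. A \<in> so_star j}"

definition F_mat :: "quat^'n^'n \<Rightarrow> quat^('n ext)^('n ext)" where
  "F_mat j = block 0 0 1 0 j 0 (- 1) 0 0"

definition SO_star_ext :: "quat^'n^'n \<Rightarrow> (quat^('n ext)^('n ext)) set" where
  "SO_star_ext j = {g. adj g ** F_mat j ** g = F_mat j}"

definition commutator :: "quat^'k^'k \<Rightarrow> quat^'k^'k \<Rightarrow> quat^'k^'k" where
  "commutator M N = M ** N - N ** M"

section \<open>Finite-dimensional real Lie algebras\<close>

definition real_ring :: "real ring" where
  "real_ring = \<lparr>carrier = UNIV, mult = (*), one = 1, zero = 0, add = (+)\<rparr>"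

(* The fields mult and one inherited from the module record are not used. *)
record 'a lie_alg = "(real, 'a) module" +
  lie :: "'a \<Rightarrow> 'a \<Rightarrow> 'a"

definition lie_algebra :: "'a lie_alg \<Rightarrow> bool" where
  "lie_algebra L \<longleftrightarrow> vectorspace real_ring L \<and> vectorspace.fin_dim real_ring L \<and>
     (\<forall>x\<in>carrier L. lie L x \<in> module_hom real_ring L L \<and>
        (\<lambda>y. lie L y x) \<in> module_hom real_ring L L \<and> lie L x x = \<zero>\<^bsub>L\<^esub>) \<and>
     (\<forall>x\<in>carrier L. \<forall>y\<in>carrier L. \<forall>z\<in>carrier L.
        lie L x (lie L y z) \<oplus>\<^bsub>L\<^esub> lie L y (lie L z x) \<oplus>\<^bsub>L\<^esub> lie L z (lie L x y) = \<zero>\<^bsub>L\<^esub>)"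

definition lie_iso :: "'a lie_alg \<Rightarrow> 'b lie_alg \<Rightarrow> ('a \<Rightarrow> 'b) \<Rightarrow> bool" where
  "lie_iso L M f \<longleftrightarrow> f \<in> module_hom real_ring L M \<and> bij_betw f (carrier L) (carrier M) \<and>
     (\<forall>x\<in>carrier L. \<forall>y\<in>carrier L. f (lie L x y) = lie M (f x) (f y))"

definition lie_ideal :: "'a lie_alg \<Rightarrow> 'a set \<Rightarrow> bool" where
  "lie_ideal L I \<longleftrightarrow> VectorSpace.subspace real_ring I L \<and> (\<forall>x\<in>carrier L. \<forall>y\<in>I. lie L x y \<in> I)"

(* the linear span of all brackets of two elements of S *)
definition lie_span :: "'a lie_alg \<Rightarrow> 'a set \<Rightarrow> 'a set" where
  "lie_span L S = LinearCombinations.module.span real_ring L {lie L x y | x y. x \<in> S \<and> y \<in> S}"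

definition matrix_lie :: "(quat^'k^'k) set \<Rightarrow> (quat^'k^'k) lie_alg" where
  "matrix_lie S = \<lparr>carrier = S, mult = undefined, one = undefined, zero = 0, add = (+),
     smult = (*\<^sub>R), lie = commutator\<rparr>"

definition quotient_lie :: "'a lie_alg \<Rightarrow> 'a set \<Rightarrow> 'a set lie_alg" where
  "quotient_lie L I = \<lparr>carrier = a_rcosets\<^bsub>L\<^esub> I, mult = undefined, one = undefined,
     zero = I, add = set_add L,
     smult = (\<lambda>r C. \<Union>x\<in>C. I +>\<^bsub>L\<^esub> (r \<odot>\<^bsub>L\<^esub> x)),
     lie = (\<lambda>C D. \<Union>x\<in>C. \<Union>y\<in>D. I +>\<^bsub>L\<^esub> lie L x y)\<rparr>"

section \<open>Quaternionic skew-Hermitian tiLas\<close>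

definition plus_space :: "'a lie_alg \<Rightarrow> ('a \<Rightarrow> 'a) \<Rightarrow> 'a set" where
  "plus_space L \<sigma> = {x \<in> carrier L. \<sigma> x = x}"

definition minus_space :: "'a lie_alg \<Rightarrow> ('a \<Rightarrow> 'a) \<Rightarrow> 'a set" where
  "minus_space L \<sigma> = {x \<in> carrier L. \<sigma> x = \<ominus>\<^bsub>L\<^esub> x}"

definition tila :: "'a lie_alg \<Rightarrow> ('a \<Rightarrow> 'a) \<Rightarrow> bool" where
  "tila L \<sigma> \<longleftrightarrow> lie_algebra L \<and> lie_iso L L \<sigma> \<and> (\<forall>x\<in>carrier L. \<sigma> (\<sigma> x) = x) \<and>
     plus_space L \<sigma> = lie_span L (minus_space L \<sigma>) \<and>
     (\<forall>I. lie_ideal L I \<and> I \<subseteq> plus_space L \<sigma> \<longrightarrow> I = {\<zero>\<^bsub>L\<^esub>})"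

(* Endomorphisms of m are extensional functions, so that equality of endomorphisms
   and of sets of endomorphisms only depends on the values on m. *)
definition End_sub :: "'a lie_alg \<Rightarrow> 'a set \<Rightarrow> ('a \<Rightarrow> 'a) set" where
  "End_sub L m = module_hom real_ring (L\<lparr>carrier := m\<rparr>) (L\<lparr>carrier := m\<rparr>) \<inter> extensional m"

definition lincomb3 :: "'a lie_alg \<Rightarrow> 'a set \<Rightarrow> ('a \<Rightarrow> 'a) \<Rightarrow> ('a \<Rightarrow> 'a) \<Rightarrow> ('a \<Rightarrow> 'a)
    \<Rightarrow> real \<Rightarrow> real \<Rightarrow> real \<Rightarrow> 'a \<Rightarrow> 'a" where
  "lincomb3 L m J1 J2 J3 a b c =
     restrict (\<lambda>x. a \<odot>\<^bsub>L\<^esub> J1 x \<oplus>\<^bsub>L\<^esub> b \<odot>\<^bsub>L\<^esub> J2 x \<oplus>\<^bsub>L\<^esub> c \<odot>\<^bsub>L\<^esub> J3 x) m"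

definition complex_str :: "'a lie_alg \<Rightarrow> 'a set \<Rightarrow> ('a \<Rightarrow> 'a) \<Rightarrow> bool" where
  "complex_str L m J \<longleftrightarrow> (\<forall>x\<in>m. J (J x) = \<ominus>\<^bsub>L\<^esub> x)"

definition quaternionic_structure :: "'a lie_alg \<Rightarrow> 'a set \<Rightarrow> ('a \<Rightarrow> 'a) set \<Rightarrow> bool" where
  "quaternionic_structure L m Q \<longleftrightarrow> (\<exists>J1\<in>End_sub L m. \<exists>J2\<in>End_sub L m. \<exists>J3\<in>End_sub L m.
     complex_str L m J1 \<and> complex_str L m J2 \<and> complex_str L m J3 \<and>
     (\<forall>x\<in>m. J1 (J2 x) = J3 x \<and> J3 x = \<ominus>\<^bsub>L\<^esub> J2 (J1 x)) \<and>
     (\<forall>a b c. lincomb3 L m J1 J2 J3 a b c = lincomb3 L m J1 J2 J3 0 0 0 \<longrightarrow> a = 0 \<and> b = 0 \<and> c = 0) \<and>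
     Q = {lincomb3 L m J1 J2 J3 a b c | a b c. True})"

definition symplectic_form :: "'a lie_alg \<Rightarrow> 'a set \<Rightarrow> ('a \<Rightarrow> 'a \<Rightarrow> real) \<Rightarrow> bool" where
  "symplectic_form L m \<omega> \<longleftrightarrow>
     (\<forall>x\<in>m. \<forall>y\<in>m. \<forall>z\<in>m. \<omega> (x \<oplus>\<^bsub>L\<^esub> y) z = \<omega> x z + \<omega> y z) \<and>
     (\<forall>r. \<forall>x\<in>m. \<forall>y\<in>m. \<omega> (r \<odot>\<^bsub>L\<^esub> x) y = r * \<omega> x y) \<and>
     (\<forall>x\<in>m. \<forall>y\<in>m. \<omega> x y = - \<omega> y x) \<and>
     (\<forall>x\<in>m. (\<forall>y\<in>m. \<omega> x y = 0) \<longrightarrow> x = \<zero>\<^bsub>L\<^esub>)"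

record 'a qsh =
  alg :: "'a lie_alg"
  invol :: "'a \<Rightarrow> 'a"
  qstr :: "('a \<Rightarrow> 'a) set"
  form :: "'a \<Rightarrow> 'a \<Rightarrow> real"

abbreviation l_part :: "'a qsh \<Rightarrow> 'a set" where
  "l_part T \<equiv> plus_space (alg T) (invol T)"

abbreviation m_part :: "'a qsh \<Rightarrow> 'a set" where
  "m_part T \<equiv> minus_space (alg T) (invol T)"

definition qsh_tila :: "'a qsh \<Rightarrow> bool" where
  "qsh_tila T \<longleftrightarrow> tila (alg T) (invol T) \<and>
     quaternionic_structure (alg T) (m_part T) (qstr T) \<and>
     symplectic_form (alg T) (m_part T) (form T) \<and>
     (\<forall>J\<in>qstr T. complex_str (alg T) (m_part T) J \<longrightarrow>
        (\<forall>x\<in>m_part T. \<forall>y\<in>m_part T. form T (J x) (J y) = form T x y)) \<and>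
     (\<forall>\<xi>\<in>l_part T. \<forall>J\<in>qstr T.
        restrict (\<lambda>x. lie (alg T) \<xi> (J x) \<ominus>\<^bsub>alg T\<^esub> J (lie (alg T) \<xi> x)) (m_part T) \<in> qstr T) \<and>
     (\<forall>\<xi>\<in>l_part T. \<forall>x\<in>m_part T. \<forall>y\<in>m_part T.
        form T (lie (alg T) \<xi> x) y + form T x (lie (alg T) \<xi> y) = 0)"

definition m_dim :: "'a qsh \<Rightarrow> nat" where
  "m_dim T = vectorspace.dim real_ring ((alg T)\<lparr>carrier := m_part T\<rparr>)"

definition qsh_iso :: "'a qsh \<Rightarrow> 'b qsh \<Rightarrow> bool" where
  "qsh_iso T1 T2 \<longleftrightarrow> (\<exists>\<phi>. lie_iso (alg T1) (alg T2) \<phi> \<and>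
     (\<forall>x\<in>carrier (alg T1). \<phi> (invol T1 x) = invol T2 (\<phi> x)) \<and>
     {restrict (\<lambda>x. inv_into (carrier (alg T1)) \<phi> (J (\<phi> x))) (m_part T1) | J. J \<in> qstr T2} = qstr T1 \<and>
     (\<forall>x\<in>m_part T1. \<forall>y\<in>m_part T1. form T2 (\<phi> x) (\<phi> y) = form T1 x y))"

(* Isomorphism classes are formed in the type nat => real, which is large enough to carry a copy of
   every finite-dimensional real vector space; T itself may live on any type. *)
definition iso_class :: "'a qsh \<Rightarrow> (nat \<Rightarrow> real) qsh set" where
  "iso_class T = {T'. qsh_tila T' \<and> qsh_iso T' T}"

definition one_param_family :: "'a qsh \<Rightarrow> (nat \<Rightarrow> real) qsh set set" where
  "one_param_family T = {iso_class (T\<lparr>form := \<lambda>x y. exp (2 * t) * form T x y\<rparr>) | t. True}"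

definition families :: "nat \<Rightarrow> (nat \<Rightarrow> real) qsh set set set" where
  "families n = {one_param_family T | T :: (nat \<Rightarrow> real) qsh. qsh_tila T \<and> m_dim T = 4 * n}"

section \<open>Subalgebras of \<open>so*(2n+4)\<close> and the associated tiLas\<close>

definition tau :: "quat \<Rightarrow> quat^'n^'n \<Rightarrow> real \<Rightarrow> quat^('n ext)^('n ext)" where
  "tau a A d = block a 0 (of_real d) 0 A 0 1 0 a"

definition admissible :: "quat^'n^'n \<Rightarrow> quat \<Rightarrow> quat^'n^'n \<Rightarrow> real \<Rightarrow> bool" where
  "admissible j a A d \<longleftrightarrow> a \<in> sp1 \<and> A \<in> so_star j \<and>
     (\<forall>X. X \<cdot> of_real d + 2 *\<^sub>R ((A *v X) \<cdot> a) - X \<cdot> a\<^sup>2 - (A ** A) *v X = 0)"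

(* The subalgebra R tau together with its orientation, the ray of positive multiples of tau.
   The normalisation of the bottom left entry of tau to +1 singles out this ray. The orientation
   is needed: R tau may be conjugate to R tau' by an element taking tau to a negative multiple
   of tau', and then the associated tiLas need not be isomorphic. This happens for n = 3,
   j = diag(i,i,i), a = 0, d = -1 with A = diag(-i,i,i) and A' = diag(i,i,i), where the isotropy
   algebras l are s(u(2)+u(1,2)) and s(u(2)+u(3)) inside g = su(3,2). *)
definition oriented_line :: "'v::real_vector \<Rightarrow> 'v set \<times> 'v set" where
  "oriented_line \<tau> = (span {\<tau>}, {s *\<^sub>R \<tau> | s. s > 0})"

definition conj_by :: "quat^'k^'k \<Rightarrow> quat^'k^'k \<Rightarrow> quat^'k^'k" where
  "conj_by g M = g ** M ** matrix_inv g"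

definition conj_class :: "quat^'n^'n \<Rightarrow> (quat^('n ext)^('n ext)) set \<times> (quat^('n ext)^('n ext)) set
    \<Rightarrow> ((quat^('n ext)^('n ext)) set \<times> (quat^('n ext)^('n ext)) set) set" where
  "conj_class j P = {(conj_by g ` fst P, conj_by g ` snd P) | g. g \<in> SO_star_ext j}"

definition subalgebra_classes :: "quat^'n^'n
    \<Rightarrow> ((quat^('n ext)^('n ext)) set \<times> (quat^('n ext)^('n ext)) set) set set" where
  "subalgebra_classes j = {conj_class j (oriented_line (tau a A d)) | a A d. admissible j a A d}"

definition centralizer :: "quat^'n^'n \<Rightarrow> quat^('n ext)^('n ext) \<Rightarrow> (quat^('n ext)^('n ext)) set" where
  "centralizer j \<tau> = {M \<in> so_star_ext j. commutator \<tau> M = 0}"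

definition m_elem :: "quat^'n^'n \<Rightarrow> quat \<Rightarrow> quat^'n^'n \<Rightarrow> quat^'n \<Rightarrow> quat^('n ext)^('n ext)" where
  "m_elem j a A X = block 0 (star_row (A *v X - X \<cdot> a) j) 0 X 0 (A *v X - X \<cdot> a) 0 (- star_row X j) 0"

definition Z_mod_t :: "quat^'n^'n \<Rightarrow> quat \<Rightarrow> quat^'n^'n \<Rightarrow> real \<Rightarrow> (quat^('n ext)^('n ext)) set lie_alg" where
  "Z_mod_t j a A d = quotient_lie (matrix_lie (centralizer j (tau a A d))) (span {tau a A d})"

(* the image in Z(t)/t of the element of m with parameter X *)
definition m_coset :: "quat^'n^'n \<Rightarrow> quat \<Rightarrow> quat^'n^'n \<Rightarrow> real \<Rightarrow> quat^'n \<Rightarrow> (quat^('n ext)^('n ext)) set" where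
  "m_coset j a A d X =
     span {tau a A d} +>\<^bsub>matrix_lie (centralizer j (tau a A d))\<^esub> m_elem j a A X"

definition assoc_qsh :: "quat^'n^'n \<Rightarrow> quat \<Rightarrow> quat^'n^'n \<Rightarrow> real \<Rightarrow> (quat^('n ext)^('n ext)) set qsh" where
  "assoc_qsh j a A d = (let Z = Z_mod_t j a A d; m = range (m_coset j a A d); l = lie_span Z m in
     \<lparr>alg = Z\<lparr>carrier := set_add Z m l\<rparr>,
      invol = (\<lambda>z. THE w. \<exists>x\<in>m. \<exists>y\<in>l. z = x \<oplus>\<^bsub>Z\<^esub> y \<and> w = (\<ominus>\<^bsub>Z\<^esub> x) \<oplus>\<^bsub>Z\<^esub> y),
      qstr = {J \<in> extensional m. \<exists>q\<in>sp1. \<forall>X. J (m_coset j a A d X) = m_coset j a A d (X \<cdot> q)},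
      form = (\<lambda>z w. THE r. \<exists>X Y. z = m_coset j a A d X \<and> w = m_coset j a A d Y \<and>
        of_real r = commutator (m_elem j a A X) (m_elem j a A Y) $ Last $ First)\<rparr>)"

end

theory Submission
  imports Defs
begin

text \<open>A frame identifies \<open>m\<close> with the quaternionic vector space in such a way that \<open>Q\<^sub>o\<close> consists of the right
  multiplications by imaginary quaternions and \<open>\<omega>\<^sub>o = - 2 Re h\<close>, where \<open>h\<close> is the form with matrix \<open>j\<close>. The
  triple bracket \<open>[[X, Y], Z]\<close> on \<open>m\<close> is then an algebraic curvature tensor with values in
  \<open>so*(2n) + sp(1)\<close>. By the first Bianchi identity it equals \<open>Rcur A a\<close> for a unique pair \<open>(A, a)\<close>, and by the
  Jacobi identity it annihilates itself, which forces \<open>X \<mapsto> A X - X a\<close> to square to a real scalar \<open>d\<close>: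
  this is the matrix equation. Conversely \<open>(A, a)\<close> determines the triple, because \<open>l = [m, m]\<close> acts faithfully
  on \<open>m\<close>. Two frames differ by an isometry of \<open>h\<close> and a unit quaternion, and rescaling \<open>\<omega>\<^sub>o\<close> multiplies
  \<open>(A, a)\<close> by a positive number, so that families correspond to pairs up to these operations.

  Elements of block diagonal form show that pairs equivalent in this sense give conjugate oriented lines
  of matrices \<open>\<tau>\<close>. For the converse, \<open>a \<noteq> 0\<close> implies \<open>A = 0\<close>, and all such pairs are equivalent. If
  \<open>a = 0\<close>, then \<open>\<tau>\<^sup>2 = d\<close>, and a quasi-reflection commuting with \<open>\<tau>\<close> brings a conjugating element into
  block diagonal form.\<close>

text \<open>The Bianchi step rests on the sp(1) part of a curvature,
  \<open>acur A a X Y = 4 Re h(X, Y) a + 2 Im h(A X, Y)\<close>: an average over the quaternion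
  units extracts \<open>A\<close>, the remainder gives \<open>a\<close>, and a curvature with values
  in so*(2n) alone vanishes. The obstacle is that \<open>h\<close> has isotropic vectors. Relations
  are therefore obtained first for orthogonal pairs whose first vector is anisotropic, and then
  spread by means of a basis with \<open>h(e, e) = i\<close>. Such a basis exists for every
  \<open>j\<close>, because each nonzero imaginary quaternion has the form
  \<open>qcnj p * i * p\<close> up to replacing \<open>p\<close> by its inverse: skew-Hermitian
  forms over H have no signature. For the same reason every abstract triple has a frame for the
  prescribed \<open>j\<close>. The condition n > 1 provides a nonzero vector orthogonal to a given
  one and a second basis vector. Equality of families and equality of conjugacy classes both reduce
  to the relation \<open>equivalent\<close>. Its positive factor is the rescaling of the form on one
  side and the ray of \<open>\<tau>\<close> on the other, so the orientation of the line is part of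
  the data.\<close>

lemmas quat_ops = zero_quat_def one_quat_def plus_quat_def uminus_quat_def minus_quat_def
  scaleR_quat_def times_quat_def

lemma quat_sel [simp]:
  "qRe 0 = 0" "qI 0 = 0" "qJ 0 = 0" "qK 0 = 0"
  "qRe 1 = 1" "qI 1 = 0" "qJ 1 = 0" "qK 1 = 0"
  "qRe (x + y) = qRe x + qRe y" "qI (x + y) = qI x + qI y"
  "qJ (x + y) = qJ x + qJ y" "qK (x + y) = qK x + qK y"
  "qRe (- x) = - qRe x" "qI (- x) = - qI x" "qJ (- x) = - qJ x" "qK (- x) = - qK x"
  "qRe (x - y) = qRe x - qRe y" "qI (x - y) = qI x - qI y"
  "qJ (x - y) = qJ x - qJ y" "qK (x - y) = qK x - qK y"
  "qRe (r *\<^sub>R x) = r * qRe x" "qI (r *\<^sub>R x) = r * qI x"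
  "qJ (r *\<^sub>R x) = r * qJ x" "qK (r *\<^sub>R x) = r * qK x"
  "qRe (qcnj x) = qRe x" "qI (qcnj x) = - qI x" "qJ (qcnj x) = - qJ x" "qK (qcnj x) = - qK x"
  by (simp_all add: quat_ops qcnj_def)

lemma quat_mult_sel:
  "qRe (x * y) = qRe x * qRe y - qI x * qI y - qJ x * qJ y - qK x * qK y"
  "qI (x * y) = qRe x * qI y + qI x * qRe y + qJ x * qK y - qK x * qJ y"
  "qJ (x * y) = qRe x * qJ y - qI x * qK y + qJ x * qRe y + qK x * qI y"
  "qK (x * y) = qRe x * qK y + qI x * qJ y - qJ x * qI y + qK x * qRe y"
  by (simp_all add: quat_ops)

lemma of_real_quat_sel [simp]:
  "qRe (of_real r) = r" "qI (of_real r) = 0" "qJ (of_real r) = 0" "qK (of_real r) = 0"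
  by (simp_all add: of_real_def)

lemma numeral_quat_sel [simp]:
  "qRe (numeral n) = numeral n" "qI (numeral n) = 0" "qJ (numeral n) = 0" "qK (numeral n) = 0"
  by (metis of_real_numeral of_real_quat_sel)+

lemma quat_eq_iff: "x = y \<longleftrightarrow> qRe x = qRe y \<and> qI x = qI y \<and> qJ x = qJ y \<and> qK x = qK y"
  by (auto intro: quat.expand)

lemma quat_sum_sel:
  "qRe (sum f A) = (\<Sum>x\<in>A. qRe (f x))" "qI (sum f A) = (\<Sum>x\<in>A. qI (f x))"
  "qJ (sum f A) = (\<Sum>x\<in>A. qJ (f x))" "qK (sum f A) = (\<Sum>x\<in>A. qK (f x))"
  by (induction A rule: infinite_finite_induct) auto

text \<open>Euler's identity, which is the multiplicativity of the quaternion norm. It serves the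
  norm inequality as well as the division algebra instance.\<close>

lemma four_squares:
  fixes a b c d e f g h :: real
  shows "(a * e - b * f - c * g - d * h)\<^sup>2 + (a * f + b * e + c * h - d * g)\<^sup>2 +
    (a * g - b * h + c * e + d * f)\<^sup>2 + (a * h + b * g - c * f + d * e)\<^sup>2 =
    (a\<^sup>2 + b\<^sup>2 + c\<^sup>2 + d\<^sup>2) * (e\<^sup>2 + f\<^sup>2 + g\<^sup>2 + h\<^sup>2)"
  by (simp add: power2_eq_square ring_distribs)

section \<open>The quaternions as a normed division algebra and a Euclidean space\<close>

instantiation quat :: real_normed_algebra_1
begin

definition "norm x = sqrt ((qRe x)\<^sup>2 + (qI x)\<^sup>2 + (qJ x)\<^sup>2 + (qK x)\<^sup>2)"
definition "sgn x = (x :: quat) /\<^sub>R norm x"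
definition "dist x y = norm (x - y :: quat)"
definition uniformity_quat_def [code del]:
  "(uniformity :: (quat \<times> quat) filter) = (INF e\<in>{0 <..}. principal {(x, y). dist x y < e})"
definition open_quat_def [code del]:
  "open (U :: quat set) \<longleftrightarrow> (\<forall>x\<in>U. eventually (\<lambda>(x', y). x' = x \<longrightarrow> y \<in> U) uniformity)"

text \<open>Coordinates as a function on four indices let the triangle inequality be inherited from
  \<open>L2_set\<close>.\<close>

definition quat_nth :: "quat \<Rightarrow> nat \<Rightarrow> real" where
  "quat_nth x n = (if n = 0 then qRe x else if n = 1 then qI x else if n = 2 then qJ x else qK x)"

lemma norm_quat_L2: "norm x = L2_set (quat_nth x) {..<4}"
  by (simp add: norm_quat_def L2_set_def quat_nth_def eval_nat_numeral lessThan_Suc add_ac)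

instance
proof
  fix r :: real and x y :: quat
  show "norm x = 0 \<longleftrightarrow> x = 0"
    by (auto simp: norm_quat_def quat_eq_iff add_nonneg_eq_0_iff)
  have "quat_nth (x + y) = (\<lambda>n. quat_nth x n + quat_nth y n)"
    by (auto simp: quat_nth_def)
  then show "norm (x + y) \<le> norm x + norm y"
    unfolding norm_quat_L2 using L2_set_triangle_ineq [of "quat_nth x" "quat_nth y" "{..<4}"] by simp
  show "norm (r *\<^sub>R x) = \<bar>r\<bar> * norm x"
    by (simp add: norm_quat_def power_mult_distrib distrib_left [symmetric] real_sqrt_mult)
  show "norm (x * y) \<le> norm x * norm y"
    unfolding norm_quat_def real_sqrt_mult [symmetric] quat_mult_sel four_squares by simp
  show "norm (1 :: quat) = 1"
    by (simp add: norm_quat_def)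
qed (rule sgn_quat_def dist_quat_def open_quat_def uniformity_quat_def)+

end

instantiation quat :: real_normed_div_algebra
begin

definition "inverse x = qcnj x /\<^sub>R (norm x)\<^sup>2"
definition "x div y = x * (qcnj y /\<^sub>R (norm (y :: quat))\<^sup>2)"

instance
proof
  fix x y :: quat
  have n: "(norm x)\<^sup>2 = (qRe x)\<^sup>2 + (qI x)\<^sup>2 + (qJ x)\<^sup>2 + (qK x)\<^sup>2" for x :: quat
    by (simp add: norm_quat_def)
  have c: "qcnj x * x = of_real ((norm x)\<^sup>2)" "x * qcnj x = of_real ((norm x)\<^sup>2)"
    by (simp_all add: quat_eq_iff quat_mult_sel n del: of_real_power) (simp_all add: power2_eq_square algebra_simps)
  show "inverse x * x = 1" "x * inverse x = 1" if "x \<noteq> 0"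
    using that c by (simp_all add: inverse_quat_def del: of_real_power) (simp_all add: of_real_def)
  show "x div y = x * inverse y" by (simp add: divide_quat_def inverse_quat_def)
  show "inverse (0 :: quat) = 0"
    by (simp add: inverse_quat_def qcnj_def quat_eq_iff)
  have "(norm (x * y))\<^sup>2 = (norm x)\<^sup>2 * (norm y)\<^sup>2"
    unfolding n quat_mult_sel by (rule four_squares)
  then show "norm (x * y) = norm x * norm y"
    by (metis norm_ge_zero power2_eq_imp_eq power_mult_distrib mult_nonneg_nonneg)
qed

end

instantiation quat :: real_inner
begin

definition inner_quat_def: "inner x y = qRe x * qRe y + qI x * qI y + qJ x * qJ y + qK x * qK y"

instance
proof
  fix x y z :: quat and r :: real
  show "inner x x = 0 \<longleftrightarrow> x = 0"
    unfolding inner_quat_def by (simp add: quat_eq_iff add_nonneg_eq_0_iff)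
  show "norm x = sqrt (inner x x)"
    unfolding inner_quat_def norm_quat_def by (simp add: power2_eq_square)
qed (simp_all add: inner_quat_def algebra_simps)

end

definition qi :: quat where "qi = Quat 0 1 0 0"
definition qj :: quat where "qj = Quat 0 0 1 0"
definition qk :: quat where "qk = Quat 0 0 0 1"

lemma quat_unit_sel [simp]:
  "qRe qi = 0" "qI qi = 1" "qJ qi = 0" "qK qi = 0"
  "qRe qj = 0" "qI qj = 0" "qJ qj = 1" "qK qj = 0"
  "qRe qk = 0" "qI qk = 0" "qJ qk = 0" "qK qk = 1"
  by (simp_all add: qi_def qj_def qk_def)

text \<open>With this instance \<open>quat^'n\<close> is Euclidean of real dimension 4n. Real
  dimension counts (injective linear maps are surjective) then replace linear algebra over the skew
  field, and \<open>quat^'n\<close> can serve as a chart for m.\<close>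

instantiation quat :: euclidean_space
begin

definition Basis_quat_def: "Basis = {1, qi, qj, qk}"

lemma Basis_quat_distinct: "1 \<noteq> qi" "1 \<noteq> qj" "1 \<noteq> qk" "qi \<noteq> qj" "qi \<noteq> qk" "qj \<noteq> qk"
  by (metis quat_sel(5) quat_unit_sel zero_neq_one, metis quat_sel(5) quat_unit_sel zero_neq_one,
      metis quat_sel(5) quat_unit_sel zero_neq_one, metis quat_unit_sel zero_neq_one,
      metis quat_unit_sel zero_neq_one, metis quat_unit_sel zero_neq_one)

instance
proof
  fix x u v :: quat
  show "u \<in> Basis \<Longrightarrow> v \<in> Basis \<Longrightarrow> inner u v = (if u = v then 1 else 0)"
    using Basis_quat_distinct by (auto simp: Basis_quat_def inner_quat_def)
  show "(\<forall>u\<in>Basis. inner x u = 0) \<longleftrightarrow> x = 0"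
    unfolding Basis_quat_def ball_simps inner_quat_def by (auto intro: quat.expand)
qed (simp_all add: Basis_quat_def)

end

lemma DIM_quat [simp]: "DIM(quat) = 4"
  using Basis_quat_distinct by (simp add: Basis_quat_def)

lemmas qcomp = quat_eq_iff quat_mult_sel

lemma qunits [simp]:
  "qi * qi = -1" "qj * qj = -1" "qk * qk = -1" "qi * qj = qk" "qj * qi = - qk"
  "qj * qk = qi" "qk * qj = - qi" "qk * qi = qj" "qi * qk = - qj"
  by (simp_all add: qcomp)

lemma qunits_assoc [simp]:
  "qi * (qi * x) = - x" "qj * (qj * x) = - x" "qk * (qk * x) = - x"
  "qi * (qj * x) = qk * x" "qj * (qi * x) = - (qk * x)"
  "qj * (qk * x) = qi * x" "qk * (qj * x) = - (qi * x)" "qk * (qi * x) = qj * x" "qi * (qk * x) = - (qj * x)"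
  by (simp_all flip: mult.assoc)

lemma qunits_cnj [simp]: "qcnj qi = - qi" "qcnj qj = - qj" "qcnj qk = - qk"
  by (simp_all add: qcomp)

lemma qcnj_simps [simp]:
  "qcnj 0 = 0" "qcnj 1 = 1" "qcnj (of_real r) = of_real r" "qcnj (x + y) = qcnj x + qcnj y"
  "qcnj (x - y) = qcnj x - qcnj y" "qcnj (- x) = - qcnj x" "qcnj (r *\<^sub>R x) = r *\<^sub>R qcnj x"
  "qcnj (qcnj x) = x"
  by (simp_all add: quat_eq_iff)

lemma qcnj_mult: "qcnj (x * y) = qcnj y * qcnj x"
  by (simp add: qcomp algebra_simps)

lemma qcnj_sum: "qcnj (sum f A) = (\<Sum>x\<in>A. qcnj (f x))"
  by (induction A rule: infinite_finite_induct) auto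

lemma qcnj_mult_self: "qcnj x * x = of_real ((norm x)\<^sup>2)" "x * qcnj x = of_real ((norm x)\<^sup>2)"
  by (simp_all add: qcomp norm_quat_def power2_eq_square)

lemma unit_cancel:
  fixes p :: quat assumes "norm p = 1"
  shows "qcnj p * p = 1" "p * qcnj p = 1" "qcnj p * (p * q) = q" "p * (qcnj p * q) = q"
  using assms by (simp_all add: qcnj_mult_self flip: mult.assoc)

lemma qcnj_eq_0 [simp]: "qcnj x = 0 \<longleftrightarrow> x = 0"
  by (auto simp: quat_eq_iff)

lemma of_real_mult_quat: "of_real r * (x :: quat) = r *\<^sub>R x" "x * of_real r = r *\<^sub>R x"
  by (simp_all add: qcomp)

lemma sp1_cnj: "a \<in> sp1 \<longleftrightarrow> qcnj a = - a"
  by (auto simp: sp1_def quat_eq_iff)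

lemma sp1_closed [simp]:
  "0 \<in> sp1" "qi \<in> sp1" "qj \<in> sp1" "qk \<in> sp1"
  "a \<in> sp1 \<Longrightarrow> b \<in> sp1 \<Longrightarrow> a + b \<in> sp1" "a \<in> sp1 \<Longrightarrow> b \<in> sp1 \<Longrightarrow> a - b \<in> sp1"
  "a \<in> sp1 \<Longrightarrow> - a \<in> sp1" "a \<in> sp1 \<Longrightarrow> r *\<^sub>R a \<in> sp1"
  by (simp_all add: sp1_def)

section \<open>Right quaternionic vector spaces and matrices acting from the left\<close>

lemma vscale_simps [simp]:
  "0 \<cdot> q = 0" "X \<cdot> 0 = 0" "X \<cdot> 1 = X" "(- X) \<cdot> q = - (X \<cdot> q)" "X \<cdot> (- q) = - (X \<cdot> q)"
  by (simp_all add: vscale_def vec_eq_iff)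

lemma vscale_distrib:
  "(X + Y) \<cdot> q = X \<cdot> q + Y \<cdot> q" "(X - Y) \<cdot> q = X \<cdot> q - Y \<cdot> q"
  "X \<cdot> (p + q) = X \<cdot> p + X \<cdot> q" "X \<cdot> (p - q) = X \<cdot> p - X \<cdot> q"
  by (simp_all add: vscale_def vec_eq_iff algebra_simps)

lemma vscale_assoc: "X \<cdot> p \<cdot> q = X \<cdot> (p * q)"
  by (simp add: vscale_def vec_eq_iff mult.assoc)

lemma vscale_scaleR: "(r *\<^sub>R X) \<cdot> q = r *\<^sub>R (X \<cdot> q)" "X \<cdot> (r *\<^sub>R q) = r *\<^sub>R (X \<cdot> q)"
  "X \<cdot> of_real r = r *\<^sub>R X"
  by (simp_all add: vscale_def vec_eq_iff of_real_mult_quat)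

lemma vscale_eq_0 [simp]: "X \<cdot> q = 0 \<longleftrightarrow> X = 0 \<or> q = 0"
  by (auto simp: vscale_def vec_eq_iff)

lemma mv_vscale: "M *v (X \<cdot> q) = (M *v X) \<cdot> q"
  by (simp add: matrix_vector_mult_def vscale_def vec_eq_iff sum_distrib_right mult.assoc)

lemma mv_scaleR: "M *v (r *\<^sub>R X) = r *\<^sub>R (M *v X)" for M :: "quat^'n^'m"
  by (simp add: matrix_vector_mult_def vec_eq_iff scaleR_sum_right)

lemma scaleR_mv: "(r *\<^sub>R M) *v X = r *\<^sub>R (M *v X)" for M :: "quat^'n^'m"
  by (simp add: matrix_vector_mult_def vec_eq_iff scaleR_sum_right)

lemma uminus_mv [simp]: "(- M) *v X = - (M *v X)" "M *v (- X) = - (M *v X)" for M :: "quat^'n^'m"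
  by (simp_all add: matrix_vector_mult_def vec_eq_iff sum_negf)

lemma linear_mv: "linear ((*v) (M :: quat^'n^'m))"
  by (intro linearI) (simp_all add: matrix_vector_right_distrib mv_scaleR)

lemma linear_vscale: "linear (\<lambda>X. X \<cdot> q)"
  by (intro linearI) (simp_all add: vscale_distrib vscale_scaleR)

lemma matrix_eqI: "(\<And>x. A *v x = B *v x) \<Longrightarrow> A = B" for A B :: "quat^'n^'m"
  by (simp add: matrix_eq)

lemma vec_decompose: "X = (\<Sum>a\<in>UNIV. axis a 1 \<cdot> (X $ a))" for X :: "quat^'n"
  by (simp add: vec_eq_iff vscale_def axis_def if_distrib [of "\<lambda>x. x * _"] sum.delta cong: if_cong)

text \<open>The columns are the images of the vectors \<open>axis a 1\<close>. Real homogeneity is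
  contained in the second assumption.\<close>

lemma Hlinear_matrix:
  fixes f :: "quat^'n \<Rightarrow> quat^'m"
  assumes "\<And>X Y. f (X + Y) = f X + f Y" "\<And>X q. f (X \<cdot> q) = f X \<cdot> q"
  shows "\<exists>M. \<forall>X. f X = M *v X"
proof (intro exI allI)
  fix X
  have z: "f 0 = 0" using assms(2) [of 0 0] by simp
  have s: "f (sum g A) = (\<Sum>a\<in>A. f (g a))" for g and A :: "'n set"
    by (induction A rule: infinite_finite_induct) (auto simp: z assms)
  have "f X = (\<Sum>a\<in>UNIV. f (axis a 1) \<cdot> (X $ a))"
    by (subst vec_decompose) (simp add: s assms)
  also have "\<dots> = (\<chi> b a. f (axis a 1) $ b) *v X"
    by (simp add: vec_eq_iff matrix_vector_mult_def vscale_def)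
  finally show "f X = (\<chi> b a. f (axis a 1) $ b) *v X" .
qed

text \<open>Every quaternion is a real combination of 1, i, j and i j, and compatibility with i and
  j entails compatibility with i j.\<close>

lemma Hlinear_if_qi_qj:
  fixes f :: "quat^'n \<Rightarrow> quat^'m"
  assumes add: "\<And>X Y. f (X + Y) = f X + f Y" and scale: "\<And>r X. f (r *\<^sub>R X) = r *\<^sub>R f X"
    and i: "\<And>X. f (X \<cdot> qi) = f X \<cdot> qi" and j: "\<And>X. f (X \<cdot> qj) = f X \<cdot> qj"
  shows "f (X \<cdot> q) = f X \<cdot> q"
proof -
  have q: "q = of_real (qRe q) + qI q *\<^sub>R qi + qJ q *\<^sub>R qj + qK q *\<^sub>R (qi * qj)"
    by (simp add: quat_eq_iff)
  have d: "Y \<cdot> q = qRe q *\<^sub>R Y + qI q *\<^sub>R (Y \<cdot> qi) + qJ q *\<^sub>R (Y \<cdot> qj) + qK q *\<^sub>R (Y \<cdot> qi \<cdot> qj)"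
    for Y :: "quat^'k"
    by (subst q) (simp only: vscale_distrib vscale_scaleR vscale_assoc)
  show ?thesis unfolding d [of X] d [of "f X"] add scale i j ..
qed

text \<open>An injective real-linear endomorphism of a Euclidean space is bijective, and its inverse
  map is again H-linear, hence a matrix.\<close>

lemma invertible_iff_inj: "invertible A \<longleftrightarrow> (\<forall>X. A *v X = 0 \<longrightarrow> X = 0)" for A :: "quat^'n^'n"
proof
  show "invertible A \<Longrightarrow> \<forall>X. A *v X = 0 \<longrightarrow> X = 0"
    unfolding invertible_def by (metis matrix_vector_mul_assoc matrix_vector_mul_lid matrix_vector_mult_0_right)
  assume "\<forall>X. A *v X = 0 \<longrightarrow> X = 0"
  then have "inj ((*v) A)"
    by (simp add: linear_injective_0 linear_mv)
  then have b: "bij ((*v) A)"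
    by (simp add: bij_def linear_injective_imp_surjective linear_mv)
  let ?g = "inv_into UNIV ((*v) A)"
  have g: "A *v ?g x = x" for x using b using bij_inv_eq_iff by metis
  have g': "?g (A *v x) = x" for x using b by (metis b bij_inv_eq_iff)
  have "?g (X + Y) = ?g X + ?g Y" "?g (X \<cdot> q) = ?g X \<cdot> q" for X Y q
    by (metis g g' matrix_vector_right_distrib, metis g g' mv_vscale)
  then obtain B where "\<And>X. ?g X = B *v X" using Hlinear_matrix by metis
  then have "A ** B = mat 1" "B ** A = mat 1"
    using g g' by (auto simp: matrix_eq simp flip: matrix_vector_mul_assoc)
  then show "invertible A" unfolding invertible_def by blast
qed

lemma matrix_inv_quat:
  fixes A :: "quat^'n^'n"
  assumes "invertible A" shows "A ** matrix_inv A = mat 1" "matrix_inv A ** A = mat 1"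
  using assms unfolding invertible_def matrix_inv_def by (metis (mono_tags, lifting) someI_ex)+

section \<open>Sesquilinear forms\<close>

text \<open>The number \<open>X^* M Y\<close>. For \<open>M = j\<close> it is the form
  \<open>h\<close>, for \<open>M = F_mat j\<close> the form that defines SO*(2n+4).\<close>

definition hf :: "quat^'n^'n \<Rightarrow> quat^'n \<Rightarrow> quat^'n \<Rightarrow> quat" where
  "hf M X Y = (\<Sum>a\<in>UNIV. qcnj (X $ a) * (M *v Y) $ a)"

lemma hf_add: "hf M (X + Y) Z = hf M X Z + hf M Y Z" "hf M X (Y + Z) = hf M X Y + hf M X Z"
  "hf M (X - Y) Z = hf M X Z - hf M Y Z" "hf M X (Y - Z) = hf M X Y - hf M X Z"
  by (simp_all add: hf_def algebra_simps sum.distrib sum_subtractf)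

lemma hf_scale: "hf M (X \<cdot> p) Y = qcnj p * hf M X Y" "hf M X (Y \<cdot> p) = hf M X Y * p"
  unfolding hf_def mv_vscale by (simp_all add: vscale_def qcnj_mult mult.assoc sum_distrib_left sum_distrib_right)

lemma hf_scaleR: "hf M (r *\<^sub>R X) Y = r *\<^sub>R hf M X Y" "hf M X (r *\<^sub>R Y) = r *\<^sub>R hf M X Y"
  using hf_scale(1) [of M X "of_real r" Y] hf_scale(2) [of M X Y "of_real r"]
  by (simp_all add: vscale_scaleR of_real_mult_quat)

lemma hf_0 [simp]: "hf M 0 Y = 0" "hf M X 0 = 0" "hf M (- X) Y = - hf M X Y" "hf M X (- Y) = - hf M X Y"
  by (simp_all add: hf_def sum_negf)

lemma hf_axis: "hf M (axis a 1) Y = (M *v Y) $ a"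
  by (simp add: hf_def axis_def if_distrib [of qcnj] if_distrib [of "\<lambda>x. x * _"] sum.delta cong: if_cong)

lemma hf_left_cong: "(\<And>X. hf M X Y = hf N X Z) \<Longrightarrow> M *v Y = N *v Z"
  by (metis hf_axis vec_eq_iff)

lemma hf_double: "hf M X Y = (\<Sum>a\<in>UNIV. \<Sum>b\<in>UNIV. qcnj (X $ a) * M $ a $ b * Y $ b)"
  by (simp add: hf_def matrix_vector_mult_def sum_distrib_left mult.assoc)

lemma hf_adj: "hf M X Y = qcnj (hf (adj M) Y X)"
  unfolding hf_double qcnj_sum by (subst sum.swap) (simp add: adj_def qcnj_mult mult.assoc)

lemma hf_mult: "hf (M ** N) X Y = hf M X (N *v Y)"
  by (simp add: hf_def matrix_vector_mul_assoc)

lemma hf_adj_mult: "hf (adj N ** M) X Y = hf M (N *v X) Y"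
proof -
  have "hf (adj N ** M) X Y = hf (adj N) X (M *v Y)" by (rule hf_mult)
  also have "\<dots> = qcnj (hf N (M *v Y) X)" by (subst hf_adj) (simp add: adj_def)
  also have "\<dots> = hf M (N *v X) Y" by (simp add: hf_def qcnj_sum qcnj_mult)
  finally show ?thesis .
qed

lemma hf_matrix_add: "hf (M + N) X Y = hf M X Y + hf N X Y" "hf (- M) X Y = - hf M X Y" "hf 0 X Y = 0"
  by (simp_all add: hf_def algebra_simps sum.distrib sum_negf)

lemma hf_eqI: "(\<And>X Y. hf M X Y = hf N X Y) \<Longrightarrow> M = N"
  by (rule matrix_eqI) (metis hf_left_cong)

lemma so_star_iff: "A \<in> so_star j \<longleftrightarrow> (\<forall>X Y. hf j (A *v X) Y = - hf j X (A *v Y))"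
proof -
  have "adj A ** j + j ** A = 0 \<longleftrightarrow> (\<forall>X Y. hf (adj A ** j + j ** A) X Y = 0)"
    by (metis hf_eqI hf_matrix_add(3))
  also have "\<dots> \<longleftrightarrow> (\<forall>X Y. hf j (A *v X) Y = - hf j X (A *v Y))"
    unfolding hf_matrix_add hf_adj_mult hf_mult [of j] by (simp add: add_eq_0_iff2)
  finally show ?thesis by (simp add: so_star_def)
qed

text \<open>Under these assumptions \<open>h\<close> is a nondegenerate skew-Hermitian form: its
  real part is symplectic, and the values \<open>h X X\<close> are imaginary.\<close>

locale skew_form =
  fixes j :: "quat^'n^'n"
  assumes adj_j: "adj j = - j" and inv_j: "invertible j"
begin

abbreviation h :: "quat^'n \<Rightarrow> quat^'n \<Rightarrow> quat" where "h \<equiv> hf j"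

lemma h_sym: "h X Y = - qcnj (h Y X)"
  by (subst hf_adj) (simp add: adj_j hf_matrix_add)

lemma h_cnj: "qcnj (h X Y) = - h Y X"
  by (subst h_sym) simp

lemma h_Re_sym: "qRe (h X Y) = - qRe (h Y X)"
  by (subst h_sym) simp

lemma h_nondeg: "(\<And>Y. h X Y = 0) \<Longrightarrow> X = 0"
proof -
  assume "\<And>Y. h X Y = 0"
  then have "h Y X = 0" for Y by (subst h_sym) simp
  then have "j *v X = j *v 0" by (intro hf_left_cong) simp
  then have "j *v X = 0" by simp
  then show "X = 0" using inv_j invertible_iff_inj by blast
qed

lemma h_nondeg': "(\<And>Y. h Y X = 0) \<Longrightarrow> X = 0"
  by (rule h_nondeg) (subst h_sym, simp)

text \<open>Multiplying \<open>Y\<close> by the units moves each component of \<open>h X Y\<close>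
  into the real part, so the real form knows all of \<open>h\<close>.\<close>

lemma Re_h_nondeg: assumes "\<And>Y. qRe (h X Y) = 0" shows "X = 0"
proof (rule h_nondeg)
  fix Y
  have "qRe (h X Y * q) = 0" for q
    using assms [of "Y \<cdot> q"] by (simp add: hf_scale)
  from this [of 1] this [of qi] this [of qj] this [of qk]
  show "h X Y = 0" by (simp add: qcomp)
qed

lemma h_exists: "X \<noteq> 0 \<Longrightarrow> \<exists>Y. h X Y = 1"
proof -
  assume "X \<noteq> 0"
  then obtain Y where "h X Y \<noteq> 0" using h_nondeg by blast
  then have "h X (Y \<cdot> inverse (h X Y)) = 1" by (simp add: hf_scale)
  then show ?thesis by blast
qed

text \<open>The operator is \<open>j^(-1) M\<close>, where \<open>M\<close> is the matrix of
  \<open>\<kappa>\<close>. As \<open>h\<close> is skew-Hermitian, hermitian symmetry of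
  \<open>\<kappa>\<close> amounts to skewness of this operator. In this way an averaged curvature
  yields an element of so*(2n).\<close>

lemma form_representable:
  assumes "\<And>X Y Z. \<kappa> X (Y + Z) = \<kappa> X Y + \<kappa> X Z" "\<And>X Y q. \<kappa> X (Y \<cdot> q) = \<kappa> X Y * q"
    and "\<And>X Y. \<kappa> X Y = qcnj (\<kappa> Y X)"
  shows "\<exists>A\<in>so_star j. \<forall>X Y. h X (A *v Y) = \<kappa> X Y"
proof -
  have l: "\<kappa> (Y + Z) X = \<kappa> Y X + \<kappa> Z X" "\<kappa> (Y \<cdot> q) X = qcnj q * \<kappa> Y X" for X Y Z q
    unfolding assms(3) [of _ X] by (simp_all add: assms(1,2) qcnj_mult)
  have z: "\<kappa> 0 Y = 0" for Y using l(2) [of 0 0] by simp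
  have s: "\<kappa> (sum f S) Y = (\<Sum>a\<in>S. \<kappa> (f a) Y)" for f and S :: "'n set" and Y
    by (induction S rule: infinite_finite_induct) (auto simp: z l)
  define f where "f Y = (\<chi> a. \<kappa> (axis a 1) Y)" for Y
  have "f (X + Y) = f X + f Y" "f (X \<cdot> q) = f X \<cdot> q" for X Y q
    unfolding f_def vec_eq_iff assms(1,2) by (simp_all add: vscale_def)
  then obtain M where M: "\<And>X. f X = M *v X" using Hlinear_matrix by metis
  have hM: "hf M X Y = \<kappa> X Y" for X Y
  proof -
    have "hf M X Y = (\<Sum>a\<in>UNIV. qcnj (X $ a) * \<kappa> (axis a 1) Y)"
      by (simp add: hf_def f_def flip: M)
    also have "\<dots> = \<kappa> (\<Sum>a\<in>UNIV. axis a 1 \<cdot> (X $ a)) Y"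
      by (simp add: s l)
    finally show ?thesis by (simp flip: vec_decompose)
  qed
  define A where "A = matrix_inv j ** M"
  have A: "h X (A *v Y) = \<kappa> X Y" for X Y
    unfolding hM [symmetric] hf_mult [symmetric] A_def
    by (simp add: matrix_mul_assoc matrix_inv_quat inv_j)
  moreover have "h (A *v X) Y = - h X (A *v Y)" for X Y
    unfolding h_sym [of "A *v X" Y] A by (simp flip: assms(3))
  ultimately have "A \<in> so_star j" by (simp add: so_star_iff)
  then show ?thesis using A by blast
qed

end

context skew_form begin

lemma h_so_star: "A \<in> so_star j \<Longrightarrow> h (A *v X) Y = - h X (A *v Y)"
  by (simp add: so_star_iff)

text \<open>The action of the pair (A, a) in so*(2n) + sp(1) on H^n. The minus sign makes up for the
  reversed order of right multiplications, so that this is a Lie algebra representation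
  (\<open>act_pbr\<close>).\<close>

definition bop :: "quat^'n^'n \<Rightarrow> quat \<Rightarrow> quat^'n \<Rightarrow> quat^'n" where
  "bop A a X = A *v X - X \<cdot> a"

lemma bop_add: "bop A a (X + Y) = bop A a X + bop A a Y" "bop A a (X - Y) = bop A a X - bop A a Y"
  "bop A a (r *\<^sub>R X) = r *\<^sub>R bop A a X" "bop A a 0 = 0" "bop A a (- X) = - bop A a X"
  by (simp_all add: bop_def algebra_simps vscale_distrib vscale_scaleR mv_scaleR)

lemma bop_vscale: "bop A a (X \<cdot> q) = bop A a X \<cdot> q + X \<cdot> (a * q - q * a)"
  by (simp add: bop_def mv_vscale vscale_distrib vscale_assoc)

lemma h_bop: assumes "A \<in> so_star j" "a \<in> sp1"
  shows "h X (bop A a Y) = - h (bop A a X) Y + (a * h X Y - h X Y * a)"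
  using assms by (simp add: bop_def hf_add hf_scale h_so_star sp1_cnj)

lemma Re_h_bop: assumes "A \<in> so_star j" "a \<in> sp1"
  shows "qRe (h X (bop A a Y)) = - qRe (h (bop A a X) Y)"
  by (simp add: h_bop [OF assms] quat_mult_sel)

text \<open>The rank one operator \<open>Z \<mapsto> X h(Y, Z)\<close>.\<close>

definition outer :: "quat^'n \<Rightarrow> quat^'n \<Rightarrow> quat^'n^'n" where
  "outer X Y = (\<chi> i k. X $ i * star_row Y j $ k)"

lemma star_row_h: "(\<Sum>k\<in>UNIV. star_row Y j $ k * Z $ k) = h Y Z"
  unfolding star_row_def hf_double by (subst sum.swap) (simp add: sum_distrib_right)

lemma outer_mv: "outer X Y *v Z = X \<cdot> h Y Z"
  by (simp add: outer_def matrix_vector_mult_def vscale_def vec_eq_iff mult.assoc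
      flip: sum_distrib_left star_row_h)

lemma outer_sym_so_star: "outer X Y + outer Y X \<in> so_star j"
  unfolding so_star_iff
proof (intro allI)
  fix Z W
  show "h ((outer X Y + outer Y X) *v Z) W = - h Z ((outer X Y + outer Y X) *v W)"
    by (simp add: algebra_simps outer_mv hf_add hf_scale h_cnj)
qed

lemma so_star_closed:
  "A \<in> so_star j \<Longrightarrow> B \<in> so_star j \<Longrightarrow> A + B \<in> so_star j"
  "A \<in> so_star j \<Longrightarrow> B \<in> so_star j \<Longrightarrow> A - B \<in> so_star j"
  "A \<in> so_star j \<Longrightarrow> - A \<in> so_star j"
  "A \<in> so_star j \<Longrightarrow> r *\<^sub>R A \<in> so_star j"
  "A \<in> so_star j \<Longrightarrow> B \<in> so_star j \<Longrightarrow> A ** B - B ** A \<in> so_star j"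
  "0 \<in> so_star j"
  by (simp_all add: so_star_iff algebra_simps hf_add scaleR_mv hf_scaleR flip: matrix_vector_mul_assoc)

section \<open>The curvature attached to a pair\<close>

text \<open>\<open>Acur\<close> and \<open>acur\<close> come from the commutator of the two elements
  of m with parameters \<open>X\<close> and \<open>Y\<close>: they are its middle and its top left
  block after adding \<open>2 Re h(X, Y)\<close> times \<open>\<tau>\<close>, which clears the
  bottom left entry (see \<open>\<psi>_bracket\<close>).\<close>

definition Acur :: "quat^'n^'n \<Rightarrow> quat \<Rightarrow> quat^'n \<Rightarrow> quat^'n \<Rightarrow> quat^'n^'n" where
  "Acur A a X Y = (2 * qRe (h X Y)) *\<^sub>R A + outer X (bop A a Y) + outer (bop A a Y) X
     - outer (bop A a X) Y - outer Y (bop A a X)"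

definition acur :: "quat^'n^'n \<Rightarrow> quat \<Rightarrow> quat^'n \<Rightarrow> quat^'n \<Rightarrow> quat" where
  "acur A a X Y = (2 * qRe (h X Y)) *\<^sub>R a + h (bop A a X) Y - h (bop A a Y) X"

definition Rcur :: "quat^'n^'n \<Rightarrow> quat \<Rightarrow> quat^'n \<Rightarrow> quat^'n \<Rightarrow> quat^'n \<Rightarrow> quat^'n" where
  "Rcur A a X Y = bop (Acur A a X Y) (acur A a X Y)"

lemma Acur_mv: "Acur A a X Y *v Z = (2 * qRe (h X Y)) *\<^sub>R (A *v Z) + X \<cdot> h (bop A a Y) Z
    + bop A a Y \<cdot> h X Z - bop A a X \<cdot> h Y Z - Y \<cdot> h (bop A a X) Z"
  by (simp add: Acur_def algebra_simps outer_mv scaleR_mv)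

definition qIm :: "quat \<Rightarrow> quat" where "qIm q = q - of_real (qRe q)"

lemma qIm_sel [simp]: "qRe (qIm q) = 0" "qI (qIm q) = qI q" "qJ (qIm q) = qJ q" "qK (qIm q) = qK q"
  by (simp_all add: qIm_def)

text \<open>Since \<open>h (A *v Y) X\<close> is the conjugate of \<open>h (A *v X) Y\<close>, the
  matrix contributes only an imaginary part, while the \<open>a\<close> hidden in \<open>bop\<close>
  doubles the explicit term. In this separated form the pair can be read off from
  \<open>acur\<close> alone.\<close>

lemma acur_alt: assumes "A \<in> so_star j" "a \<in> sp1"
  shows "acur A a X Y = (4 * qRe (h X Y)) *\<^sub>R a + 2 *\<^sub>R qIm (h (A *v X) Y)"
proof -
  have "h (A *v Y) X = qcnj (h (A *v X) Y)"
    by (simp add: h_cnj h_so_star [OF assms(1)])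
  moreover have "h Y X = - qcnj (h X Y)" by (rule h_sym)
  ultimately show ?thesis using assms(2)
    by (simp add: acur_def bop_def hf_add hf_scale sp1_def qcomp)
qed

lemma Acur_so_star: assumes "A \<in> so_star j" shows "Acur A a X Y \<in> so_star j"
proof -
  have "Acur A a X Y = (2 * qRe (h X Y)) *\<^sub>R A + (outer X (bop A a Y) + outer (bop A a Y) X)
     - (outer (bop A a X) Y + outer Y (bop A a X))"
    by (simp add: Acur_def)
  then show ?thesis by (simp add: so_star_closed outer_sym_so_star assms)
qed

lemma acur_sp1: assumes "A \<in> so_star j" "a \<in> sp1" shows "acur A a X Y \<in> sp1"
  using assms(2) by (simp add: acur_alt [OF assms] sp1_def)

lemma Acur_skew: "Acur A a X Y = - Acur A a Y X"
  by (rule matrix_eqI) (simp add: Acur_mv h_Re_sym [of X Y])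

lemma acur_skew: "acur A a X Y = - acur A a Y X"
  by (simp add: acur_def h_Re_sym [of X Y])

lemma Acur_add: "Acur A a (X + Y) Z = Acur A a X Z + Acur A a Y Z"
  by (rule matrix_eqI) (simp add: Acur_mv algebra_simps hf_add bop_add vscale_distrib)

lemma Acur_scaleR: "Acur A a (r *\<^sub>R X) Y = r *\<^sub>R Acur A a X Y"
  by (rule matrix_eqI) (simp add: Acur_mv hf_scaleR bop_add vscale_scaleR scaleR_mv algebra_simps)

lemma acur_add: "acur A a (X + Y) Z = acur A a X Z + acur A a Y Z"
  by (simp add: acur_def algebra_simps hf_add bop_add)

lemma acur_scaleR: "acur A a (r *\<^sub>R X) Y = r *\<^sub>R acur A a X Y"
  by (simp add: acur_def hf_scaleR bop_add algebra_simps)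

text \<open>After substituting \<open>A U = bop A a U + U a\<close>, the values of \<open>h\<close>
  group into differences \<open>h X Y - h Y X\<close>. These are the real numbers
  \<open>2 Re h(X, Y)\<close> and cancel against the explicit terms.\<close>

lemma cur_bianchi:
  "Acur A a X Y *v Z + Acur A a Y Z *v X + Acur A a Z X *v Y
    = Z \<cdot> acur A a X Y + X \<cdot> acur A a Y Z + Y \<cdot> acur A a Z X"
proof -
  have c: "U \<cdot> h X' Y' - U \<cdot> h Y' X' = (2 * qRe (h X' Y')) *\<^sub>R U" for X' Y' U
  proof -
    have "h X' Y' - h Y' X' = of_real (2 * qRe (h X' Y'))"
      by (subst (2) h_sym) (simp add: quat_eq_iff del: of_real_mult)
    then have "U \<cdot> (h X' Y' - h Y' X') = U \<cdot> of_real (2 * qRe (h X' Y'))" by simp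
    then show ?thesis by (simp add: vscale_distrib vscale_scaleR del: of_real_mult)
  qed
  have A: "A *v U = bop A a U + U \<cdot> a" for U by (simp add: bop_def)
  show ?thesis
    unfolding Acur_mv acur_def A vscale_distrib vscale_scaleR scaleR_add_right
    using c [of "bop A a Z" X Y] c [of "bop A a X" Y Z] c [of "bop A a Y" Z X]
    by (simp add: algebra_simps)
qed

text \<open>Comparing the values at \<open>X q\<close> and at \<open>X\<close> shows that
  \<open>a\<close> commutes with every quaternion. Being imaginary, it vanishes, and then so does
  \<open>A\<close>.\<close>

lemma pair_eq_0:
  assumes "\<And>X. bop A a X = 0" "a \<in> sp1" shows "A = 0" "a = 0"
proof -
  have "X \<cdot> (a * q - q * a) = 0" for X :: "quat^'n" and q
    using assms(1) [of "X \<cdot> q"] assms(1) [of X] by (simp add: bop_vscale)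
  from this [of "axis undefined 1"] have "a * q - q * a = 0" for q
    by (simp add: axis_eq_0_iff)
  from this [of qi] this [of qj] show "a = 0"
    using assms(2) by (simp add: qcomp sp1_def)
  then show "A = 0" using assms(1) by (intro matrix_eqI) (simp add: bop_def)
qed

lemma pair_eqI:
  assumes "\<And>X. bop A a X = bop A' a' X" "a \<in> sp1" "a' \<in> sp1" shows "A = A' \<and> a = a'"
proof -
  have "bop (A - A') (a - a') X = 0" for X
    using assms(1) [of X] by (simp add: bop_def algebra_simps vscale_distrib)
  then show ?thesis using pair_eq_0 [of "A - A'" "a - a'"] assms by simp
qed

text \<open>The sp(1) component of the curvature alone remembers the pair.\<close>

lemma acur_inj:
  assumes "A \<in> so_star j" "a \<in> sp1" "\<And>X Y. acur A a X Y = 0" shows "A = 0" "a = 0"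
proof -
  have eq: "(4 * qRe (h X Y * q)) *\<^sub>R a + 2 *\<^sub>R qIm (h (A *v X) Y * q) = 0" for X Y q
    using assms(3) [of X "Y \<cdot> q"] unfolding acur_alt [OF assms(1,2)] hf_scale .
  have k: "h (A *v X) Y = 0" for X Y
  proof (rule ccontr)
    assume nz: "h (A *v X) Y \<noteq> 0"
    \<comment> \<open>Rescaling \<open>Y\<close> turns the second term into the imaginary part of an
      arbitrary quaternion, whereas the first term stays on the real line of \<open>a\<close>. But i
      and j do not lie on a common line.\<close>
    have *: "(4 * qRe (h X Y * (inverse (h (A *v X) Y) * q))) *\<^sub>R a + 2 *\<^sub>R qIm q = 0" for q
      using eq [of X Y "inverse (h (A *v X) Y) * q"] nz by (simp flip: mult.assoc)
    define c where "c q = qRe (h X Y * (inverse (h (A *v X) Y) * q))" for q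
    from * [of qi] * [of qj] have "4 * c qi * qI a + 2 = 0" "c qj * qI a = 0" "4 * c qj * qJ a + 2 = 0"
      unfolding c_def [symmetric] quat_eq_iff by simp_all
    then show False by auto
  qed
  then have "A *v X = 0" for X using h_nondeg by blast
  then show "A = 0" by (intro matrix_eqI) simp
  have "axis undefined 1 \<noteq> (0 :: quat^'n)" by (simp add: axis_eq_0_iff)
  then obtain Y where "h (axis undefined 1) Y = 1" using h_exists by blast
  then show "a = 0" using eq [of "axis undefined 1" Y 1] k by (simp add: qIm_def)
qed

section \<open>Invariant curvatures\<close>

text \<open>One Gram-Schmidt step on two coordinate vectors, of which there are two because n >
  1.\<close>

lemma orth_vector:
  assumes "CARD('n) > 1" shows "\<exists>Z. Z \<noteq> 0 \<and> h Y Z = 0"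
proof -
  have "\<exists>b c :: 'n. b \<noteq> c"
  proof (rule ccontr)
    assume "\<not> (\<exists>b c :: 'n. b \<noteq> c)"
    then have "(UNIV :: 'n set) \<subseteq> {undefined}" by blast
    then have "CARD('n) \<le> card {undefined :: 'n}" by (intro card_mono) auto
    then show False using assms by simp
  qed
  then obtain b c :: 'n where bc: "b \<noteq> c" by blast
  show ?thesis
  proof (cases "h Y (axis b 1) = 0")
    case True
    moreover have "axis b 1 \<noteq> (0 :: quat^'n)" by (simp add: axis_eq_0_iff)
    ultimately show ?thesis by blast
  next
    case False
    define u where "u = h Y (axis b 1)"
    define Z where "Z = axis b 1 \<cdot> (- (inverse u * h Y (axis c 1))) + axis c 1"
    have "Z $ c = 1" using bc by (simp add: Z_def vscale_def axis_def)
    then have "Z \<noteq> 0" by auto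
    moreover have "h Y Z = u * - (inverse u * h Y (axis c 1)) + h Y (axis c 1)"
      unfolding Z_def u_def by (simp only: hf_add hf_scale)
    moreover have "u * (inverse u * h Y (axis c 1)) = h Y (axis c 1)"
      using False unfolding u_def [symmetric] mult.assoc [symmetric] by simp
    ultimately show ?thesis by auto
  qed
qed

text \<open>For \<open>h X W = 1\<close> every vector \<open>Z - W h(X, Z)\<close> is orthogonal to
  \<open>X\<close>, hence to \<open>Y\<close>. This says that \<open>Y\<close> minus a multiple of
  \<open>X\<close> is orthogonal to everything.\<close>

lemma in_line:
  assumes "X \<noteq> 0" "\<And>Z. h X Z = 0 \<Longrightarrow> h Y Z = 0" shows "\<exists>q. Y = X \<cdot> q"
proof -
  obtain W where W: "h X W = 1" using h_exists assms(1) by blast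
  have "h (Y - X \<cdot> qcnj (h Y W)) Z = 0" for Z
    using assms(2) [of "Z - W \<cdot> h X Z"] by (simp add: hf_add hf_scale W)
  then have "Y - X \<cdot> qcnj (h Y W) = 0"
    by (rule h_nondeg)
  then show ?thesis by auto
qed

text \<open>For \<open>Y\<close> orthogonal to \<open>Z\<close> the identity forces
  \<open>S Y\<close> to be orthogonal to \<open>Z\<close> too, so \<open>S\<close> preserves each
  line and \<open>S Y = Y p(Y)\<close>. Next, \<open>p\<close> at a vector orthogonal to
  \<open>Z\<close> is conjugate to \<open>p\<close> at any vector not orthogonal to
  \<open>Z\<close>. Additivity of \<open>S\<close> makes these values equal, hence real, and finally
  constant.\<close>

lemma scalar_operator:
  assumes n: "CARD('n) > 1" and add: "\<And>X Y. S (X + Y) = S X + S Y"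
    and S: "\<And>X Y Z. X \<cdot> h (S Y) Z + S Y \<cdot> h X Z = S X \<cdot> h Y Z + Y \<cdot> h (S X) Z"
  shows "\<exists>d. \<forall>X. S X = d *\<^sub>R X"
proof -
  have 1: "h (S Y) Z = 0" if "h Y Z = 0" for Y Z
  proof -
    have re: "qRe (h (S Y) Z) = 0" if o: "h Y Z = 0" and nz: "Z \<noteq> 0" for Z
    proof -
      obtain W where "h Z W = 1" using h_exists [OF nz] by blast
      then have "h (- W) Z = 1" using h_sym [of W Z] by simp
      then obtain X where X: "h X Z = 1" by blast
      \<comment> \<open>Pairing the identity with \<open>Z\<close> once more leaves
        \<open>qcnj w + w = 0\<close> for \<open>w = h (S Y) Z\<close>.\<close>
      have "h (X \<cdot> h (S Y) Z + S Y) Z = h (Y \<cdot> h (S X) Z) Z"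
        using S [of X Y Z] X o by simp
      then have "qcnj (h (S Y) Z) + h (S Y) Z = 0"
        using X o by (simp add: hf_add hf_scale)
      then show ?thesis by (simp add: quat_eq_iff)
    qed
    show ?thesis
    proof (cases "Z = 0")
      case False
      have u: "qi \<noteq> 0" "qj \<noteq> 0" "qk \<noteq> 0" by (simp_all add: quat_eq_iff)
      show ?thesis
        using re [of Z] re [of "Z \<cdot> qi"] re [of "Z \<cdot> qj"] re [of "Z \<cdot> qk"] that False u
        by (simp add: hf_scale qcomp)
    qed simp
  qed
  have "\<exists>p. S Y = Y \<cdot> p" if "Y \<noteq> 0" for Y
    using in_line [OF that] 1 by blast
  moreover have "S 0 = 0" using add [of 0 0] by simp
  ultimately have "\<exists>p. \<forall>Y. S Y = Y \<cdot> p Y"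
    by (metis vscale_simps(1))
  then obtain p where p: "\<And>Y. S Y = Y \<cdot> p Y" by blast
  have 2: "p X = p Y \<and> p X = qcnj (p X)" if "X \<noteq> 0" "h X Z = 0" "h Y Z \<noteq> 0" for X Y Z
  proof -
    have q: "p X = qcnj (p W)" if "h W Z \<noteq> 0" for W
    proof -
      have "X \<cdot> (qcnj (p W) * h W Z) = X \<cdot> (p X * h W Z)"
        using S [of X W Z] \<open>h X Z = 0\<close> by (simp add: p hf_scale vscale_assoc)
      then have "X \<cdot> ((qcnj (p W) - p X) * h W Z) = 0"
        by (simp add: vscale_distrib algebra_simps)
      then show ?thesis using \<open>X \<noteq> 0\<close> that by simp
    qed
    have "p X = qcnj (p Y)" using q that by blast
    moreover have "p X = qcnj (p (X + Y))"
      by (rule q) (use that in \<open>simp add: hf_add\<close>)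
    ultimately have "p X = qcnj (p Y)" "p X = qcnj (p (X + Y))" by blast+
    then have "qcnj (qcnj (p (X + Y))) = qcnj (qcnj (p Y))" by simp
    then have "p (X + Y) = p Y" by simp
    then have "X \<cdot> (p X - p Y) = 0"
      using add [of X Y] by (simp add: p vscale_distrib)
    then have "p X = p Y" using that by simp
    then show ?thesis using \<open>p X = qcnj (p Y)\<close> by simp
  qed
  have 3: "\<exists>Z. h X Z = 0 \<and> h Y Z \<noteq> 0" if "X \<noteq> 0" "\<And>q. Y \<noteq> X \<cdot> q" for X Y
    using in_line that by blast
  have "p X = p Y" if X0: "X \<noteq> 0" and Y0: "Y \<noteq> 0" for X Y
  proof (cases "\<exists>q. Y = X \<cdot> q")
    case True
    then obtain q where q: "Y = X \<cdot> q" by blast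
    \<comment> \<open>No \<open>Z\<close> separates proportional vectors, so both are compared with
      a third vector \<open>W\<close>.\<close>
    obtain Z where Z: "Z \<noteq> 0" "h X Z = 0" using orth_vector [OF n] by blast
    then obtain W where W: "h W Z \<noteq> 0" using h_nondeg' by blast
    have "p X = p W" "p Y = p W" using 2 [OF _ _ W] Z that q by (auto simp: hf_scale)
    then show ?thesis by simp
  next
    case False
    then obtain Z where "h X Z = 0" "h Y Z \<noteq> 0" using 3 [OF X0] by blast
    then show ?thesis using 2 X0 by blast
  qed
  moreover have "p X = of_real (qRe (p X))" if "X \<noteq> 0" for X
  proof -
    obtain Z where Z: "Z \<noteq> 0" "h X Z = 0" using orth_vector [OF n] by blast
    then obtain W where W: "h W Z \<noteq> 0" using h_nondeg' by blast
    have "p X = qcnj (p X)" using 2 [OF that _ W] Z by blast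
    then show ?thesis unfolding quat_eq_iff by simp
  qed
  ultimately have r: "p X = of_real (qRe (p (axis undefined 1)))" if "X \<noteq> 0" for X
    using that by (metis axis_eq_0_iff zero_neq_one)
  have "S X = qRe (p (axis undefined 1)) *\<^sub>R X" for X
  proof (cases "X = 0")
    case False
    have "S X = X \<cdot> of_real (qRe (p (axis undefined 1)))"
      using p [of X] r [OF False] by simp
    then show ?thesis by (simp only: vscale_scaleR)
  qed (simp add: \<open>S 0 = 0\<close>)
  then show ?thesis by blast
qed

text \<open>The derivative of the curvature of (A, a) along one of its values (D, p) is, up to sign,
  the curvature of the commutator of the two pairs. Invariance makes it zero, so by
  \<open>acur_inj\<close> every curvature value commutes with (A, a). Commutation of
  \<open>Acur\<close> with \<open>bop A a\<close>, written out, is the identity that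
  \<open>scalar_operator\<close> asks for, with \<open>S\<close> the square of
  \<open>bop A a\<close>.\<close>

lemma invariant_curvature:
  assumes n: "CARD('n) > 1" and A: "A \<in> so_star j" and a: "a \<in> sp1"
    and inv: "\<And>U V X Y Z. Rcur A a U V (Rcur A a X Y Z) - Rcur A a X Y (Rcur A a U V Z)
      = Rcur A a (Rcur A a U V X) Y Z + Rcur A a X (Rcur A a U V Y) Z"
  shows "\<exists>d. \<forall>X. bop A a (bop A a X) = d *\<^sub>R X"
proof -
  have com: "A ** Acur A a U V = Acur A a U V ** A \<and> a * acur A a U V = acur A a U V * a" for U V
  proof -
    define D p where "D = Acur A a U V" and "p = acur A a U V"
    have D: "D \<in> so_star j" and p: "p \<in> sp1"
      by (simp_all add: D_def p_def Acur_so_star A a acur_sp1)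
    have "p * acur A a X Y - acur A a X Y * p = acur A a (bop D p X) Y + acur A a X (bop D p Y)" for X Y
    proof -
      let ?B = "Acur A a X Y" and ?b = "acur A a X Y"
      let ?C = "Acur A a (bop D p X) Y + Acur A a X (bop D p Y)"
      let ?c = "acur A a (bop D p X) Y + acur A a X (bop D p Y)"
      have l: "bop D p (bop ?B ?b Z) - bop ?B ?b (bop D p Z) = bop (D ** ?B - ?B ** D) (p * ?b - ?b * p) Z" for Z
        by (simp add: bop_def algebra_simps vscale_distrib mv_vscale vscale_assoc flip: matrix_vector_mul_assoc)
      have r: "bop (Acur A a (bop D p X) Y) (acur A a (bop D p X) Y) Z
         + bop (Acur A a X (bop D p Y)) (acur A a X (bop D p Y)) Z = bop ?C ?c Z" for Z
        by (simp add: bop_def algebra_simps vscale_distrib)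
      have "bop (D ** ?B - ?B ** D) (p * ?b - ?b * p) Z = bop ?C ?c Z" for Z
        using inv [of U V X Y Z] unfolding Rcur_def D_def [symmetric] p_def [symmetric] l r .
      moreover have "?c \<in> sp1" "p * ?b - ?b * p \<in> sp1"
        using p acur_sp1 [OF A a] by (auto simp: sp1_def quat_mult_sel algebra_simps)
      ultimately show ?thesis using pair_eqI by blast
    qed
    moreover have "acur A a (bop D p X) Y + acur A a X (bop D p Y) - (p * acur A a X Y - acur A a X Y * p)
        = - acur (D ** A - A ** D) (p * a - a * p) X Y" for X Y
    proof -
      have so: "D ** A - A ** D \<in> so_star j" and sp: "p * a - a * p \<in> sp1"
        using so_star_closed(5) [OF D A] a p by (auto simp: sp1_def quat_mult_sel algebra_simps)
      have w: "qRe (h X (bop D p Y)) = - qRe (h (bop D p X) Y)" by (rule Re_h_bop [OF D p])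
      have k: "h (A *v bop D p X) Y + h (A *v X) (bop D p Y)
         = - h ((D ** A - A ** D) *v X) Y + (p * h (A *v X) Y - h (A *v X) Y * p)"
        using p by (simp add: bop_def algebra_simps hf_add hf_scale mv_vscale h_so_star [OF D] sp1_cnj
            flip: matrix_vector_mul_assoc)
      have im: "qIm u + qIm v = qIm (u + v)" "qIm (u - v) = qIm u - qIm v" "qIm (- u) = - qIm u" for u v
        by (simp_all add: quat_eq_iff)
      have "2 *\<^sub>R qIm (h (A *v bop D p X) Y) + 2 *\<^sub>R qIm (h (A *v X) (bop D p Y))
        = - (2 *\<^sub>R qIm (h ((D ** A - A ** D) *v X) Y)) + 2 *\<^sub>R (p * qIm (h (A *v X) Y) - qIm (h (A *v X) Y) * p)"
        unfolding scaleR_add_right [symmetric] im(1) k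
        using p by (simp add: qcomp sp1_def algebra_simps)
      then show ?thesis
        unfolding acur_alt [OF A a] acur_alt [OF so sp] w
        by (simp add: algebra_simps)
    qed
    ultimately have z: "acur (D ** A - A ** D) (p * a - a * p) X Y = 0" for X Y
      by (metis add.inverse_inverse diff_self neg_0_equal_iff_equal)
    have "p * a - a * p \<in> sp1" using a p by (auto simp: sp1_def quat_mult_sel algebra_simps)
    from acur_inj [OF so_star_closed(5) [OF D A] this z] show ?thesis
      by (simp add: D_def p_def)
  qed
  define S where "S X = bop A a (bop A a X)" for X
  \<comment> \<open>\<open>bop\<close> and \<open>h\<close> each satisfy a Leibniz rule only up to a
    commutator with \<open>a\<close>; in this combination the two commutators cancel.\<close>
  have o: "bop A a (X \<cdot> h U Z) - X \<cdot> h U (bop A a Z) = bop A a X \<cdot> h U Z + X \<cdot> h (bop A a U) Z" for X U Z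
    by (simp add: bop_vscale h_bop [OF A a] vscale_distrib)
  have "X \<cdot> h (S Y) Z + S Y \<cdot> h X Z = S X \<cdot> h Y Z + Y \<cdot> h (S X) Z" for X Y Z
  proof -
    let ?c = "acur A a X Y"
    have b: "bop A a (Acur A a X Y *v Z) = Acur A a X Y *v bop A a Z"
    proof -
      have "A *v (Acur A a X Y *v Z) = Acur A a X Y *v (A *v Z)"
        using com [of X Y] by (simp add: matrix_vector_mul_assoc)
      then show ?thesis by (simp add: bop_def algebra_simps mv_vscale)
    qed
    have c: "A *v bop A a Z - bop A a (A *v Z) = 0"
      by (simp add: bop_def algebra_simps mv_vscale)
    have "bop A a (Acur A a X Y *v Z) - Acur A a X Y *v bop A a Z =
      (bop A a (X \<cdot> h (bop A a Y) Z) - X \<cdot> h (bop A a Y) (bop A a Z))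
      + (bop A a (bop A a Y \<cdot> h X Z) - bop A a Y \<cdot> h X (bop A a Z))
      - (bop A a (bop A a X \<cdot> h Y Z) - bop A a X \<cdot> h Y (bop A a Z))
      - (bop A a (Y \<cdot> h (bop A a X) Z) - Y \<cdot> h (bop A a X) (bop A a Z))"
      unfolding Acur_mv bop_add using c by (simp add: algebra_simps)
    then show ?thesis unfolding o b S_def by (simp add: algebra_simps)
  qed
  moreover have "S (X + Y) = S X + S Y" for X Y by (simp add: S_def bop_add)
  ultimately show ?thesis using scalar_operator [OF n, of S] by (simp add: S_def)
qed

end

section \<open>Orthonormal frames\<close>

text \<open>The unit vector of \<open>\<eta>\<close> is conjugate to i, and the length of
  \<open>p\<close> absorbs the length of \<open>\<eta>\<close>. This is why an orthonormal basis for
  a skew-Hermitian form involves no signs.\<close>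

lemma conj_to_qi:
  assumes "\<eta> \<in> sp1" "\<eta> \<noteq> 0" shows "\<exists>p. qcnj p * \<eta> * p = qi"
proof -
  define u where "u = \<eta> /\<^sub>R norm \<eta>"
  have nz: "norm \<eta> > 0" using assms by simp
  have u: "u * u = -1"
  proof -
    have "\<eta> * \<eta> = - (\<eta> * qcnj \<eta>)" using assms(1) by (simp add: sp1_cnj)
    also have "\<dots> = - of_real ((norm \<eta>)\<^sup>2)" by (simp only: qcnj_mult_self)
    finally show ?thesis
      using nz by (simp add: u_def power2_eq_square of_real_def) (simp add: field_simps)
  qed
  \<comment> \<open>Because \<open>u\<close> and i both square to -1, \<open>u + i\<close>
    intertwines them. If it is zero, j does.\<close>
  have "\<exists>p. p \<noteq> 0 \<and> u * p = p * qi"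
  proof (cases "u + qi = 0")
    case True
    then have "u = - qi" by (simp add: eq_neg_iff_add_eq_0)
    then have "u * qj = qj * qi" by simp
    moreover have "qj \<noteq> 0" by (simp add: quat_eq_iff)
    ultimately show ?thesis by blast
  next
    case False
    have "u * (u + qi) = (u + qi) * qi" by (simp add: algebra_simps u)
    then show ?thesis using False by blast
  qed
  then obtain p where p: "p \<noteq> 0" "u * p = p * qi" by blast
  define c where "c = 1 / (norm p * sqrt (norm \<eta>))"
  have "\<eta> = norm \<eta> *\<^sub>R u" using nz by (simp add: u_def)
  then have "qcnj p * \<eta> * p = norm \<eta> *\<^sub>R (qcnj p * (u * p))" by (metis mult.assoc mult_scaleR_left mult_scaleR_right)
  also have "\<dots> = norm \<eta> *\<^sub>R ((qcnj p * p) * qi)" by (simp add: p mult.assoc)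
  also have "\<dots> = (norm \<eta> * (norm p)\<^sup>2) *\<^sub>R qi" unfolding qcnj_mult_self of_real_def by simp
  finally have "qcnj (c *\<^sub>R p) * \<eta> * (c *\<^sub>R p) = (c\<^sup>2 * (norm \<eta> * (norm p)\<^sup>2)) *\<^sub>R qi"
    by (simp add: power2_eq_square)
  also have "c\<^sup>2 * (norm \<eta> * (norm p)\<^sup>2) = 1"
    using nz p by (simp add: c_def power_divide power_mult_distrib)
  finally have "qcnj (c *\<^sub>R p) * \<eta> * (c *\<^sub>R p) = qi" by (simp only: scaleR_one)
  then show ?thesis by blast
qed

text \<open>Gram-Schmidt for the quaternion-valued form whose real part is \<open>\<omega>\<close>.
  The domain of \<open>f\<close> carries its standard quaternionic structure, while the codomain is
  a real space of dimension 4n equipped with the foreign structures \<open>I\<close> and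
  \<open>J\<close>.\<close>

lemma orthonormal_frame:
  fixes I J :: "quat^'n \<Rightarrow> quat^'n" and \<omega> :: "quat^'n \<Rightarrow> quat^'n \<Rightarrow> real"
  assumes I: "linear I" "\<And>x. I (I x) = - x" and J: "linear J" "\<And>x. J (J x) = - x"
    and IJ: "\<And>x. I (J x) = - J (I x)"
    and \<omega>: "\<And>x. linear (\<omega> x)" "\<And>x y. \<omega> x y = - \<omega> y x" "\<And>x y. \<omega> (I x) (I y) = \<omega> x y"
      "\<And>x y. \<omega> (J x) (J y) = \<omega> x y" and nondeg: "\<And>x. (\<And>y. \<omega> x y = 0) \<Longrightarrow> x = 0"
  shows "\<exists>f :: quat^'n \<Rightarrow> quat^'n. linear f \<and> bij f \<and> (\<forall>X. f (X \<cdot> qi) = I (f X)) \<and> (\<forall>X. f (X \<cdot> qj) = J (f X)) \<and>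
    (\<forall>X Y. \<omega> (f X) (f Y) = qRe (\<Sum>m\<in>UNIV. qcnj (X $ m) * qi * Y $ m))"
proof -
  note Il = linear_add [OF I(1)] linear_scale [OF I(1)] linear_neg [OF I(1)] linear_diff [OF I(1)] I(2)
  note Jl = linear_add [OF J(1)] linear_scale [OF J(1)] linear_neg [OF J(1)] linear_diff [OF J(1)] J(2)
  note wl = linear_add [OF \<omega>(1)] linear_scale [OF \<omega>(1)] linear_neg [OF \<omega>(1)] linear_diff [OF \<omega>(1)]
  \<comment> \<open>Right multiplication by k = i j applies \<open>I\<close> before
    \<open>J\<close>.\<close>
  define act where "act x q = qRe q *\<^sub>R x + qI q *\<^sub>R I x + qJ q *\<^sub>R J x + qK q *\<^sub>R J (I x)" for x q
  \<comment> \<open>The imaginary components of a quaternion are minus the real parts of its right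
    multiples by i, j and k.\<close>
  define H where "H x y = Quat (\<omega> x y) (- \<omega> x (I y)) (- \<omega> x (J y)) (- \<omega> x (J (I y)))" for x y
  have act_act: "act (act x p) q = act x (p * q)" for x p q
    by (simp add: act_def Il Jl IJ quat_mult_sel algebra_simps)
  have act_add: "act (x + y) q = act x q + act y q" "act x (p + q) = act x p + act x q"
    "act (r *\<^sub>R x) q = r *\<^sub>R act x q" "act x (r *\<^sub>R q) = r *\<^sub>R act x q" for x y p q r
    by (simp_all add: act_def Il Jl algebra_simps)
  have act_unit: "act x 1 = x" "act x qi = I x" "act x qj = J x" for x
    by (simp_all add: act_def)
  have H_add: "H x (y + z) = H x y + H x z" "H x (r *\<^sub>R y) = r *\<^sub>R H x y" for x y z r
    by (simp_all add: H_def quat_eq_iff wl Il Jl)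
  have H_Re: "qRe (H x y) = \<omega> x y" for x y by (simp add: H_def)
  have H_act: "H x (act y q) = H x y * q" for x y q
    by (simp add: H_def act_def wl Il Jl IJ qcomp)
  have H_sym: "H y x = - qcnj (H x y)" for x y
  proof -
    have i: "\<omega> x (I y) = \<omega> y (I x)" for x y
      using \<omega>(3) [of x "I y"] \<omega>(2) [of "I x" y] by (simp add: I wl)
    have j: "\<omega> x (J y) = \<omega> y (J x)" for x y
      using \<omega>(4) [of x "J y"] \<omega>(2) [of "J x" y] by (simp add: J wl)
    have "\<omega> x (J (I y)) = \<omega> (I y) (J x)" by (rule j)
    also have "\<dots> = - \<omega> (J x) (I y)" by (rule \<omega>(2))
    also have "\<dots> = - \<omega> y (I (J x))" by (simp add: i)
    also have "\<dots> = \<omega> y (J (I x))" by (simp add: IJ wl)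
    finally show ?thesis
      by (simp add: H_def quat_eq_iff i [of x y] j [of x y] \<omega>(2) [of y x])
  qed
  have H_linear: "linear (H x)" for x by (intro linearI) (simp_all add: H_add)
  have H_sum: "H x (sum g S) = (\<Sum>m\<in>S. H x (g m))" for x g and S :: "'n set"
    by (rule linear_sum [OF H_linear])
  have H_diff: "H x (y - z) = H x y - H x z" for x y z by (rule linear_diff [OF H_linear])
  have H_left: "H (x + y) z = H x z + H y z" "H (act x q) z = qcnj q * H x z" for x y z q
    unfolding H_sym [where x = z] by (simp_all add: H_add H_act qcnj_mult)
  have ex: "\<exists>e. \<forall>m\<in>S. \<forall>l\<in>S. H (e m) (e l) = (if m = l then qi else 0)" for S :: "'n set"
    using finite [of S]
  proof (induction S rule: finite_induct)
    case (insert b S)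
    then obtain e where e: "\<And>m l. m \<in> S \<Longrightarrow> l \<in> S \<Longrightarrow> H (e m) (e l) = (if m = l then qi else 0)"
      by blast
    define W where "W = {x. \<forall>m\<in>S. H (e m) x = 0}"
    have Wact: "act x q \<in> W" if "x \<in> W" for x q using that by (simp add: W_def H_act)
    have Wadd: "x + y \<in> W" if "x \<in> W" "y \<in> W" for x y using that by (simp add: W_def H_add)
    \<comment> \<open>A real dimension count: all values of \<open>L\<close> have zero component at
      \<open>b\<close>, so \<open>L\<close> is not surjective, hence not injective, and the
      orthogonal complement \<open>W\<close> contains a nonzero vector.\<close>
    define L where "L x = (\<chi> m. if m \<in> S then H (e m) x else 0)" for x
    have "linear L" by (intro linearI) (simp_all add: L_def vec_eq_iff H_add)
    moreover have "\<not> surj L"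
    proof
      assume "surj L"
      then obtain x where "L x = axis b 1" by (metis surjD)
      then have "L x $ b = axis b 1 $ b" by simp
      then show False using insert.hyps by (simp add: L_def axis_def)
    qed
    ultimately have "\<not> inj L" using linear_injective_imp_surjective by blast
    then obtain x where x: "x \<noteq> 0" "L x = 0" using \<open>linear L\<close> linear_injective_0 by blast
    have xW: "x \<in> W"
    proof -
      have "L x $ m = 0" for m using x by simp
      then have "H (e m) x = 0" if "m \<in> S" for m using that by (simp add: L_def split: if_splits) metis
      then show ?thesis by (simp add: W_def)
    qed
    have "\<exists>y\<in>W. H y y \<noteq> 0"
    proof (rule ccontr)
      assume "\<not> (\<exists>y\<in>W. H y y \<noteq> 0)"
      then have iso: "H y y = 0" if "y \<in> W" for y using that by blast
      \<comment> \<open>If all \<open>H y y\<close> vanish on \<open>W\<close>, polarisation makes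
        \<open>H x y\<close> real; applied to \<open>y i\<close> as well, it makes
        \<open>H x y\<close> zero. Then \<open>x\<close> lies in the radical of
        \<open>\<omega>\<close>.\<close>
      have im: "qI (H x y) = 0" "qJ (H x y) = 0" "qK (H x y) = 0" if "y \<in> W" for y
      proof -
        have "H x y + H y x = 0"
          using iso [OF Wadd [OF xW that]] iso [OF xW] iso [OF that] by (simp add: H_add H_left add.commute)
        then have "H x y = qcnj (H x y)" by (simp add: H_sym [of y x])
        then show "qI (H x y) = 0" "qJ (H x y) = 0" "qK (H x y) = 0" by (simp_all add: quat_eq_iff)
      qed
      have xy: "H x y = 0" if "y \<in> W" for y
        using im [OF that] im [OF Wact [OF that, of qi]] by (simp add: H_act qcomp)
      have "\<omega> x z = 0" for z
      proof -
        \<comment> \<open>The projection of \<open>z\<close> to \<open>W\<close>. The coefficients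
          contain \<open>- i\<close>, the inverse of \<open>H (e m) (e m) = i\<close>.\<close>
        define w where "w = z - (\<Sum>m\<in>S. act (e m) (- (qi * H (e m) z)))"
        have "H (e l) w = 0" if "l \<in> S" for l
        proof -
          have "(\<Sum>m\<in>S. H (e l) (act (e m) (- (qi * H (e m) z)))) = (\<Sum>m\<in>S. if l = m then H (e l) z else 0)"
            using e that by (intro sum.cong) (auto simp: H_act)
          then show ?thesis using that by (simp add: w_def H_diff H_sum insert.hyps)
        qed
        then have "w \<in> W" by (simp add: W_def)
        moreover have "H x (e m) = 0" if "m \<in> S" for m
          using xW that by (simp add: W_def H_sym [of x "e m"])
        ultimately have "H x (w + (\<Sum>m\<in>S. act (e m) (- (qi * H (e m) z)))) = 0"
          unfolding H_add H_sum H_act using xy by simp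
        then have "H x z = 0" by (simp add: w_def)
        then show ?thesis using H_Re [of x z] by simp
      qed
      then show False using nondeg x by blast
    qed
    then obtain y where y: "y \<in> W" "H y y \<noteq> 0" by blast
    have "H y y \<in> sp1" using H_sym [of y y] unfolding sp1_cnj by (metis minus_minus)
    then obtain p where p: "qcnj p * H y y * p = qi" using conj_to_qi y by blast
    let ?e = "e(b := act y p)"
    have "H (act y p) (act y p) = qi" using p by (simp add: H_left H_act mult.assoc)
    moreover have 0: "H (e m) (act y p) = 0" if "m \<in> S" for m
      using that y by (simp add: W_def H_act)
    moreover have "H (act y p) (e m) = 0" if "m \<in> S" for m
      using 0 [OF that] H_sym [of "act y p" "e m"] by simp
    ultimately show ?case using e insert.hyps by (intro exI [of _ ?e]) auto
  qed simp
  obtain e :: "'n \<Rightarrow> quat^'n" where e: "\<And>m l. H (e m) (e l) = (if m = l then qi else 0)"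
    using ex [of UNIV] by blast
  define f where "f X = (\<Sum>m\<in>UNIV. act (e m) (X $ m))" for X
  have f: "linear f"
    by (intro linearI) (simp_all add: f_def act_add sum.distrib scaleR_sum_right)
  have Hef: "H (e l) (f X) = qi * X $ l" for l X
    by (simp add: f_def H_sum H_act e if_distrib [of "\<lambda>x. x * _"] sum.delta cong: if_cong)
  have "inj f"
  proof (unfold linear_injective_0 [OF f], intro allI impI)
    fix X assume "f X = 0"
    moreover have "H (e l) 0 = 0" for l using H_add(2) [of "e l" 0 0] by simp
    ultimately have "qi * X $ l = 0" for l by (metis Hef)
    moreover have "qi \<noteq> 0" by (simp add: quat_eq_iff)
    ultimately show "X = 0" by (simp add: vec_eq_iff)
  qed
  then have bij: "bij f" by (simp add: bij_def linear_injective_imp_surjective f)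
  have fact: "f (X \<cdot> q) = act (f X) q" for X q
  proof -
    have "act (sum g S) q = (\<Sum>m\<in>S. act (g m) q)" for g and S :: "'n set"
      by (rule linear_sum [of "\<lambda>x. act x q"]) (intro linearI, simp_all add: act_add)
    then show ?thesis by (simp add: f_def vscale_def act_act)
  qed
  have "\<omega> (f X) (f Y) = qRe (\<Sum>m\<in>UNIV. qcnj (X $ m) * qi * Y $ m)" for X Y
  proof -
    have "H (f X) (f Y) = - qcnj (\<Sum>m\<in>UNIV. H (f Y) (act (e m) (X $ m)))"
      unfolding H_sym [of "f X"] by (simp add: f_def [of X] H_sum)
    also have "\<dots> = - qcnj (\<Sum>m\<in>UNIV. - qcnj (qi * Y $ m) * X $ m)"
      by (simp add: H_act H_sym [of "f Y"] Hef)
    also have "\<dots> = (\<Sum>m\<in>UNIV. qcnj (X $ m) * qi * Y $ m)"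
      by (simp add: qcnj_sum qcnj_mult sum_negf mult.assoc)
    finally show ?thesis by (metis H_Re)
  qed
  moreover have "f (X \<cdot> qi) = I (f X)" "f (X \<cdot> qj) = J (f X)" for X
    by (simp_all add: fact act_unit)
  ultimately show ?thesis using f bij by blast
qed

section \<open>Algebraic curvature tensors\<close>

context skew_form begin

text \<open>\<open>orthonormal_frame\<close> for the real part of \<open>h\<close> and the given
  right multiplications; the resulting map commutes with i and j and is therefore a matrix.\<close>

lemma orthonormal_basis:
  shows "\<exists>P :: quat^'n^'n. invertible P \<and> (\<forall>X Y. h (P *v X) (P *v Y) = (\<Sum>m\<in>UNIV. qcnj (X $ m) * qi * Y $ m))"
proof -
  have w: "linear (\<lambda>Y. qRe (h X Y))" for X
    by (intro linearI) (simp_all add: hf_add hf_scaleR)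
  have "\<exists>f :: quat^'n \<Rightarrow> quat^'n. linear f \<and> bij f \<and> (\<forall>X. f (X \<cdot> qi) = f X \<cdot> qi) \<and> (\<forall>X. f (X \<cdot> qj) = f X \<cdot> qj) \<and>
    (\<forall>X Y. qRe (h (f X) (f Y)) = qRe (\<Sum>m\<in>UNIV. qcnj (X $ m) * qi * Y $ m))"
  proof (rule orthonormal_frame [of "\<lambda>X. X \<cdot> qi" "\<lambda>X. X \<cdot> qj" "\<lambda>X Y. qRe (h X Y)"])
    show "qRe (h X Y) = - qRe (h Y X)" for X Y by (rule h_Re_sym)
    show "(\<And>Y. qRe (h X Y) = 0) \<Longrightarrow> X = 0" for X by (rule Re_h_nondeg)
  qed (simp_all add: linear_vscale vscale_assoc hf_scale w quat_mult_sel)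
  then obtain f :: "quat^'n \<Rightarrow> quat^'n" where f: "linear f" "bij f" and i: "\<And>X. f (X \<cdot> qi) = f X \<cdot> qi"
    and j: "\<And>X. f (X \<cdot> qj) = f X \<cdot> qj"
    and w: "\<And>X Y. qRe (h (f X) (f Y)) = qRe (\<Sum>m\<in>UNIV. qcnj (X $ m) * qi * Y $ m)" by blast
  have "f (X \<cdot> q) = f X \<cdot> q" for X q
    by (rule Hlinear_if_qi_qj) (simp_all add: linear_add [OF f(1)] linear_scale [OF f(1)] i j)
  then obtain P where P: "\<And>X. f X = P *v X"
    using Hlinear_matrix [of f] linear_add [OF f(1)] by blast
  have "invertible P" unfolding invertible_iff_inj P [symmetric]
    using linear_injective_0 [OF f(1)] bij_is_inj [OF f(2)] by simp
  moreover have "h (P *v X) (P *v Y) = (\<Sum>m\<in>UNIV. qcnj (X $ m) * qi * Y $ m)" (is "?l = ?r Y") for X Y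
  proof -
    have "qRe (?l * q) = qRe (?r Y * q)" for q
      using w [of X "Y \<cdot> q"] unfolding P mv_vscale hf_scale
      by (simp add: vscale_def sum_distrib_right mult.assoc)
    from this [of 1] this [of qi] this [of qj] this [of qk] show ?thesis
      unfolding quat_eq_iff by (simp add: quat_mult_sel)
  qed
  ultimately show ?thesis by blast
qed

end

text \<open>An algebraic curvature tensor with values in so*(2n) + sp(1), split into its two
  components. The last assumption is the first Bianchi identity for the operators
  \<open>Z \<mapsto> A X Y *v Z - Z \<cdot> a X Y\<close>.\<close>

locale curvature = skew_form j for j :: "quat^'n^'n" +
  fixes A :: "quat^'n \<Rightarrow> quat^'n \<Rightarrow> quat^'n^'n" and a :: "quat^'n \<Rightarrow> quat^'n \<Rightarrow> quat"
  assumes A_so: "A X Y \<in> so_star j" and a_sp: "a X Y \<in> sp1"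
    and A_skew: "A X Y = - A Y X" and a_skew: "a X Y = - a Y X"
    and A_add: "A (X + Y) Z = A X Z + A Y Z" and a_add: "a (X + Y) Z = a X Z + a Y Z"
    and A_scaleR: "A (r *\<^sub>R X) Y = r *\<^sub>R A X Y" and a_scaleR: "a (r *\<^sub>R X) Y = r *\<^sub>R a X Y"
    and bianchi: "A X Y *v Z + A Y Z *v X + A Z X *v Y = Z \<cdot> a X Y + X \<cdot> a Y Z + Y \<cdot> a Z X"
begin

lemma A_add2: "A Z (X + Y) = A Z X + A Z Y" and a_add2: "a Z (X + Y) = a Z X + a Z Y"
  by (metis A_add A_skew minus_add_distrib) (metis a_add a_skew minus_add_distrib)

lemma A_scaleR2: "A Y (r *\<^sub>R X) = r *\<^sub>R A Y X" and a_scaleR2: "a Y (r *\<^sub>R X) = r *\<^sub>R a Y X"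
  by (metis A_scaleR A_skew scaleR_minus_right) (metis a_scaleR a_skew scaleR_minus_right)

lemma A_minus [simp]: "A (- X) Y = - A X Y" "A X (- Y) = - A X Y"
  using A_scaleR [of "-1" X Y] A_scaleR2 [of X "-1" Y] by simp_all

lemma a_minus [simp]: "a (- X) Y = - a X Y" "a X (- Y) = - a X Y"
  using a_scaleR [of "-1" X Y] a_scaleR2 [of X "-1" Y] by simp_all

lemma a_Re [simp]: "qRe (a X Y) = 0"
  using a_sp by (simp add: sp1_def)

definition E :: "quat^'n \<Rightarrow> quat^'n \<Rightarrow> quat^'n \<Rightarrow> quat^'n" where
  "E X Y Z = Z \<cdot> a X Y + X \<cdot> a Y Z + Y \<cdot> a Z X"

text \<open>For an imaginary unit \<open>q\<close>, this combination of Bianchi identities only involves the part of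
  \<open>A\<close> which changes sign under \<open>(X, Z) \<mapsto> (X q, Z q)\<close>.\<close>

lemma bianchi_q:
  assumes "q * q = -1"
  shows "(A (X \<cdot> q) (Z \<cdot> q) - A X Z) *v Y - (A (X \<cdot> q) Z + A X (Z \<cdot> q)) *v (Y \<cdot> q)
    = E (X \<cdot> q) Y Z \<cdot> q + E X Y Z - E (X \<cdot> q) Y (Z \<cdot> q) + E X Y (Z \<cdot> q) \<cdot> q"
proof -
  have qq: "U \<cdot> q \<cdot> q = - U" for U :: "quat^'n" by (simp add: vscale_assoc assms)
  have s: "A Z' X' *v W = - (A X' Z' *v W)" for X' Z' W by (subst A_skew) simp
  show ?thesis
    unfolding E_def bianchi [symmetric] vscale_distrib mv_vscale qq
      s [of Z] s [of "Z \<cdot> q"]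
    by (simp add: algebra_simps mv_vscale qq vscale_distrib)
qed

text \<open>Replacing \<open>Y\<close> by \<open>Y r\<close> and multiplying the result by
  \<open>r\<close> reverses the first term of \<open>bianchi_q\<close> and preserves the second,
  because \<open>r q r = q\<close>. The difference isolates the first term.\<close>

lemma bianchi_qr:
  assumes q: "q * q = -1" and r: "r * r = -1" and qr: "q * r = - (r * q)"
  defines "G Y X Z \<equiv> E (X \<cdot> q) Y Z \<cdot> q + E X Y Z - E (X \<cdot> q) Y (Z \<cdot> q) + E X Y (Z \<cdot> q) \<cdot> q"
  shows "2 *\<^sub>R ((A (X \<cdot> q) (Z \<cdot> q) - A X Z) *v Y) = G Y X Z - G (Y \<cdot> r) X Z \<cdot> r"
proof -
  have rr: "U \<cdot> r \<cdot> r = - U" for U :: "quat^'n" by (simp add: vscale_assoc r)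
  have "r * (q * r) = q" using qr r by (metis mult.assoc mult_minus1_right mult_minus_right minus_minus)
  then have rqr: "U \<cdot> r \<cdot> q \<cdot> r = U \<cdot> q" for U :: "quat^'n" by (simp add: vscale_assoc mult.assoc)
  show ?thesis
    unfolding G_def bianchi_q [OF q, symmetric] vscale_distrib mv_vscale rqr
    by (simp add: rr mv_vscale vscale_distrib rqr scaleR_2 flip: mult_2)
qed

lemma E_coefficients:
  assumes "q * q = -1"
  shows "E (X \<cdot> q) Y Z \<cdot> q + E X Y Z - E (X \<cdot> q) Y (Z \<cdot> q) + E X Y (Z \<cdot> q) \<cdot> q
    = Z \<cdot> (a (X \<cdot> q) Y * q + a X Y - q * a (X \<cdot> q) Y + q * a X Y * q)
    + Y \<cdot> (a Z (X \<cdot> q) * q + a Z X - a (Z \<cdot> q) (X \<cdot> q) + a (Z \<cdot> q) X * q)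
    + X \<cdot> (q * a Y Z * q + a Y Z - q * a Y (Z \<cdot> q) + a Y (Z \<cdot> q) * q)"
  by (simp add: E_def vscale_distrib vscale_assoc mult.assoc)

end

lemma real_if_central:
  assumes "\<And>t. b * t = t * (b :: quat)" shows "b = of_real (qRe b)"
  using assms [of qi] assms [of qj] by (simp add: qcomp)

text \<open>The vector \<open>(x, y)\<close> is a multiple of \<open>(y, - x)\<close>, hence
  orthogonal to itself.\<close>

lemma rotated_eq_0:
  fixes x y c :: real
  assumes "x * c + y = 0" "y * c - x = 0" shows "x = 0 \<and> y = 0"
proof -
  have x: "x = y * c" and y: "y = - (x * c)" using assms by simp_all
  have "x * x + y * y = x * (y * c) + y * (- (x * c))" using x y by simp
  also have "\<dots> = 0" by simp
  finally show ?thesis by (simp add: sum_squares_eq_zero_iff)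
qed

section \<open>The sp(1) part on orthogonal pairs of vectors\<close>

context curvature begin

text \<open>Pairing \<open>bianchi_qr\<close> with \<open>X\<close> removes the terms along
  \<open>Z\<close>. What is left has the form \<open>\<eta> (y b(p) + p K(y))\<close> with
  \<open>\<eta> = h X X\<close>, where \<open>p\<close> and \<open>y\<close> multiply the two
  occurrences of \<open>X\<close>. H-linearity in \<open>y\<close> makes \<open>b\<close>
  real-valued and \<open>K\<close> linear, and since the operator on the left lies in so*(2n),
  hermitian symmetry then leaves only zero.\<close>

lemma orth_core:
  assumes q: "q * q = -1" and r: "r * r = -1" and qr: "q * r = - (r * q)"
    and o: "h X Z = 0" and aniso: "h X X \<noteq> 0"
  defines "\<beta> \<equiv> \<lambda>p. a Z (X \<cdot> p \<cdot> q) * q + a Z (X \<cdot> p) - a (Z \<cdot> q) (X \<cdot> p \<cdot> q) + a (Z \<cdot> q) (X \<cdot> p) * q"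
    and "k \<equiv> \<lambda>Y. q * a Y Z * q + a Y Z - q * a Y (Z \<cdot> q) + a Y (Z \<cdot> q) * q"
  shows "\<beta> 1 - r * \<beta> 1 * r = 0" "k (X \<cdot> y) - k (X \<cdot> y \<cdot> r) * r = 0"
proof -
  define \<eta> where "\<eta> = h X X"
  define b where "b p = \<beta> p - r * \<beta> p * r" for p
  define K where "K y = k (X \<cdot> y) - k (X \<cdot> y \<cdot> r) * r" for y
  define M where "M p = A (X \<cdot> p \<cdot> q) (Z \<cdot> q) - A (X \<cdot> p) Z" for p
  have kd: "k Y = q * a Y Z * q + a Y Z - q * a Y (Z \<cdot> q) + a Y (Z \<cdot> q) * q" for Y
    by (simp add: k_def)
  have \<beta>d: "\<beta> p = a Z (X \<cdot> p \<cdot> q) * q + a Z (X \<cdot> p) - a (Z \<cdot> q) (X \<cdot> p \<cdot> q) + a (Z \<cdot> q) (X \<cdot> p) * q" for p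
    by (simp add: \<beta>_def)
  have M: "2 *\<^sub>R h X (M p *v (X \<cdot> y)) = \<eta> * (y * b p + p * K y)" for p y
  proof -
    have "2 *\<^sub>R h X (M p *v (X \<cdot> y)) = h X (2 *\<^sub>R (M p *v (X \<cdot> y)))" by (simp add: hf_scaleR)
    also have "\<dots> = \<eta> * (y * b p + p * K y)"
      unfolding M_def bianchi_qr [OF q r qr] E_coefficients [OF q] kd [symmetric] \<beta>d [symmetric]
      unfolding b_def K_def
      by (simp add: hf_add hf_scale o \<eta>_def algebra_simps)
    finally show ?thesis .
  qed
  have \<eta>0: "\<eta> \<noteq> 0" using aniso by (simp add: \<eta>_def)
  have L: "y * t * b p + p * K (y * t) = (y * b p + p * K y) * t" for y t p
  proof -
    have "\<eta> * (y * t * b p + p * K (y * t)) = \<eta> * (y * b p + p * K y) * t"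
      unfolding M [symmetric] by (simp add: mv_vscale hf_scale flip: vscale_assoc)
    then show ?thesis using \<eta>0 by (simp add: mult.assoc)
  qed
  have K: "K t = (b 1 + K 1) * t - t * b 1" for t using L [of 1 t 1] by (simp add: algebra_simps)
  have c: "p * (b 1 * t - t * b 1) = b p * t - t * b p" for p t
    using L [of 1 t p] K [of t] by (simp add: algebra_simps)
  \<comment> \<open>The right side of \<open>c\<close> has zero real part for every
    \<open>p\<close>; the choice for \<open>p\<close> is the conjugate of the commutator
    itself.\<close>
  have b1: "b 1 * t = t * b 1" for t
  proof -
    let ?c = "b 1 * t - t * b 1"
    have "qRe (qcnj ?c * ?c) = 0" unfolding c by (simp add: quat_mult_sel)
    then have "?c = 0" unfolding qcnj_mult_self of_real_quat_sel by simp
    then show ?thesis by simp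
  qed
  have bp: "b p = of_real (qRe (b p))" for p
  proof (rule real_if_central)
    fix t show "b p * t = t * b p" using c [of p t] b1 [of t] by simp
  qed
  have K': "K t = K 1 * t" for t using K [of t] b1 [of t] by (simp add: distrib_right)
  have Mso: "M p \<in> so_star j" for p by (simp add: M_def so_star_closed A_so)
  have "qcnj (h X (M p *v X)) = h X (M p *v X)" for p
    by (simp add: h_cnj h_so_star [OF Mso])
  then have "qcnj (2 *\<^sub>R h X (M p *v (X \<cdot> 1))) = 2 *\<^sub>R h X (M p *v (X \<cdot> 1))" for p by simp
  then have herm: "qcnj (\<eta> * (b p + p * K 1)) = \<eta> * (b p + p * K 1)" for p
    unfolding M by simp
  have \<eta>: "qRe \<eta> = 0" using h_Re_sym [of X X] by (simp add: \<eta>_def)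
  \<comment> \<open>Otherwise \<open>p\<close> equal to \<open>x\<close> times the inverse of
    \<open>K 1\<close> makes \<open>\<eta> (c(x) + x)\<close> real with real \<open>c(x)\<close>.
    For x = i and x = j this contradicts that \<open>\<eta>\<close> is imaginary and
    nonzero.\<close>
  have K1: "K 1 = 0"
  proof (rule ccontr)
    assume nz: "K 1 \<noteq> 0"
    have e: "qcnj (\<eta> * (b (x * inverse (K 1)) + x)) = \<eta> * (b (x * inverse (K 1)) + x)" for x
      using herm [of "x * inverse (K 1)"] nz by (simp add: mult.assoc)
    define c where "c x = qRe (b (x * inverse (K 1)))" for x
    have e: "qcnj (\<eta> * (of_real (c x) + x)) = \<eta> * (of_real (c x) + x)" for x
      using e [of x] bp [of "x * inverse (K 1)"] by (simp add: c_def)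
    have im: "qI u = 0 \<and> qJ u = 0 \<and> qK u = 0" if "qcnj u = u" for u
      using that by (simp add: quat_eq_iff)
    have "qJ \<eta> * c qi + qK \<eta> = 0" "qK \<eta> * c qi - qJ \<eta> = 0"
      using im [OF e [of qi]] by (simp_all add: quat_mult_sel \<eta>)
    moreover have "qK \<eta> * c qj + qI \<eta> = 0" "qI \<eta> * c qj - qK \<eta> = 0"
      using im [OF e [of qj]] by (simp_all add: quat_mult_sel \<eta>)
    ultimately show False
      using rotated_eq_0 \<eta>0 \<eta> unfolding quat_eq_iff by (metis quat_sel(1-4))
  qed
  have "b 1 = 0"
  proof -
    have "qcnj (\<eta> * of_real (qRe (b 1))) = \<eta> * of_real (qRe (b 1))"
      using herm [of 1] K1 bp [of 1] by simp
    then have "qRe (b 1) = 0 \<or> \<eta> = 0" by (auto simp: qcomp \<eta>)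
    then show ?thesis using \<eta>0 bp [of 1] by simp
  qed
  then show "\<beta> 1 - r * \<beta> 1 * r = 0" by (simp add: b_def)
  show "k (X \<cdot> y) - k (X \<cdot> y \<cdot> r) * r = 0" using K' [of y] K1 by (simp add: K_def)
qed

text \<open>\<open>orth_core\<close> for (q, r) equal to (i, j), (j, k) and (k, i), read off
  componentwise.\<close>

lemma orth_components:
  assumes "h X Z = 0" "h X X \<noteq> 0"
  shows "qJ (a (X \<cdot> y) Z) = - qK (a (X \<cdot> y) (Z \<cdot> qi))" "qK (a (X \<cdot> y) Z) = qJ (a (X \<cdot> y) (Z \<cdot> qi))"
    "qK (a (X \<cdot> y) Z) = - qI (a (X \<cdot> y) (Z \<cdot> qj))" "qI (a (X \<cdot> y) Z) = qK (a (X \<cdot> y) (Z \<cdot> qj))"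
    "qI (a (X \<cdot> y) Z) = - qJ (a (X \<cdot> y) (Z \<cdot> qk))" "qJ (a (X \<cdot> y) Z) = qI (a (X \<cdot> y) (Z \<cdot> qk))"
    "qI (a (X \<cdot> qi) Z) = - qI (a X (Z \<cdot> qi))"
    "qJ (a (X \<cdot> qj) Z) = - qJ (a X (Z \<cdot> qj))"
    "qK (a (X \<cdot> qk) Z) = - qK (a X (Z \<cdot> qk))"
proof -
  note i = orth_core [of qi qj, OF _ _ _ assms, simplified]
  note j = orth_core [of qj qk, OF _ _ _ assms, simplified]
  note k = orth_core [of qk qi, OF _ _ _ assms, simplified]
  show "qJ (a (X \<cdot> y) Z) = - qK (a (X \<cdot> y) (Z \<cdot> qi))" "qK (a (X \<cdot> y) Z) = qJ (a (X \<cdot> y) (Z \<cdot> qi))"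
    using i(2) [of y] by (simp_all add: qcomp)
  show "qK (a (X \<cdot> y) Z) = - qI (a (X \<cdot> y) (Z \<cdot> qj))" "qI (a (X \<cdot> y) Z) = qK (a (X \<cdot> y) (Z \<cdot> qj))"
    using j(2) [of y] by (simp_all add: qcomp)
  show "qI (a (X \<cdot> y) Z) = - qJ (a (X \<cdot> y) (Z \<cdot> qk))" "qJ (a (X \<cdot> y) Z) = qI (a (X \<cdot> y) (Z \<cdot> qk))"
    using k(2) [of y] by (simp_all add: qcomp)
  show "qI (a (X \<cdot> qi) Z) = - qI (a X (Z \<cdot> qi))"
    using i(1) a_skew [of Z "X \<cdot> qi"] a_skew [of "Z \<cdot> qi" X] by (simp add: qcomp)
  show "qJ (a (X \<cdot> qj) Z) = - qJ (a X (Z \<cdot> qj))"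
    using j(1) a_skew [of Z "X \<cdot> qj"] a_skew [of "Z \<cdot> qj" X] by (simp add: qcomp)
  show "qK (a (X \<cdot> qk) Z) = - qK (a X (Z \<cdot> qk))"
    using k(1) a_skew [of Z "X \<cdot> qk"] a_skew [of "Z \<cdot> qk" X] by (simp add: qcomp)
qed

end

section \<open>Averaging over the quaternion units\<close>

definition sum4 :: "(quat \<Rightarrow> quat) \<Rightarrow> quat" where
  "sum4 g = g 1 + g qi + g qj + g qk"

text \<open>Averaging over the quaternion group projects a real bilinear form to a sesquilinear one; the
  factor makes it recover \<open>h (A X) Y\<close> from \<open>acur A a X Y\<close>.\<close>

definition qavg :: "(quat^'n \<Rightarrow> quat^'n \<Rightarrow> quat) \<Rightarrow> quat^'n \<Rightarrow> quat^'n \<Rightarrow> quat" where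
  "qavg f X Y = (1/24) *\<^sub>R sum4 (\<lambda>p. sum4 (\<lambda>q. p * f (X \<cdot> p) (Y \<cdot> q) * qcnj q))"

context skew_form begin

text \<open>The number 24 is 16 + 8. Put \<open>w = h (A *v X) Y\<close>; twice the imaginary part
  of \<open>x = qcnj p * w * q\<close> is \<open>x - qcnj x\<close>. The first term returns
  \<open>w\<close> for each of the 16 choices of units, and the second contributes
  \<open>8 w\<close> because the sum of all \<open>p x p\<close> is
  \<open>- 2 qcnj x\<close>.\<close>

lemma qavg_acur: assumes "A \<in> so_star j" shows "qavg (acur A 0) X Y = h (A *v X) Y"
  by (simp add: qavg_def sum4_def acur_alt assms hf_scale mv_vscale) (simp add: qcomp)

end

context curvature begin

text \<open>Multiplication by i, j or k permutes the four units up to signs, and these cancel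
  between the argument of \<open>a\<close> and the outer factor. Hermitian symmetry holds because
  \<open>a\<close> is both skew and imaginary.\<close>

lemma qavg_sesquilinear:
  "qavg a X (Y + Z) = qavg a X Y + qavg a X Z" "qavg a X (Y \<cdot> r) = qavg a X Y * r"
  "qavg a X Y = qcnj (qavg a Y X)"
proof -
  show add: "qavg a X (Y + Z) = qavg a X Y + qavg a X Z" for Y Z
    by (simp add: qavg_def sum4_def vscale_distrib a_add2 algebra_simps)
  have sc: "qavg a X (t *\<^sub>R Y) = t *\<^sub>R qavg a X Y" for t Y
    by (simp add: qavg_def sum4_def vscale_scaleR a_scaleR2 scaleR_add_right scaleR_diff_right)
  have "qavg a X (Y \<cdot> qi) = qavg a X Y * qi" "qavg a X (Y \<cdot> qj) = qavg a X Y * qj"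
    "qavg a X (Y \<cdot> qk) = qavg a X Y * qk"
    by (simp_all add: qavg_def sum4_def vscale_assoc algebra_simps)
  moreover have "Y \<cdot> r = qRe r *\<^sub>R Y + qI r *\<^sub>R (Y \<cdot> qi) + qJ r *\<^sub>R (Y \<cdot> qj) + qK r *\<^sub>R (Y \<cdot> qk)"
  proof -
    have "r = of_real (qRe r) + qI r *\<^sub>R qi + qJ r *\<^sub>R qj + qK r *\<^sub>R qk" by (simp add: quat_eq_iff)
    then have "Y \<cdot> r = Y \<cdot> (of_real (qRe r) + qI r *\<^sub>R qi + qJ r *\<^sub>R qj + qK r *\<^sub>R qk)" by simp
    then show ?thesis by (simp only: vscale_distrib vscale_scaleR)
  qed
  ultimately show "qavg a X (Y \<cdot> r) = qavg a X Y * r"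
    by (simp only: add sc) (simp add: qcomp algebra_simps)
  have "qcnj (a (Y \<cdot> p) (X \<cdot> q)) = a (X \<cdot> q) (Y \<cdot> p)" for p q
    using a_sp a_skew by (metis sp1_cnj)
  then have c: "qcnj (p * a (Y \<cdot> p) (X \<cdot> q) * qcnj q) = q * a (X \<cdot> q) (Y \<cdot> p) * qcnj p" for p q
    by (simp add: qcnj_mult mult.assoc)
  show "qavg a X Y = qcnj (qavg a Y X)"
    unfolding qavg_def sum4_def by (simp only: qcnj_simps(4,7) c) (simp add: add_ac)
qed

text \<open>By \<open>orth_components\<close>, applied to \<open>Z\<close> and to its multiples by
  the units, \<open>a\<close> on the lines of \<open>X\<close> and \<open>Z\<close> is determined by
  the four numbers \<open>f0 X\<close>, \<open>f1 X\<close>, \<open>f2 X\<close>,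
  \<open>f3 X\<close>. They are the components of twice the average.\<close>

lemma orth_vanish:
  assumes o: "h X Z = 0" and aniso: "h X X \<noteq> 0" and avg: "qavg a X Z = 0"
  shows "a X Z = 0"
proof -
  define f0 f1 f2 f3 where "f0 Y = qI (a Y (Z \<cdot> qi))" "f1 Y = qI (a Y Z)" "f2 Y = qJ (a Y Z)"
    "f3 Y = qK (a Y Z)" for Y
  have o': "h X (Z \<cdot> q) = 0" for q by (simp add: hf_scale o)
  note e = orth_components(1-6) [OF o aniso]
  have p: "qJ (a (X \<cdot> y) (Z \<cdot> qj)) = qI (a (X \<cdot> y) (Z \<cdot> qi))"
    "qK (a (X \<cdot> y) (Z \<cdot> qk)) = qI (a (X \<cdot> y) (Z \<cdot> qi))" for y
    using orth_components(5) [OF o' [of qi] aniso, of y] orth_components(4) [OF o' [of qi] aniso, of y]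
    by (simp_all add: vscale_assoc)
  note d = orth_components(7-9) [OF o aniso] orth_components(7-9) [OF o' [of qi] aniso]
    orth_components(7-9) [OF o' [of qj] aniso] orth_components(7-9) [OF o' [of qk] aniso]
  note ds = d [unfolded vscale_assoc qunits vscale_simps a_minus quat_sel minus_minus]
  note e1 = e [of 1, unfolded vscale_simps] p [of 1, unfolded vscale_simps]
  have f: "a (X \<cdot> y) (Z \<cdot> 1) = Quat 0 (f1 (X \<cdot> y)) (f2 (X \<cdot> y)) (f3 (X \<cdot> y))"
    "a (X \<cdot> y) (Z \<cdot> qi) = Quat 0 (f0 (X \<cdot> y)) (f3 (X \<cdot> y)) (- f2 (X \<cdot> y))"
    "a (X \<cdot> y) (Z \<cdot> qj) = Quat 0 (- f3 (X \<cdot> y)) (f0 (X \<cdot> y)) (f1 (X \<cdot> y))"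
    "a (X \<cdot> y) (Z \<cdot> qk) = Quat 0 (f2 (X \<cdot> y)) (- f1 (X \<cdot> y)) (f0 (X \<cdot> y))" for y
    unfolding f0_f1_f2_f3_def quat_eq_iff quat.sel vscale_simps
    by (intro conjI; (rule a_Re | rule refl | use e [of y] p [of y] in linarith))+
  have g: "f1 (X \<cdot> qi) = - f0 X" "f2 (X \<cdot> qj) = - f0 X" "f3 (X \<cdot> qk) = - f0 X"
    "f0 (X \<cdot> qi) = f1 X" "f0 (X \<cdot> qj) = f2 X" "f0 (X \<cdot> qk) = f3 X"
    unfolding f0_f1_f2_f3_def using e1 p [of qi] p [of qj] p [of qk] ds by linarith+
  have g': "f2 (X \<cdot> qi) = f3 X" "f3 (X \<cdot> qi) = - f2 X" "f1 (X \<cdot> qj) = - f3 X" "f3 (X \<cdot> qj) = f1 X"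
    "f1 (X \<cdot> qk) = f2 X" "f2 (X \<cdot> qk) = - f1 X"
    unfolding f0_f1_f2_f3_def using e1 e [of qi] e [of qj] e [of qk] ds by linarith+
  have "sum4 (\<lambda>p. sum4 (\<lambda>q. p * a (X \<cdot> p) (Z \<cdot> q) * qcnj q)) = 0"
    using avg by (simp add: qavg_def)
  then have "f1 X = 0 \<and> f2 X = 0 \<and> f3 X = 0"
    unfolding sum4_def f by (simp add: qcomp g g')
  then show ?thesis using f(1) [of 1] by (simp add: quat_eq_iff)
qed

end

section \<open>Curvatures with vanishing average or vanishing sp(1) part\<close>

context curvature begin

lemma a_sum: "a (sum f S) Y = (\<Sum>x\<in>S. a (f x) Y)" "a X (sum f S) = (\<Sum>x\<in>S. a X (f x))"
  using a_scaleR [of 0] a_scaleR2 [of _ 0]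
  by (induction S rule: infinite_finite_induct) (auto simp: a_add a_add2)

text \<open>In an orthonormal basis \<open>orth_vanish\<close> removes the mixed blocks of
  \<open>a\<close>. Applied to vectors \<open>e m + e l t\<close> it ties the diagonal blocks to one
  another, and skewness leaves the single value \<open>F qi\<close>.\<close>

lemma a_eq_form:
  assumes n: "CARD('n) > 1" and avg: "\<And>X Y. qavg a X Y = 0"
  shows "\<exists>c\<in>sp1. \<forall>X Y. a X Y = (4 * qRe (h X Y)) *\<^sub>R c"
proof -
  obtain P :: "quat^'n^'n" where P: "invertible P"
    and hP: "\<And>X Y. h (P *v X) (P *v Y) = (\<Sum>m\<in>UNIV. qcnj (X $ m) * qi * Y $ m)"
    using orthonormal_basis by blast
  define e where "e m = P *v axis m 1" for m
  have Pe: "P *v X = (\<Sum>m\<in>UNIV. e m \<cdot> (X $ m))" for X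
  proof -
    have "P *v X = P *v (\<Sum>m\<in>UNIV. axis m 1 \<cdot> (X $ m))" by (simp flip: vec_decompose)
    then show ?thesis unfolding linear_sum [OF linear_mv] mv_vscale e_def .
  qed
  have he: "h (e m) (e l) = (if m = l then qi else 0)" for m l
  proof -
    have "h (e m) (e l) = (\<Sum>k\<in>UNIV. if m = k then (if m = l then qi else 0) else 0)"
      unfolding e_def hP by (rule sum.cong) (auto simp: axis_def)
    then show ?thesis by simp
  qed
  have nz: "qcnj s * (qi * s) \<noteq> 0" if "s \<noteq> 0" for s
  proof -
    have "qi \<noteq> 0" by (simp add: quat_eq_iff)
    then show ?thesis using that by simp
  qed
  have off: "a (e m \<cdot> s) (e l \<cdot> w) = 0" if "m \<noteq> l" for m l s w
  proof (cases "s = 0")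
    case False
    show ?thesis
      by (rule orth_vanish) (use that nz [OF False] in \<open>simp_all add: hf_scale he avg mult.assoc\<close>)
  qed (use a_scaleR [of 0] in simp)
  have rel: "a (e m) (e m \<cdot> (qi * qcnj s * qi * w)) = - a (e l \<cdot> s) (e l \<cdot> w)" if ml: "m \<noteq> l" for m l s w
  proof -
    \<comment> \<open>Shrinking \<open>s\<close> to norm below 1 keeps
      \<open>e m + e l \<cdot> t\<close> anisotropic; bilinearity undoes the scaling at the
      end.\<close>
    define c where "c = 1 / (2 + norm s)"
    have c: "c > 0" by (simp add: c_def add_pos_nonneg)
    define t where "t = c *\<^sub>R s"
    have "norm t = norm s / (2 + norm s)" using c by (simp add: t_def c_def)
    also have "\<dots> < 1" using add_pos_nonneg [of 2 "norm s"] by (simp add: divide_less_eq)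
    finally have "norm t < 1" .
    then have "(norm t)\<^sup>2 < 1" by (simp add: abs_square_less_1)
    have an: "qi + qcnj t * qi * t \<noteq> 0"
    proof
      assume "qi + qcnj t * qi * t = 0"
      then have "norm qi = norm (qcnj t * qi * t)" unfolding eq_neg_iff_add_eq_0 [symmetric] by (metis norm_minus_cancel)
      moreover have "norm (qcnj t) = norm t" by (simp add: norm_quat_def)
      moreover have "norm qi = 1" by (simp add: norm_quat_def)
      ultimately show False using \<open>(norm t)\<^sup>2 < 1\<close> by (simp add: norm_mult power2_eq_square)
    qed
    \<comment> \<open>The coefficient of \<open>e m\<close> in the second argument is the one that
      makes it orthogonal to the first.\<close>
    have "a (e m + e l \<cdot> t) (e m \<cdot> (qi * qcnj t * qi * w) + e l \<cdot> w) = 0"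
      by (rule orth_vanish) (use ml an in \<open>simp_all add: hf_add hf_scale he avg mult.assoc\<close>)
    then have "a (e m) (e m \<cdot> (qi * qcnj t * qi * w)) + a (e l \<cdot> t) (e l \<cdot> w) = 0"
      using off [of m l 1 w] off [of l m] ml by (simp add: a_add a_add2)
    moreover have "e m \<cdot> (qi * qcnj t * qi * w) = c *\<^sub>R (e m \<cdot> (qi * qcnj s * qi * w))" "e l \<cdot> t = c *\<^sub>R (e l \<cdot> s)"
      by (simp_all add: t_def vscale_scaleR)
    ultimately have "c *\<^sub>R (a (e m) (e m \<cdot> (qi * qcnj s * qi * w)) + a (e l \<cdot> s) (e l \<cdot> w)) = 0"
      by (simp add: a_scaleR a_scaleR2 scaleR_add_right)
    then show ?thesis using c by (simp add: eq_neg_iff_add_eq_0)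
  qed
  obtain m0 l0 :: 'n where ml: "m0 \<noteq> l0"
  proof -
    have "\<exists>b c :: 'n. b \<noteq> c"
    proof (rule ccontr)
      assume "\<not> (\<exists>b c :: 'n. b \<noteq> c)"
      then have "(UNIV :: 'n set) \<subseteq> {undefined}" by blast
      then have "CARD('n) \<le> card {undefined :: 'n}" by (intro card_mono) auto
      then show False using n by simp
    qed
    then show ?thesis using that by blast
  qed
  \<comment> \<open>For \<open>l = m0\<close> the relation is used twice, by way of the second basis
    vector \<open>l0\<close>.\<close>
  have diag: "a (e l \<cdot> s) (e l \<cdot> w) = - a (e m0) (e m0 \<cdot> (qi * qcnj s * qi * w))" for l s w
  proof (cases "l = m0")
    case False
    then show ?thesis using rel [of m0 l s w] by simp
  next
    case True
    have "a (e l0) (e l0 \<cdot> x) = a (e m0) (e m0 \<cdot> x)" for x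
      using rel [OF ml, of 1 x] by simp
    then show ?thesis using rel [of l0 m0 s w] ml True by simp
  qed
  define F where "F w = a (e m0) (e m0 \<cdot> w)" for w
  have F_add: "F (x + y) = F x + F y" "F (r *\<^sub>R x) = r *\<^sub>R F x" "F (- x) = - F x" for x y r
    by (simp_all add: F_def vscale_distrib vscale_scaleR a_add2 a_scaleR2)
  have self: "a X X = 0" for X
  proof -
    have "2 *\<^sub>R a X X = 0" using a_skew [of X X] by (simp add: scaleR_2 eq_neg_iff_add_eq_0)
    then show ?thesis by simp
  qed
  have "F (qi * qcnj s * qi * s) = 0" for s
    using diag [of m0 s s] by (simp add: self F_def)
  \<comment> \<open>The values 1, 1 + j and 1 + k of \<open>s\<close> lead to multiples of 1, j and
    k. Since \<open>qcnj s * qi * s\<close> is imaginary, these products never have an i component,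
    which is why \<open>F qi\<close> stays free.\<close>
  moreover have "qi * qcnj (1 + qj) * qi * (1 + qj) = (-2) *\<^sub>R qj" "qi * qcnj (1 + qk) * qi * (1 + qk) = (-2) *\<^sub>R qk"
    "qi * qcnj 1 * qi * 1 = - 1"
    by (simp_all add: qcomp)
  ultimately have "F (- 1) = 0" "F ((-2) *\<^sub>R qj) = 0" "F ((-2) *\<^sub>R qk) = 0"
    by metis+
  then have F0: "F 1 = 0" "F qj = 0" "F qk = 0" unfolding F_add by simp_all
  \<comment> \<open>Since \<open>h(e, e i) = - 1\<close>, the claim at this pair of vectors reads
    \<open>F qi = - 4 c\<close>.\<close>
  define c where "c = - (1/4) *\<^sub>R F qi"
  have F: "F w = - (4 * qI w) *\<^sub>R c" for w
  proof -
    have "F w = F (qRe w *\<^sub>R 1 + qI w *\<^sub>R qi + qJ w *\<^sub>R qj + qK w *\<^sub>R qk)"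
      by (rule arg_cong [of _ _ F]) (simp add: quat_eq_iff)
    then show ?thesis unfolding F_add F0 by (simp add: c_def)
  qed
  have "a (P *v X) (P *v Y) = (4 * qRe (h (P *v X) (P *v Y))) *\<^sub>R c" for X Y
  proof -
    have "a (P *v X) (P *v Y) = (\<Sum>m\<in>UNIV. \<Sum>l\<in>UNIV. a (e m \<cdot> (X $ m)) (e l \<cdot> (Y $ l)))"
      unfolding Pe a_sum by (rule sum.swap)
    also have "\<dots> = (\<Sum>m\<in>UNIV. a (e m \<cdot> (X $ m)) (e m \<cdot> (Y $ m)))"
    proof (rule sum.cong [OF refl])
      fix m
      have "(\<Sum>l\<in>UNIV. a (e m \<cdot> (X $ m)) (e l \<cdot> (Y $ l)))
          = (\<Sum>l\<in>UNIV. if m = l then a (e m \<cdot> (X $ m)) (e m \<cdot> (Y $ m)) else 0)"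
        by (rule sum.cong) (auto simp: off)
      then show "(\<Sum>l\<in>UNIV. a (e m \<cdot> (X $ m)) (e l \<cdot> (Y $ l))) = a (e m \<cdot> (X $ m)) (e m \<cdot> (Y $ m))"
        by simp
    qed
    also have "\<dots> = (\<Sum>m\<in>UNIV. (4 * qRe (qcnj (X $ m) * qi * Y $ m)) *\<^sub>R c)"
      unfolding diag F_def [symmetric] F by (simp add: quat_mult_sel algebra_simps)
    also have "\<dots> = (4 * qRe (h (P *v X) (P *v Y))) *\<^sub>R c"
      unfolding hP quat_sum_sel by (simp add: scaleR_sum_left sum_distrib_left)
    finally show ?thesis .
  qed
  from this [of "matrix_inv P *v X" "matrix_inv P *v Y" for X Y]
  have "a X Y = (4 * qRe (h X Y)) *\<^sub>R c" for X Y
    unfolding matrix_vector_mul_assoc matrix_inv_quat [OF P] matrix_vector_mul_lid .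
  moreover have "c \<in> sp1" using a_sp by (simp add: c_def F_def)
  ultimately show ?thesis by blast
qed

text \<open>For \<open>a = 0\<close>, \<open>bianchi_qr\<close> says that \<open>A X Z\<close> is
  unchanged when both vectors are multiplied by i, j or k. Combined with the Bianchi identity this
  permits the exchange \<open>star\<close> of \<open>Y\<close> and \<open>Z\<close> in
  \<open>h W (A X Y *v Z)\<close>, which conflicts with hermitian symmetry unless everything
  vanishes.\<close>

lemma A_eq_0:
  assumes a0: "\<And>X Y. a X Y = 0" shows "A X Y = 0"
proof -
  have Mq: "A (X \<cdot> q) (Z \<cdot> q) = A X Z" if "q * q = -1" "r * r = -1" "q * r = - (r * q)" for X Z q r
  proof -
    have "2 *\<^sub>R ((A (X \<cdot> q) (Z \<cdot> q) - A X Z) *v Y) = 0" for Y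
      using bianchi_qr [OF that, of X Z Y] by (simp add: E_def a0)
    then have "A (X \<cdot> q) (Z \<cdot> q) - A X Z = 0" by (intro matrix_eqI) simp
    then show ?thesis by simp
  qed
  have swap1: "A X (Z \<cdot> q) = - A (X \<cdot> q) Z" if "q * q = -1" "r * r = -1" "q * r = - (r * q)" for X Z q r
  proof -
    have "- A X (Z \<cdot> q) = A (X \<cdot> q) Z"
      using Mq [OF that, of "X \<cdot> q" Z] that(1) by (simp add: vscale_assoc)
    then show ?thesis by (metis minus_minus)
  qed
  have swap: "A X (Z \<cdot> qi) = - A (X \<cdot> qi) Z" "A X (Z \<cdot> qj) = - A (X \<cdot> qj) Z" "A X (Z \<cdot> qk) = - A (X \<cdot> qk) Z" for X Z
    using swap1 [of qi qj X Z] swap1 [of qj qk X Z] swap1 [of qk qi X Z] by simp_all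
  have bi: "A U V *v W = A U W *v V - A V W *v U" for U V W
    using bianchi [of U V W] a0 A_skew [of W U] by (simp add: algebra_simps)
  define C where "C X Y W Z = h W (A X Y *v Z)" for X Y W Z
  have C_scale: "C X Y (W \<cdot> p) Z = qcnj p * C X Y W Z" "C X Y W (Z \<cdot> p) = C X Y W Z * p" for X Y W Z p
    by (simp_all add: C_def hf_scale mv_vscale)
  have C_herm: "qcnj (C X Y W Z) = C X Y Z W" for X Y W Z
    by (simp add: C_def h_cnj h_so_star [OF A_so])
  have C_bi: "C U V R W = C U W R V - C V W R U" for U V W R
    by (simp add: C_def bi [of U V W] hf_add)
  have C_skew: "C U V R W = - C V U R W" for U V W R
    by (simp add: C_def A_skew [of U V])
  have C_minus: "C (- U) V R W = - C U V R W" for U V W R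
    by (simp add: C_def)
  have C_swap: "C X (Z \<cdot> qi) R W = - C (X \<cdot> qi) Z R W" "C X (Z \<cdot> qj) R W = - C (X \<cdot> qj) Z R W"
    "C X (Z \<cdot> qk) R W = - C (X \<cdot> qk) Z R W" for X Z R W
    by (simp_all add: C_def swap)
  have star: "2 *\<^sub>R C X Y W Z = C X Z W Y + C (X \<cdot> qi) Z W Y * qi + C (X \<cdot> qj) Z W Y * qj + C (X \<cdot> qk) Z W Y * qk"
    for X Y W Z
  proof -
    \<comment> \<open>The Bianchi identity for \<open>X i\<close> minus i times the one for
      \<open>X\<close>: the terms with \<open>A Y Z\<close> drop out.\<close>
    have 1: "C (X \<cdot> qi) Y W Z - C X Y W Z * qi = C (X \<cdot> qi) Z W Y - C X Z W Y * qi" for Z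
    proof -
      have "C Y Z W X = C X Z W Y - C X Y W Z" using C_bi [of X Y W Z] by (simp add: algebra_simps)
      then have "C Y Z W X * qi = C X Z W Y * qi - C X Y W Z * qi" by (simp add: left_diff_distrib)
      then show ?thesis using C_bi [of "X \<cdot> qi" Y W Z] by (simp add: C_scale)
    qed
    \<comment> \<open>Replacing \<open>Z\<close> by \<open>Z j\<close> gives a second equation, and
      \<open>C (X i) Y W Z\<close> can be eliminated.\<close>
    have 2: "C (X \<cdot> qi) Y W Z * qj - C X Y W Z * (qj * qi) = - C (X \<cdot> qk) Z W Y + C (X \<cdot> qj) Z W Y * qi"
      using 1 [of "Z \<cdot> qj"] by (simp add: C_scale C_swap vscale_assoc mult.assoc)
    have "C (X \<cdot> qi) Y W Z = C X Y W Z * qi + C (X \<cdot> qi) Z W Y - C X Z W Y * qi"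
      using 1 [of Z] by (simp add: algebra_simps)
    from 2 [unfolded this] have "(2 *\<^sub>R C X Y W Z) * qk
      = C X Z W Y * qk - C (X \<cdot> qk) Z W Y + C (X \<cdot> qj) Z W Y * qi - C (X \<cdot> qi) Z W Y * qj"
      by (simp add: algebra_simps scaleR_2)
    then have "(2 *\<^sub>R C X Y W Z) * qk * (- qk)
      = (C X Z W Y * qk - C (X \<cdot> qk) Z W Y + C (X \<cdot> qj) Z W Y * qi - C (X \<cdot> qi) Z W Y * qj) * (- qk)" by simp
    then show ?thesis by (simp add: mult.assoc left_diff_distrib distrib_right)
  qed
  text \<open>Exchanging the last two pairs of arguments in the two possible orders gives opposite answers.\<close>
  have "C X Y W Z = 0" for X Y W Z
  proof -
    define D where "D s = C (X \<cdot> s) W Z Y" for s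
    define S where "S = qcnj (D 1) - qi * qcnj (D qi) - qj * qcnj (D qj) - qk * qcnj (D qk)"
    have 1: "2 *\<^sub>R C X Y W Z = S"
    proof -
      have "2 *\<^sub>R C X Y W Z = qcnj (2 *\<^sub>R C X Y Z W)" by (simp add: C_herm)
      also have "\<dots> = S" unfolding star [of X Y Z W] by (simp add: S_def D_def qcnj_mult)
      finally show ?thesis .
    qed
    have 2: "2 *\<^sub>R C (X \<cdot> q) Z W Y = qcnj (2 *\<^sub>R C (X \<cdot> q) Z Y W)" for q by (simp add: C_herm)
    have 3: "4 *\<^sub>R C X Y W Z = 2 *\<^sub>R C X Z W Y + (2 *\<^sub>R C (X \<cdot> qi) Z W Y) * qi
        + (2 *\<^sub>R C (X \<cdot> qj) Z W Y) * qj + (2 *\<^sub>R C (X \<cdot> qk) Z W Y) * qk"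
      using arg_cong [OF star [of X Y W Z], of "\<lambda>x. 2 *\<^sub>R x"] by (simp add: scaleR_add_right)
    have 4: "2 *\<^sub>R C (X \<cdot> q) Z W Y = qcnj (C (X \<cdot> q) W Y Z + C (X \<cdot> q \<cdot> qi) W Y Z * qi
        + C (X \<cdot> q \<cdot> qj) W Y Z * qj + C (X \<cdot> q \<cdot> qk) W Y Z * qk)" for q
      unfolding 2 star [of "X \<cdot> q" Z Y W] ..
    have D': "C (X \<cdot> s) W Y Z = qcnj (D s)" for s by (simp add: D_def C_herm)
    have D1: "C X W Y Z = qcnj (D 1)" using D' [of 1] by simp
    have "4 *\<^sub>R C X Y W Z = - (2 *\<^sub>R S)"
      unfolding 3 4 [of 1, unfolded vscale_simps] 4 S_def
      by (simp add: vscale_assoc C_minus D' D1 qcnj_mult) (simp add: qcomp)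
    moreover have "4 *\<^sub>R C X Y W Z = 2 *\<^sub>R S"
      using 1 by (metis mult_2 numeral_Bit0 scaleR_scaleR)
    moreover have "4 *\<^sub>R S = 2 *\<^sub>R S + 2 *\<^sub>R S" by (simp flip: scaleR_add_left)
    ultimately have "4 *\<^sub>R S = 0" by (simp add: eq_neg_iff_add_eq_0)
    then have "S = 0" by simp
    then show ?thesis using 1 by simp
  qed
  then have "h W (A X Y *v Z) = 0" for W Z by (simp add: C_def)
  then have "A X Y *v Z = 0" for Z using h_nondeg' by blast
  then show ?thesis by (intro matrix_eqI) simp
qed

lemma curvature_diff:
  assumes "B \<in> so_star j" "b \<in> sp1"
  shows "curvature j (\<lambda>X Y. A X Y - Acur B b X Y) (\<lambda>X Y. a X Y - acur B b X Y)"
proof unfold_locales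
  fix X Y Z :: "quat^'n" and r :: real
  show "A X Y - Acur B b X Y \<in> so_star j" by (simp add: so_star_closed A_so Acur_so_star assms)
  show "a X Y - acur B b X Y \<in> sp1" by (simp add: a_sp acur_sp1 assms)
  show "A X Y - Acur B b X Y = - (A Y X - Acur B b Y X)"
    by (subst A_skew, subst Acur_skew) simp
  show "a X Y - acur B b X Y = - (a Y X - acur B b Y X)"
    by (subst a_skew, subst acur_skew) simp
  show "A (X + Y) Z - Acur B b (X + Y) Z = A X Z - Acur B b X Z + (A Y Z - Acur B b Y Z)"
    by (simp add: A_add Acur_add)
  show "a (X + Y) Z - acur B b (X + Y) Z = a X Z - acur B b X Z + (a Y Z - acur B b Y Z)"
    by (simp add: a_add acur_add)
  show "A (r *\<^sub>R X) Y - Acur B b (r *\<^sub>R X) Y = r *\<^sub>R (A X Y - Acur B b X Y)"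
    by (simp add: A_scaleR Acur_scaleR scaleR_diff_right)
  show "a (r *\<^sub>R X) Y - acur B b (r *\<^sub>R X) Y = r *\<^sub>R (a X Y - acur B b X Y)"
    by (simp add: a_scaleR acur_scaleR scaleR_diff_right)
  show "(A X Y - Acur B b X Y) *v Z + (A Y Z - Acur B b Y Z) *v X + (A Z X - Acur B b Z X) *v Y
    = Z \<cdot> (a X Y - acur B b X Y) + X \<cdot> (a Y Z - acur B b Y Z) + Y \<cdot> (a Z X - acur B b Z X)"
    using bianchi [of X Y Z] cur_bianchi [of B b X Y Z] by (simp add: algebra_simps vscale_distrib)
qed

text \<open>The average of \<open>a\<close> supplies the matrix of the pair. After its curvature is
  subtracted the average is zero, so \<open>a_eq_form\<close> supplies the quaternion, and the
  remaining curvature has no sp(1) part and vanishes by \<open>A_eq_0\<close>.\<close>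

theorem curvature_classification:
  assumes n: "CARD('n) > 1"
  shows "\<exists>B\<in>so_star j. \<exists>b\<in>sp1. \<forall>X Y. A X Y = Acur B b X Y \<and> a X Y = acur B b X Y"
proof -
  have "\<exists>A'\<in>so_star j. \<forall>X Y. h X (A' *v Y) = qavg a X Y"
    by (rule form_representable) (rule qavg_sesquilinear)+
  then obtain A' where A': "A' \<in> so_star j" "\<And>X Y. h X (A' *v Y) = qavg a X Y" by blast
  define B where "B = - A'"
  have B: "B \<in> so_star j" "\<And>X Y. h (B *v X) Y = qavg a X Y"
    using A' by (simp_all add: B_def so_star_closed h_so_star)
  interpret c1: curvature j "\<lambda>X Y. A X Y - Acur B 0 X Y" "\<lambda>X Y. a X Y - acur B 0 X Y"
    by (rule curvature_diff) (simp_all add: B)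
  have "qavg (\<lambda>X Y. a X Y - acur B 0 X Y) X Y = qavg a X Y - qavg (acur B 0) X Y" for X Y
    by (simp add: qavg_def sum4_def algebra_simps)
  then have "qavg (\<lambda>X Y. a X Y - acur B 0 X Y) X Y = 0" for X Y
    by (simp add: qavg_acur B)
  from c1.a_eq_form [OF n this] obtain c where c: "c \<in> sp1"
    "\<And>X Y. a X Y - acur B 0 X Y = (4 * qRe (h X Y)) *\<^sub>R c" by blast
  have ac: "a X Y = acur B c X Y" for X Y
    using c(2) [of X Y] by (simp add: acur_alt B c(1)) (simp add: algebra_simps)
  interpret c2: curvature j "\<lambda>X Y. A X Y - Acur B c X Y" "\<lambda>X Y. a X Y - acur B c X Y"
    by (rule curvature_diff) (simp_all add: B c)
  have "A X Y - Acur B c X Y = 0" for X Y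
    by (rule c2.A_eq_0) (simp add: ac)
  then have "A X Y = Acur B c X Y" for X Y using right_minus_eq by blast
  then show ?thesis using B(1) c(1) ac by blast
qed

end

section \<open>Charts of real vector spaces\<close>

lemma real_ring_simps [simp]:
  "carrier real_ring = UNIV" "mult real_ring = (*)" "one real_ring = 1" "zero real_ring = 0"
  "add real_ring = (+)"
  by (simp_all add: real_ring_def)

lemma field_real_ring: "Ring.field real_ring"
proof -
  have c: "cring real_ring"
  proof (intro cringI abelian_groupI comm_monoidI)
    show "\<exists>y\<in>carrier real_ring. y \<oplus>\<^bsub>real_ring\<^esub> x = \<zero>\<^bsub>real_ring\<^esub>" for x
      by (auto intro: exI [of _ "- x"])
  qed (simp_all add: algebra_simps)
  show ?thesis
  proof (rule cring.cring_fieldI2 [OF c])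
    show "\<exists>b\<in>carrier real_ring. a \<otimes>\<^bsub>real_ring\<^esub> b = \<one>\<^bsub>real_ring\<^esub>" if "a \<noteq> \<zero>\<^bsub>real_ring\<^esub>" for a
      using that by (auto intro!: exI [of _ "1 / a"])
  qed simp
qed

lemma module_hom_realI:
  assumes "\<And>x. x \<in> carrier M \<Longrightarrow> f x \<in> carrier N"
    "\<And>x y. x \<in> carrier M \<Longrightarrow> y \<in> carrier M \<Longrightarrow> f (x \<oplus>\<^bsub>M\<^esub> y) = f x \<oplus>\<^bsub>N\<^esub> f y"
    "\<And>r x. x \<in> carrier M \<Longrightarrow> f (r \<odot>\<^bsub>M\<^esub> x) = r \<odot>\<^bsub>N\<^esub> f x"
  shows "f \<in> module_hom real_ring M N"
  using assms by (auto simp: module_hom_def)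

text \<open>The bridge between type-class vector spaces, in which the computations take place, and
  the record-based modules of the statement. As \<open>L\<close> is not assumed to be a module, its
  zero has its own clause; the module laws are transported in \<open>chart_module\<close>.\<close>

definition chart :: "(real, 'a, 'm) module_scheme \<Rightarrow> ('v::real_vector \<Rightarrow> 'a) \<Rightarrow> 'v set \<Rightarrow> bool" where
  "chart L \<kappa> G \<longleftrightarrow> Real_Vector_Spaces.subspace G \<and> bij_betw \<kappa> G (carrier L) \<and>
     (\<forall>x\<in>G. \<forall>y\<in>G. \<kappa> (x + y) = \<kappa> x \<oplus>\<^bsub>L\<^esub> \<kappa> y) \<and> (\<forall>r. \<forall>x\<in>G. \<kappa> (r *\<^sub>R x) = r \<odot>\<^bsub>L\<^esub> \<kappa> x) \<and> \<kappa> 0 = \<zero>\<^bsub>L\<^esub>"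

context
  fixes L :: "(real, 'a, 'm) module_scheme" and \<kappa> :: "'v::real_vector \<Rightarrow> 'a" and G
  assumes ch: "chart L \<kappa> G"
begin

lemma chart_sub: "Real_Vector_Spaces.subspace G" using ch by (simp add: chart_def)
lemma chart_bij: "bij_betw \<kappa> G (carrier L)" using ch by (simp add: chart_def)
lemma chart_add: "x \<in> G \<Longrightarrow> y \<in> G \<Longrightarrow> \<kappa> (x + y) = \<kappa> x \<oplus>\<^bsub>L\<^esub> \<kappa> y" using ch by (simp add: chart_def)
lemma chart_scale: "x \<in> G \<Longrightarrow> \<kappa> (r *\<^sub>R x) = r \<odot>\<^bsub>L\<^esub> \<kappa> x" using ch by (simp add: chart_def)
lemma chart_zero: "\<kappa> 0 = \<zero>\<^bsub>L\<^esub>" using ch by (simp add: chart_def)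
lemma chart_carrier: "carrier L = \<kappa> ` G" using chart_bij by (simp add: bij_betw_def)
lemma chart_in: "x \<in> G \<Longrightarrow> \<kappa> x \<in> carrier L" by (simp add: chart_carrier)
lemma chart_inj: "x \<in> G \<Longrightarrow> y \<in> G \<Longrightarrow> \<kappa> x = \<kappa> y \<longleftrightarrow> x = y"
  using chart_bij by (meson bij_betw_imp_inj_on inj_on_eq_iff)

lemmas chart_G = subspace_add [OF chart_sub] subspace_scale [OF chart_sub] subspace_0 [OF chart_sub]
  subspace_neg [OF chart_sub] subspace_diff [OF chart_sub]

lemma chart_module: "module real_ring L"
proof (intro moduleI abelian_groupI)
  show "cring real_ring" using field_real_ring by (simp add: Ring.field_def domain_def)
  fix x y z :: 'a and r s :: real
  assume "x \<in> carrier L"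
  then obtain a where a: "a \<in> G" "x = \<kappa> a" by (auto simp: chart_carrier)
  show "r \<odot>\<^bsub>L\<^esub> x \<in> carrier L"
    using a chart_in [of "r *\<^sub>R a"] by (simp add: chart_scale chart_G)
  show "(r \<oplus>\<^bsub>real_ring\<^esub> s) \<odot>\<^bsub>L\<^esub> x = r \<odot>\<^bsub>L\<^esub> x \<oplus>\<^bsub>L\<^esub> s \<odot>\<^bsub>L\<^esub> x"
    using a by (simp add: chart_G scaleR_add_left flip: chart_scale chart_add)
  show "(r \<otimes>\<^bsub>real_ring\<^esub> s) \<odot>\<^bsub>L\<^esub> x = r \<odot>\<^bsub>L\<^esub> (s \<odot>\<^bsub>L\<^esub> x)"
    using a by (simp add: chart_G flip: chart_scale)
  show "\<one>\<^bsub>real_ring\<^esub> \<odot>\<^bsub>L\<^esub> x = x"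
    using a by (simp flip: chart_scale)
  show "\<zero>\<^bsub>L\<^esub> \<oplus>\<^bsub>L\<^esub> x = x" using a by (simp add: chart_G flip: chart_zero chart_add)
  show "\<exists>y\<in>carrier L. y \<oplus>\<^bsub>L\<^esub> x = \<zero>\<^bsub>L\<^esub>"
    using a by (intro bexI [of _ "\<kappa> (- a)"]) (simp_all add: chart_G chart_in flip: chart_zero chart_add)
  assume "y \<in> carrier L"
  then obtain b where b: "b \<in> G" "y = \<kappa> b" by (auto simp: chart_carrier)
  show "r \<odot>\<^bsub>L\<^esub> (x \<oplus>\<^bsub>L\<^esub> y) = r \<odot>\<^bsub>L\<^esub> x \<oplus>\<^bsub>L\<^esub> r \<odot>\<^bsub>L\<^esub> y"
    using a b by (simp add: chart_G scaleR_add_right flip: chart_scale chart_add)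
  show "x \<oplus>\<^bsub>L\<^esub> y \<in> carrier L" using a b by (simp add: chart_G chart_in flip: chart_add)
  show "x \<oplus>\<^bsub>L\<^esub> y = y \<oplus>\<^bsub>L\<^esub> x" using a b by (simp add: add.commute flip: chart_add)
  assume "z \<in> carrier L"
  then obtain c where c: "c \<in> G" "z = \<kappa> c" by (auto simp: chart_carrier)
  show "x \<oplus>\<^bsub>L\<^esub> y \<oplus>\<^bsub>L\<^esub> z = x \<oplus>\<^bsub>L\<^esub> (y \<oplus>\<^bsub>L\<^esub> z)"
    using a b c by (simp add: chart_G add.assoc flip: chart_add)
next
  show "\<zero>\<^bsub>L\<^esub> \<in> carrier L" using chart_in [OF chart_G(3)] by (simp add: chart_zero)
qed

lemma chart_vectorspace: "vectorspace real_ring L"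
  by (simp add: vectorspace_def chart_module field_real_ring)

lemma chart_neg: "x \<in> G \<Longrightarrow> \<kappa> (- x) = \<ominus>\<^bsub>L\<^esub> \<kappa> x"
proof -
  interpret M: module real_ring L by (rule chart_module)
  show "x \<in> G \<Longrightarrow> \<kappa> (- x) = \<ominus>\<^bsub>L\<^esub> \<kappa> x"
    by (rule M.minus_equality [symmetric]) (simp_all add: chart_in chart_G flip: chart_add chart_zero)
qed

lemma chart_diff: "x \<in> G \<Longrightarrow> y \<in> G \<Longrightarrow> \<kappa> (x - y) = \<kappa> x \<ominus>\<^bsub>L\<^esub> \<kappa> y"
  using chart_add [of x "- y"] by (simp add: a_minus_def chart_neg chart_G)

lemma chart_span:
  assumes "S \<subseteq> G" shows "LinearCombinations.module.span real_ring L (\<kappa> ` S) = \<kappa> ` span S"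
proof -
  interpret M: module real_ring L by (rule chart_module)
  have sG: "span S \<subseteq> G" using assms chart_sub by (rule span_minimal)
  have SC: "\<kappa> ` S \<subseteq> carrier L" using assms by (auto simp: chart_carrier)
  have "LinearCombinations.submodule real_ring (\<kappa> ` span S) L"
    unfolding LinearCombinations.submodule_def
  proof (intro conjI allI impI)
    show "module real_ring L" by (rule chart_module)
    show "\<kappa> ` span S \<subseteq> carrier L" using sG by (auto simp: chart_carrier)
    show "\<zero>\<^bsub>L\<^esub> \<in> \<kappa> ` span S" using span_zero chart_zero by (metis imageI)
    fix v w c assume v: "v \<in> \<kappa> ` span S"
    then obtain a where a: "a \<in> span S" "v = \<kappa> a" by blast
    show "c \<odot>\<^bsub>L\<^esub> v \<in> \<kappa> ` span S"
      using a sG chart_scale [of a c] span_scale [OF a(1), of c] by (metis imageI subsetD)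
    assume "w \<in> \<kappa> ` span S"
    then obtain b where b: "b \<in> span S" "w = \<kappa> b" by blast
    show "v \<oplus>\<^bsub>L\<^esub> w \<in> \<kappa> ` span S"
      using a b sG chart_add [of a b] span_add [OF a(1) b(1)] by (metis imageI subsetD)
  qed
  then have "M.span (\<kappa> ` S) \<subseteq> \<kappa> ` span S"
    by (intro M.span_is_subset) (auto simp: span_base)
  moreover have "\<kappa> ` span S \<subseteq> M.span (\<kappa> ` S)"
  proof -
    have s: "LinearCombinations.submodule real_ring (M.span (\<kappa> ` S)) L" by (rule M.span_is_submodule [OF SC])
    have "span S \<subseteq> {x \<in> G. \<kappa> x \<in> M.span (\<kappa> ` S)}"
    proof (rule span_minimal)
      show "S \<subseteq> {x \<in> G. \<kappa> x \<in> M.span (\<kappa> ` S)}"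
        using assms M.in_own_span [OF SC] by auto
      show "Real_Vector_Spaces.subspace {x \<in> G. \<kappa> x \<in> M.span (\<kappa> ` S)}"
        using s unfolding LinearCombinations.submodule_def Real_Vector_Spaces.subspace_def
        by (auto simp: chart_G chart_zero chart_add chart_scale)
    qed
    then show ?thesis by auto
  qed
  ultimately show ?thesis by blast
qed

end

text \<open>\<open>vectorspace.dim\<close> is the least size of a finite generating set, and
  generating sets of \<open>L\<close> correspond under \<open>\<kappa>\<close> to spanning sets of
  \<open>G\<close>.\<close>

lemma chart_fin_dim:
  fixes \<kappa> :: "'v::euclidean_space \<Rightarrow> 'a"
  assumes ch: "chart L \<kappa> G"
  shows "vectorspace.fin_dim real_ring L" "vectorspace.dim real_ring L = Real_Vector_Spaces.dim G"
proof -
  interpret V: vectorspace real_ring L by (rule chart_vectorspace [OF ch])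
  note sub = chart_sub [OF ch]
  obtain B where B: "B \<subseteq> G" "independent B" "G \<subseteq> span B" "card B = Real_Vector_Spaces.dim G"
    using basis_exists by blast
  have fB: "finite B" using B(2) by (rule independent_imp_finite)
  have sB: "span B = G" using B sub by (simp add: span_minimal subset_antisym)
  have inj: "inj_on \<kappa> G" using chart_bij [OF ch] by (simp add: bij_betw_def)
  have gen: "V.span (\<kappa> ` B) = carrier L"
    using chart_span [OF ch B(1)] sB chart_carrier [OF ch] by simp
  have C: "\<kappa> ` B \<subseteq> carrier L" using B(1) chart_carrier [OF ch] by auto
  show "V.fin_dim" unfolding V.fin_dim_def using gen C fB by blast
  show "V.dim = Real_Vector_Spaces.dim G"
    unfolding V.dim_def
  proof (rule Least_equality)
    have "card (\<kappa> ` B) = Real_Vector_Spaces.dim G"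
      using B card_image inj_on_subset [OF inj B(1)] by metis
    then show "\<exists>A. finite A \<and> card A = Real_Vector_Spaces.dim G \<and> A \<subseteq> carrier L \<and> V.span A = carrier L"
      using gen C fB by blast
    fix k assume "\<exists>A. finite A \<and> card A = k \<and> A \<subseteq> carrier L \<and> V.span A = carrier L"
    then obtain A where A: "finite A" "card A = k" "A \<subseteq> carrier L" "V.span A = carrier L" by blast
    define S where "S = {x \<in> G. \<kappa> x \<in> A}"
    have SA: "\<kappa> ` S = A" using A(3) chart_carrier [OF ch] by (auto simp: S_def)
    have "inj_on \<kappa> S" using inj by (rule inj_on_subset) (auto simp: S_def)
    then have S: "finite S" "card S = k" using SA A by (metis finite_image_iff, metis card_image)
    have "\<kappa> ` span S = \<kappa> ` G" using chart_span [OF ch, of S] SA A(4) chart_carrier [OF ch] by (auto simp: S_def)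
    moreover have "span S \<subseteq> G" using sub by (intro span_minimal) (auto simp: S_def)
    ultimately have "span S = G" using inj by (meson inj_on_image_eq_iff subset_refl)
    then show "Real_Vector_Spaces.dim G \<le> k" using dim_le_card [of G S] S by auto
  qed
qed

text \<open>A basis of \<open>L\<close> is matched with \<open>Basis\<close> by equality of
  cardinalities, and vectors are sent to the linear combinations with the same coordinates.\<close>

lemma chart_exists:
  assumes "vectorspace real_ring L" "vectorspace.fin_dim real_ring L"
    "vectorspace.dim real_ring L = DIM('v::euclidean_space)"
  shows "\<exists>\<kappa> :: 'v \<Rightarrow> 'a. chart L \<kappa> UNIV"
proof -
  interpret V: vectorspace real_ring L by fact
  obtain \<beta> where \<beta>: "finite \<beta>" "V.basis \<beta>" using V.finite_basis_exists assms(2) by blast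
  have \<beta>C: "\<beta> \<subseteq> carrier L" using \<beta>(2) by (simp add: V.basis_def)
  have "card \<beta> = card (Basis :: 'v set)" using V.dim_basis [OF \<beta>] assms(3) by simp
  then obtain b where b: "bij_betw b \<beta> (Basis :: 'v set)"
    using finite_same_card_bij [OF \<beta>(1) finite_Basis] by blast
  define c where "c x v = inner x (b v)" for x v
  define \<kappa> where "\<kappa> x = V.lincomb (c x) \<beta>" for x
  have u: "\<exists>!f. f \<in> \<beta> \<rightarrow>\<^sub>E UNIV \<and> V.lincomb f \<beta> = v" if "v \<in> carrier L" for v
    using V.basis_criterion [OF \<beta>(1) \<beta>C] \<beta>(2) that by simp
  have r: "V.lincomb (restrict f \<beta>) \<beta> = V.lincomb f \<beta>" for f
    by (rule V.lincomb_cong [OF refl \<beta>C]) auto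
  have in_C: "\<kappa> x \<in> carrier L" for x unfolding \<kappa>_def by (rule V.lincomb_closed [OF \<beta>C]) auto
  have inj: "inj \<kappa>"
  proof
    fix x y assume eq: "\<kappa> x = \<kappa> y"
    have ru: "restrict (c z) \<beta> \<in> \<beta> \<rightarrow>\<^sub>E UNIV" for z by simp
    have "V.lincomb (restrict (c x) \<beta>) \<beta> = \<kappa> x" "V.lincomb (restrict (c y) \<beta>) \<beta> = \<kappa> x"
      by (simp_all only: r \<kappa>_def [symmetric] eq)
    then have e: "restrict (c x) \<beta> = restrict (c y) \<beta>"
      using u [OF in_C [of x]] ru by blast
    have cv: "c x v = c y v" if "v \<in> \<beta>" for v using fun_cong [OF e, of v] that by simp
    have "inner x i = inner y i" if i: "i \<in> Basis" for i
    proof -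
      have "i \<in> b ` \<beta>" using b i by (simp add: bij_betw_def)
      then obtain v where "v \<in> \<beta>" "b v = i" by blast
      then show ?thesis using cv [of v] by (simp add: c_def)
    qed
    then show "x = y" by (rule euclidean_eqI)
  qed
  have surj: "\<exists>x. v = \<kappa> x" if v: "v \<in> carrier L" for v
  proof -
    obtain f where f: "f \<in> \<beta> \<rightarrow>\<^sub>E UNIV" "V.lincomb f \<beta> = v"
      using ex1_implies_ex [OF u [OF v]] by blast
    define x where "x = (\<Sum>w\<in>\<beta>. f w *\<^sub>R b w)"
    have bB: "b w \<in> Basis" if "w \<in> \<beta>" for w using b that by (rule bij_betwE [THEN bspec])
    have cx: "c x u = f u" if u: "u \<in> \<beta>" for u
    proof -
      have "c x u = (\<Sum>w\<in>\<beta>. f w * inner (b w) (b u))" by (simp add: c_def x_def inner_sum_left)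
      also have "\<dots> = (\<Sum>w\<in>\<beta>. if w = u then f w else 0)"
      proof (rule sum.cong [OF refl])
        fix w assume w: "w \<in> \<beta>"
        have "b w = b u \<longleftrightarrow> w = u" using bij_betw_imp_inj_on [OF b] w u by (rule inj_on_eq_iff)
        then show "f w * inner (b w) (b u) = (if w = u then f w else 0)"
          using bB w u by (simp add: inner_Basis)
      qed
      finally show ?thesis using u \<beta>(1) by simp
    qed
    have "V.lincomb (c x) \<beta> = V.lincomb f \<beta>" by (rule V.lincomb_cong [OF refl \<beta>C]) (simp_all add: cx)
    then have "v = \<kappa> x" unfolding \<kappa>_def using f(2) by simp
    then show ?thesis by blast
  qed
  have ca: "c (x + y) = (\<lambda>v. c x v + c y v)" for x y by (rule ext) (simp add: c_def inner_add_left)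
  have ct: "c (t *\<^sub>R x) = (\<lambda>v. t * c x v)" for t x by (rule ext) (simp add: c_def)
  have add: "\<kappa> (x + y) = \<kappa> x \<oplus>\<^bsub>L\<^esub> \<kappa> y" for x y
    using V.lincomb_sum [OF \<beta>(1) \<beta>C, of "c x" "c y"] ca by (simp add: \<kappa>_def)
  have sc: "\<kappa> (t *\<^sub>R x) = t \<odot>\<^bsub>L\<^esub> \<kappa> x" for t x
    using V.lincomb_smult [OF \<beta>C, of "c x" t] ct by (simp add: \<kappa>_def)
  have "\<kappa> 0 = \<zero>\<^bsub>L\<^esub>" using sc [of 0 0] V.smult_l_null [OF in_C] by simp
  moreover have "bij_betw \<kappa> UNIV (carrier L)"
    using inj surj in_C by (auto simp: bij_betw_def)
  ultimately show ?thesis unfolding chart_def using add sc by (intro exI [of _ \<kappa>]) auto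
qed

section \<open>The model Lie algebra\<close>

type_synonym 'n qpair = "(quat^'n^'n) \<times> quat"

text \<open>The first factor carries the isotropy algebra inside so*(2n) + sp(1), the second one
  stands for m.\<close>

type_synonym 'n qmodel = "'n qpair \<times> (quat^'n)"

lemma matrix_scaleR_mult: "(r *\<^sub>R M) ** N = r *\<^sub>R (M ** N)" "M ** (r *\<^sub>R N) = r *\<^sub>R (M ** N)"
  for M N :: "quat^'n^'n"
  by (rule matrix_eqI, simp add: scaleR_mv mv_scaleR flip: matrix_vector_mul_assoc)+

lemma matrix_distrib:
  "(M + M') ** N = M ** N + M' ** N" "M ** (N + N') = M ** N + M ** N'"
  "(M - M') ** N = M ** N - M' ** N" "M ** (N - N') = M ** N - M ** N'"
  for M M' N N' :: "quat^'n^'n"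
  by (rule matrix_eqI, simp add: algebra_simps flip: matrix_vector_mul_assoc)+

context skew_form begin

lemma outer_bilinear:
  "outer (X + Y) Z = outer X Z + outer Y Z" "outer Z (X + Y) = outer Z X + outer Z Y"
  "outer (r *\<^sub>R X) Z = r *\<^sub>R outer X Z" "outer Z (r *\<^sub>R X) = r *\<^sub>R outer Z X"
  by (rule matrix_eqI, simp add: outer_mv algebra_simps vscale_distrib hf_add vscale_scaleR scaleR_mv hf_scaleR)+

text \<open>The operator commutator acts as a derivation on rank one operators. Any imaginary
  \<open>p\<close> may be inserted, as its two contributions cancel because of
  \<open>qcnj p = - p\<close>.\<close>

lemma outer_bop:
  assumes "D \<in> so_star j" "p \<in> sp1"
  shows "D ** outer X U - outer X U ** D = outer (bop D p X) U + outer X (bop D p U)"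
proof (rule matrix_eqI)
  fix Z
  have "X \<cdot> h U (D *v Z) = - (X \<cdot> h (D *v U) Z)" by (simp add: h_so_star [OF assms(1)])
  then show "(D ** outer X U - outer X U ** D) *v Z = (outer (bop D p X) U + outer X (bop D p U)) *v Z"
    using assms(2) by (simp add: algebra_simps outer_mv mv_vscale bop_def vscale_distrib hf_add hf_scale
        vscale_assoc sp1_cnj flip: matrix_vector_mul_assoc)
qed

lemma h_bop2:
  assumes "D \<in> so_star j" "p \<in> sp1"
  shows "h (bop D p X) Y + h X (bop D p Y) = p * h X Y - h X Y * p"
  by (simp add: h_bop [OF assms])

text \<open>The stabiliser of the pair (A, a) in so*(2n) + sp(1). It will turn out to contain the
  isotropy algebra (\<open>lset_commutant\<close>), and membership can be tested by equations,
  unlike membership in a span.\<close>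

definition commutant :: "quat^'n^'n \<Rightarrow> quat \<Rightarrow> 'n qpair set" where
  "commutant A a = {S. fst S \<in> so_star j \<and> snd S \<in> sp1 \<and> fst S ** A = A ** fst S \<and> snd S * a = a * snd S}"

lemma subspace_commutant: "Real_Vector_Spaces.subspace (commutant A a)"
  unfolding Real_Vector_Spaces.subspace_def commutant_def
  by (auto simp: so_star_closed matrix_distrib matrix_scaleR_mult distrib_left distrib_right)

lemma bop_commute:
  assumes "(D, p) \<in> commutant A a"
  shows "bop D p (bop A a X) = bop A a (bop D p X)"
proof -
  have "D *v (A *v X) = A *v (D *v X)" "p * a = a * p"
    using assms by (simp_all add: commutant_def matrix_vector_mul_assoc)
  then show ?thesis by (simp add: bop_def algebra_simps vscale_distrib vscale_assoc mv_vscale)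
qed

text \<open>An element commuting with (A, a) respects every ingredient of the curvature: the pair
  itself, \<open>bop A a\<close>, and infinitesimally the form \<open>h\<close>.\<close>

lemma cur_equivariant:
  assumes "(D, p) \<in> commutant A a"
  shows "D ** Acur A a X Y - Acur A a X Y ** D = Acur A a (bop D p X) Y + Acur A a X (bop D p Y)"
    "p * acur A a X Y - acur A a X Y * p = acur A a (bop D p X) Y + acur A a X (bop D p Y)"
proof -
  have D: "D \<in> so_star j" and p: "p \<in> sp1" and DA: "D ** A = A ** D" and pa: "p * a = a * p"
    using assms by (auto simp: commutant_def)
  have w: "qRe (h X (bop D p Y)) = - qRe (h (bop D p X) Y)" by (rule Re_h_bop [OF D p])
  have "D ** Acur A a X Y - Acur A a X Y ** D = (2 * qRe (h X Y)) *\<^sub>R (D ** A - A ** D)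
     + (D ** outer X (bop A a Y) - outer X (bop A a Y) ** D)
     + (D ** outer (bop A a Y) X - outer (bop A a Y) X ** D)
     - (D ** outer (bop A a X) Y - outer (bop A a X) Y ** D)
     - (D ** outer Y (bop A a X) - outer Y (bop A a X) ** D)"
    by (simp add: Acur_def matrix_distrib matrix_scaleR_mult scaleR_diff_right)
  then show "D ** Acur A a X Y - Acur A a X Y ** D = Acur A a (bop D p X) Y + Acur A a X (bop D p Y)"
    unfolding outer_bop [OF D p] bop_commute [OF assms] DA Acur_def w by simp
  have "p * acur A a X Y - acur A a X Y * p = (2 * qRe (h X Y)) *\<^sub>R (p * a - a * p)
    + (p * h (bop A a X) Y - h (bop A a X) Y * p) - (p * h (bop A a Y) X - h (bop A a Y) X * p)"
    by (simp add: acur_def algebra_simps)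
  then show "p * acur A a X Y - acur A a X Y * p = acur A a (bop D p X) Y + acur A a X (bop D p Y)"
    unfolding h_bop2 [OF D p, symmetric] bop_commute [OF assms] pa acur_def w by simp
qed

text \<open>Here the matrix equation enters: differentiating along (A, a) inserts one more
  \<open>bop A a\<close>, and two of them on the same vector give the scalar \<open>d\<close>, so
  that the terms cancel in pairs.\<close>

lemma cur_commuting:
  assumes A: "A \<in> so_star j" and a: "a \<in> sp1" and d: "\<And>X. bop A a (bop A a X) = d *\<^sub>R X"
  shows "(Acur A a X Y, acur A a X Y) \<in> commutant A a"
proof -
  have "A ** Acur A a X Y - Acur A a X Y ** A
     = (A ** outer X (bop A a Y) - outer X (bop A a Y) ** A)
     + (A ** outer (bop A a Y) X - outer (bop A a Y) X ** A)
     - (A ** outer (bop A a X) Y - outer (bop A a X) Y ** A)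
     - (A ** outer Y (bop A a X) - outer Y (bop A a X) ** A)"
    by (simp add: Acur_def matrix_distrib matrix_scaleR_mult)
  also have "\<dots> = 0" unfolding outer_bop [OF A a] d by (simp add: outer_bilinear)
  finally have 1: "A ** Acur A a X Y = Acur A a X Y ** A" by simp
  have "qRe (h X (d *\<^sub>R Y)) = - qRe (h (bop A a X) (bop A a Y))"
    using Re_h_bop [OF A a, of X "bop A a Y"] by (simp add: d)
  then have w: "qRe (h (bop A a X) (bop A a Y)) = - (d * qRe (h X Y))" by (simp add: hf_scaleR)
  have s: "h U V - h V U = of_real (2 * qRe (h U V))" for U V
    by (subst (2) h_sym) (simp add: quat_eq_iff del: of_real_mult)
  have "a * acur A a X Y - acur A a X Y * a
    = (a * h (bop A a X) Y - h (bop A a X) Y * a) - (a * h (bop A a Y) X - h (bop A a Y) X * a)"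
    by (simp add: acur_def algebra_simps)
  also have "\<dots> = d *\<^sub>R (h X Y - h Y X) + (h (bop A a X) (bop A a Y) - h (bop A a Y) (bop A a X))"
    unfolding h_bop2 [OF A a, symmetric] d by (simp add: hf_scaleR scaleR_diff_right)
  also have "\<dots> = 0" unfolding s w by (simp add: qcomp)
  finally have "acur A a X Y * a = a * acur A a X Y" by simp
  then show ?thesis using 1 by (simp add: commutant_def Acur_so_star acur_sp1 A a)
qed

definition lset :: "quat^'n^'n \<Rightarrow> quat \<Rightarrow> 'n qpair set" where
  "lset A a = span {(Acur A a X Y, acur A a X Y) | X Y. True}"

definition act :: "'n qpair \<Rightarrow> quat^'n \<Rightarrow> quat^'n" where
  "act S = bop (fst S) (snd S)"

definition pbr :: "'n qpair \<Rightarrow> 'n qpair \<Rightarrow> 'n qpair" where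
  "pbr S T = (fst S ** fst T - fst T ** fst S, snd S * snd T - snd T * snd S)"

definition cur :: "quat^'n^'n \<Rightarrow> quat \<Rightarrow> quat^'n \<Rightarrow> quat^'n \<Rightarrow> 'n qpair" where
  "cur A a X Y = (Acur A a X Y, acur A a X Y)"

text \<open>The bracket of a symmetric pair rebuilt from its curvature: l acts on m by
  \<open>act\<close>, and two elements of m bracket into l by \<open>cur\<close>.\<close>

definition brk :: "quat^'n^'n \<Rightarrow> quat \<Rightarrow> 'n qmodel \<Rightarrow> 'n qmodel \<Rightarrow> 'n qmodel" where
  "brk A a x y = (pbr (fst x) (fst y) + cur A a (snd x) (snd y), act (fst x) (snd y) - act (fst y) (snd x))"

definition gset :: "quat^'n^'n \<Rightarrow> quat \<Rightarrow> 'n qmodel set" where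
  "gset A a = lset A a \<times> UNIV"

lemma cur_bilinear:
  "cur A a (X + Y) Z = cur A a X Z + cur A a Y Z" "cur A a (r *\<^sub>R X) Z = r *\<^sub>R cur A a X Z"
  "cur A a X Y = - cur A a Y X"
  by (simp_all add: cur_def Acur_add acur_add Acur_scaleR acur_scaleR Acur_skew [of A a X Y] acur_skew [of A a X Y])

lemma cur_bilinear2:
  "cur A a Z (X + Y) = cur A a Z X + cur A a Z Y" "cur A a Z (r *\<^sub>R X) = r *\<^sub>R cur A a Z X"
  "cur A a X X = 0"
proof -
  show "cur A a Z (X + Y) = cur A a Z X + cur A a Z Y"
    unfolding cur_bilinear(3) [of A a Z] by (simp add: cur_bilinear(1))
  show "cur A a Z (r *\<^sub>R X) = r *\<^sub>R cur A a Z X"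
    unfolding cur_bilinear(3) [of A a Z] by (simp add: cur_bilinear(2))
  have "2 *\<^sub>R cur A a X X = 0" using cur_bilinear(3) [of A a X X] by (simp add: scaleR_2 eq_neg_iff_add_eq_0)
  then show "cur A a X X = 0" by simp
qed

lemma cur_zero [simp]: "cur A a 0 Y = 0" "cur A a Y 0 = 0" "cur A a (- X) Y = - cur A a X Y" "cur A a Y (- X) = - cur A a Y X"
  using cur_bilinear(2) [of A a 0 0 Y] cur_bilinear2(2) [of A a Y 0 0]
    cur_bilinear(2) [of A a "-1" X Y] cur_bilinear2(2) [of A a Y "-1" X] by simp_all

lemma act_linear:
  "act (S + T) X = act S X + act T X" "act (r *\<^sub>R S) X = r *\<^sub>R act S X" "act 0 X = 0" "act (- S) X = - act S X"
  "act (S - T) X = act S X - act T X"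
  "act S (X + Y) = act S X + act S Y" "act S (r *\<^sub>R X) = r *\<^sub>R act S X" "act S 0 = 0" "act S (- X) = - act S X"
  "act S (X - Y) = act S X - act S Y"
  by (simp_all add: act_def bop_def algebra_simps vscale_distrib vscale_scaleR scaleR_mv mv_scaleR)

lemma act_pbr: "act (pbr S T) X = act S (act T X) - act T (act S X)"
  by (simp add: act_def pbr_def bop_def algebra_simps vscale_distrib mv_vscale vscale_assoc flip: matrix_vector_mul_assoc)

lemma act_cur: "act (cur A a X Y) Z = Rcur A a X Y Z"
  by (simp add: act_def cur_def Rcur_def)

lemma pbr_bilinear:
  "pbr (S + T) U = pbr S U + pbr T U" "pbr U (S + T) = pbr U S + pbr U T"
  "pbr (r *\<^sub>R S) U = r *\<^sub>R pbr S U" "pbr U (r *\<^sub>R S) = r *\<^sub>R pbr U S" "pbr S S = 0" "pbr S T = - pbr T S"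
  by (simp_all add: pbr_def matrix_distrib matrix_scaleR_mult algebra_simps zero_prod_def)

lemma pbr_zero [simp]: "pbr 0 S = 0" "pbr S 0 = 0" "pbr (- S) T = - pbr S T" "pbr S (- T) = - pbr S T"
  using pbr_bilinear(3) [of 0 0 S] pbr_bilinear(4) [of S 0 0] pbr_bilinear(3) [of "-1" S T] pbr_bilinear(4) [of S "-1" T]
  by simp_all

lemma pbr_jacobi: "pbr S (pbr T U) + pbr T (pbr U S) + pbr U (pbr S T) = 0"
proof -
  have m: "(M ** (N ** P - P ** N) - (N ** P - P ** N) ** M) + (N ** (P ** M - M ** P) - (P ** M - M ** P) ** N)
    + (P ** (M ** N - N ** M) - (M ** N - N ** M) ** P) = 0" for M N P :: "quat^'n^'n"
    unfolding matrix_distrib matrix_mul_assoc by simp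
  have q: "(x * (y * z - z * y) - (y * z - z * y) * x) + (y * (z * x - x * z) - (z * x - x * z) * y)
    + (z * (x * y - y * x) - (x * y - y * x) * z) = 0" for x y z :: quat
    by (simp add: algebra_simps)
  show ?thesis by (simp add: pbr_def m q zero_prod_def)
qed

lemma brk_bilinear:
  "brk A a (x + y) z = brk A a x z + brk A a y z" "brk A a z (x + y) = brk A a z x + brk A a z y"
  "brk A a (r *\<^sub>R x) z = r *\<^sub>R brk A a x z" "brk A a z (r *\<^sub>R x) = r *\<^sub>R brk A a z x" "brk A a x x = 0"
  by (simp_all add: brk_def pbr_bilinear(1-5) cur_bilinear(1,2) cur_bilinear2 act_linear scaleR_add_right scaleR_diff_right zero_prod_def)

lemma brk_simps:
  "brk A a (0, X) (0, Y) = (cur A a X Y, 0)" "brk A a (S, 0) (0, Y) = (0, act S Y)"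
  "brk A a (0, Y) (S, 0) = (0, - act S Y)" "brk A a (S, 0) (T, 0) = (pbr S T, 0)"
  by (simp_all add: brk_def act_linear)

lemma cur_lset: "cur A a X Y \<in> lset A a"
  unfolding lset_def cur_def by (rule span_base) blast

lemma lset_induct:
  assumes "S \<in> lset A a" "\<And>X Y. cur A a X Y \<in> W" "Real_Vector_Spaces.subspace W" shows "S \<in> W"
proof -
  have "lset A a \<subseteq> W"
    unfolding lset_def by (rule span_minimal) (use assms(2,3) in \<open>auto simp: cur_def\<close>)
  then show ?thesis using assms(1) by blast
qed

lemma subspace_lset: "Real_Vector_Spaces.subspace (lset A a)" by (simp add: lset_def)

lemma subspace_gset: "Real_Vector_Spaces.subspace (gset A a)"
  using subspace_lset [of A a] unfolding gset_def Real_Vector_Spaces.subspace_def by (auto simp: zero_prod_def)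

lemma act_inj: assumes "S \<in> commutant A a" "\<And>X. act S X = 0" shows "S = 0"
  using pair_eq_0 [of "fst S" "snd S"] assms by (simp add: act_def commutant_def prod_eq_iff)

end

text \<open>The last assumption is the matrix equation of the theorem, because
  \<open>bop A a (bop A a X)\<close> is \<open>A^2 X - 2 A X a + X a^2\<close>. Over a fixed
  \<open>skew_form\<close> the locale amounts to \<open>admissible\<close>.\<close>

locale symmetric_pair = skew_form j for j :: "quat^'n^'n" +
  fixes A :: "quat^'n^'n" and a :: quat and d :: real
  assumes A: "A \<in> so_star j" and a: "a \<in> sp1" and square: "bop A a (bop A a X) = d *\<^sub>R X"
begin

lemma lset_commutant: "S \<in> lset A a \<Longrightarrow> S \<in> commutant A a"
  by (rule lset_induct) (auto simp: cur_def intro: cur_commuting A a square subspace_commutant)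

lemma pbr_cur: assumes "S \<in> lset A a"
  shows "pbr S (cur A a X Y) = cur A a (act S X) Y + cur A a X (act S Y)"
  using cur_equivariant [of "fst S" "snd S" A a X Y] lset_commutant [OF assms]
  by (simp add: act_def pbr_def cur_def)

lemma pbr_lset: assumes S: "S \<in> lset A a" and T: "T \<in> lset A a" shows "pbr S T \<in> lset A a"
proof -
  have "T \<in> {T. pbr S T \<in> lset A a}"
  proof (rule lset_induct [OF T])
    show "cur A a X Y \<in> {T. pbr S T \<in> lset A a}" for X Y
      using subspace_add [OF subspace_lset cur_lset cur_lset] by (simp add: pbr_cur [OF S])
    show "Real_Vector_Spaces.subspace {T. pbr S T \<in> lset A a}"
      using subspace_lset [of A a] unfolding Real_Vector_Spaces.subspace_def by (simp add: pbr_bilinear(2,4))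
  qed
  then show ?thesis by simp
qed

lemma brk_gset: "x \<in> gset A a \<Longrightarrow> y \<in> gset A a \<Longrightarrow> brk A a x y \<in> gset A a"
  unfolding gset_def mem_Times_iff by (simp add: brk_def subspace_add [OF subspace_lset pbr_lset cur_lset])

text \<open>The l-component reduces to the Jacobi identity of pairs and the equivariance of
  \<open>cur\<close>, the m-component to the Bianchi identity and \<open>act_pbr\<close>.\<close>

lemma brk_jacobi:
  assumes "x \<in> gset A a" "y \<in> gset A a" "z \<in> gset A a"
  shows "brk A a x (brk A a y z) + brk A a y (brk A a z x) + brk A a z (brk A a x y) = 0"
proof -
  obtain S X T Y U Z where xyz: "x = (S, X)" "y = (T, Y)" "z = (U, Z)" by (metis surj_pair)
  have l: "S \<in> lset A a" "T \<in> lset A a" "U \<in> lset A a" using assms by (auto simp: gset_def xyz)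
  have b: "act (cur A a X Y) Z + act (cur A a Y Z) X + act (cur A a Z X) Y = 0"
    unfolding act_cur Rcur_def bop_def using cur_bianchi [of A a X Y Z] by (simp add: algebra_simps)
  have sk: "cur A a (act U' P) Q = - cur A a Q (act U' P)" for U' P Q by (rule cur_bilinear(3))
  have "act U (act T X) - act T (act U X) = - act (pbr T U) X" for T U X by (simp add: act_pbr)
  have 1: "snd (brk A a x (brk A a y z) + brk A a y (brk A a z x) + brk A a z (brk A a x y)) = 0"
  proof -
    have "act (cur A a Y Z) X = (act (cur A a X Y) Z + act (cur A a Y Z) X + act (cur A a Z X) Y)
      - act (cur A a X Y) Z - act (cur A a Z X) Y" by simp
    then have "act (cur A a Y Z) X = - act (cur A a X Y) Z - act (cur A a Z X) Y" unfolding b by simp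
    then show ?thesis by (simp add: brk_def xyz act_linear act_pbr)
  qed
  have d: "cur A a P (Q - R) = cur A a P Q - cur A a P R" for P Q R
    using cur_bilinear2(1) [of A a P Q "- R"] by simp
  have 2: "fst (brk A a x (brk A a y z) + brk A a y (brk A a z x) + brk A a z (brk A a x y)) = 0"
    using pbr_jacobi [of S T U]
    by (simp add: brk_def xyz pbr_bilinear(2) pbr_cur l d sk [of _ _ X] sk [of _ _ Y] sk [of _ _ Z] algebra_simps)
  show ?thesis using 1 2 by (simp add: prod_eq_iff)
qed

end

section \<open>Triples with a model chart\<close>

context skew_form begin

text \<open>Here \<open>\<kappa>\<close> identifies the whole Lie algebra with the model; in
  contrast, \<open>framed\<close> speaks of m only.\<close>

definition canonical :: "quat^'n^'n \<Rightarrow> quat \<Rightarrow> 'a qsh \<Rightarrow> ('n qmodel \<Rightarrow> 'a) \<Rightarrow> bool" where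
  "canonical A a T \<kappa> \<longleftrightarrow> chart (alg T) \<kappa> (gset A a) \<and>
    (\<forall>x\<in>gset A a. \<forall>y\<in>gset A a. lie (alg T) (\<kappa> x) (\<kappa> y) = \<kappa> (brk A a x y)) \<and>
    (\<forall>S\<in>lset A a. \<forall>X. invol T (\<kappa> (S, X)) = \<kappa> (S, - X))"

text \<open>Knowledge of the triple bracket on m is enough, since it determines l and all brackets
  (\<open>canonical_exists\<close>). The factor -2 is that of the bottom left entry of the
  commutator of two elements of m (\<open>assoc_form\<close>).\<close>

definition framed :: "quat^'n^'n \<Rightarrow> quat \<Rightarrow> 'a qsh \<Rightarrow> (quat^'n \<Rightarrow> 'a) \<Rightarrow> bool" where
  "framed A a T u \<longleftrightarrow> bij_betw u UNIV (m_part T) \<and> (\<forall>X Y. u (X + Y) = u X \<oplus>\<^bsub>alg T\<^esub> u Y) \<and>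
    (\<forall>r X. u (r *\<^sub>R X) = r \<odot>\<^bsub>alg T\<^esub> u X) \<and>
    qstr T = {J \<in> extensional (m_part T). \<exists>q\<in>sp1. \<forall>X. J (u X) = u (X \<cdot> q)} \<and>
    (\<forall>X Y. form T (u X) (u Y) = - 2 * qRe (h X Y)) \<and>
    (\<forall>X Y Z. lie (alg T) (lie (alg T) (u X) (u Y)) (u Z) = u (Rcur A a X Y Z))"

lemma norm_unit_if_square: fixes q :: quat assumes "q * q = -1" shows "norm q = 1"
proof -
  have "norm q * norm q = norm (- 1 :: quat)" by (simp add: assms flip: norm_mult)
  then have "(norm q)\<^sup>2 = 1\<^sup>2" by (simp add: power2_eq_square)
  then show ?thesis by (metis norm_ge_zero power2_eq_imp_eq zero_le_one)
qed

end

context symmetric_pair begin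

text \<open>The axioms are verified once for everything isomorphic to the model. The result is used
  for a copy of the model on \<open>nat \<Rightarrow> real\<close> and for the algebra inside
  \<open>Z(t)/t\<close>.\<close>

theorem canonical_qsh:
  fixes T :: "'a qsh"
  assumes can: "canonical A a T \<kappa>"
    and Q: "qstr T = {J \<in> extensional (range (\<lambda>X. \<kappa> (0, X))). \<exists>q\<in>sp1. \<forall>X. J (\<kappa> (0, X)) = \<kappa> (0, X \<cdot> q)}"
    and \<omega>: "\<And>X Y. form T (\<kappa> (0, X)) (\<kappa> (0, Y)) = - 2 * qRe (h X Y)"
  shows "qsh_tila T" "framed A a T (\<lambda>X. \<kappa> (0, X))" "m_dim T = 4 * CARD('n)"
    "m_part T = range (\<lambda>X. \<kappa> (0, X))"
proof -
  let ?L = "alg T" and ?G = "gset A a" and ?l = "lset A a"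
  define u where "u X = \<kappa> (0, X)" for X
  have ch: "chart ?L \<kappa> ?G" using can by (simp add: canonical_def)
  have br: "lie ?L (\<kappa> x) (\<kappa> y) = \<kappa> (brk A a x y)" if "x \<in> ?G" "y \<in> ?G" for x y
    using can that by (simp add: canonical_def)
  have inv: "invol T (\<kappa> (S, X)) = \<kappa> (S, - X)" if "S \<in> ?l" for S X
    using can that by (simp add: canonical_def)
  interpret V: vectorspace real_ring ?L by (rule chart_vectorspace [OF ch])
  note l0 = subspace_0 [OF subspace_lset, of A a] subspace_neg [OF subspace_lset, of _ A a]
  note cadd = chart_add [OF ch] and cscale = chart_scale [OF ch] and czero = chart_zero [OF ch]
    and cinj = chart_inj [OF ch] and cneg = chart_neg [OF ch] and cdiff = chart_diff [OF ch]
    and cin = chart_in [OF ch] and cG = chart_G [OF ch]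
  have Gmem: "(S, X) \<in> ?G \<longleftrightarrow> S \<in> ?l" for S X by (simp add: gset_def)
  have carr: "carrier ?L = \<kappa> ` ?G" by (rule chart_carrier [OF ch])
  have carrE: "\<exists>S X. S \<in> ?l \<and> z = \<kappa> (S, X)" if "z \<in> carrier ?L" for z
    using that by (auto simp: carr gset_def)
  have uG: "(0, X) \<in> ?G" for X by (simp add: Gmem l0)
  have u_add: "u (X + Y) = u X \<oplus>\<^bsub>?L\<^esub> u Y" for X Y using cadd [OF uG uG, of X Y] by (simp add: u_def)
  have u_scale: "u (r *\<^sub>R X) = r \<odot>\<^bsub>?L\<^esub> u X" for r X using cscale [OF uG, of r X] by (simp add: u_def)
  have u_neg: "u (- X) = \<ominus>\<^bsub>?L\<^esub> u X" for X using cneg [OF uG, of X] by (simp add: u_def)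
  have u_diff: "u (X - Y) = u X \<ominus>\<^bsub>?L\<^esub> u Y" for X Y using cdiff [OF uG uG, of X Y] by (simp add: u_def)
  have u_zero: "u 0 = \<zero>\<^bsub>?L\<^esub>" using czero by (simp add: u_def zero_prod_def)
  have u_inj: "u X = u Y \<longleftrightarrow> X = Y" for X Y using cinj [OF uG uG] by (simp add: u_def)
  have u_in: "u X \<in> carrier ?L" for X by (simp add: u_def cin uG)
  have minus: "m_part T = range u"
  proof (intro equalityI subsetI)
    fix z assume "z \<in> m_part T"
    then have z: "z \<in> carrier ?L" "invol T z = \<ominus>\<^bsub>?L\<^esub> z" by (auto simp: minus_space_def)
    then obtain S X where S: "S \<in> ?l" "z = \<kappa> (S, X)" using carrE by blast
    have "\<kappa> (- (S, X)) = \<ominus>\<^bsub>?L\<^esub> \<kappa> (S, X)" by (rule cneg) (simp add: Gmem S)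
    then have "\<kappa> (S, - X) = \<kappa> (- (S, X))" using z(2) S by (simp add: inv)
    then have "(S, - X) = - (S, X)" using S by (subst (asm) cinj) (simp_all add: Gmem l0)
    then have "2 *\<^sub>R S = 0" by (simp add: scaleR_2 eq_neg_iff_add_eq_0)
    then show "z \<in> range u" using S by (auto simp: u_def)
  next
    fix z assume "z \<in> range u"
    then show "z \<in> m_part T"
      using u_neg u_in by (auto simp: minus_space_def) (simp add: u_def inv l0)
  qed
  have plus: "l_part T = \<kappa> ` (?l \<times> {0})"
  proof (intro equalityI subsetI)
    fix z assume "z \<in> l_part T"
    then have z: "z \<in> carrier ?L" "invol T z = z" by (auto simp: plus_space_def)
    then obtain S X where S: "S \<in> ?l" "z = \<kappa> (S, X)" using carrE by blast
    have "\<kappa> (S, - X) = \<kappa> (S, X)" using z(2) S by (simp add: inv)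
    then have "- X = X" using S by (subst (asm) cinj) (simp_all add: Gmem)
    then have "X = 0" by (metis add.right_inverse scaleR_2 scaleR_eq_0_iff zero_neq_numeral)
    then show "z \<in> \<kappa> ` (?l \<times> {0})" using S by auto
  next
    fix z assume "z \<in> \<kappa> ` (?l \<times> {0})"
    then show "z \<in> l_part T" using inv by (auto simp: plus_space_def cin Gmem)
  qed
  show 1: "m_part T = range (\<lambda>X. \<kappa> (0, X))" using minus by (simp add: u_def)
  have u_bij: "bij_betw u UNIV (m_part T)" unfolding minus bij_betw_def by (auto intro: injI simp: u_inj)
  have span: "l_part T = lie_span ?L (m_part T)"
  proof -
    have "{lie ?L x y |x y. x \<in> m_part T \<and> y \<in> m_part T} = {lie ?L (u X) (u Y) |X Y. True}"
      unfolding minus by auto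
    also have "\<dots> = \<kappa> ` (\<lambda>S. (S, 0)) ` {(Acur A a X Y, acur A a X Y) | X Y. True}"
      unfolding u_def br [OF uG uG] brk_simps by (auto simp: cur_def)
    finally have eq: "{lie ?L x y |x y. x \<in> m_part T \<and> y \<in> m_part T}
      = \<kappa> ` (\<lambda>S. (S, 0)) ` {(Acur A a X Y, acur A a X Y) | X Y. True}" .
    have "lie_span ?L (m_part T) = \<kappa> ` span ((\<lambda>S. (S, 0)) ` {(Acur A a X Y, acur A a X Y) | X Y. True})"
      unfolding lie_span_def eq
      by (rule chart_span [OF ch]) (use cur_lset [of A a] in \<open>auto simp: Gmem cur_def\<close>)
    also have "span ((\<lambda>S. (S, 0 :: quat^'n)) ` {(Acur A a X Y, acur A a X Y) | X Y. True}) = (\<lambda>S. (S, 0)) ` ?l"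
      unfolding lset_def by (rule linear_span_image) (intro linearI, simp_all)
    also have "(\<lambda>S. (S, 0 :: quat^'n)) ` ?l = ?l \<times> {0}" by auto
    finally show ?thesis using plus by simp
  qed
  have lie_alg: "lie_algebra ?L"
    unfolding lie_algebra_def
  proof (intro conjI ballI)
    show "vectorspace real_ring ?L" by (rule chart_vectorspace [OF ch])
    show "vectorspace.fin_dim real_ring ?L" by (rule chart_fin_dim [OF ch])
    fix x assume "x \<in> carrier ?L"
    then obtain x' where x: "x' \<in> ?G" "x = \<kappa> x'" by (auto simp: carr)
    have lin: "lie ?L x y \<in> carrier ?L \<and> lie ?L y x \<in> carrier ?L \<and>
        lie ?L x (r \<odot>\<^bsub>?L\<^esub> y) = r \<odot>\<^bsub>?L\<^esub> lie ?L x y \<and> lie ?L (r \<odot>\<^bsub>?L\<^esub> y) x = r \<odot>\<^bsub>?L\<^esub> lie ?L y x \<and>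
        lie ?L x (y \<oplus>\<^bsub>?L\<^esub> z) = lie ?L x y \<oplus>\<^bsub>?L\<^esub> lie ?L x z \<and>
        lie ?L (y \<oplus>\<^bsub>?L\<^esub> z) x = lie ?L y x \<oplus>\<^bsub>?L\<^esub> lie ?L z x"
      if "y \<in> carrier ?L" "z \<in> carrier ?L" for y z r
    proof -
      have "y \<in> \<kappa> ` ?G" "z \<in> \<kappa> ` ?G" using that by (simp_all add: carr)
      then obtain y' z' where "y' \<in> ?G" "y = \<kappa> y'" "z' \<in> ?G" "z = \<kappa> z'" by blast
      then show ?thesis using x
        by (simp add: br brk_gset cG cin brk_bilinear flip: cadd cscale)
    qed
    show "lie ?L x \<in> module_hom real_ring ?L ?L" "(\<lambda>y. lie ?L y x) \<in> module_hom real_ring ?L ?L"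
      by (rule module_hom_realI; use lin in blast)+
    show "lie ?L x x = \<zero>\<^bsub>?L\<^esub>" by (simp add: x br brk_bilinear czero)
    fix y z assume "y \<in> carrier ?L" "z \<in> carrier ?L"
    then obtain y' z' where y: "y' \<in> ?G" "y = \<kappa> y'" and z: "z' \<in> ?G" "z = \<kappa> z'" by (auto simp: carr)
    show "lie ?L x (lie ?L y z) \<oplus>\<^bsub>?L\<^esub> lie ?L y (lie ?L z x) \<oplus>\<^bsub>?L\<^esub> lie ?L z (lie ?L x y) = \<zero>\<^bsub>?L\<^esub>"
      using x y z by (simp add: br brk_gset cG brk_jacobi flip: cadd czero)
  qed
  have swap_G: "(fst x, - snd x) \<in> ?G" if "x \<in> ?G" for x using that by (simp add: gset_def mem_Times_iff)
  have inv': "invol T (\<kappa> x) = \<kappa> (fst x, - snd x)" if "x \<in> ?G" for x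
    using that inv [of "fst x" "snd x"] by (simp add: gset_def mem_Times_iff)
  have tila: "tila ?L (invol T)"
    unfolding tila_def
  proof (intro conjI allI impI ballI)
    show "lie_algebra ?L" by (rule lie_alg)
    show "l_part T = lie_span ?L (m_part T)" by (rule span)
    show ii: "invol T (invol T x) = x" if "x \<in> carrier ?L" for x
      using carrE [OF that] by (auto simp: inv)
    show "lie_iso ?L ?L (invol T)"
      unfolding lie_iso_def
    proof (intro conjI ballI)
      show "invol T \<in> module_hom real_ring ?L ?L"
      proof (rule module_hom_realI)
        fix x y :: 'a and r assume "x \<in> carrier ?L"
        then obtain x' where x: "x' \<in> ?G" "x = \<kappa> x'" by (auto simp: carr)
        show "invol T x \<in> carrier ?L" using x by (simp add: inv' cin swap_G)
        show "invol T (r \<odot>\<^bsub>?L\<^esub> x) = r \<odot>\<^bsub>?L\<^esub> invol T x"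
          using x swap_G [OF x(1)] by (simp add: inv' cG flip: cscale)
        assume "y \<in> carrier ?L"
        then obtain y' where y: "y' \<in> ?G" "y = \<kappa> y'" by (auto simp: carr)
        show "invol T (x \<oplus>\<^bsub>?L\<^esub> y) = invol T x \<oplus>\<^bsub>?L\<^esub> invol T y"
          using x y swap_G [OF x(1)] swap_G [OF y(1)] by (simp add: inv' cG flip: cadd)
      qed
      have "invol T x \<in> carrier ?L" if "x \<in> carrier ?L" for x
      proof -
        obtain x' where "x' \<in> ?G" "x = \<kappa> x'" using \<open>x \<in> carrier ?L\<close> by (auto simp: carr)
        then show ?thesis by (simp add: inv' cin swap_G)
      qed
      then show "bij_betw (invol T) (carrier ?L) (carrier ?L)"
        by (intro bij_betw_byWitness [of _ "invol T"]) (auto simp: ii)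
      fix x y assume "x \<in> carrier ?L" "y \<in> carrier ?L"
      then obtain x' y' where x: "x' \<in> ?G" "x = \<kappa> x'" and y: "y' \<in> ?G" "y = \<kappa> y'" by (auto simp: carr)
      show "invol T (lie ?L x y) = lie ?L (invol T x) (invol T y)"
        using x y swap_G [OF x(1)] swap_G [OF y(1)]
        by (simp add: inv' br brk_gset) (simp add: brk_def act_linear)
    qed
    fix I assume "lie_ideal ?L I \<and> I \<subseteq> l_part T"
    then have I: "VectorSpace.subspace real_ring I ?L" "\<And>x y. x \<in> carrier ?L \<Longrightarrow> y \<in> I \<Longrightarrow> lie ?L x y \<in> I"
      and Il: "I \<subseteq> l_part T" by (auto simp: lie_ideal_def)
    show "I = {\<zero>\<^bsub>?L\<^esub>}"
    proof (intro equalityI subsetI)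
      \<comment> \<open>The bracket of an element of m with \<open>z\<close> lies in m and also in
        the ideal, hence in l. So it is zero, and the action on m is faithful.\<close>
      fix z assume zI: "z \<in> I"
      then obtain S where S: "S \<in> ?l" "z = \<kappa> (S, 0)" using Il plus by auto
      have "act S X = 0" for X
      proof -
        have "\<kappa> (0, - act S X) \<in> I" using I(2) [OF u_in [of X] zI] S by (simp add: u_def br l0 Gmem brk_simps)
        then obtain S' where "S' \<in> ?l" "\<kappa> (0, - act S X) = \<kappa> (S', 0)" using Il plus by auto
        then show ?thesis by (subst (asm) cinj) (auto simp: Gmem l0)
      qed
      then have "S = 0" using act_inj lset_commutant S by blast
      then show "z \<in> {\<zero>\<^bsub>?L\<^esub>}" using S czero by (simp add: zero_prod_def)
    next
      fix z assume "z \<in> {\<zero>\<^bsub>?L\<^esub>}"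
      then show "z \<in> I"
        using I(1) by (auto simp: VectorSpace.subspace_def LinearCombinations.submodule_def)
    qed
  qed
  define Jq where "Jq q = restrict (\<lambda>x. u (inv_into UNIV u x \<cdot> q)) (m_part T)" for q
  have inv_u: "inv_into UNIV u (u X) = X" for X
    by (rule inv_into_f_f) (auto intro: injI simp: u_inj)
  have Jq: "Jq q (u X) = u (X \<cdot> q)" for q X by (simp add: Jq_def minus inv_u)
  have JqI: "J = Jq q" if "J \<in> extensional (m_part T)" "\<And>X. J (u X) = u (X \<cdot> q)" for J q
    by (rule extensionalityI [OF that(1), of "Jq q"]) (auto simp: Jq_def minus inv_u that(2))
  have Jext: "Jq q \<in> extensional (m_part T)" for q by (simp add: Jq_def)
  have QJ: "qstr T = {Jq q | q. q \<in> sp1}"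
    unfolding Q 1 [symmetric] using JqI Jext Jq by (auto simp: u_def [symmetric])
  have JEnd: "Jq q \<in> End_sub ?L (m_part T)" for q
    unfolding End_sub_def
    by (intro IntI Jext module_hom_realI)
      (auto simp: minus Jq vscale_distrib vscale_scaleR u_add u_scale simp flip: u_add u_scale)
  \<comment> \<open>Right multiplications compose in reverse order: the product of the structures
    for i and j is right multiplication by j i = - k. Hence the third structure is
    \<open>Jq (- qk)\<close>.\<close>
  have lc: "lincomb3 ?L (m_part T) (Jq qi) (Jq qj) (Jq (- qk)) x y z = Jq (x *\<^sub>R qi + y *\<^sub>R qj - z *\<^sub>R qk)" for x y z
    by (rule JqI) (auto simp: lincomb3_def minus Jq vscale_distrib vscale_scaleR simp flip: u_add u_scale)
  have Jinj: "Jq p = Jq q \<Longrightarrow> p = q" for p q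
  proof -
    assume "Jq p = Jq q"
    then have "u (axis undefined 1 \<cdot> p) = u (axis undefined 1 \<cdot> q)" by (metis Jq)
    then have "axis undefined 1 \<cdot> (p - q) = (0 :: quat^'n)" by (simp add: u_inj vscale_distrib)
    then show "p = q" by (simp add: axis_eq_0_iff)
  qed
  have qs: "quaternionic_structure ?L (m_part T) (qstr T)"
    unfolding quaternionic_structure_def
  proof (intro bexI conjI ballI allI impI)
    show "complex_str ?L (m_part T) (Jq qi)" "complex_str ?L (m_part T) (Jq qj)" "complex_str ?L (m_part T) (Jq (- qk))"
      by (simp_all add: complex_str_def minus Jq vscale_assoc flip: u_neg)
    fix x assume "x \<in> m_part T"
    then obtain X where X: "x = u X" by (auto simp: minus)
    show "Jq qi (Jq qj x) = Jq (- qk) x" "Jq (- qk) x = \<ominus>\<^bsub>?L\<^esub> Jq qj (Jq qi x)"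
      by (simp_all add: X Jq vscale_assoc flip: u_neg)
  next
    fix x y z assume "lincomb3 ?L (m_part T) (Jq qi) (Jq qj) (Jq (- qk)) x y z
      = lincomb3 ?L (m_part T) (Jq qi) (Jq qj) (Jq (- qk)) 0 0 0"
    then have "x *\<^sub>R qi + y *\<^sub>R qj - z *\<^sub>R qk = 0" using Jinj unfolding lc by fastforce
    then show "x = 0" "y = 0" "z = 0" by (simp_all add: quat_eq_iff)
  next
    have "\<exists>x y z. q = x *\<^sub>R qi + y *\<^sub>R qj - z *\<^sub>R qk" if "q \<in> sp1" for q
      by (intro exI [of _ "qI q"] exI [of _ "qJ q"] exI [of _ "- qK q"]) (use that in \<open>simp add: quat_eq_iff sp1_def\<close>)
    then show "qstr T = {lincomb3 ?L (m_part T) (Jq qi) (Jq qj) (Jq (- qk)) x y z |x y z. True}"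
      unfolding QJ lc by (intro equalityI subsetI) (blast, auto simp: sp1_def)
  qed (rule JEnd)+
  have \<omega>u: "form T (u X) (u Y) = - 2 * qRe (h X Y)" for X Y by (simp add: u_def \<omega>)
  have sf: "symplectic_form ?L (m_part T) (form T)"
    unfolding symplectic_form_def
  proof (intro conjI ballI allI impI)
    fix x assume "x \<in> m_part T"
    then obtain X where x: "x = u X" by (auto simp: minus)
    show "x = \<zero>\<^bsub>?L\<^esub>" if "\<forall>y\<in>m_part T. form T x y = 0"
    proof -
      have "qRe (h X Y) = 0" for Y using that by (simp add: minus x \<omega>u)
      then have "X = 0" by (rule Re_h_nondeg)
      then show ?thesis by (simp add: x u_zero)
    qed
    fix y assume "y \<in> m_part T"
    then obtain Y where y: "y = u Y" by (auto simp: minus)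
    show "form T x y = - form T y x" by (simp add: x y \<omega>u h_Re_sym [of X Y])
    show "form T (r \<odot>\<^bsub>?L\<^esub> x) y = r * form T x y" for r by (simp add: x y \<omega>u hf_scaleR flip: u_scale)
    fix z assume "z \<in> m_part T"
    then obtain Z where z: "z = u Z" by (auto simp: minus)
    show "form T (x \<oplus>\<^bsub>?L\<^esub> y) z = form T x z + form T y z" by (simp add: x y z \<omega>u hf_add flip: u_add)
  qed
  have lact: "lie ?L (\<kappa> (S, 0)) (u X) = u (act S X)" if "S \<in> ?l" for S X
    using that by (simp add: u_def br Gmem l0 brk_simps)
  show qsh: "qsh_tila T"
    unfolding qsh_tila_def
  proof (intro conjI ballI impI)
    show "tila ?L (invol T)" "quaternionic_structure ?L (m_part T) (qstr T)"
      "symplectic_form ?L (m_part T) (form T)" by (rule tila qs sf)+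
  next
    fix J x y assume J: "J \<in> qstr T" "complex_str ?L (m_part T) J" and "x \<in> m_part T" "y \<in> m_part T"
    then obtain X Y where xy: "x = u X" "y = u Y" by (auto simp: minus)
    obtain q where q: "J = Jq q" using J(1) QJ by blast
    \<comment> \<open>Evaluation at one nonzero vector turns the square of \<open>J\<close> into
      \<open>q * q = - 1\<close>. Then \<open>q\<close> has norm 1, and conjugation by it does not
      change real parts.\<close>
    have "u (axis undefined 1 \<cdot> (q * q)) = u (- axis undefined 1)"
      using J(2) by (simp add: complex_str_def minus q Jq vscale_assoc u_neg)
    then have "axis undefined 1 \<cdot> (q * q) + axis undefined 1 \<cdot> 1 = (0 :: quat^'n)" by (simp add: u_inj)
    then have "axis undefined 1 \<cdot> (q * q + 1) = (0 :: quat^'n)" by (simp only: vscale_distrib)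
    then have "q * q = - 1" by (simp add: axis_eq_0_iff eq_neg_iff_add_eq_0)
    then have n: "norm q = 1" by (rule norm_unit_if_square)
    have "qRe (qcnj q * h X Y * q) = qRe (h X Y * (q * qcnj q))"
      by (simp add: quat_mult_sel algebra_simps)
    then show "form T (J x) (J y) = form T x y"
      by (simp add: xy q Jq \<omega>u hf_scale qcnj_mult_self n mult.assoc)
  next
    fix \<xi> J assume \<xi>: "\<xi> \<in> l_part T" and J: "J \<in> qstr T"
    obtain S where S: "S \<in> ?l" "\<xi> = \<kappa> (S, 0)" using \<xi> plus by auto
    obtain q where q: "J = Jq q" "q \<in> sp1" using J QJ by blast
    have "restrict (\<lambda>x. lie ?L \<xi> (J x) \<ominus>\<^bsub>?L\<^esub> J (lie ?L \<xi> x)) (m_part T) = Jq (snd S * q - q * snd S)"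
      by (rule JqI) (auto simp: minus q Jq S lact act_def bop_vscale simp flip: u_diff)
    moreover have "snd S * q - q * snd S \<in> sp1" by (simp add: sp1_def quat_mult_sel)
    ultimately show "restrict (\<lambda>x. lie ?L \<xi> (J x) \<ominus>\<^bsub>?L\<^esub> J (lie ?L \<xi> x)) (m_part T) \<in> qstr T"
      using QJ by blast
  next
    fix \<xi> x y assume \<xi>: "\<xi> \<in> l_part T" and "x \<in> m_part T" "y \<in> m_part T"
    then obtain X Y where xy: "x = u X" "y = u Y" by (auto simp: minus)
    obtain S where S: "S \<in> ?l" "\<xi> = \<kappa> (S, 0)" using \<xi> plus by auto
    have "fst S \<in> so_star j" "snd S \<in> sp1" using lset_commutant [OF S(1)] by (auto simp: commutant_def)
    then show "form T (lie ?L \<xi> x) y + form T x (lie ?L \<xi> y) = 0"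
      by (simp add: xy S lact \<omega>u act_def Re_h_bop)
  qed
  have fr: "framed A a T u"
    unfolding framed_def
  proof (intro conjI allI)
    show "qstr T = {J \<in> extensional (m_part T). \<exists>q\<in>sp1. \<forall>X. J (u X) = u (X \<cdot> q)}"
      unfolding Q 1 u_def ..
    show "lie ?L (lie ?L (u X) (u Y)) (u Z) = u (Rcur A a X Y Z)" for X Y Z
    proof -
      have "lie ?L (u X) (u Y) = \<kappa> (cur A a X Y, 0)" by (simp add: u_def br uG brk_simps)
      then show ?thesis by (simp add: lact cur_lset act_cur)
    qed
  qed (simp_all add: u_bij u_add u_scale \<omega>u)
  then show "framed A a T (\<lambda>X. \<kappa> (0, X))" by (simp add: u_def [abs_def])
  have "chart (?L\<lparr>carrier := m_part T\<rparr>) u UNIV"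
    by (simp add: chart_def u_bij u_add u_scale u_zero)
  from chart_fin_dim(2) [OF this] show "m_dim T = 4 * CARD('n)" by (simp add: m_dim_def)
qed

end

section \<open>Frames of abstract triples\<close>

context skew_form begin

text \<open>Compatibility with Q attaches to \<open>D\<close> a derivation
  \<open>q \<mapsto> p\<close> of the quaternions. It is inner, \<open>p = a q - q a\<close>, and
  \<open>D X + X a\<close> is then H-linear, which gives \<open>A\<close>.\<close>

lemma derivation_pair:
  assumes D: "linear D" and Q: "\<And>q. q \<in> sp1 \<Longrightarrow> \<exists>p\<in>sp1. \<forall>X. D (X \<cdot> q) - D X \<cdot> q = X \<cdot> p"
    and \<omega>: "\<And>X Y. qRe (h (D X) Y) + qRe (h X (D Y)) = 0"
  shows "\<exists>A\<in>so_star j. \<exists>a\<in>sp1. \<forall>X. D X = bop A a X"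
proof -
  have D_add: "D (X + Y) = D X + D Y" "D (r *\<^sub>R X) = r *\<^sub>R D X" "D (- X) = - D X" for X Y r
    by (simp_all add: linear_add linear_scale linear_neg D)
  obtain pi where pi: "pi \<in> sp1" "\<And>X. D (X \<cdot> qi) = D X \<cdot> qi + X \<cdot> pi"
    using Q [of qi] by (auto simp: diff_eq_eq add.commute)
  obtain pj where pj: "pj \<in> sp1" "\<And>X. D (X \<cdot> qj) = D X \<cdot> qj + X \<cdot> pj"
    using Q [of qj] by (auto simp: diff_eq_eq add.commute)
  obtain pk where pk: "pk \<in> sp1" "\<And>X. D (X \<cdot> qk) = D X \<cdot> qk + X \<cdot> pk"
    using Q [of qk] by (auto simp: diff_eq_eq add.commute)
  have eq0: "q = 0" if "\<And>X. X \<cdot> q = (0 :: quat^'n)" for q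
    using that [of "axis undefined 1"] by (simp add: axis_eq_0_iff)
  have "X \<cdot> (pi * qi + qi * pi) = 0" for X :: "quat^'n"
    using pi(2) [of "X \<cdot> qi"] by (simp add: pi(2) vscale_assoc vscale_distrib D_add)
  then have i: "pi * qi + qi * pi = 0" by (rule eq0)
  have "X \<cdot> (pj * qj + qj * pj) = 0" for X :: "quat^'n"
    using pj(2) [of "X \<cdot> qj"] by (simp add: pj(2) vscale_assoc vscale_distrib D_add)
  then have j: "pj * qj + qj * pj = 0" by (rule eq0)
  have "X \<cdot> (pi * qj + qi * pj - pk) = 0" for X :: "quat^'n"
    using pj(2) [of "X \<cdot> qi"] by (simp add: pi(2) pk(2) vscale_assoc vscale_distrib)
  then have k: "pi * qj + qi * pj - pk = 0" by (rule eq0)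
  \<comment> \<open>The solution of \<open>a i - i a = pi\<close> and \<open>a j - j a = pj\<close>;
    the commutator of two imaginary quaternions is twice their cross product.\<close>
  define a where "a = Quat 0 (qK pj / 2) (- qK pi / 2) (qJ pi / 2)"
  have ai: "a * qi - qi * a = pi" and aj: "a * qj - qj * a = pj"
    using i j k pi(1) pj(1) pk(1) by (simp_all add: qcomp sp1_def a_def)
  define E where "E X = D X + X \<cdot> a" for X
  have E: "E (X + Y) = E X + E Y" "E (r *\<^sub>R X) = r *\<^sub>R E X" for X Y r
    by (simp_all add: E_def D_add vscale_distrib vscale_scaleR scaleR_add_right)
  have Ei: "E (X \<cdot> qi) = E X \<cdot> qi" for X
    by (simp add: E_def pi(2) vscale_distrib vscale_assoc flip: ai)
  have Ej: "E (X \<cdot> qj) = E X \<cdot> qj" for X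
    by (simp add: E_def pj(2) vscale_distrib vscale_assoc flip: aj)
  have "E (X \<cdot> q) = E X \<cdot> q" for X q
    by (rule Hlinear_if_qi_qj) (fact E Ei Ej)+
  then obtain A where A: "\<And>X. E X = A *v X" using Hlinear_matrix [of E] E(1) by blast
  have DA: "D X = bop A a X" for X using A [of X] by (simp add: bop_def E_def algebra_simps)
  have asp: "a \<in> sp1" by (simp add: a_def sp1_def)
  have "h (A *v X) Y = - h X (A *v Y)" for X Y
  proof -
    have w: "qRe (h (A *v X) Y + h X (A *v Y)) = 0" for X Y
      using \<omega> [of X Y] asp by (simp add: DA bop_def hf_add hf_scale sp1_def quat_mult_sel)
    have "qRe ((h (A *v X) Y + h X (A *v Y)) * q) = 0" for q
      using w [of X "Y \<cdot> q"] by (simp add: mv_vscale hf_scale distrib_right)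
    from this [of 1] this [of qi] this [of qj] this [of qk]
    have "h (A *v X) Y + h X (A *v Y) = 0" unfolding quat_eq_iff by (simp add: quat_mult_sel)
    then show ?thesis by (simp add: eq_neg_iff_add_eq_0)
  qed
  then have "A \<in> so_star j" by (simp add: so_star_iff)
  then show ?thesis using asp DA by blast
qed

end

section \<open>Calculus in real Lie algebras and in tiLas given as records\<close>

locale real_lie =
  fixes L :: "'a lie_alg" (structure)
  assumes lie_algebra: "lie_algebra L"
begin

sublocale V: vectorspace real_ring L using lie_algebra by (simp add: lie_algebra_def)

abbreviation br :: "'a \<Rightarrow> 'a \<Rightarrow> 'a" where "br \<equiv> lie L"

lemma br_closed [simp, intro]: "x \<in> carrier L \<Longrightarrow> y \<in> carrier L \<Longrightarrow> br x y \<in> carrier L"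
  using lie_algebra unfolding lie_algebra_def by (blast dest: module_hom_closed [THEN funcset_mem])

lemma br_add_right: "x \<in> carrier L \<Longrightarrow> y \<in> carrier L \<Longrightarrow> z \<in> carrier L \<Longrightarrow> br x (y \<oplus> z) = br x y \<oplus> br x z"
  using lie_algebra unfolding lie_algebra_def by (blast intro: module_hom_add)

lemma br_add_left: "x \<in> carrier L \<Longrightarrow> y \<in> carrier L \<Longrightarrow> z \<in> carrier L \<Longrightarrow> br (y \<oplus> z) x = br y x \<oplus> br z x"
  using lie_algebra module_hom_add [of "\<lambda>y. br y x" real_ring L L y z] unfolding lie_algebra_def by blast

lemma br_smult_right: "x \<in> carrier L \<Longrightarrow> y \<in> carrier L \<Longrightarrow> br x (r \<odot> y) = r \<odot> br x y"
  using lie_algebra module_hom_smult [of "br x" real_ring L L r y] unfolding lie_algebra_def by simp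

lemma br_smult_left: "x \<in> carrier L \<Longrightarrow> y \<in> carrier L \<Longrightarrow> br (r \<odot> y) x = r \<odot> br y x"
  using lie_algebra module_hom_smult [of "\<lambda>y. br y x" real_ring L L r y] unfolding lie_algebra_def by simp

lemma br_self: "x \<in> carrier L \<Longrightarrow> br x x = \<zero>"
  using lie_algebra unfolding lie_algebra_def by blast

lemma br_jacobi0: "x \<in> carrier L \<Longrightarrow> y \<in> carrier L \<Longrightarrow> z \<in> carrier L
    \<Longrightarrow> br x (br y z) \<oplus> br y (br z x) \<oplus> br z (br x y) = \<zero>"
  using lie_algebra unfolding lie_algebra_def by blast

lemma smult_0 [simp]: "x \<in> carrier L \<Longrightarrow> 0 \<odot> x = \<zero>"
  using V.smult_l_null [of x] by simp

lemma smult_1 [simp]: "x \<in> carrier L \<Longrightarrow> 1 \<odot> x = x"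
  using V.smult_one [of x] by simp

lemma smult_add: "x \<in> carrier L \<Longrightarrow> (r + s) \<odot> x = r \<odot> x \<oplus> s \<odot> x"
  using V.smult_l_distr [of r s x] by simp

lemma br_zero [simp]: "x \<in> carrier L \<Longrightarrow> br x \<zero> = \<zero>" "x \<in> carrier L \<Longrightarrow> br \<zero> x = \<zero>"
  using br_smult_right [of x \<zero> 0] br_smult_left [of x \<zero> 0] by simp_all

lemma neg_smult: "x \<in> carrier L \<Longrightarrow> \<ominus> x = (-1) \<odot> x"
proof -
  have "\<ominus>\<^bsub>real_ring\<^esub> 1 = -1" by (rule V.R.minus_equality) simp_all
  then show "x \<in> carrier L \<Longrightarrow> \<ominus> x = (-1) \<odot> x" using V.smult_l_minus [of 1 x] V.smult_one [of x] by simp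
qed

lemma br_neg: "x \<in> carrier L \<Longrightarrow> y \<in> carrier L \<Longrightarrow> br x (\<ominus> y) = \<ominus> br x y"
  "x \<in> carrier L \<Longrightarrow> y \<in> carrier L \<Longrightarrow> br (\<ominus> y) x = \<ominus> br y x"
  by (simp_all add: neg_smult br_smult_left br_smult_right)

lemma br_skew: assumes "x \<in> carrier L" "y \<in> carrier L" shows "br x y = \<ominus> br y x"
proof -
  have "br (x \<oplus> y) (x \<oplus> y) = \<zero>" using assms by (simp add: br_self)
  moreover have "br (x \<oplus> y) (x \<oplus> y) = br x y \<oplus> br y x"
    using assms by (simp add: br_add_left br_add_right br_self [OF assms(1)] br_self [OF assms(2)] V.a_comm)
  ultimately show ?thesis using assms V.minus_equality [of "br x y" "br y x"] by simp
qed

lemma br_jacobi: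
  assumes "x \<in> carrier L" "y \<in> carrier L" "z \<in> carrier L"
  shows "br (br x y) z = br x (br y z) \<ominus> br y (br x z)"
proof -
  have "br y (br z x) = \<ominus> br y (br x z)"
    using assms by (subst br_skew [of z x]) (simp_all add: br_neg)
  moreover have "br z (br x y) = \<ominus> br (br x y) z" using assms by (simp add: br_skew [of z])
  ultimately have "(br x (br y z) \<ominus> br y (br x z)) \<oplus> \<ominus> br (br x y) z = \<zero>"
    using br_jacobi0 [OF assms] by (simp add: a_minus_def)
  then have "\<ominus> (\<ominus> br (br x y) z) = br x (br y z) \<ominus> br y (br x z)"
    using assms by (intro V.minus_equality) auto
  then show ?thesis using assms by simp
qed

lemma neg_zero [simp]: "\<ominus> \<zero> = \<zero>"
  by (simp add: neg_smult)

end

locale real_tila =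
  fixes L :: "'a lie_alg" (structure) and \<sigma> :: "'a \<Rightarrow> 'a"
  assumes tila: "tila L \<sigma>"
begin

sublocale real_lie L by unfold_locales (use tila in \<open>simp add: tila_def\<close>)

abbreviation l :: "'a set" where "l \<equiv> plus_space L \<sigma>"
abbreviation m :: "'a set" where "m \<equiv> minus_space L \<sigma>"

lemma \<sigma>: "x \<in> carrier L \<Longrightarrow> \<sigma> x \<in> carrier L" "x \<in> carrier L \<Longrightarrow> \<sigma> (\<sigma> x) = x"
  "x \<in> carrier L \<Longrightarrow> y \<in> carrier L \<Longrightarrow> \<sigma> (x \<oplus> y) = \<sigma> x \<oplus> \<sigma> y"
  "x \<in> carrier L \<Longrightarrow> \<sigma> (r \<odot> x) = r \<odot> \<sigma> x"
  "x \<in> carrier L \<Longrightarrow> y \<in> carrier L \<Longrightarrow> \<sigma> (br x y) = br (\<sigma> x) (\<sigma> y)"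
proof -
  have h: "\<sigma> \<in> module_hom real_ring L L" and
    b: "\<forall>x\<in>carrier L. \<forall>y\<in>carrier L. \<sigma> (br x y) = br (\<sigma> x) (\<sigma> y)" and
    i: "\<forall>x\<in>carrier L. \<sigma> (\<sigma> x) = x"
    using tila by (simp_all add: tila_def lie_iso_def)
  show "x \<in> carrier L \<Longrightarrow> \<sigma> x \<in> carrier L" "x \<in> carrier L \<Longrightarrow> \<sigma> (\<sigma> x) = x"
    "x \<in> carrier L \<Longrightarrow> y \<in> carrier L \<Longrightarrow> \<sigma> (x \<oplus> y) = \<sigma> x \<oplus> \<sigma> y"
    "x \<in> carrier L \<Longrightarrow> \<sigma> (r \<odot> x) = r \<odot> \<sigma> x"
    "x \<in> carrier L \<Longrightarrow> y \<in> carrier L \<Longrightarrow> \<sigma> (br x y) = br (\<sigma> x) (\<sigma> y)"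
    using b i module_hom_add [OF h] module_hom_smult [OF h, of r x] funcset_mem [OF module_hom_closed [OF h]] by simp_all
qed

lemma \<sigma>_neg: "x \<in> carrier L \<Longrightarrow> \<sigma> (\<ominus> x) = \<ominus> \<sigma> x"
  by (simp add: neg_smult \<sigma>)

lemma lm: "x \<in> l \<Longrightarrow> x \<in> carrier L" "x \<in> l \<Longrightarrow> \<sigma> x = x" "x \<in> m \<Longrightarrow> x \<in> carrier L" "x \<in> m \<Longrightarrow> \<sigma> x = \<ominus> x"
  by (simp_all add: plus_space_def minus_space_def)

lemma l_closed: "x \<in> l \<Longrightarrow> y \<in> l \<Longrightarrow> x \<oplus> y \<in> l" "x \<in> l \<Longrightarrow> r \<odot> x \<in> l" "\<zero> \<in> l" "x \<in> l \<Longrightarrow> y \<in> l \<Longrightarrow> br x y \<in> l"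
  "x \<in> l \<Longrightarrow> \<ominus> x \<in> l" "x \<in> l \<Longrightarrow> y \<in> l \<Longrightarrow> x \<ominus> y \<in> l"
proof -
  have z: "\<sigma> \<zero> = \<zero>" using \<sigma>(4) [of \<zero> 0] \<sigma>(1) [of \<zero>] by simp
  show "x \<in> l \<Longrightarrow> y \<in> l \<Longrightarrow> x \<oplus> y \<in> l" "x \<in> l \<Longrightarrow> r \<odot> x \<in> l" "\<zero> \<in> l" "x \<in> l \<Longrightarrow> y \<in> l \<Longrightarrow> br x y \<in> l"
    "x \<in> l \<Longrightarrow> \<ominus> x \<in> l" "x \<in> l \<Longrightarrow> y \<in> l \<Longrightarrow> x \<ominus> y \<in> l"
    by (auto simp: plus_space_def \<sigma> z \<sigma>_neg a_minus_def)
qed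

lemma m_closed: "x \<in> m \<Longrightarrow> y \<in> m \<Longrightarrow> x \<oplus> y \<in> m" "x \<in> m \<Longrightarrow> r \<odot> x \<in> m" "\<zero> \<in> m"
  "x \<in> m \<Longrightarrow> y \<in> m \<Longrightarrow> br x y \<in> l" "x \<in> l \<Longrightarrow> y \<in> m \<Longrightarrow> br x y \<in> m" "x \<in> m \<Longrightarrow> \<ominus> x \<in> m"
proof -
  have z: "\<sigma> \<zero> = \<zero>" using \<sigma>(4) [of \<zero> 0] \<sigma>(1) [of \<zero>] by simp
  show "x \<in> m \<Longrightarrow> y \<in> m \<Longrightarrow> x \<oplus> y \<in> m" "x \<in> m \<Longrightarrow> r \<odot> x \<in> m" "\<zero> \<in> m"
    "x \<in> m \<Longrightarrow> y \<in> m \<Longrightarrow> br x y \<in> l" "x \<in> l \<Longrightarrow> y \<in> m \<Longrightarrow> br x y \<in> m" "x \<in> m \<Longrightarrow> \<ominus> x \<in> m"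
    by (auto simp: plus_space_def minus_space_def \<sigma> z \<sigma>_neg br_neg V.minus_add V.smult_r_minus V.a_comm)
qed

lemma decompose: assumes z: "z \<in> carrier L" shows "\<exists>x\<in>l. \<exists>y\<in>m. z = x \<oplus> y"
proof (intro bexI)
  let ?x = "(1/2) \<odot> (z \<oplus> \<sigma> z)" and ?y = "(1/2) \<odot> (z \<ominus> \<sigma> z)"
  show "?x \<in> l" using z by (simp add: plus_space_def \<sigma> V.a_comm)
  show "?y \<in> m" using z by (simp add: minus_space_def \<sigma> \<sigma>_neg a_minus_def V.minus_add V.a_comm flip: V.smult_r_minus)
  have "(z \<oplus> \<sigma> z) \<oplus> (z \<ominus> \<sigma> z) = z \<oplus> z"
    using z \<sigma>(1) [OF z] by (simp add: a_minus_def V.a_ac V.r_neg)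
  also have "\<dots> = 2 \<odot> z" using z smult_add [of z 1 1] by simp
  finally have "?x \<oplus> ?y = (1/2) \<odot> (2 \<odot> z)"
    using z \<sigma>(1) [OF z] by (simp flip: V.smult_r_distr)
  then show "z = ?x \<oplus> ?y" using z V.smult_assoc1 [of "1/2" 2 z] V.smult_one [of z] by simp
qed

lemma l_span: "l = lie_span L m" using tila by (simp add: tila_def)

lemma l_induct:
  assumes "\<xi> \<in> l" "\<And>x y. x \<in> m \<Longrightarrow> y \<in> m \<Longrightarrow> br x y \<in> W" "LinearCombinations.submodule real_ring W L"
  shows "\<xi> \<in> W"
proof -
  have "V.span {br x y | x y. x \<in> m \<and> y \<in> m} \<subseteq> W"
    by (rule V.span_is_subset) (use assms in auto)
  then show ?thesis using assms(1) l_span by (auto simp: lie_span_def)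
qed

text \<open>The kernel of the action of l on m is an ideal of g contained in l, hence zero.\<close>

lemma faithful: assumes "\<xi> \<in> l" "\<And>y. y \<in> m \<Longrightarrow> br \<xi> y = \<zero>" shows "\<xi> = \<zero>"
proof -
  define I where "I = {\<xi> \<in> l. \<forall>y\<in>m. br \<xi> y = \<zero>}"
  have "lie_ideal L I"
    unfolding lie_ideal_def VectorSpace.subspace_def LinearCombinations.submodule_def
  proof (intro conjI ballI allI impI)
    show "vectorspace real_ring L" "module real_ring L" by unfold_locales
    show "I \<subseteq> carrier L" by (auto simp: I_def lm)
    show "\<zero> \<in> I" by (auto simp: I_def l_closed lm)
    fix x y r assume xy: "x \<in> I" "y \<in> I"
    then show "x \<oplus> y \<in> I" by (auto simp: I_def l_closed lm br_add_left)
  next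
    fix x r assume "x \<in> I"
    then show "r \<odot> x \<in> I" by (auto simp: I_def l_closed lm br_smult_left)
  next
    fix x y assume x: "x \<in> carrier L" and y: "y \<in> I"
    then have yl: "y \<in> l" "\<And>z. z \<in> m \<Longrightarrow> br y z = \<zero>" by (auto simp: I_def)
    obtain x1 x2 where x12: "x1 \<in> l" "x2 \<in> m" "x = x1 \<oplus> x2" using decompose [OF x] by blast
    have "br x2 y = \<ominus> br y x2" using x12 yl lm by (intro br_skew) auto
    then have "br x2 y = \<zero>" using yl x12 by simp
    then have e: "br x y = br x1 y" using x12 yl(1) lm by (simp add: br_add_left)
    have "br (br x1 y) z = \<zero>" if z: "z \<in> m" for z
    proof -
      have "br x1 z \<in> m" using m_closed x12 z by blast
      then have "br x1 (br y z) = \<zero>" "br y (br x1 z) = \<zero>"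
        using yl z x12 lm by auto
      then show ?thesis using br_jacobi [of x1 y z] lm x12 yl z by simp
    qed
    then show "br x y \<in> I" using e l_closed x12 yl by (auto simp: I_def)
  qed
  moreover have "I \<subseteq> l" by (auto simp: I_def)
  ultimately have "I = {\<zero>}" using tila by (auto simp: tila_def)
  then show ?thesis using assms by (auto simp: I_def)
qed

end

context symmetric_pair begin

text \<open>Elements of l are compared with pairs through their action on m. The relation
  \<open>rep\<close> is linear, respects brackets and relates \<open>cur A a X Y\<close> to the
  bracket of \<open>u X\<close> and \<open>u Y\<close>. As l and \<open>lset A a\<close> are both
  spanned by such elements and both act faithfully, it is the graph of an isomorphism.\<close>

lemma canonical_exists:
  fixes T :: "'a qsh"
  assumes til: "tila (alg T) (invol T)" and bij: "bij_betw u UNIV (m_part T)"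
    and u_add: "\<And>X Y. u (X + Y) = u X \<oplus>\<^bsub>alg T\<^esub> u Y"
    and u_scale: "\<And>r X. u (r *\<^sub>R X) = r \<odot>\<^bsub>alg T\<^esub> u X"
    and triple: "\<And>X Y Z. lie (alg T) (lie (alg T) (u X) (u Y)) (u Z) = u (Rcur A a X Y Z)"
  shows "\<exists>\<kappa>. canonical A a T \<kappa> \<and> (\<forall>X. \<kappa> (0, X) = u X)"
proof -
  interpret R: real_tila "alg T" "invol T" by unfold_locales (rule til)
  let ?L = "alg T"
  have um: "u X \<in> R.m" for X using bij by (auto simp: bij_betw_def)
  note uc [simp] = R.lm(3) [OF um]
  have uE: "\<exists>X. y = u X" if "y \<in> R.m" for y using bij that by (auto simp: bij_betw_def)
  have u_inj: "u X = u Y \<longleftrightarrow> X = Y" for X Y using bij by (metis UNIV_I bij_betw_imp_inj_on inj_on_eq_iff)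
  have u0: "u 0 = \<zero>\<^bsub>?L\<^esub>" using u_scale [of 0 0] by simp
  have u_neg: "u (- X) = \<ominus>\<^bsub>?L\<^esub> u X" for X using u_scale [of "-1" X] by (simp add: R.neg_smult)
  define rep where "rep S \<xi> \<longleftrightarrow> \<xi> \<in> R.l \<and> (\<forall>Y. lie ?L \<xi> (u Y) = u (act S Y))" for S \<xi>
  have repl: "rep S \<xi> \<Longrightarrow> \<xi> \<in> R.l" "rep S \<xi> \<Longrightarrow> \<xi> \<in> carrier ?L" "rep S \<xi> \<Longrightarrow> lie ?L \<xi> (u Y) = u (act S Y)" for S \<xi> Y
    using R.lm(1) by (auto simp: rep_def)
  have rep_add: "rep (S + S') (\<xi> \<oplus>\<^bsub>?L\<^esub> \<xi>')" if "rep S \<xi>" "rep S' \<xi>'" for S S' \<xi> \<xi>'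
    using repl [OF that(1)] repl [OF that(2)] unfolding rep_def
    by (simp add: R.l_closed R.br_add_left act_linear u_add)
  have rep_scale: "rep (r *\<^sub>R S) (r \<odot>\<^bsub>?L\<^esub> \<xi>)" if "rep S \<xi>" for S \<xi> r
    using repl [OF that] unfolding rep_def
    by (simp add: R.l_closed R.br_smult_left act_linear u_scale)
  have rep_0: "rep 0 \<zero>\<^bsub>?L\<^esub>" by (simp add: rep_def R.l_closed act_linear u0)
  have rep_cur: "rep (cur A a X Y) (lie ?L (u X) (u Y))" for X Y
    by (simp add: rep_def R.m_closed um triple act_cur)
  have rep_br: "rep (pbr S S') (lie ?L \<xi> \<xi>')" if "rep S \<xi>" "rep S' \<xi>'" for S S' \<xi> \<xi>'
    using repl [OF that(1)] repl [OF that(2)] unfolding rep_def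
    by (simp add: R.l_closed R.br_jacobi act_pbr a_minus_def u_add [symmetric] u_neg [symmetric])
  have rep_uniq: "\<xi> = \<eta>" if "rep S \<xi>" "rep S \<eta>" for S \<xi> \<eta>
  proof -
    have "rep (S + (-1) *\<^sub>R S) (\<xi> \<oplus>\<^bsub>?L\<^esub> (-1) \<odot>\<^bsub>?L\<^esub> \<eta>)" by (intro rep_add rep_scale that)
    then have r: "rep 0 (\<xi> \<oplus>\<^bsub>?L\<^esub> \<ominus>\<^bsub>?L\<^esub> \<eta>)" using repl(2) [OF that(2)] by (simp add: R.neg_smult)
    have "\<xi> \<oplus>\<^bsub>?L\<^esub> \<ominus>\<^bsub>?L\<^esub> \<eta> = \<zero>\<^bsub>?L\<^esub>"
    proof (rule R.faithful [OF repl(1) [OF r]])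
      fix y assume "y \<in> R.m"
      then obtain Y where "y = u Y" using uE by blast
      then show "lie ?L (\<xi> \<oplus>\<^bsub>?L\<^esub> \<ominus>\<^bsub>?L\<^esub> \<eta>) y = \<zero>\<^bsub>?L\<^esub>" using repl(3) [OF r] by (simp add: act_linear u0)
    qed
    then show ?thesis using repl(2) [OF that(1)] repl(2) [OF that(2)]
      by (metis R.V.a_inv_closed R.V.minus_equality R.V.minus_minus R.V.a_comm)
  qed
  have rep_ex: "\<exists>\<xi>. rep S \<xi>" if "S \<in> lset A a" for S
  proof -
    have "Real_Vector_Spaces.subspace {S. \<exists>\<xi>. rep S \<xi>}"
      unfolding Real_Vector_Spaces.subspace_def
    proof (intro conjI ballI allI)
      show "0 \<in> {S. \<exists>\<xi>. rep S \<xi>}" using rep_0 by blast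
      fix x y r assume "x \<in> {S. \<exists>\<xi>. rep S \<xi>}"
      then obtain \<xi> where x: "rep x \<xi>" by blast
      show "r *\<^sub>R x \<in> {S. \<exists>\<xi>. rep S \<xi>}" using rep_scale [OF x] by blast
      assume "y \<in> {S. \<exists>\<xi>. rep S \<xi>}"
      then obtain \<eta> where y: "rep y \<eta>" by blast
      show "x + y \<in> {S. \<exists>\<xi>. rep S \<xi>}" using rep_add [OF x y] by blast
    qed
    moreover have "cur A a X Y \<in> {S. \<exists>\<xi>. rep S \<xi>}" for X Y using rep_cur by blast
    ultimately have "S \<in> {S. \<exists>\<xi>. rep S \<xi>}" using lset_induct [OF that] by blast
    then show ?thesis by simp
  qed
  have rep_surj: "\<exists>S\<in>lset A a. rep S \<xi>" if "\<xi> \<in> R.l" for \<xi>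
  proof -
    have "\<xi> \<in> {\<xi>. \<exists>S\<in>lset A a. rep S \<xi>}"
    proof (rule R.l_induct [OF that])
      fix x y assume "x \<in> R.m" "y \<in> R.m"
      then obtain X Y where "x = u X" "y = u Y" using uE by blast
      then show "lie ?L x y \<in> {\<xi>. \<exists>S\<in>lset A a. rep S \<xi>}" using rep_cur cur_lset by blast
    next
      show "LinearCombinations.submodule real_ring {\<xi>. \<exists>S\<in>lset A a. rep S \<xi>} ?L"
        unfolding LinearCombinations.submodule_def
      proof (intro conjI allI impI)
        show "module real_ring ?L" by unfold_locales
        show "{\<xi>. \<exists>S\<in>lset A a. rep S \<xi>} \<subseteq> carrier ?L" using repl by blast
        show "\<zero>\<^bsub>?L\<^esub> \<in> {\<xi>. \<exists>S\<in>lset A a. rep S \<xi>}" using rep_0 subspace_0 [OF subspace_lset] by blast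
      qed (use rep_add rep_scale subspace_add [OF subspace_lset] subspace_scale [OF subspace_lset] in blast)+
    qed
    then show ?thesis by simp
  qed
  have rep_inj: "S = S'" if "rep S \<xi>" "rep S' \<xi>" "S \<in> lset A a" "S' \<in> lset A a" for S S' \<xi>
  proof -
    have "u (act S X) = u (act S' X)" for X using repl(3) [OF that(1)] repl(3) [OF that(2)] by simp
    then have "act (S - S') X = 0" for X by (simp add: u_inj act_linear)
    moreover have "S - S' \<in> commutant A a"
      using subspace_diff [OF subspace_lset that(3,4)] lset_commutant by blast
    ultimately show ?thesis using act_inj by fastforce
  qed
  define g where "g S = (SOME \<xi>. rep S \<xi>)" for S
  have g: "rep S (g S)" if "S \<in> lset A a" for S unfolding g_def using rep_ex [OF that] by (rule someI_ex)
  have gI: "g S = \<xi>" if "rep S \<xi>" "S \<in> lset A a" for S \<xi> using rep_uniq g that by blast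
  note gl = repl(1) [OF g] repl(2) [OF g] repl(3) [OF g]
  note ls = subspace_add [OF subspace_lset, of _ A a] subspace_scale [OF subspace_lset, of _ A a]
    subspace_0 [OF subspace_lset, of A a]
  have g_add: "g (S + S') = g S \<oplus>\<^bsub>?L\<^esub> g S'" if "S \<in> lset A a" "S' \<in> lset A a" for S S'
    using that by (intro gI rep_add g ls)
  have g_scale: "g (r *\<^sub>R S) = r \<odot>\<^bsub>?L\<^esub> g S" if "S \<in> lset A a" for r S
    using that by (intro gI rep_scale g ls)
  have g_0: "g 0 = \<zero>\<^bsub>?L\<^esub>" by (intro gI rep_0 ls)
  have g_br: "lie ?L (g S) (g S') = g (pbr S S')" if "S \<in> lset A a" "S' \<in> lset A a" for S S'
    using that by (intro gI [symmetric] rep_br g pbr_lset)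
  have g_cur: "lie ?L (u X) (u Y) = g (cur A a X Y)" for X Y
    by (intro gI [symmetric] rep_cur cur_lset)
  define \<kappa> where "\<kappa> x = g (fst x) \<oplus>\<^bsub>?L\<^esub> u (snd x)" for x
  \<comment> \<open>Applying the involution reverses the m-component; adding the two equations
    recovers the l-component.\<close>
  have lm0: "\<xi> = \<xi>' \<and> y = y'" if "\<xi> \<oplus>\<^bsub>?L\<^esub> y = \<xi>' \<oplus>\<^bsub>?L\<^esub> y'" "\<xi> \<in> R.l" "\<xi>' \<in> R.l" "y \<in> R.m" "y' \<in> R.m" for \<xi> \<xi>' y y'
  proof -
    have c: "\<xi> \<in> carrier ?L" "\<xi>' \<in> carrier ?L" "y \<in> carrier ?L" "y' \<in> carrier ?L"
      using that R.lm by auto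
    have "invol T (\<xi> \<oplus>\<^bsub>?L\<^esub> y) = \<xi> \<oplus>\<^bsub>?L\<^esub> \<ominus>\<^bsub>?L\<^esub> y" "invol T (\<xi>' \<oplus>\<^bsub>?L\<^esub> y') = \<xi>' \<oplus>\<^bsub>?L\<^esub> \<ominus>\<^bsub>?L\<^esub> y'"
      using that(2-5) c by (simp_all add: R.\<sigma> R.lm)
    then have s: "\<xi> \<oplus>\<^bsub>?L\<^esub> \<ominus>\<^bsub>?L\<^esub> y = \<xi>' \<oplus>\<^bsub>?L\<^esub> \<ominus>\<^bsub>?L\<^esub> y'"
      using that(1) by metis
    have "(\<xi> \<oplus>\<^bsub>?L\<^esub> y) \<oplus>\<^bsub>?L\<^esub> (\<xi> \<oplus>\<^bsub>?L\<^esub> \<ominus>\<^bsub>?L\<^esub> y) = (\<xi>' \<oplus>\<^bsub>?L\<^esub> y') \<oplus>\<^bsub>?L\<^esub> (\<xi>' \<oplus>\<^bsub>?L\<^esub> \<ominus>\<^bsub>?L\<^esub> y')"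
      using that(1) s by simp
    moreover have "(p \<oplus>\<^bsub>?L\<^esub> q) \<oplus>\<^bsub>?L\<^esub> (p \<oplus>\<^bsub>?L\<^esub> \<ominus>\<^bsub>?L\<^esub> q) = 2 \<odot>\<^bsub>?L\<^esub> p" if "p \<in> carrier ?L" "q \<in> carrier ?L" for p q
      using that R.smult_add [of p 1 1] by (simp add: R.V.a_ac R.V.r_neg)
    ultimately have "2 \<odot>\<^bsub>?L\<^esub> \<xi> = 2 \<odot>\<^bsub>?L\<^esub> \<xi>'" using c by simp
    then have "(1/2) \<odot>\<^bsub>?L\<^esub> (2 \<odot>\<^bsub>?L\<^esub> \<xi>) = (1/2) \<odot>\<^bsub>?L\<^esub> (2 \<odot>\<^bsub>?L\<^esub> \<xi>')" by simp
    then have e: "\<xi> = \<xi>'" using c R.V.smult_assoc1 [of "1/2" 2 \<xi>] R.V.smult_assoc1 [of "1/2" 2 \<xi>'] by simp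
    then show ?thesis using that(1) c by simp
  qed
  have can: "canonical A a T \<kappa>"
    unfolding canonical_def chart_def
  proof (intro conjI ballI allI)
    show "Real_Vector_Spaces.subspace (gset A a)" by (rule subspace_gset)
    have in_c: "\<kappa> x \<in> carrier ?L" if "x \<in> gset A a" for x
      using that gl(2) [of "fst x"] by (simp add: \<kappa>_def gset_def mem_Times_iff)
    have inj: "inj_on \<kappa> (gset A a)"
    proof (rule inj_onI)
      fix x y assume x: "x \<in> gset A a" and y: "y \<in> gset A a" and eq: "\<kappa> x = \<kappa> y"
      have l: "fst x \<in> lset A a" "fst y \<in> lset A a" using x y by (auto simp: gset_def)
      have "g (fst x) = g (fst y) \<and> u (snd x) = u (snd y)"
        using lm0 [OF eq [unfolded \<kappa>_def] gl(1) [OF l(1)] gl(1) [OF l(2)] um um] .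
      then have e: "g (fst x) = g (fst y)" "snd x = snd y" by (auto simp: u_inj)
      have "fst x = fst y"
        by (rule rep_inj [OF g [OF l(1)] _ l]) (use g [OF l(2)] e in simp)
      then show "x = y" using e by (simp add: prod_eq_iff)
    qed
    have "carrier ?L \<subseteq> \<kappa> ` gset A a"
    proof
      fix z assume "z \<in> carrier ?L"
      then obtain \<xi> y where z: "\<xi> \<in> R.l" "y \<in> R.m" "z = \<xi> \<oplus>\<^bsub>?L\<^esub> y" using R.decompose by blast
      obtain S where S: "S \<in> lset A a" "rep S \<xi>" using rep_surj z by blast
      obtain Y where Y: "y = u Y" using uE z by blast
      have "z = \<kappa> (S, Y)" using z S Y gI by (simp add: \<kappa>_def)
      then show "z \<in> \<kappa> ` gset A a" using S by (auto simp: gset_def)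
    qed
    then show "bij_betw \<kappa> (gset A a) (carrier ?L)" using inj in_c by (auto simp: bij_betw_def)
    fix x assume x: "x \<in> gset A a"
    then have xl: "fst x \<in> lset A a" by (auto simp: gset_def)
    note gx = gl(2) [OF xl] gl(3) [OF xl]
    show "\<kappa> (r *\<^sub>R x) = r \<odot>\<^bsub>?L\<^esub> \<kappa> x" for r
      using gx by (simp add: \<kappa>_def g_scale [OF xl] u_scale R.V.smult_r_distr)
    fix y assume y: "y \<in> gset A a"
    then have yl: "fst y \<in> lset A a" by (auto simp: gset_def)
    note gy = gl(2) [OF yl] gl(3) [OF yl]
    show "\<kappa> (x + y) = \<kappa> x \<oplus>\<^bsub>?L\<^esub> \<kappa> y"
      using gx gy by (simp add: \<kappa>_def g_add [OF xl yl] u_add R.V.a_ac)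
    have sk: "lie ?L (u (snd x)) (g (fst y)) = u (- act (fst y) (snd x))"
      using R.br_skew [OF uc gy(1), of "snd x"] gy by (simp add: u_neg)
    have gp: "g (pbr (fst x) (fst y)) \<in> carrier ?L" "g (cur A a (snd x) (snd y)) \<in> carrier ?L"
      by (rule gl(2) pbr_lset xl yl cur_lset)+
    have "lie ?L (\<kappa> x) (\<kappa> y) = g (pbr (fst x) (fst y)) \<oplus>\<^bsub>?L\<^esub> u (act (fst x) (snd y))
       \<oplus>\<^bsub>?L\<^esub> (u (- act (fst y) (snd x)) \<oplus>\<^bsub>?L\<^esub> g (cur A a (snd x) (snd y)))"
      using gx gy gp unfolding \<kappa>_def
      by (simp add: R.br_add_left R.br_add_right g_br [OF xl yl] g_cur sk) (simp add: R.V.a_ac)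
    also have "\<dots> = (g (pbr (fst x) (fst y)) \<oplus>\<^bsub>?L\<^esub> g (cur A a (snd x) (snd y))) \<oplus>\<^bsub>?L\<^esub>
        (u (act (fst x) (snd y)) \<oplus>\<^bsub>?L\<^esub> u (- act (fst y) (snd x)))"
      using gp by (simp add: R.V.a_ac)
    also have "\<dots> = \<kappa> (brk A a x y)"
      unfolding u_add [symmetric] g_add [OF pbr_lset [OF xl yl] cur_lset, symmetric]
      by (simp add: \<kappa>_def brk_def)
    finally show "lie ?L (\<kappa> x) (\<kappa> y) = \<kappa> (brk A a x y)" .
  next
    show "\<kappa> 0 = \<zero>\<^bsub>?L\<^esub>" by (simp add: \<kappa>_def g_0 u0)
    fix S X assume S: "S \<in> lset A a"
    show "invol T (\<kappa> (S, X)) = \<kappa> (S, - X)"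
      using gl(1,2) [OF S] um [of X] by (simp add: \<kappa>_def R.\<sigma> R.lm u_neg)
  qed
  moreover have "\<kappa> (0, X) = u X" for X by (simp add: \<kappa>_def g_0)
  ultimately show ?thesis by blast
qed

text \<open>Both triples are charted by the same model, so one chart followed by the inverse of the
  other is an isomorphism. It takes frame to frame, and the frames determine Q and the form.\<close>

lemma iso_of_frames:
  fixes T1 :: "'a qsh" and T2 :: "'b qsh"
  assumes t1: "tila (alg T1) (invol T1)" and t2: "tila (alg T2) (invol T2)"
    and f1: "framed A a T1 u1" and f2: "framed A a T2 u2"
  shows "qsh_iso T1 T2"
proof -
  obtain \<kappa>1 where c1: "canonical A a T1 \<kappa>1" and k1: "\<And>X. \<kappa>1 (0, X) = u1 X"
    using canonical_exists [OF t1, of u1] f1 unfolding framed_def by blast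
  obtain \<kappa>2 where c2: "canonical A a T2 \<kappa>2" and k2: "\<And>X. \<kappa>2 (0, X) = u2 X"
    using canonical_exists [OF t2, of u2] f2 unfolding framed_def by blast
  let ?G = "gset A a"
  have ch1: "chart (alg T1) \<kappa>1 ?G" and ch2: "chart (alg T2) \<kappa>2 ?G" using c1 c2 by (auto simp: canonical_def)
  define \<phi> where "\<phi> z = \<kappa>2 (inv_into ?G \<kappa>1 z)" for z
  have inj1: "inj_on \<kappa>1 ?G" using chart_bij [OF ch1] by (simp add: bij_betw_def)
  have \<phi>: "\<phi> (\<kappa>1 x) = \<kappa>2 x" if "x \<in> ?G" for x using that inj1 by (simp add: \<phi>_def)
  have E1: "z \<in> carrier (alg T1) \<Longrightarrow> \<exists>x\<in>?G. z = \<kappa>1 x" for z using chart_carrier [OF ch1] by auto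
  note G = chart_G [OF ch1]
  have uG: "(0, X) \<in> ?G" for X using subspace_0 [OF subspace_lset] by (simp add: gset_def)
  have \<phi>u: "\<phi> (u1 X) = u2 X" for X using \<phi> [OF uG, of X] by (simp add: k1 k2)
  have bij: "bij_betw \<phi> (carrier (alg T1)) (carrier (alg T2))"
    unfolding \<phi>_def [abs_def]
    using bij_betw_trans [OF bij_betw_inv_into [OF chart_bij [OF ch1]] chart_bij [OF ch2]] by (simp add: o_def)
  have m1: "m_part T1 = range u1" and m2: "m_part T2 = range u2"
    using f1 f2 by (auto simp: framed_def bij_betw_def)
  have iso: "lie_iso (alg T1) (alg T2) \<phi>"
    unfolding lie_iso_def
  proof (intro conjI ballI)
    show "\<phi> \<in> module_hom real_ring (alg T1) (alg T2)"
    proof (rule module_hom_realI)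
      fix x y r assume "x \<in> carrier (alg T1)"
      then obtain x' where x: "x' \<in> ?G" "x = \<kappa>1 x'" using E1 by blast
      show "\<phi> x \<in> carrier (alg T2)" using x chart_in [OF ch2] by (simp add: \<phi>)
      show "\<phi> (r \<odot>\<^bsub>alg T1\<^esub> x) = r \<odot>\<^bsub>alg T2\<^esub> \<phi> x"
        using x by (simp add: \<phi> G flip: chart_scale [OF ch1] chart_scale [OF ch2])
      assume "y \<in> carrier (alg T1)"
      then obtain y' where y: "y' \<in> ?G" "y = \<kappa>1 y'" using E1 by blast
      show "\<phi> (x \<oplus>\<^bsub>alg T1\<^esub> y) = \<phi> x \<oplus>\<^bsub>alg T2\<^esub> \<phi> y"
        using x y by (simp add: \<phi> G flip: chart_add [OF ch1] chart_add [OF ch2])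
    qed
    show "bij_betw \<phi> (carrier (alg T1)) (carrier (alg T2))" by (rule bij)
    fix x y assume "x \<in> carrier (alg T1)" "y \<in> carrier (alg T1)"
    then obtain x' y' where x: "x' \<in> ?G" "x = \<kappa>1 x'" and y: "y' \<in> ?G" "y = \<kappa>1 y'" using E1 by metis
    show "\<phi> (lie (alg T1) x y) = lie (alg T2) (\<phi> x) (\<phi> y)"
      using x y c1 c2 brk_gset by (simp add: \<phi> canonical_def)
  qed
  have inv: "\<phi> (invol T1 z) = invol T2 (\<phi> z)" if z: "z \<in> carrier (alg T1)" for z
  proof -
    obtain x where "x \<in> ?G" "z = \<kappa>1 x" using E1 [OF z] by blast
    then obtain S X where S: "S \<in> lset A a" "z = \<kappa>1 (S, X)" by (auto simp: gset_def)
    then show ?thesis using c1 c2 \<phi> [of "(S, X)"] \<phi> [of "(S, - X)"] by (simp add: canonical_def gset_def)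
  qed
  have u1c: "u1 X \<in> carrier (alg T1)" for X using m1 by (auto simp: minus_space_def)
  have inv\<phi>: "inv_into (carrier (alg T1)) \<phi> (u2 X) = u1 X" for X
    using inv_into_f_f [OF bij_betw_imp_inj_on [OF bij] u1c, of X] by (simp add: \<phi>u)
  have inj2: "u2 X = u2 Y \<longleftrightarrow> X = Y" for X Y using f2 by (auto simp: framed_def bij_betw_def inj_eq)
  have injU: "u1 X = u1 Y \<longleftrightarrow> X = Y" for X Y using f1 by (auto simp: framed_def bij_betw_def inj_eq)
  have Q1: "qstr T1 = {J \<in> extensional (range u1). \<exists>q\<in>sp1. \<forall>X. J (u1 X) = u1 (X \<cdot> q)}"
    and Q2: "qstr T2 = {J \<in> extensional (range u2). \<exists>q\<in>sp1. \<forall>X. J (u2 X) = u2 (X \<cdot> q)}"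
    using f1 f2 m1 m2 by (simp_all add: framed_def)
  have Q: "{restrict (\<lambda>x. inv_into (carrier (alg T1)) \<phi> (J (\<phi> x))) (m_part T1) | J. J \<in> qstr T2} = qstr T1"
  proof (intro equalityI subsetI)
    fix K assume "K \<in> {restrict (\<lambda>x. inv_into (carrier (alg T1)) \<phi> (J (\<phi> x))) (m_part T1) | J. J \<in> qstr T2}"
    then obtain J where J: "J \<in> qstr T2" "K = restrict (\<lambda>x. inv_into (carrier (alg T1)) \<phi> (J (\<phi> x))) (m_part T1)"
      by blast
    then obtain q where q: "q \<in> sp1" "\<And>X. J (u2 X) = u2 (X \<cdot> q)" by (auto simp: Q2)
    have "K (u1 X) = u1 (X \<cdot> q)" for X by (simp add: J(2) m1 \<phi>u q inv\<phi>)
    then show "K \<in> qstr T1" using q by (auto simp: Q1 J(2) m1)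
  next
    fix K assume K: "K \<in> qstr T1"
    then obtain q where q: "q \<in> sp1" "\<And>X. K (u1 X) = u1 (X \<cdot> q)" and Ke: "K \<in> extensional (range u1)"
      by (auto simp: Q1)
    define J where "J = restrict (\<lambda>x. u2 (inv_into UNIV u2 x \<cdot> q)) (range u2)"
    have J: "J (u2 X) = u2 (X \<cdot> q)" for X
      using inv_into_f_f [of u2 UNIV X] by (simp add: J_def inj_def inj2)
    have "J \<in> qstr T2" using J q by (auto simp: Q2 J_def)
    moreover have "K = restrict (\<lambda>x. inv_into (carrier (alg T1)) \<phi> (J (\<phi> x))) (m_part T1)"
      by (rule extensionalityI [OF Ke]) (auto simp: m1 \<phi>u J inv\<phi> q)
    ultimately show "K \<in> {restrict (\<lambda>x. inv_into (carrier (alg T1)) \<phi> (J (\<phi> x))) (m_part T1) | J. J \<in> qstr T2}"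
      by blast
  qed
  have "form T2 (\<phi> x) (\<phi> y) = form T1 x y" if "x \<in> m_part T1" "y \<in> m_part T1" for x y
    using that f1 f2 by (auto simp: m1 \<phi>u framed_def)
  then show ?thesis unfolding qsh_iso_def using iso inv Q by blast
qed

end

lemma (in real_lie) br_derivation:
  assumes "x \<in> carrier L" "y \<in> carrier L" "z \<in> carrier L"
  shows "br x (br y z) = br (br x y) z \<oplus> br y (br x z)"
  using assms by (simp add: br_jacobi a_minus_def V.a_ac V.r_neg)

context real_tila begin

text \<open>m is the image of the projection \<open>(1 - \<sigma>) / 2\<close> of a
  finite-dimensional space.\<close>

lemma m_space: "vectorspace real_ring (L\<lparr>carrier := m\<rparr>)" "vectorspace.fin_dim real_ring (L\<lparr>carrier := m\<rparr>)"
proof -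
  have "VectorSpace.subspace real_ring m L"
    unfolding VectorSpace.subspace_def LinearCombinations.submodule_def
  proof (intro conjI allI impI)
    show "vectorspace real_ring L" "module real_ring L" by unfold_locales
  qed (auto simp: m_closed lm)
  then show vs: "vectorspace real_ring (L\<lparr>carrier := m\<rparr>)" by (rule V.subspace_is_vs)
  have sm: "r \<odot> (s \<odot> x) = (r * s) \<odot> x" if "x \<in> carrier L" for r s x
    using that V.smult_assoc1 [of r s x] by simp
  define pr where "pr z = (1/2) \<odot> z \<oplus> (-1/2) \<odot> \<sigma> z" for z
  have pr_m: "pr z \<in> m" if "z \<in> carrier L" for z
    using that by (simp add: pr_def minus_space_def \<sigma> neg_smult sm V.smult_r_distr V.a_comm)
  have hom: "pr \<in> module_hom real_ring L (L\<lparr>carrier := m\<rparr>)"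
  proof (rule module_hom_realI)
    fix x y r assume x: "x \<in> carrier L"
    show "pr x \<in> carrier (L\<lparr>carrier := m\<rparr>)" using x pr_m by simp
    show "pr (r \<odot> x) = r \<odot>\<^bsub>L\<lparr>carrier := m\<rparr>\<^esub> pr x"
      using x by (simp add: pr_def \<sigma> sm V.smult_r_distr mult.commute)
    assume y: "y \<in> carrier L"
    show "pr (x \<oplus> y) = pr x \<oplus>\<^bsub>L\<lparr>carrier := m\<rparr>\<^esub> pr y"
      using x y by (simp add: pr_def \<sigma> V.smult_r_distr V.a_ac)
  qed
  interpret M: vectorspace real_ring "L\<lparr>carrier := m\<rparr>" by (rule vs)
  interpret lin: linear_map real_ring L "L\<lparr>carrier := m\<rparr>" pr
    by unfold_locales (rule hom)
  have "pr x = x" if "x \<in> m" for x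
  proof -
    have "pr x = (1/2) \<odot> x \<oplus> (1/2) \<odot> x" using that by (simp add: pr_def lm neg_smult sm)
    also have "\<dots> = x" using that lm smult_add [of x "1/2" "1/2"] by simp
    finally show ?thesis .
  qed
  then have "x \<in> pr ` carrier L" if "x \<in> m" for x using lm(3) [OF that] that by (metis imageI)
  then have "pr ` carrier L = carrier (L\<lparr>carrier := m\<rparr>)" using pr_m by (simp add: image_subset_iff subsetI equalityI)
  then show "vectorspace.fin_dim real_ring (L\<lparr>carrier := m\<rparr>)"
    using lin.surj_fin_dim lie_algebra by (simp add: lie_algebra_def)
qed

end

context skew_form begin

text \<open>\<open>orthonormal_frame\<close> for the form on m and \<open>orthonormal_basis\<close>
  for \<open>h\<close> lead to the same normal form with value i on each basis vector; combining
  \<open>f\<close> with the inverse of \<open>P\<close> gives a frame for the prescribed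
  \<open>j\<close>. The curvature theorems then apply to the triple bracket.\<close>

theorem frame_exists:
  fixes T :: "'a qsh"
  assumes n: "CARD('n) > 1" and qsh: "qsh_tila T" and dim: "m_dim T = 4 * CARD('n)"
  shows "\<exists>u A a d. symmetric_pair j A a d \<and> framed A a T u"
proof -
  let ?L = "alg T"
  interpret R: real_tila ?L "invol T" by unfold_locales (use qsh in \<open>simp add: qsh_tila_def\<close>)
  obtain w :: "quat^'n \<Rightarrow> 'a" where w: "chart (?L\<lparr>carrier := R.m\<rparr>) w UNIV"
    using chart_exists [OF R.m_space, where 'v = "quat^'n"] dim by (auto simp: m_dim_def)
  have w_bij: "bij_betw w UNIV R.m" using chart_bij [OF w] by simp
  have w_in: "w x \<in> R.m" for x using w_bij by (auto simp: bij_betw_def)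
  have w_add: "w (x + y) = w x \<oplus>\<^bsub>?L\<^esub> w y" and w_scale: "w (r *\<^sub>R x) = r \<odot>\<^bsub>?L\<^esub> w x" for x y r
    using chart_add [OF w] chart_scale [OF w] by simp_all
  have w_inj: "w x = w y \<longleftrightarrow> x = y" for x y using chart_inj [OF w] by simp
  have w_neg: "w (- x) = \<ominus>\<^bsub>?L\<^esub> w x" for x using w_scale [of "-1" x] w_in by (simp add: R.neg_smult R.lm)
  define wi where "wi = inv_into UNIV w"
  have w_wi: "w (wi y) = y" if "y \<in> R.m" for y
    using that w_bij by (simp add: wi_def bij_betw_inv_into_right)
  obtain J1 J2 J3 where J_End: "J1 \<in> End_sub ?L R.m" "J2 \<in> End_sub ?L R.m" "J3 \<in> End_sub ?L R.m"
    and J_cpx: "complex_str ?L R.m J1" "complex_str ?L R.m J2"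
    and J12: "\<And>x. x \<in> R.m \<Longrightarrow> J1 (J2 x) = J3 x" "\<And>x. x \<in> R.m \<Longrightarrow> J3 x = \<ominus>\<^bsub>?L\<^esub> J2 (J1 x)"
    and Q: "qstr T = {lincomb3 ?L R.m J1 J2 J3 a b c | a b c. True}"
  proof -
    have "quaternionic_structure ?L R.m (qstr T)" using qsh by (simp add: qsh_tila_def)
    then show thesis
      unfolding quaternionic_structure_def by (elim bexE conjE) (rule that, assumption+, blast, blast, assumption)
  qed
  have End: "J x \<in> R.m" "J (x \<oplus>\<^bsub>?L\<^esub> y) = J x \<oplus>\<^bsub>?L\<^esub> J y" "J (r \<odot>\<^bsub>?L\<^esub> x) = r \<odot>\<^bsub>?L\<^esub> J x"
    if "J \<in> End_sub ?L R.m" "x \<in> R.m" "y \<in> R.m" for J x y r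
    using that by (auto simp: End_sub_def module_hom_def)
  have J_ext: "J \<in> extensional R.m" if "J \<in> End_sub ?L R.m" for J using that by (simp add: End_sub_def)
  define tr where "tr J x = wi (J (w x))" for J x
  have w_tr: "w (tr J x) = J (w x)" if "J \<in> End_sub ?L R.m" for J x
    using End(1) [OF that w_in w_in] by (simp add: tr_def w_wi)
  have tr_lin: "linear (tr J)" if "J \<in> End_sub ?L R.m" for J
    using End(2,3) [OF that w_in w_in]
    by (intro linearI) (simp_all add: w_tr [OF that] w_add w_scale flip: w_inj)
  have tr_sq: "tr J (tr J x) = - x" if "J \<in> End_sub ?L R.m" "complex_str ?L R.m J" for J x
    using that w_in by (simp add: w_tr w_neg complex_str_def flip: w_inj)
  have tr_12: "tr J1 (tr J2 x) = - tr J2 (tr J1 x)" for x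
    using J12 w_in by (simp add: w_tr J_End w_neg flip: w_inj)
  have lc: "lincomb3 ?L R.m J1 J2 J3 a b c x = a \<odot>\<^bsub>?L\<^esub> J1 x \<oplus>\<^bsub>?L\<^esub> b \<odot>\<^bsub>?L\<^esub> J2 x \<oplus>\<^bsub>?L\<^esub> c \<odot>\<^bsub>?L\<^esub> J3 x"
    if "x \<in> R.m" for a b c x using that by (simp add: lincomb3_def)
  have lc_ext: "lincomb3 ?L R.m J1 J2 J3 a b c \<in> extensional R.m" for a b c by (simp add: lincomb3_def)
  note Jc = R.lm(3) [OF End(1) [OF J_End(1)]] R.lm(3) [OF End(1) [OF J_End(2)]] R.lm(3) [OF End(1) [OF J_End(3)]]
  have "lincomb3 ?L R.m J1 J2 J3 1 0 0 = J1"
    by (rule extensionalityI [OF lc_ext J_ext [OF J_End(1)]]) (simp add: lc Jc)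
  then have J1Q: "J1 \<in> qstr T" unfolding Q by (metis (mono_tags, lifting) mem_Collect_eq)
  have "lincomb3 ?L R.m J1 J2 J3 0 1 0 = J2"
    by (rule extensionalityI [OF lc_ext J_ext [OF J_End(2)]]) (simp add: lc Jc)
  then have J2Q: "J2 \<in> qstr T" unfolding Q by (metis (mono_tags, lifting) mem_Collect_eq)
  \<comment> \<open>The factor \<open>- 1/2\<close> anticipates the normalisation
    \<open>- 2 Re h\<close> in \<open>framed\<close>.\<close>
  define \<omega> where "\<omega> x y = - form T (w x) (w y) / 2" for x y
  have form_add: "form T (x \<oplus>\<^bsub>?L\<^esub> y) z = form T x z + form T y z"
    if "x \<in> R.m" "y \<in> R.m" "z \<in> R.m" for x y z
    using qsh that unfolding qsh_tila_def symplectic_form_def by blast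
  have form_scale: "form T (r \<odot>\<^bsub>?L\<^esub> x) y = r * form T x y" and form_skew: "form T x y = - form T y x"
    if "x \<in> R.m" "y \<in> R.m" for x y r
    using qsh that unfolding qsh_tila_def symplectic_form_def by blast+
  have \<omega>_skew: "\<omega> x y = - \<omega> y x" for x y using form_skew [OF w_in w_in, of x y] by (simp add: \<omega>_def)
  have "linear (\<lambda>x. \<omega> x y)" for y
    using w_in by (intro linearI) (simp_all add: \<omega>_def w_add w_scale form_add form_scale add_divide_distrib)
  then have \<omega>_lin: "linear (\<omega> x)" for x
    unfolding \<omega>_skew [of x, abs_def] by (rule linear_compose_neg)
  have \<omega>_J: "\<omega> (tr J1 x) (tr J1 y) = \<omega> x y" "\<omega> (tr J2 x) (tr J2 y) = \<omega> x y" for x y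
    using qsh J1Q J2Q J_cpx w_in unfolding qsh_tila_def by (simp_all add: \<omega>_def w_tr J_End)
  have \<omega>_nd: "x = 0" if "\<And>y. \<omega> x y = 0" for x
  proof -
    have "form T (w x) y = 0" if "y \<in> R.m" for y
      using \<open>\<And>y. \<omega> x y = 0\<close> [of "wi y"] w_wi [OF that] by (simp add: \<omega>_def)
    then have "w x = \<zero>\<^bsub>?L\<^esub>" using qsh w_in unfolding qsh_tila_def symplectic_form_def by blast
    also have "\<dots> = w 0" using w_scale [of 0 0] w_in by (simp add: R.lm)
    finally show ?thesis by (simp add: w_inj)
  qed
  have "\<exists>f :: quat^'n \<Rightarrow> quat^'n. linear f \<and> bij f \<and> (\<forall>X. f (X \<cdot> qi) = tr J1 (f X)) \<and>
    (\<forall>X. f (X \<cdot> qj) = tr J2 (f X)) \<and> (\<forall>X Y. \<omega> (f X) (f Y) = qRe (\<Sum>m\<in>UNIV. qcnj (X $ m) * qi * Y $ m))"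
    by (rule orthonormal_frame)
      (rule tr_lin tr_sq J_End J_cpx tr_12 \<omega>_lin \<omega>_J \<omega>_skew \<omega>_nd | assumption)+
  then obtain f :: "quat^'n \<Rightarrow> quat^'n" where f: "linear f" "bij f" "\<And>X. f (X \<cdot> qi) = tr J1 (f X)" "\<And>X. f (X \<cdot> qj) = tr J2 (f X)"
    "\<And>X Y. \<omega> (f X) (f Y) = qRe (\<Sum>m\<in>UNIV. qcnj (X $ m) * qi * Y $ m)"
    by blast
  obtain P :: "quat^'n^'n" where P: "invertible P" "\<And>X Y. h (P *v X) (P *v Y) = (\<Sum>m\<in>UNIV. qcnj (X $ m) * qi * Y $ m)"
    using orthonormal_basis by blast
  define P' where "P' = matrix_inv P"
  have PP: "P *v (P' *v X) = X" "P' *v (P *v X) = X" for X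
    using matrix_inv_quat [OF P(1)] by (simp_all add: P'_def matrix_vector_mul_assoc)
  define u where "u X = w (f (P' *v X))" for X
  have u_add: "u (X + Y) = u X \<oplus>\<^bsub>?L\<^esub> u Y" and u_scale: "u (r *\<^sub>R X) = r \<odot>\<^bsub>?L\<^esub> u X" for X Y r
    by (simp_all add: u_def matrix_vector_right_distrib mv_scaleR linear_add [OF f(1)] linear_scale [OF f(1)] w_add w_scale)
  have um: "u X \<in> R.m" for X by (simp add: u_def w_in)
  note uc [simp] = R.lm(3) [OF um]
  have u_neg: "u (- X) = \<ominus>\<^bsub>?L\<^esub> u X" for X using u_scale [of "-1" X] by (simp add: R.neg_smult)
  have u_diff: "u (X - Y) = u X \<ominus>\<^bsub>?L\<^esub> u Y" for X Y
    using u_add [of X "- Y"] by (simp add: u_neg a_minus_def)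
  have u_bij: "bij_betw u UNIV R.m"
  proof -
    have "bij ((*v) P')" using PP by (intro o_bij [of "(*v) P"]) auto
    from bij_betw_trans [OF bij_betw_trans [OF this f(2)] w_bij] show ?thesis by (simp add: u_def [abs_def] o_def)
  qed
  then have u_inj: "u X = u Y \<longleftrightarrow> X = Y" for X Y by (auto simp: bij_betw_def inj_eq)
  have uE: "\<exists>X. y = u X" if "y \<in> R.m" for y using that u_bij by (auto simp: bij_betw_def)
  have u_i: "u (X \<cdot> qi) = J1 (u X)" and u_j: "u (X \<cdot> qj) = J2 (u X)" for X
    by (simp_all add: u_def mv_vscale f w_tr J_End)
  \<comment> \<open>\<open>J3 = J1 J2\<close> is right multiplication by j i = - k.\<close>
  have u_k: "u (X \<cdot> (- qk)) = J3 (u X)" for X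
    using J12(1) [OF um, of X] u_i [of "X \<cdot> qj"] by (simp add: vscale_assoc flip: u_j)
  have form_u: "form T (u X) (u Y) = - 2 * qRe (h X Y)" for X Y
    using f(5) [of "P' *v X" "P' *v Y"] unfolding P(2) [symmetric] PP by (simp add: \<omega>_def u_def)
  have lcu: "lincomb3 ?L R.m J1 J2 J3 a b c (u X) = u (X \<cdot> (a *\<^sub>R qi + b *\<^sub>R qj - c *\<^sub>R qk))" for a b c X
  proof -
    have "u (X \<cdot> (a *\<^sub>R qi + b *\<^sub>R qj - c *\<^sub>R qk)) = u (a *\<^sub>R (X \<cdot> qi) + b *\<^sub>R (X \<cdot> qj) + c *\<^sub>R (X \<cdot> (- qk)))"
      by (simp add: vscale_distrib vscale_scaleR)
    then show ?thesis by (simp only: u_add u_scale u_i u_j u_k lc um)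
  qed
  have Qu: "qstr T = {J \<in> extensional R.m. \<exists>q\<in>sp1. \<forall>X. J (u X) = u (X \<cdot> q)}"
  proof (intro equalityI subsetI)
    fix J assume "J \<in> qstr T"
    then obtain a b c where "J = lincomb3 ?L R.m J1 J2 J3 a b c" by (auto simp: Q)
    then show "J \<in> {J \<in> extensional R.m. \<exists>q\<in>sp1. \<forall>X. J (u X) = u (X \<cdot> q)}"
      using lcu lc_ext by (auto intro!: bexI [of _ "a *\<^sub>R qi + b *\<^sub>R qj - c *\<^sub>R qk"])
  next
    fix J assume "J \<in> {J \<in> extensional R.m. \<exists>q\<in>sp1. \<forall>X. J (u X) = u (X \<cdot> q)}"
    then obtain q where J: "J \<in> extensional R.m" "q \<in> sp1" "\<And>X. J (u X) = u (X \<cdot> q)" by blast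
    have q: "q = qI q *\<^sub>R qi + qJ q *\<^sub>R qj - (- qK q) *\<^sub>R qk" using J(2) by (simp add: quat_eq_iff sp1_def)
    have "J = lincomb3 ?L R.m J1 J2 J3 (qI q) (qJ q) (- qK q)"
    proof (rule extensionalityI [OF J(1) lc_ext])
      fix x assume "x \<in> R.m"
      then obtain X where "x = u X" using uE by blast
      then show "J x = lincomb3 ?L R.m J1 J2 J3 (qI q) (qJ q) (- qK q) x" using J(3) lcu q by simp
    qed
    then show "J \<in> qstr T" unfolding Q by blast
  qed
  have Jq: "\<exists>J\<in>qstr T. \<forall>X. J (u X) = u (X \<cdot> q)" if "q \<in> sp1" for q
    using lcu [of "qI q" "qJ q" "- qK q"] that unfolding Q
    by (intro bexI [of _ "lincomb3 ?L R.m J1 J2 J3 (qI q) (qJ q) (- qK q)"]) (auto simp: quat_eq_iff sp1_def intro!: arg_cong [of _ _ u] arg_cong [of _ _ "vscale _"])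
  have pair_ex: "\<exists>p. fst p \<in> so_star j \<and> snd p \<in> sp1 \<and> (\<forall>X. lie ?L \<xi> (u X) = u (bop (fst p) (snd p) X))"
    if \<xi>: "\<xi> \<in> R.l" for \<xi>
  proof -
    note \<xi>c [simp] = R.lm(1) [OF \<xi>]
    have "\<exists>Y. lie ?L \<xi> (u X) = u Y" for X by (rule uE) (rule R.m_closed(5) [OF \<xi> um])
    then obtain D where D: "\<And>X. lie ?L \<xi> (u X) = u (D X)" by metis
    have "linear D"
      by (intro linearI)
        (simp_all add: D [symmetric] u_add u_scale R.br_add_right R.br_smult_right flip: u_inj)
    moreover have "\<exists>p\<in>sp1. \<forall>X. D (X \<cdot> q) - D X \<cdot> q = X \<cdot> p" if q: "q \<in> sp1" for q
    proof -
      obtain J where J: "J \<in> qstr T" "\<And>X. J (u X) = u (X \<cdot> q)" using Jq [OF q] by blast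
      have "restrict (\<lambda>x. lie ?L \<xi> (J x) \<ominus>\<^bsub>?L\<^esub> J (lie ?L \<xi> x)) R.m \<in> qstr T"
        using qsh \<xi> J(1) unfolding qsh_tila_def by blast
      then obtain p where p: "p \<in> sp1" "\<And>X. restrict (\<lambda>x. lie ?L \<xi> (J x) \<ominus>\<^bsub>?L\<^esub> J (lie ?L \<xi> x)) R.m (u X) = u (X \<cdot> p)"
        unfolding Qu by blast
      have "D (X \<cdot> q) - D X \<cdot> q = X \<cdot> p" for X
        using p(2) [of X] um by (simp add: J(2) D u_inj flip: u_diff)
      then show ?thesis using p(1) by blast
    qed
    moreover have "qRe (h (D X) Y) + qRe (h X (D Y)) = 0" for X Y
    proof -
      have "form T (lie ?L \<xi> (u X)) (u Y) + form T (u X) (lie ?L \<xi> (u Y)) = 0"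
        using qsh \<xi> um unfolding qsh_tila_def by blast
      then show ?thesis by (simp add: D form_u)
    qed
    ultimately obtain A a where "A \<in> so_star j" "a \<in> sp1" "\<And>X. D X = bop A a X"
      using derivation_pair [of D] by blast
    then show ?thesis using D by (intro exI [of _ "(A, a)"]) simp
  qed
  \<comment> \<open>The pair is chosen separately for each \<open>X\<close> and \<open>Y\<close>;
    bilinearity and skewness follow from its uniqueness (\<open>pair_eqI\<close>).\<close>
  define p where "p X Y = (SOME p. fst p \<in> so_star j \<and> snd p \<in> sp1 \<and>
    (\<forall>Z. lie ?L (lie ?L (u X) (u Y)) (u Z) = u (bop (fst p) (snd p) Z)))" for X Y
  have p: "fst (p X Y) \<in> so_star j \<and> snd (p X Y) \<in> sp1 \<and>
    (\<forall>Z. lie ?L (lie ?L (u X) (u Y)) (u Z) = u (bop (fst (p X Y)) (snd (p X Y)) Z))" for X Y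
    unfolding p_def by (rule someI_ex) (rule pair_ex [OF R.m_closed(4) [OF um um]])
  define A where "A X Y = fst (p X Y)" for X Y
  define a where "a X Y = snd (p X Y)" for X Y
  have A_so: "A X Y \<in> so_star j" and a_sp: "a X Y \<in> sp1" for X Y using p by (simp_all add: A_def a_def)
  have Aa: "u (bop (A X Y) (a X Y) Z) = lie ?L (lie ?L (u X) (u Y)) (u Z)" for X Y Z
    using p by (simp add: A_def a_def)
  have bop_lin: "bop (M + N) (r + s) Z = bop M r Z + bop N s Z" "bop (- M) (- r) Z = - bop M r Z"
    "bop (t *\<^sub>R M) (t *\<^sub>R r) Z = t *\<^sub>R bop M r Z" for M N r s t Z
    by (simp_all add: bop_def vscale_distrib matrix_vector_mult_add_rdistrib scaleR_mv vscale_scaleR scaleR_diff_right)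
  have skew: "A X Y = - A Y X \<and> a X Y = - a Y X" for X Y
  proof (rule pair_eqI)
    fix Z
    show "bop (A X Y) (a X Y) Z = bop (- A Y X) (- a Y X) Z"
      unfolding u_inj [symmetric] bop_lin u_neg Aa
      by (subst R.br_skew [of "u X"]) (simp_all add: R.br_neg)
  qed (simp_all add: a_sp)
  have add: "A (X + Y) Z = A X Z + A Y Z \<and> a (X + Y) Z = a X Z + a Y Z" for X Y Z
  proof (rule pair_eqI)
    fix U
    show "bop (A (X + Y) Z) (a (X + Y) Z) U = bop (A X Z + A Y Z) (a X Z + a Y Z) U"
      unfolding u_inj [symmetric] bop_lin u_add Aa by (simp add: R.br_add_left)
  qed (simp_all add: a_sp)
  have scl: "A (r *\<^sub>R X) Y = r *\<^sub>R A X Y \<and> a (r *\<^sub>R X) Y = r *\<^sub>R a X Y" for r X Y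
  proof (rule pair_eqI)
    fix U
    show "bop (A (r *\<^sub>R X) Y) (a (r *\<^sub>R X) Y) U = bop (r *\<^sub>R A X Y) (r *\<^sub>R a X Y) U"
      unfolding u_inj [symmetric] bop_lin u_scale Aa by (simp add: R.br_smult_left)
  qed (simp_all add: a_sp)
  have bianchi: "A X Y *v Z + A Y Z *v X + A Z X *v Y = Z \<cdot> a X Y + X \<cdot> a Y Z + Y \<cdot> a Z X" for X Y Z
  proof -
    have "lie ?L (lie ?L (u X) (u Y)) (u Z) \<oplus>\<^bsub>?L\<^esub> lie ?L (lie ?L (u Y) (u Z)) (u X)
        \<oplus>\<^bsub>?L\<^esub> lie ?L (lie ?L (u Z) (u X)) (u Y)
      = \<ominus>\<^bsub>?L\<^esub> (lie ?L (u X) (lie ?L (u Y) (u Z)) \<oplus>\<^bsub>?L\<^esub> lie ?L (u Y) (lie ?L (u Z) (u X)) \<oplus>\<^bsub>?L\<^esub> lie ?L (u Z) (lie ?L (u X) (u Y)))"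
      by (simp add: R.br_skew [of "lie ?L _ _" "u _"] R.V.minus_add R.V.a_ac)
    also have "\<dots> = u 0" using R.br_jacobi0 [of "u X" "u Y" "u Z"] u_scale [of 0 0] by simp
    finally have "bop (A X Y) (a X Y) Z + bop (A Y Z) (a Y Z) X + bop (A Z X) (a Z X) Y = 0"
      unfolding Aa [symmetric] u_add [symmetric] u_inj .
    then show ?thesis by (simp add: bop_def algebra_simps)
  qed
  interpret C: curvature j A a
    by unfold_locales (use A_so a_sp skew add scl bianchi in blast)+
  obtain B b where B: "B \<in> so_star j" "b \<in> sp1" "\<And>X Y. A X Y = Acur B b X Y \<and> a X Y = acur B b X Y"
    using C.curvature_classification [OF n] by blast
  have triple: "lie ?L (lie ?L (u X) (u Y)) (u Z) = u (Rcur B b X Y Z)" for X Y Z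
    using Aa [of X Y Z] B(3) [of X Y] by (simp add: Rcur_def)
  \<comment> \<open>By the Jacobi identity the bracket of \<open>u U\<close> and \<open>u V\<close>
    acts on the triple bracket as a derivation.\<close>
  have "Rcur B b U V (Rcur B b X Y Z) - Rcur B b X Y (Rcur B b U V Z)
      = Rcur B b (Rcur B b U V X) Y Z + Rcur B b X (Rcur B b U V Y) Z" for U V X Y Z
  proof -
    let ?\<xi> = "lie ?L (u U) (u V)"
    have "lie ?L (lie ?L ?\<xi> (lie ?L (u X) (u Y))) (u Z) = lie ?L ?\<xi> (lie ?L (lie ?L (u X) (u Y)) (u Z))
        \<ominus>\<^bsub>?L\<^esub> lie ?L (lie ?L (u X) (u Y)) (lie ?L ?\<xi> (u Z))"
      by (rule R.br_jacobi) simp_all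
    moreover have "lie ?L ?\<xi> (lie ?L (u X) (u Y)) = lie ?L (lie ?L ?\<xi> (u X)) (u Y) \<oplus>\<^bsub>?L\<^esub> lie ?L (u X) (lie ?L ?\<xi> (u Y))"
      by (rule R.br_derivation) simp_all
    ultimately show ?thesis
      unfolding u_inj [symmetric] u_diff u_add triple [symmetric] by (simp add: R.br_add_left)
  qed
  then obtain d where "\<And>X. bop B b (bop B b X) = d *\<^sub>R X" using invariant_curvature [OF n B(1,2)] by blast
  then have "symmetric_pair j B b d" by unfold_locales (use B in auto)
  moreover have "framed B b T u"
    unfolding framed_def using u_bij u_add u_scale Qu form_u triple by simp
  ultimately show ?thesis by blast
qed

end

section \<open>Change of frame\<close>

context skew_form begin

text \<open>Counterpart of \<open>iso_of_frames\<close>: possession of a frame for a given pair is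
  an isomorphism invariant.\<close>

lemma frame_pullback:
  fixes T1 :: "'a qsh" and T2 :: "'b qsh"
  assumes t1: "tila (alg T1) (invol T1)" and t2: "tila (alg T2) (invol T2)"
    and iso: "qsh_iso T1 T2" and fr: "framed A a T2 u"
  shows "\<exists>u. framed A a T1 u"
proof -
  let ?L1 = "alg T1" and ?L2 = "alg T2"
  interpret R1: real_tila ?L1 "invol T1" by unfold_locales (rule t1)
  interpret R2: real_tila ?L2 "invol T2" by unfold_locales (rule t2)
  obtain \<phi> where lie: "lie_iso ?L1 ?L2 \<phi>" and inv: "\<And>x. x \<in> carrier ?L1 \<Longrightarrow> \<phi> (invol T1 x) = invol T2 (\<phi> x)"
    and Q: "{restrict (\<lambda>x. inv_into (carrier ?L1) \<phi> (J (\<phi> x))) R1.m | J. J \<in> qstr T2} = qstr T1"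
    and form: "\<And>x y. x \<in> R1.m \<Longrightarrow> y \<in> R1.m \<Longrightarrow> form T2 (\<phi> x) (\<phi> y) = form T1 x y"
    using iso unfolding qsh_iso_def by (elim exE conjE) (rule that, assumption, drule bspec, assumption+, blast)
  have hom: "\<phi> \<in> module_hom real_ring ?L1 ?L2" and bij: "bij_betw \<phi> (carrier ?L1) (carrier ?L2)"
    and \<phi>br: "\<And>x y. x \<in> carrier ?L1 \<Longrightarrow> y \<in> carrier ?L1 \<Longrightarrow> \<phi> (lie ?L1 x y) = lie ?L2 (\<phi> x) (\<phi> y)"
    using lie by (auto simp: lie_iso_def)
  have \<phi>: "\<phi> x \<in> carrier ?L2" "\<phi> (x \<oplus>\<^bsub>?L1\<^esub> y) = \<phi> x \<oplus>\<^bsub>?L2\<^esub> \<phi> y" "\<phi> (r \<odot>\<^bsub>?L1\<^esub> x) = r \<odot>\<^bsub>?L2\<^esub> \<phi> x"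
    if "x \<in> carrier ?L1" "y \<in> carrier ?L1" for x y r
    using that hom by (auto simp: module_hom_def)
  have \<phi>c: "\<phi> x \<in> carrier ?L2" if "x \<in> carrier ?L1" for x using \<phi>(1) that by blast
  have \<phi>neg: "\<phi> (\<ominus>\<^bsub>?L1\<^esub> x) = \<ominus>\<^bsub>?L2\<^esub> \<phi> x" if "x \<in> carrier ?L1" for x
    using that \<phi>(3) [of x x "-1"] by (simp add: R1.neg_smult R2.neg_smult \<phi>c)
  have \<phi>inj: "\<phi> x = \<phi> y \<longleftrightarrow> x = y" if "x \<in> carrier ?L1" "y \<in> carrier ?L1" for x y
    using bij that by (auto simp: bij_betw_def inj_on_eq_iff)
  define \<psi> where "\<psi> = inv_into (carrier ?L1) \<phi>"
  have \<psi>: "\<psi> y \<in> carrier ?L1" "\<phi> (\<psi> y) = y" if "y \<in> carrier ?L2" for y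
    using bij that by (auto simp: \<psi>_def bij_betw_def inv_into_into f_inv_into_f)
  have \<psi>\<phi>: "\<psi> (\<phi> x) = x" if "x \<in> carrier ?L1" for x
    using bij that by (simp add: \<psi>_def bij_betw_def)
  have \<phi>m: "\<phi> x \<in> R2.m \<longleftrightarrow> x \<in> R1.m" if "x \<in> carrier ?L1" for x
  proof -
    have "\<phi> x \<in> R2.m \<longleftrightarrow> \<phi> (invol T1 x) = \<phi> (\<ominus>\<^bsub>?L1\<^esub> x)"
      using that by (simp add: minus_space_def \<phi>c inv \<phi>neg)
    also have "\<dots> \<longleftrightarrow> x \<in> R1.m" using that by (subst \<phi>inj) (simp_all add: minus_space_def R1.\<sigma>)
    finally show ?thesis .
  qed
  have u_add: "u (X + Y) = u X \<oplus>\<^bsub>?L2\<^esub> u Y" and u_scale: "u (r *\<^sub>R X) = r \<odot>\<^bsub>?L2\<^esub> u X"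
    and u_form: "form T2 (u X) (u Y) = - 2 * qRe (h X Y)"
    and u_br: "lie ?L2 (lie ?L2 (u X) (u Y)) (u Z) = u (Rcur A a X Y Z)"
    and u_bij: "bij_betw u UNIV R2.m"
    and Q2: "qstr T2 = {J \<in> extensional R2.m. \<exists>q\<in>sp1. \<forall>X. J (u X) = u (X \<cdot> q)}" for X Y Z r
    using fr by (simp_all add: framed_def)
  have um: "u X \<in> R2.m" and uE: "y \<in> R2.m \<Longrightarrow> \<exists>X. y = u X" for X y
    using u_bij by (auto simp: bij_betw_def)
  note uc [simp] = R2.lm(3) [OF um]
  have u_inj: "u X = u Y \<longleftrightarrow> X = Y" for X Y using u_bij by (auto simp: bij_betw_def inj_eq)
  define v where "v X = \<psi> (u X)" for X
  have v: "v X \<in> carrier ?L1" "\<phi> (v X) = u X" for X by (simp_all add: v_def \<psi>)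
  have vm: "v X \<in> R1.m" for X using \<phi>m [OF v(1), of X] um by (simp add: v)
  have vE: "\<exists>X. x = v X" if "x \<in> R1.m" for x
  proof -
    have "\<phi> x \<in> R2.m" using that \<phi>m R1.lm by blast
    then obtain X where "\<phi> x = u X" using uE by blast
    then show ?thesis using \<psi>\<phi> [OF R1.lm(3) [OF that]] by (auto simp: v_def)
  qed
  have veqI: "x = y" if "\<phi> x = \<phi> y" "x \<in> carrier ?L1" "y \<in> carrier ?L1" for x y using that \<phi>inj by blast
  have "framed A a T1 v"
    unfolding framed_def
  proof (intro conjI allI)
    have "inj v" by (rule injI) (metis u_inj v(2))
    then show v_bij: "bij_betw v UNIV R1.m" using vm vE by (auto simp: bij_betw_def intro: rangeI dest!: vE)
    fix X Y Z r
    show "v (X + Y) = v X \<oplus>\<^bsub>?L1\<^esub> v Y" by (rule veqI) (simp_all add: v \<phi> u_add)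
    show "v (r *\<^sub>R X) = r \<odot>\<^bsub>?L1\<^esub> v X" by (rule veqI) (simp_all add: v \<phi>(3) [OF v(1) v(1)] u_scale)
    show "form T1 (v X) (v Y) = - 2 * qRe (h X Y)" using form [OF vm vm] u_form by (simp add: v)
    show "lie ?L1 (lie ?L1 (v X) (v Y)) (v Z) = v (Rcur A a X Y Z)"
      by (rule veqI) (simp_all add: v \<phi>br u_br)
    show "qstr T1 = {J \<in> extensional R1.m. \<exists>q\<in>sp1. \<forall>X. J (v X) = v (X \<cdot> q)}"
    proof (intro equalityI subsetI)
      fix K assume "K \<in> qstr T1"
      then obtain J where J: "J \<in> qstr T2" "K = restrict (\<lambda>x. \<psi> (J (\<phi> x))) R1.m"
        unfolding Q [symmetric] \<psi>_def by blast
      then obtain q where q: "q \<in> sp1" "\<And>X. J (u X) = u (X \<cdot> q)" by (auto simp: Q2)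
      have "K (v X) = v (X \<cdot> q)" for X using vm by (simp add: J(2) v q) (simp add: v_def)
      then show "K \<in> {J \<in> extensional R1.m. \<exists>q\<in>sp1. \<forall>X. J (v X) = v (X \<cdot> q)}" using q by (auto simp: J(2))
    next
      fix K assume "K \<in> {J \<in> extensional R1.m. \<exists>q\<in>sp1. \<forall>X. J (v X) = v (X \<cdot> q)}"
      then obtain q where K: "K \<in> extensional R1.m" and q: "q \<in> sp1" "\<And>X. K (v X) = v (X \<cdot> q)" by blast
      define J where "J = restrict (\<lambda>x. u (inv_into UNIV u x \<cdot> q)) R2.m"
      have J: "J (u X) = u (X \<cdot> q)" for X
        using inv_into_f_f [of u UNIV X] um by (simp add: J_def inj_def u_inj)
      have "J \<in> qstr T2" using J q by (auto simp: Q2 J_def)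
      moreover have "K = restrict (\<lambda>x. \<psi> (J (\<phi> x))) R1.m"
      proof (rule extensionalityI [OF K])
        fix x assume "x \<in> R1.m"
        then obtain X where "x = v X" using vE by blast
        then show "K x = restrict (\<lambda>x. \<psi> (J (\<phi> x))) R1.m x" using vm by (simp add: q v J) (simp add: v_def)
      qed simp
      ultimately show "K \<in> qstr T1" unfolding Q [symmetric] \<psi>_def by blast
    qed
  qed
  then show ?thesis by blast
qed

text \<open>Membership in the group SO*(2n) of \<open>h\<close>. Nondegeneracy supplies inverses
  (\<open>isometry_inv\<close>).\<close>

definition isometry :: "quat^'n^'n \<Rightarrow> bool" where
  "isometry g \<longleftrightarrow> (\<forall>X Y. h (g *v X) (g *v Y) = h X Y)"

lemma isometry_inv:
  assumes "isometry g"
  obtains g' where "\<And>X. g *v (g' *v X) = X" "\<And>X. g' *v (g *v X) = X" "isometry g'"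
proof -
  have "X = 0" if "g *v X = 0" for X
  proof (rule h_nondeg)
    show "h X Y = 0" for Y using assms that by (metis isometry_def hf_0(1))
  qed
  then have "invertible g" by (simp add: invertible_iff_inj)
  note i = matrix_inv_quat [OF this]
  have g: "g *v (matrix_inv g *v X) = X" "matrix_inv g *v (g *v X) = X" for X
    by (simp_all add: matrix_vector_mul_assoc i)
  moreover have "isometry (matrix_inv g)"
    unfolding isometry_def using assms g by (metis isometry_def)
  ultimately show thesis by (rule that)
qed

lemma Re_conj: fixes p :: quat assumes "norm p = 1" shows "qRe (p * q * qcnj p) = qRe q"
proof -
  have "qRe (p * q * qcnj p) = qRe (qcnj p * (p * q))" by (simp add: quat_mult_sel)
  then show ?thesis by (simp add: unit_cancel assms)
qed

context
  fixes g A1 A2 :: "quat^'n^'n" and p a1 a2 :: quat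
  assumes g: "isometry g" and p: "norm p = 1" and A: "A1 ** g = g ** A2" and a: "a1 * p = p * a2"
begin

lemma bop_isometry: "bop A1 a1 ((g *v X) \<cdot> qcnj p) = (g *v bop A2 a2 X) \<cdot> qcnj p"
proof -
  have "qcnj p * a1 = qcnj p * (a1 * p) * qcnj p" by (simp add: mult.assoc unit_cancel p)
  also have "\<dots> = a2 * qcnj p" by (simp add: a unit_cancel p)
  finally have "qcnj p * a1 = a2 * qcnj p" .
  moreover have "A1 *v (g *v X) = g *v (A2 *v X)" using A by (simp add: matrix_vector_mul_assoc)
  ultimately show ?thesis
    by (simp add: bop_def mv_vscale vscale_assoc vscale_distrib matrix_vector_mult_diff_distrib)
qed

lemma h_isometry: "h ((g *v X) \<cdot> qcnj p) ((g *v Y) \<cdot> qcnj p) = p * h X Y * qcnj p"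
  using g by (simp add: hf_scale isometry_def mult.assoc)

text \<open>The map \<open>X \<mapsto> g X p^(-1)\<close> carries \<open>bop A2 a2\<close> to
  \<open>bop A1 a1\<close> and conjugates the values of \<open>h\<close> by \<open>p\<close>. The
  curvature is built from these data.\<close>

lemma Rcur_isometry:
  "Rcur A1 a1 ((g *v X) \<cdot> qcnj p) ((g *v Y) \<cdot> qcnj p) ((g *v Z) \<cdot> qcnj p) = (g *v Rcur A2 a2 X Y Z) \<cdot> qcnj p"
proof -
  have c: "(g *v X) \<cdot> qcnj p \<cdot> (p * q * qcnj p) = (g *v (X \<cdot> q)) \<cdot> qcnj p" for X q
    by (simp add: vscale_assoc mv_vscale mult.assoc unit_cancel p)
  have Re: "qRe (p * q * qcnj p) = qRe q" for q by (rule Re_conj [OF p])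
  have A12: "A1 *v ((g *v Z) \<cdot> qcnj p) = (g *v (A2 *v Z)) \<cdot> qcnj p"
    using A by (simp add: matrix_vector_mul_assoc mv_vscale)
  have 1: "Acur A1 a1 ((g *v X) \<cdot> qcnj p) ((g *v Y) \<cdot> qcnj p) *v ((g *v Z) \<cdot> qcnj p) = (g *v (Acur A2 a2 X Y *v Z)) \<cdot> qcnj p"
    unfolding Acur_mv bop_isometry h_isometry c Re A12
    by (simp add: vscale_distrib matrix_vector_right_distrib matrix_vector_mult_diff_distrib mv_scaleR vscale_scaleR)
  have "a1 = p * a2 * qcnj p" using a by (metis mult.assoc mult.right_neutral unit_cancel(2) [OF p])
  then have 2: "acur A1 a1 ((g *v X) \<cdot> qcnj p) ((g *v Y) \<cdot> qcnj p) = p * acur A2 a2 X Y * qcnj p"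
    unfolding acur_def bop_isometry h_isometry Re by (simp add: algebra_simps)
  show ?thesis unfolding Rcur_def bop_def [of "Acur A1 a1 _ _"] 1 2 c
    by (simp add: bop_def vscale_distrib matrix_vector_mult_diff_distrib)
qed

lemma frame_isometry:
  assumes fr: "framed A1 a1 T u" shows "framed A2 a2 T (\<lambda>X. u ((g *v X) \<cdot> qcnj p))"
proof -
  obtain g' where g': "\<And>X. g *v (g' *v X) = X" "\<And>X. g' *v (g *v X) = X" using isometry_inv [OF g] by metis
  have "bij (\<lambda>X. (g *v X) \<cdot> qcnj p)"
    by (rule o_bij [of "\<lambda>X. g' *v (X \<cdot> p)"]) (auto simp: fun_eq_iff g' vscale_assoc unit_cancel p)
  moreover have "bij_betw u UNIV (m_part T)" using fr by (simp add: framed_def)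
  ultimately have bij: "bij_betw (\<lambda>X. u ((g *v X) \<cdot> qcnj p)) UNIV (m_part T)"
    using bij_betw_trans [of "\<lambda>X. (g *v X) \<cdot> qcnj p" UNIV UNIV u] by (simp add: o_def)
  have hRe: "qRe (h ((g *v X) \<cdot> qcnj p) ((g *v Y) \<cdot> qcnj p)) = qRe (h X Y)" for X Y
    by (simp only: h_isometry Re_conj [OF p])
  have sp: "r * q * qcnj r \<in> sp1" if "q \<in> sp1" for r q :: quat
    using that by (simp add: sp1_cnj qcnj_mult mult.assoc)
  have "(\<exists>q\<in>sp1. \<forall>X. J (u X) = u (X \<cdot> q)) \<longleftrightarrow>
      (\<exists>q\<in>sp1. \<forall>X. J (u ((g *v X) \<cdot> qcnj p)) = u ((g *v (X \<cdot> q)) \<cdot> qcnj p))" for J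
  proof
    assume "\<exists>q\<in>sp1. \<forall>X. J (u X) = u (X \<cdot> q)"
    then obtain q where q: "q \<in> sp1" "\<And>X. J (u X) = u (X \<cdot> q)" by blast
    then show "\<exists>q\<in>sp1. \<forall>X. J (u ((g *v X) \<cdot> qcnj p)) = u ((g *v (X \<cdot> q)) \<cdot> qcnj p)"
      using sp [of q "qcnj p"]
      by (intro bexI [of _ "qcnj p * q * p"]) (simp_all add: mv_vscale vscale_assoc mult.assoc unit_cancel p)
  next
    assume "\<exists>q\<in>sp1. \<forall>X. J (u ((g *v X) \<cdot> qcnj p)) = u ((g *v (X \<cdot> q)) \<cdot> qcnj p)"
    then obtain q where q: "q \<in> sp1" "\<And>X. J (u ((g *v X) \<cdot> qcnj p)) = u ((g *v (X \<cdot> q)) \<cdot> qcnj p)" by blast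
    have "J (u X) = u (X \<cdot> (p * q * qcnj p))" for X
      using q(2) [of "(g' *v X) \<cdot> p"] by (simp add: mv_vscale vscale_assoc g' unit_cancel p mult.assoc)
    then show "\<exists>q\<in>sp1. \<forall>X. J (u X) = u (X \<cdot> q)" using sp q(1) by blast
  qed
  then show ?thesis
    using fr bij hRe unfolding framed_def Rcur_isometry [symmetric]
    by (simp add: matrix_vector_right_distrib vscale_distrib mv_scaleR vscale_scaleR)
qed

end

lemma bop_scaleR: "bop (r *\<^sub>R A) (r *\<^sub>R a) X = r *\<^sub>R bop A a X"
  by (simp add: bop_def scaleR_mv vscale_scaleR scaleR_diff_right)

text \<open>\<open>Rcur\<close> is cubic in the vectors and linear in the pair. With
  \<open>u (t X)\<close> as the new frame, one of the three factors \<open>t\<close> belongs to the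
  frame and the other two move to the pair.\<close>

lemma frame_scale:
  assumes fr: "framed A a T u" and t: "t > 0"
  shows "framed (t\<^sup>2 *\<^sub>R A) (t\<^sup>2 *\<^sub>R a) (T\<lparr>form := \<lambda>x y. form T x y / t\<^sup>2\<rparr>) (\<lambda>X. u (t *\<^sub>R X))"
proof -
  have "bij (\<lambda>X :: quat^'n. t *\<^sub>R X)"
    by (rule o_bij [of "\<lambda>X. (1/t) *\<^sub>R X"]) (use t in \<open>auto simp: fun_eq_iff\<close>)
  moreover have "bij_betw u UNIV (m_part T)" using fr by (simp add: framed_def)
  ultimately have bij: "bij_betw (\<lambda>X. u (t *\<^sub>R X)) UNIV (m_part T)"
    using bij_betw_trans [of "\<lambda>X. t *\<^sub>R X" UNIV UNIV u] by (simp add: o_def)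
  have Qf: "(\<forall>X. J (u X) = u (X \<cdot> q)) \<longleftrightarrow> (\<forall>X. J (u (t *\<^sub>R X)) = u (t *\<^sub>R (X \<cdot> q)))" for J q
  proof
    assume a: "\<forall>X. J (u (t *\<^sub>R X)) = u (t *\<^sub>R (X \<cdot> q))"
    show "\<forall>X. J (u X) = u (X \<cdot> q)"
    proof
      fix X show "J (u X) = u (X \<cdot> q)"
        using t spec [OF a, of "(1/t) *\<^sub>R X"] by (simp add: vscale_scaleR)
    qed
  qed (simp add: vscale_scaleR)
  have Rt: "Rcur A a (t *\<^sub>R X) (t *\<^sub>R Y) (t *\<^sub>R Z) = t *\<^sub>R Rcur (t\<^sup>2 *\<^sub>R A) (t\<^sup>2 *\<^sub>R a) X Y Z" for X Y Z
  proof -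
    have "Acur A a (t *\<^sub>R X) (t *\<^sub>R Y) = Acur (t\<^sup>2 *\<^sub>R A) (t\<^sup>2 *\<^sub>R a) X Y"
      "acur A a (t *\<^sub>R X) (t *\<^sub>R Y) = acur (t\<^sup>2 *\<^sub>R A) (t\<^sup>2 *\<^sub>R a) X Y"
      by (simp_all add: Acur_def acur_def bop_scaleR bop_add outer_bilinear hf_scaleR power2_eq_square algebra_simps)
    then show ?thesis by (simp add: Rcur_def bop_add)
  qed
  have u: "u (X + Y) = u X \<oplus>\<^bsub>alg T\<^esub> u Y" "u (r *\<^sub>R X) = r \<odot>\<^bsub>alg T\<^esub> u X" "form T (u X) (u Y) = - 2 * qRe (h X Y)"
    "lie (alg T) (lie (alg T) (u X) (u Y)) (u Z) = u (Rcur A a X Y Z)"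
    and Q: "qstr T = {J \<in> extensional (m_part T). \<exists>q\<in>sp1. \<forall>X. J (u X) = u (X \<cdot> q)}" for X Y Z r
    using fr by (simp_all add: framed_def)
  show ?thesis
    unfolding framed_def Qf [symmetric]
  proof (intro conjI allI)
    fix X Y Z r
    show "u (t *\<^sub>R r *\<^sub>R X) = r \<odot>\<^bsub>alg (T\<lparr>form := \<lambda>x y. form T x y / t\<^sup>2\<rparr>)\<^esub> u (t *\<^sub>R X)"
      using u(2) [of r "t *\<^sub>R X"] by (simp add: mult.commute del: u)
    have "form T (u (t *\<^sub>R X)) (u (t *\<^sub>R Y)) = t\<^sup>2 * (- 2 * qRe (h X Y))"
      by (simp only: u(3) hf_scaleR) (simp add: power2_eq_square)
    then show "form (T\<lparr>form := \<lambda>x y. form T x y / t\<^sup>2\<rparr>) (u (t *\<^sub>R X)) (u (t *\<^sub>R Y)) = - 2 * qRe (h X Y)"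
      using t by simp
  qed (use bij Q u(1,4) in \<open>simp_all add: scaleR_add_right Rt\<close>)
qed

text \<open>An explicit instance of the Skolem-Noether theorem: averaging any \<open>v\<close> over
  the two systems of units gives an intertwiner \<open>R v\<close>.\<close>

lemma unit_frame:
  fixes pi pj pk :: quat
  assumes ij: "pi * pj = pk" "pj * pi = - pk" and sq: "pi * pi = -1" "pj * pj = -1"
  shows "\<exists>r. norm r = 1 \<and> pi * r = r * qi \<and> pj * r = r * qj"
proof -
  have ij': "pi * (pj * x) = pk * x" "pj * (pi * x) = - (pk * x)" "pi * (pi * x) = - x" "pj * (pj * x) = - x" for x
    using ij sq by (simp_all flip: mult.assoc)
  have ik: "pi * (pk * x) = - (pj * x)" "pj * (pk * x) = pi * x" for x
  proof -
    show "pi * (pk * x) = - (pj * x)" using ij'(3) [of "pj * x"] by (simp only: ij'(1))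
    have "pj * (pj * (pi * x)) = - (pi * x)" by (rule ij'(4))
    then show "pj * (pk * x) = pi * x" by (simp only: ij'(2)) simp
  qed
  define R where "R v = v - pi * v * qi - pj * v * qj - pk * v * qk" for v
  have int: "pi * R v = R v * qi" "pj * R v = R v * qj" for v
    by (simp_all add: R_def right_diff_distrib left_diff_distrib mult.assoc ij' ik)
  \<comment> \<open>This combination shows that not all averages vanish.\<close>
  have R4: "R 1 - R qi * qi - R qj * qj - R qk * qk = 4"
    by (simp add: R_def algebra_simps)
  have "\<exists>v. R v \<noteq> 0"
  proof (rule ccontr)
    assume "\<not> (\<exists>v. R v \<noteq> 0)"
    then have "R v = 0" for v by blast
    then show False using R4 by simp
  qed
  then obtain v where v: "R v \<noteq> 0" by blast
  show ?thesis
    by (rule exI [of _ "R v /\<^sub>R norm (R v)"]) (use v in \<open>simp add: int\<close>)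
qed

text \<open>The transition map \<open>f\<close> turns right multiplications by i and j into right
  multiplications by other units, which \<open>unit_frame\<close> straightens. Thus
  \<open>f X = g X r^(-1)\<close> with \<open>g\<close> in SO*(2n). Transport by \<open>g\<close>
  and \<open>r\<close> changes the first pair into one with the curvature of the second, and the
  curvature determines the pair.\<close>

lemma two_frames:
  assumes A1: "A1 \<in> so_star j" "a1 \<in> sp1" and A2: "A2 \<in> so_star j" "a2 \<in> sp1"
    and f1: "framed A1 a1 T u1" and f2: "framed A2 a2 T u2"
  shows "\<exists>g p. isometry g \<and> norm p = 1 \<and> A1 ** g = g ** A2 \<and> a1 * p = p * a2"
proof -
  have b1: "bij_betw u1 UNIV (m_part T)" and b2: "bij_betw u2 UNIV (m_part T)"
    using f1 f2 by (auto simp: framed_def)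
  have inj1: "u1 X = u1 Y \<longleftrightarrow> X = Y" and inj2: "u2 X = u2 Y \<longleftrightarrow> X = Y" for X Y
    using b1 b2 by (auto simp: bij_betw_def inj_eq)
  have "\<exists>Y. u2 X = u1 Y" for X using b1 b2 by (metis UNIV_I bij_betw_imp_surj_on bij_betwE imageE)
  then obtain f where f: "\<And>X. u2 X = u1 (f X)" by metis
  note f1' = f1 [unfolded framed_def] and f2' = f2 [unfolded framed_def]
  have f_add: "f (X + Y) = f X + f Y" and f_scale: "f (r *\<^sub>R X) = r *\<^sub>R f X" for X Y r
    using f1' f2' f by (metis inj1)+
  have f_form: "qRe (h (f X) (f Y)) = qRe (h X Y)" for X Y
  proof -
    have "- 2 * qRe (h (f X) (f Y)) = form T (u1 (f X)) (u1 (f Y))" using f1' by simp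
    also have "\<dots> = - 2 * qRe (h X Y)" using f2' by (simp flip: f)
    finally show ?thesis by simp
  qed
  have f_cur: "f (Rcur A2 a2 X Y Z) = Rcur A1 a1 (f X) (f Y) (f Z)" for X Y Z
  proof -
    have "u1 (f (Rcur A2 a2 X Y Z)) = lie (alg T) (lie (alg T) (u2 X) (u2 Y)) (u2 Z)" using f2' by (simp flip: f)
    also have "\<dots> = u1 (Rcur A1 a1 (f X) (f Y) (f Z))" using f1' by (simp add: f)
    finally show ?thesis by (simp add: inj1)
  qed
  have \<theta>: "\<exists>p. \<forall>X. f (X \<cdot> q) = f X \<cdot> p" if q: "q \<in> sp1" for q
  proof -
    \<comment> \<open>Right multiplication by \<open>q\<close> in the second frame belongs to Q,
      hence is a right multiplication in the first frame as well.\<close>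
    define J where "J = restrict (\<lambda>x. u2 (inv_into UNIV u2 x \<cdot> q)) (m_part T)"
    have "u2 X \<in> m_part T" for X using b2 by (auto simp: bij_betw_def)
    then have J: "J (u2 X) = u2 (X \<cdot> q)" for X
      using inv_into_f_f [of u2 UNIV X] by (simp add: J_def inj_def inj2)
    have "J \<in> qstr T" using f2' J q by (auto simp: J_def)
    then obtain p where "\<And>X. J (u1 X) = u1 (X \<cdot> p)" using f1' by auto
    then have "f (X \<cdot> q) = f X \<cdot> p" for X using J [of X] by (simp add: f inj1)
    then show ?thesis by blast
  qed
  obtain pi where pi: "\<And>X. f (X \<cdot> qi) = f X \<cdot> pi" using \<theta> [of qi] by auto
  obtain pj where pj: "\<And>X. f (X \<cdot> qj) = f X \<cdot> pj" using \<theta> [of qj] by auto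
  obtain X0 where X0: "f X0 \<noteq> 0"
  proof -
    obtain Y where "h (axis undefined 1) Y = 1" using h_exists [of "axis undefined 1"] by (auto simp: axis_eq_0_iff)
    then have "f Y \<noteq> 0" using f_form [of "axis undefined 1" Y] by auto
    then show thesis by (rule that)
  qed
  have f_neg: "f (- X) = - f X" for X using f_scale [of "-1" X] by simp
  have eqI: "p = q" if "f X0 \<cdot> p = f X0 \<cdot> q" for p q
    using that X0 vscale_distrib(4) [of "f X0" p q] by simp
  have "pi * pi = -1" by (rule eqI) (simp add: vscale_assoc f_neg flip: vscale_assoc pi, simp add: vscale_assoc f_neg)
  moreover have "pj * pj = -1" by (rule eqI) (simp add: vscale_assoc f_neg flip: vscale_assoc pj, simp add: vscale_assoc f_neg)
  moreover have "pj * pi = - (pi * pj)"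
    by (rule eqI) (simp add: vscale_assoc f_neg flip: vscale_assoc pi pj, simp add: vscale_assoc f_neg)
  ultimately obtain r where r: "norm r = 1" "pi * r = r * qi" "pj * r = r * qj"
    using unit_frame [of pi pj "pi * pj"] by auto
  define E where "E X = f X \<cdot> r" for X
  have E_add: "E (X + Y) = E X + E Y" "E (t *\<^sub>R X) = t *\<^sub>R E X" for X Y t
    by (simp_all add: E_def f_add f_scale vscale_distrib vscale_scaleR)
  have Ei: "E (X \<cdot> qi) = E X \<cdot> qi" and Ej: "E (X \<cdot> qj) = E X \<cdot> qj" for X
    by (simp_all add: E_def pi pj vscale_assoc r)
  have "E (X \<cdot> q) = E X \<cdot> q" for X q
    by (rule Hlinear_if_qi_qj) (fact E_add Ei Ej)+
  then obtain g where g: "\<And>X. E X = g *v X" using Hlinear_matrix [of E] E_add(1) by blast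
  have fg: "f X = (g *v X) \<cdot> qcnj r" for X
    by (simp add: E_def vscale_assoc unit_cancel r(1) flip: g)
  have "h (g *v X) (g *v Y) = h X Y" for X Y
  proof -
    have w: "qRe (h (g *v X) (g *v Y) - h X Y) = 0" for X Y
      using f_form [of X Y] Re_conj [OF r(1)] by (simp add: fg hf_scale mult.assoc)
    have "qRe ((h (g *v X) (g *v Y) - h X Y) * q) = 0" for q
      using w [of X "Y \<cdot> q"] by (simp add: mv_vscale hf_scale left_diff_distrib)
    from this [of 1] this [of qi] this [of qj] this [of qk]
    show ?thesis unfolding quat_eq_iff by (simp add: quat_mult_sel)
  qed
  then have iso: "isometry g" by (simp add: isometry_def)
  obtain g' where g': "\<And>X. g *v (g' *v X) = X" "\<And>X. g' *v (g *v X) = X" "isometry g'"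
    using isometry_inv [OF iso] by metis
  define A where "A = g' ** A1 ** g"
  define a where "a = qcnj r * a1 * r"
  have gA: "A1 ** g = g ** A" by (rule matrix_eqI) (simp add: A_def g' flip: matrix_vector_mul_assoc)
  have ra: "a1 * r = r * a" by (simp add: a_def unit_cancel r(1) mult.assoc)
  have A_so: "A \<in> so_star j"
    unfolding so_star_iff
  proof (intro allI)
    fix X Y
    have "h (A *v X) Y = h (g *v (A *v X)) (g *v Y)" using iso by (simp add: isometry_def)
    also have "\<dots> = h (A1 *v (g *v X)) (g *v Y)" by (simp add: A_def g' flip: matrix_vector_mul_assoc)
    also have "\<dots> = - h (g *v X) (g *v (A *v Y))"
      by (simp add: A_def g' h_so_star [OF A1(1)] flip: matrix_vector_mul_assoc)
    finally show "h (A *v X) Y = - h X (A *v Y)" using iso by (simp add: isometry_def)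
  qed
  have a_sp: "a \<in> sp1" using A1(2) by (simp add: a_def sp1_cnj qcnj_mult mult.assoc)
  have "Rcur A2 a2 X Y Z = Rcur A a X Y Z" for X Y Z
  proof -
    have "f (Rcur A2 a2 X Y Z) = f (Rcur A a X Y Z)"
      unfolding f_cur unfolding fg by (rule Rcur_isometry [OF iso r(1) gA ra])
    then show ?thesis by (metis f inj2)
  qed
  then have "Acur A2 a2 X Y = Acur A a X Y \<and> acur A2 a2 X Y = acur A a X Y" for X Y
    unfolding Rcur_def by (rule pair_eqI) (use A2 A_so a_sp acur_sp1 in auto)
  moreover have "acur (A2 - A) (a2 - a) X Y = acur A2 a2 X Y - acur A a X Y" for X Y
    by (simp add: acur_def bop_def vscale_distrib hf_add algebra_simps)
  ultimately have "acur (A2 - A) (a2 - a) X Y = 0" for X Y by simp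
  from acur_inj [OF so_star_closed(2) [OF A2(1) A_so] sp1_closed(6) [OF A2(2) a_sp] this]
  have "A2 = A" "a2 = a" by simp_all
  then show ?thesis using iso r(1) gA ra by (intro exI [of _ g] exI [of _ r]) simp
qed

end

section \<open>The associated triple\<close>

definition bvec :: "quat \<Rightarrow> quat^'n \<Rightarrow> quat \<Rightarrow> quat^('n ext)" where
  "bvec x Z y = (\<chi> p. case p of First \<Rightarrow> x | Mid i \<Rightarrow> Z $ i | Last \<Rightarrow> y)"

lemma bvec_sel [simp]: "bvec x Z y $ First = x" "bvec x Z y $ Mid i = Z $ i" "bvec x Z y $ Last = y"
  by (simp_all add: bvec_def)

lemma bvec_eq_iff: "V = W \<longleftrightarrow> V $ First = W $ First \<and> (\<forall>i. V $ Mid i = W $ Mid i) \<and> V $ Last = W $ Last"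
  for V W :: "quat^('n::finite ext)"
  unfolding vec_eq_iff by (metis ext.exhaust)

lemma bvec_inject [simp]: "bvec x Z y = bvec x' Z' y' \<longleftrightarrow> x = x' \<and> Z = Z' \<and> y = y'"
  by (simp add: bvec_eq_iff) (simp add: vec_eq_iff)

lemma bvec_exists: "\<exists>x Z y. V = bvec x Z y"
  by (intro exI [of _ "V $ First"] exI [of _ "\<chi> i. V $ Mid i"] exI [of _ "V $ Last"]) (simp add: bvec_eq_iff)

lemma bvec_ops: "bvec x Z y + bvec x' Z' y' = bvec (x + x') (Z + Z') (y + y')"
  "bvec x Z y - bvec x' Z' y' = bvec (x - x') (Z - Z') (y - y')"
  "r *\<^sub>R bvec x Z y = bvec (r *\<^sub>R x) (r *\<^sub>R Z) (r *\<^sub>R y)" "0 = bvec 0 0 0"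
  "bvec x Z y \<cdot> q = bvec (x * q) (Z \<cdot> q) (y * q)"
  by (simp_all add: bvec_eq_iff vscale_def)

lemma ext_matrix_eqI: "(\<And>x Z y. M *v bvec x Z y = N *v bvec x Z y) \<Longrightarrow> M = N" for M N :: "quat^('n::finite ext)^('n ext)"
  by (rule matrix_eqI) (metis bvec_exists)

lemma sum_ext: "(\<Sum>p\<in>UNIV. f p) = f First + (\<Sum>k\<in>UNIV. f (Mid k)) + f Last" for f :: "'n::finite ext \<Rightarrow> quat"
proof -
  have "UNIV = insert First (insert Last (range (Mid :: 'n \<Rightarrow> 'n ext)))" using ext.exhaust by auto
  then have "sum f UNIV = sum f (insert First (insert Last (range Mid)))" by (rule arg_cong)
  also have "\<dots> = f First + (f Last + sum f (range Mid))" by (subst sum.insert sum.insert; auto)+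
  also have "sum f (range Mid) = (\<Sum>k\<in>UNIV. f (Mid k))" by (simp add: sum.reindex inj_def)
  finally show ?thesis by (simp add: add.assoc add.commute [of "f Last"])
qed

lemma block_mv: "block a r e X A Y c s f *v bvec x Z y =
  bvec (a * x + (\<Sum>k\<in>UNIV. r $ k * Z $ k) + e * y) (X \<cdot> x + A *v Z + Y \<cdot> y)
    (c * x + (\<Sum>k\<in>UNIV. s $ k * Z $ k) + f * y)"
  by (simp add: bvec_eq_iff matrix_vector_mult_def sum_ext block_def vscale_def)

context skew_form begin

definition sblk :: "quat \<Rightarrow> quat^'n \<Rightarrow> quat^'n \<Rightarrow> real \<Rightarrow> real \<Rightarrow> quat^'n^'n \<Rightarrow> quat^('n ext)^('n ext)" where
  "sblk a X Y c d A = block a (star_row Y j) (of_real d) X A Y (of_real c) (- star_row X j) (- qcnj a)"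

lemma so_star_ext_sblk: "so_star_ext j = {sblk a X Y c d A | a X Y c d A. A \<in> so_star j}"
  by (simp add: so_star_ext_def sblk_def)

lemma sblk_mv: "sblk a X Y c d A *v bvec x Z y =
  bvec (a * x + h Y Z + d *\<^sub>R y) (X \<cdot> x + A *v Z + Y \<cdot> y) (c *\<^sub>R x - h X Z - qcnj a * y)"
  by (simp add: sblk_def block_mv star_row_h sum_negf of_real_mult_quat)

lemma sblk_ops: "sblk a X Y c d A + sblk a' X' Y' c' d' A' = sblk (a + a') (X + X') (Y + Y') (c + c') (d + d') (A + A')"
  "r *\<^sub>R sblk a X Y c d A = sblk (r *\<^sub>R a) (r *\<^sub>R X) (r *\<^sub>R Y) (r * c) (r * d) (r *\<^sub>R A)"
  by (rule ext_matrix_eqI, simp add: sblk_mv matrix_vector_mult_add_rdistrib bvec_ops hf_add vscale_distrib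
      scaleR_mv hf_scaleR vscale_scaleR algebra_simps)+

lemma sblk_LF: "sblk a X Y c d A $ Last $ First = of_real c"
  by (simp add: sblk_def block_def)

lemma sblk_0: "sblk 0 0 0 0 0 0 = 0"
  by (rule ext_matrix_eqI) (simp add: sblk_mv bvec_ops)

lemma sblk_inject: "sblk a X Y c d A = sblk a' X' Y' c' d' A' \<longleftrightarrow>
  a = a' \<and> X = X' \<and> Y = Y' \<and> c = c' \<and> d = d' \<and> A = A'"
proof
  assume eq: "sblk a X Y c d A = sblk a' X' Y' c' d' A'"
  have e: "sblk a X Y c d A *v bvec x Z y = sblk a' X' Y' c' d' A' *v bvec x Z y" for x Z y by (simp add: eq)
  have "A = A'" by (rule matrix_eqI) (use e [of 0 _ 0] in \<open>simp add: sblk_mv\<close>)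
  then show "a = a' \<and> X = X' \<and> Y = Y' \<and> c = c' \<and> d = d' \<and> A = A'"
    using e [of 1 0 0] e [of 0 0 1] by (auto simp: sblk_mv quat_eq_iff)
qed simp

lemma subspace_so_star_ext: "Real_Vector_Spaces.subspace (so_star_ext j)"
  unfolding Real_Vector_Spaces.subspace_def
proof (intro conjI ballI allI)
  show "0 \<in> so_star_ext j" unfolding so_star_ext_sblk using sblk_0 so_star_closed(6) by fastforce
  fix x y r assume "x \<in> so_star_ext j"
  then obtain a X Y c d A where x: "x = sblk a X Y c d A" "A \<in> so_star j" unfolding so_star_ext_sblk by blast
  show "r *\<^sub>R x \<in> so_star_ext j" unfolding x(1) sblk_ops so_star_ext_sblk using so_star_closed(4) [OF x(2)] by blast
  assume "y \<in> so_star_ext j"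
  then obtain a' X' Y' c' d' A' where y: "y = sblk a' X' Y' c' d' A'" "A' \<in> so_star j" unfolding so_star_ext_sblk by blast
  show "x + y \<in> so_star_ext j" unfolding x(1) y(1) sblk_ops so_star_ext_sblk using so_star_closed(1) [OF x(2) y(2)] by blast
qed

lemma admissible_symmetric_pair:
  assumes "admissible j a A d" shows "symmetric_pair j A a d"
proof unfold_locales
  show "A \<in> so_star j" "a \<in> sp1" using assms by (simp_all add: admissible_def)
  fix X
  have "X \<cdot> of_real d + 2 *\<^sub>R ((A *v X) \<cdot> a) - X \<cdot> a\<^sup>2 - (A ** A) *v X = 0" using assms by (simp add: admissible_def)
  then show "bop A a (bop A a X) = d *\<^sub>R X"
    by (simp add: bop_def vscale_distrib mv_vscale vscale_assoc power2_eq_square vscale_scaleR scaleR_2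
        matrix_vector_mult_diff_distrib flip: matrix_vector_mul_assoc) (simp add: algebra_simps)
qed

end

lemma commutator_add:
  "commutator (M + M') N = commutator M N + commutator M' N" "commutator N (M + M') = commutator N M + commutator N M'"
  "commutator (r *\<^sub>R M) N = r *\<^sub>R commutator M N" "commutator N (r *\<^sub>R M) = r *\<^sub>R commutator N M"
  "commutator M M = 0" "commutator M N = - commutator N M"
  for M M' N :: "quat^'k^'k"
  by (simp_all add: commutator_def matrix_distrib matrix_scaleR_mult scaleR_diff_right)

section \<open>Lifting the model to the centralizer of \<open>\<tau>\<close>\<close>

context symmetric_pair begin

definition \<tau> :: "quat^('n ext)^('n ext)" where "\<tau> = tau a A d"

lemma tau_sblk: "\<tau> = sblk a 0 0 1 d A"
  unfolding \<tau>_def tau_def sblk_def using a by (simp add: star_row_def sp1_cnj vec_eq_iff block_def split: ext.split)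

lemma m_elem_sblk: "m_elem j a A X = sblk 0 X (bop A a X) 0 0 0"
  by (simp add: m_elem_def sblk_def bop_def)

text \<open>A linear lift of the model to matrices: the representative modulo \<open>\<tau>\<close>
  whose bottom left entry is zero.\<close>

definition \<psi> :: "'n qmodel \<Rightarrow> quat^('n ext)^('n ext)" where
  "\<psi> x = sblk (snd (fst x)) (snd x) (bop A a (snd x)) 0 0 (fst (fst x))"

lemma \<psi>_linear: "linear \<psi>"
  by (intro linearI) (simp_all add: \<psi>_def sblk_ops bop_add)

lemma \<psi>_inj: "\<psi> x = \<psi> y \<longleftrightarrow> x = y"
  by (auto simp: \<psi>_def sblk_inject prod_eq_iff)

lemma \<psi>_m: "\<psi> (0, X) = m_elem j a A X"
  by (simp add: \<psi>_def m_elem_sblk)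

lemma \<tau>_mv: "\<tau> *v bvec x Z y = bvec (a * x + d *\<^sub>R y) (A *v Z) (x + a * y)"
  using a by (simp add: tau_sblk sblk_mv sp1_cnj)

lemma \<psi>_mv: "S \<in> commutant A a \<Longrightarrow> \<psi> (S, X) *v bvec x Z y =
  bvec (snd S * x + h (bop A a X) Z) (X \<cdot> x + fst S *v Z + bop A a X \<cdot> y) (snd S * y - h X Z)"
  by (simp add: \<psi>_def sblk_mv commutant_def sp1_cnj)

lemma A_bop: "A *v X = bop A a X + X \<cdot> a" "A *v bop A a X = d *\<^sub>R X + bop A a X \<cdot> a"
  using square [of X] by (simp_all add: bop_def [of A a] algebra_simps)

lemma h_A: "h X (A *v Z) = a * h X Z - h (bop A a X) Z" "h (bop A a X) (A *v Z) = a * h (bop A a X) Z - d *\<^sub>R h X Z"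
proof -
  have "h Y (A *v Z) = - h (A *v Y) Z" for Y by (simp add: h_so_star [OF A])
  then show "h X (A *v Z) = a * h X Z - h (bop A a X) Z" "h (bop A a X) (A *v Z) = a * h (bop A a X) Z - d *\<^sub>R h X Z"
    using a by (simp_all only: A_bop) (simp_all add: hf_add hf_scale hf_scaleR sp1_cnj square)
qed

lemma \<psi>_commutes: assumes S: "S \<in> commutant A a" shows "commutator \<tau> (\<psi> (S, X)) = 0"
proof -
  have SA: "fst S *v (A *v Z) = A *v (fst S *v Z)" "snd S * a = a * snd S" for Z
    using S by (simp_all add: commutant_def matrix_vector_mul_assoc)
  have Sa: "snd S * (a * x) = a * (snd S * x)" for x using SA(2) by (metis mult.assoc)
  have "\<tau> *v (\<psi> (S, X) *v bvec x Z y) = \<psi> (S, X) *v (\<tau> *v bvec x Z y)" for x Z y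
    unfolding \<tau>_mv \<psi>_mv [OF S] bvec_inject matrix_vector_right_distrib mv_vscale A_bop(2) A_bop(1) [of X] h_A SA(1)
    by (simp add: square hf_scaleR Sa vscale_distrib vscale_assoc vscale_scaleR distrib_left right_diff_distrib scaleR_diff_right scaleR_add_right)
  then have "\<tau> ** \<psi> (S, X) = \<psi> (S, X) ** \<tau>"
    by (intro ext_matrix_eqI) (simp flip: matrix_vector_mul_assoc)
  then show ?thesis by (simp add: commutator_def)
qed

text \<open>The bottom left entry of the commutator is \<open>- (h X Y - h Y X)\<close>. Lifted
  elements have entry 0 there and \<open>\<tau>\<close> has entry 1, which fixes the multiple of
  \<open>\<tau>\<close>. The same entry is the source of the form on m.\<close>

lemma \<psi>_bracket:
  assumes S: "S \<in> lset A a" and T: "T \<in> lset A a"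
  shows "commutator (\<psi> (S, X)) (\<psi> (T, Y)) = \<psi> (brk A a (S, X) (T, Y)) + (- 2 * qRe (h X Y)) *\<^sub>R \<tau>"
proof -
  let ?r = "2 * qRe (h X Y)"
  have Sc: "S \<in> commutant A a" and Tc: "T \<in> commutant A a" using S T lset_commutant by auto
  obtain D p where Dp: "S = (D, p)" by force
  obtain E q where Eq: "T = (E, q)" by force
  have D: "D \<in> so_star j" "p \<in> sp1" and E: "E \<in> so_star j" "q \<in> sp1" using Sc Tc by (auto simp: commutant_def Dp Eq)
  have brk: "pbr S T + cur A a X Y \<in> commutant A a"
    using lset_commutant subspace_add [OF subspace_lset pbr_lset [OF S T] cur_lset] by blast
  have b: "bop A a (act S Y - act T X) = bop D p (bop A a Y) - bop E q (bop A a X)"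
    using bop_commute [of D p A a Y] bop_commute [of E q A a X] Sc Tc by (simp add: act_def Dp Eq bop_add)
  have hD: "h X (D *v Z) = p * h X Z - h (bop D p X) Z" for X Z
    using h_so_star [OF D(1), of X Z] D(2) by (simp add: bop_def hf_add hf_scale sp1_cnj)
  have hE: "h X (E *v Z) = q * h X Z - h (bop E q X) Z" for X Z
    using h_so_star [OF E(1), of X Z] E(2) by (simp add: bop_def hf_add hf_scale sp1_cnj)
  have hs: "h X Y - h Y X = ?r *\<^sub>R 1"
    by (subst (2) h_sym) (simp add: quat_eq_iff)
  have hb1: "h (bop A a X) Y - h (bop A a Y) X = acur A a X Y - ?r *\<^sub>R a"
    by (simp add: acur_def)
  have hb: "h Y (bop A a X) - h X (bop A a Y) = acur A a X Y - ?r *\<^sub>R a"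
  proof -
    have "h Y (bop A a X) - h X (bop A a Y) = - qcnj (h (bop A a X) Y - h (bop A a Y) X)"
      by (simp add: h_cnj)
    also have "\<dots> = acur A a X Y - ?r *\<^sub>R a"
      using acur_sp1 [OF A a, of X Y] a unfolding hb1 by (simp add: sp1_cnj)
    finally show ?thesis .
  qed
  have hbb: "h (bop A a X) (bop A a Y) - h (bop A a Y) (bop A a X) = - (?r * d) *\<^sub>R 1"
  proof -
    have "qRe (h (bop A a X) (bop A a Y)) = - qRe (h X (bop A a (bop A a Y)))"
      using Re_h_bop [OF A a, of X "bop A a Y"] by simp
    then have "qRe (h (bop A a X) (bop A a Y)) = - (d * qRe (h X Y))" by (simp add: square hf_scaleR)
    then show ?thesis by (subst (2) h_sym) (simp add: quat_eq_iff)
  qed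
  have "\<psi> (S, X) *v (\<psi> (T, Y) *v bvec x Z y) - \<psi> (T, Y) *v (\<psi> (S, X) *v bvec x Z y)
      = \<psi> (brk A a (S, X) (T, Y)) *v bvec x Z y + (- ?r) *\<^sub>R (\<tau> *v bvec x Z y)" for x Z y
  proof -
    \<comment> \<open>The facts \<open>1\<close>, \<open>2\<close> and \<open>3\<close> are the
      first, the middle and the last component of the identity applied to a block vector.\<close>
    have 1: "p * (q * x + h (bop A a Y) Z) + h (bop A a X) (Y \<cdot> x + E *v Z + bop A a Y \<cdot> y)
        - (q * (p * x + h (bop A a X) Z) + h (bop A a Y) (X \<cdot> x + D *v Z + bop A a X \<cdot> y))
      = (p * q - q * p + acur A a X Y) * x + h (bop D p (bop A a Y) - bop E q (bop A a X)) Z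
        + (- ?r) *\<^sub>R (a * x + d *\<^sub>R y)"
    proof -
      have "p * (q * x + h (bop A a Y) Z) + h (bop A a X) (Y \<cdot> x + E *v Z + bop A a Y \<cdot> y)
          - (q * (p * x + h (bop A a X) Z) + h (bop A a Y) (X \<cdot> x + D *v Z + bop A a X \<cdot> y))
        = (p * q - q * p) * x + (h (bop A a X) Y - h (bop A a Y) X) * x + h (bop D p (bop A a Y) - bop E q (bop A a X)) Z
        + (h (bop A a X) (bop A a Y) - h (bop A a Y) (bop A a X)) * y"
        by (simp add: hD hE hf_add hf_scale algebra_simps)
      then show ?thesis unfolding hb1 hbb by (simp add: algebra_simps)
    qed
    have 2: "Y \<cdot> x + E *v Z + bop A a Y \<cdot> y = V \<Longrightarrow> X \<cdot> x + D *v Z + bop A a X \<cdot> y = U \<Longrightarrow>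
        X \<cdot> (q * x + h (bop A a Y) Z) + D *v V + bop A a X \<cdot> (q * y - h Y Z)
        - (Y \<cdot> (p * x + h (bop A a X) Z) + E *v U + bop A a Y \<cdot> (p * y - h X Z))
      = (bop D p Y - bop E q X) \<cdot> x + (D ** E - E ** D + Acur A a X Y) *v Z
        + (bop D p (bop A a Y) - bop E q (bop A a X)) \<cdot> y + (- ?r) *\<^sub>R (A *v Z)" for U V
    proof -
      assume "Y \<cdot> x + E *v Z + bop A a Y \<cdot> y = V" "X \<cdot> x + D *v Z + bop A a X \<cdot> y = U"
      then have V: "V = Y \<cdot> x + E *v Z + bop A a Y \<cdot> y" and U: "U = X \<cdot> x + D *v Z + bop A a X \<cdot> y" by simp_all
      have "(D ** E - E ** D + Acur A a X Y) *v Z = D *v (E *v Z) - E *v (D *v Z) + Acur A a X Y *v Z"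
        by (simp add: matrix_vector_mult_add_rdistrib matrix_vector_mult_diff_rdistrib flip: matrix_vector_mul_assoc)
      then show ?thesis unfolding V U Acur_mv
        by (simp add: bop_def [of D p] bop_def [of E q] matrix_vector_right_distrib vscale_distrib mv_vscale vscale_assoc algebra_simps)
    qed
    have 3: "p * (q * y - h Y Z) - h X (Y \<cdot> x + E *v Z + bop A a Y \<cdot> y)
        - (q * (p * y - h X Z) - h Y (X \<cdot> x + D *v Z + bop A a X \<cdot> y))
      = (p * q - q * p + acur A a X Y) * y - h (bop D p Y - bop E q X) Z + (- ?r) *\<^sub>R (x + a * y)"
    proof -
      have "p * (q * y - h Y Z) - h X (Y \<cdot> x + E *v Z + bop A a Y \<cdot> y)
          - (q * (p * y - h X Z) - h Y (X \<cdot> x + D *v Z + bop A a X \<cdot> y))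
        = (p * q - q * p) * y - (h X Y - h Y X) * x + (h Y (bop A a X) - h X (bop A a Y)) * y - h (bop D p Y - bop E q X) Z"
        by (simp add: hD hE hf_add hf_scale algebra_simps)
      then show ?thesis unfolding hs hb by (simp add: algebra_simps)
    qed
    show ?thesis
      unfolding brk_def fst_conv snd_conv \<psi>_mv [OF brk] \<psi>_mv [OF Sc] \<psi>_mv [OF Tc] \<tau>_mv bvec_ops bvec_inject b
      using 1 2 [OF refl refl] 3 by (simp add: Dp Eq pbr_def cur_def act_def)
  qed
  then show ?thesis
    by (intro ext_matrix_eqI) (simp add: commutator_def matrix_vector_mult_add_rdistrib
          matrix_vector_mult_diff_rdistrib scaleR_mv flip: matrix_vector_mul_assoc)
qed

end

section \<open>The quotient by the line of \<open>\<tau>\<close> and its identification with the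
  model\<close>

context symmetric_pair begin

definition Cent :: "(quat^('n ext)^('n ext)) set" where "Cent = centralizer j \<tau>"

text \<open>A complement of the line of \<open>\<tau>\<close> in the centralizer, as
  \<open>\<tau>\<close> has bottom left entry 1.\<close>

definition W :: "(quat^('n ext)^('n ext)) set" where "W = {M \<in> Cent. M $ Last $ First = 0}"

definition \<kappa>0 :: "quat^('n ext)^('n ext) \<Rightarrow> (quat^('n ext)^('n ext)) set" where
  "\<kappa>0 M = {M + s *\<^sub>R \<tau> | s. True}"

abbreviation Z :: "(quat^('n ext)^('n ext)) set lie_alg" where "Z \<equiv> Z_mod_t j a A d"

lemma subspace_Cent: "Real_Vector_Spaces.subspace Cent"
proof -
  have "commutator \<tau> 0 = 0" using commutator_add(4) [of \<tau> 0 0] by simp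
  then show ?thesis using subspace_so_star_ext
    unfolding Real_Vector_Spaces.subspace_def Cent_def centralizer_def by (simp add: commutator_add(2,4))
qed

lemma subspace_W: "Real_Vector_Spaces.subspace W"
  unfolding W_def using subspace_Cent by (auto simp: Real_Vector_Spaces.subspace_def)

lemma \<tau>_so_star_ext: "\<tau> \<in> so_star_ext j"
  using A unfolding tau_sblk so_star_ext_sblk by blast

lemma \<tau>_Cent: "\<tau> \<in> Cent"
  using \<tau>_so_star_ext by (simp add: Cent_def centralizer_def commutator_add(5))

lemma \<tau>_LF: "\<tau> $ Last $ First = 1"
  by (simp add: tau_sblk sblk_LF)

lemma \<psi>_W: assumes "x \<in> gset A a" shows "\<psi> x \<in> W"
proof -
  obtain S X where x: "x = (S, X)" "S \<in> lset A a" using assms by (auto simp: gset_def)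
  then have S: "S \<in> commutant A a" using lset_commutant by blast
  then have "fst S \<in> so_star j" by (simp add: commutant_def)
  then have "\<psi> x \<in> so_star_ext j" unfolding x(1) \<psi>_def so_star_ext_sblk fst_conv by blast
  then show ?thesis using \<psi>_commutes [OF S, of X] by (simp add: x(1) W_def Cent_def centralizer_def \<psi>_def sblk_LF)
qed

lemma coset_\<kappa>0: "span {\<tau>} +>\<^bsub>matrix_lie S\<^esub> M = \<kappa>0 M"
  by (auto simp: a_r_coset_def r_coset_def matrix_lie_def \<kappa>0_def span_singleton add.commute)

lemma \<kappa>0_self: "M \<in> \<kappa>0 M"
  unfolding \<kappa>0_def by (auto intro: exI [of _ 0])

lemma \<kappa>0_shift: "\<kappa>0 (M + s *\<^sub>R \<tau>) = \<kappa>0 M"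
proof -
  have "M + t *\<^sub>R \<tau> = M + s *\<^sub>R \<tau> + (t - s) *\<^sub>R \<tau>" "M + s *\<^sub>R \<tau> + t *\<^sub>R \<tau> = M + (s + t) *\<^sub>R \<tau>" for t
    by (simp_all add: algebra_simps)
  then show ?thesis unfolding \<kappa>0_def by (intro equalityI subsetI) blast+
qed

text \<open>Since \<open>\<tau>\<close> commutes with the centralizer, the bracket is independent of
  representatives, and the unions in \<open>quotient_lie\<close> collapse to single cosets.\<close>

lemma Z_simps:
  "carrier Z = \<kappa>0 ` Cent" "zero Z = \<kappa>0 0"
  "add Z (\<kappa>0 M) (\<kappa>0 N) = \<kappa>0 (M + N)" "r \<odot>\<^bsub>Z\<^esub> \<kappa>0 M = \<kappa>0 (r *\<^sub>R M)"
  "M \<in> Cent \<Longrightarrow> N \<in> Cent \<Longrightarrow> lie Z (\<kappa>0 M) (\<kappa>0 N) = \<kappa>0 (commutator M N)"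
proof -
  let ?L = "matrix_lie Cent"
  have Z: "Z = quotient_lie ?L (span {\<tau>})" by (simp add: Z_mod_t_def Cent_def \<tau>_def)
  have L: "carrier ?L = Cent" "add ?L = (+)" "smult ?L = (*\<^sub>R)" "lie ?L = commutator"
    by (simp_all add: matrix_lie_def)
  show "carrier Z = \<kappa>0 ` Cent"
  proof -
    have "a_rcosets\<^bsub>?L\<^esub> (span {\<tau>}) = (\<Union>M\<in>Cent. {span {\<tau>} +>\<^bsub>?L\<^esub> M})"
      by (simp add: A_RCOSETS_def RCOSETS_def a_r_coset_def L)
    then show ?thesis by (auto simp: Z quotient_lie_def coset_\<kappa>0)
  qed
  show "zero Z = \<kappa>0 0" by (auto simp: Z quotient_lie_def \<kappa>0_def span_singleton)
  show "add Z (\<kappa>0 M) (\<kappa>0 N) = \<kappa>0 (M + N)"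
  proof -
    have "add Z (\<kappa>0 M) (\<kappa>0 N) = {x + y | x y. x \<in> \<kappa>0 M \<and> y \<in> \<kappa>0 N}"
      by (auto simp: Z quotient_lie_def set_add_def set_mult_def matrix_lie_def)
    also have "\<dots> = {M + N + (s + t) *\<^sub>R \<tau> | s t. True}"
    proof -
      have "M + s *\<^sub>R \<tau> + (N + t *\<^sub>R \<tau>) = M + N + (s + t) *\<^sub>R \<tau>" for s t by (simp add: algebra_simps)
      then show ?thesis unfolding \<kappa>0_def by (intro equalityI subsetI; clarsimp; metis)
    qed
    also have "\<dots> = \<kappa>0 (M + N)" unfolding \<kappa>0_def by (intro equalityI subsetI; clarsimp; metis add.right_neutral)
    finally show ?thesis .
  qed
  show "r \<odot>\<^bsub>Z\<^esub> \<kappa>0 M = \<kappa>0 (r *\<^sub>R M)"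
  proof -
    have "r \<odot>\<^bsub>Z\<^esub> \<kappa>0 M = (\<Union>x\<in>\<kappa>0 M. \<kappa>0 (r *\<^sub>R x))"
      by (simp add: Z quotient_lie_def L coset_\<kappa>0)
    also have "\<dots> = (\<Union>x\<in>\<kappa>0 M. \<kappa>0 (r *\<^sub>R M))"
      by (rule SUP_cong) (auto simp: \<kappa>0_def [of M] scaleR_add_right \<kappa>0_shift)
    finally show ?thesis using \<kappa>0_self by blast
  qed
  assume M: "M \<in> Cent" and N: "N \<in> Cent"
  have c: "commutator \<tau> M = 0" "commutator M \<tau> = 0" "commutator \<tau> N = 0"
    using M N commutator_add(6) [of M \<tau>] by (simp_all add: Cent_def centralizer_def)
  show "lie Z (\<kappa>0 M) (\<kappa>0 N) = \<kappa>0 (commutator M N)"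
  proof -
    have "lie Z (\<kappa>0 M) (\<kappa>0 N) = (\<Union>x\<in>\<kappa>0 M. \<Union>y\<in>\<kappa>0 N. \<kappa>0 (commutator x y))"
      by (simp add: Z quotient_lie_def L coset_\<kappa>0)
    also have "\<dots> = (\<Union>x\<in>\<kappa>0 M. \<Union>y\<in>\<kappa>0 N. \<kappa>0 (commutator M N))"
    proof (intro SUP_cong refl)
      fix x y assume "x \<in> \<kappa>0 M" "y \<in> \<kappa>0 N"
      then obtain s t where "x = M + s *\<^sub>R \<tau>" "y = N + t *\<^sub>R \<tau>" by (auto simp: \<kappa>0_def)
      then have "commutator x y = commutator M N" by (simp add: commutator_add(1-5) c)
      then show "\<kappa>0 (commutator x y) = \<kappa>0 (commutator M N)" by simp
    qed
    finally show ?thesis using \<kappa>0_self by blast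
  qed
qed

text \<open>Every coset meets \<open>W\<close> exactly once: the bottom left entry of a matrix in
  so*(2n+4) is real, and that multiple of \<open>\<tau>\<close> is subtracted.\<close>

lemma chart_Z: "chart Z \<kappa>0 W"
  unfolding chart_def
proof (intro conjI ballI allI)
  show "Real_Vector_Spaces.subspace W" by (rule subspace_W)
  have "inj_on \<kappa>0 W"
  proof (rule inj_onI)
    fix M N assume M: "M \<in> W" and N: "N \<in> W" and eq: "\<kappa>0 M = \<kappa>0 N"
    then have "M \<in> \<kappa>0 N" using \<kappa>0_self by blast
    then obtain s where s: "M = N + s *\<^sub>R \<tau>" by (auto simp: \<kappa>0_def)
    have "M $ Last $ First = N $ Last $ First + of_real s" by (simp add: s \<tau>_LF of_real_def)
    then show "M = N" using M N s by (simp add: W_def)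
  qed
  moreover have "\<kappa>0 ` W = \<kappa>0 ` Cent"
  proof (intro equalityI subsetI)
    fix z assume "z \<in> \<kappa>0 ` Cent"
    then obtain M where M: "M \<in> Cent" "z = \<kappa>0 M" by blast
    then have "M \<in> so_star_ext j" by (simp add: Cent_def centralizer_def)
    then obtain c where c: "M $ Last $ First = of_real c" unfolding so_star_ext_sblk using sblk_LF by blast
    have "M + (- c) *\<^sub>R \<tau> \<in> Cent"
      by (intro subspace_add [OF subspace_Cent] subspace_scale [OF subspace_Cent] M \<tau>_Cent)
    then have "M + (- c) *\<^sub>R \<tau> \<in> W" by (simp add: W_def c \<tau>_LF of_real_def)
    moreover have "z = \<kappa>0 (M + (- c) *\<^sub>R \<tau>)" using M \<kappa>0_shift by metis
    ultimately show "z \<in> \<kappa>0 ` W" by blast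
  qed (auto simp: W_def)
  ultimately show "bij_betw \<kappa>0 W (carrier Z)" by (simp add: bij_betw_def Z_simps)
qed (simp_all add: Z_simps)

definition \<kappa> :: "'n qmodel \<Rightarrow> (quat^('n ext)^('n ext)) set" where "\<kappa> x = \<kappa>0 (\<psi> x)"

lemma m_coset_\<kappa>: "m_coset j a A d X = \<kappa> (0, X)"
  unfolding m_coset_def \<kappa>_def \<psi>_m using coset_\<kappa>0 [unfolded \<tau>_def] .

lemma \<kappa>_inj: "x \<in> gset A a \<Longrightarrow> y \<in> gset A a \<Longrightarrow> \<kappa> x = \<kappa> y \<longleftrightarrow> x = y"
  unfolding \<kappa>_def using chart_inj [OF chart_Z] \<psi>_W \<psi>_inj by metis

lemma \<kappa>_ops: "add Z (\<kappa> x) (\<kappa> y) = \<kappa> (x + y)" "r \<odot>\<^bsub>Z\<^esub> \<kappa> x = \<kappa> (r *\<^sub>R x)" "zero Z = \<kappa> 0"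
  by (simp_all add: \<kappa>_def Z_simps linear_add [OF \<psi>_linear] linear_scale [OF \<psi>_linear] linear_0 [OF \<psi>_linear])

lemma \<kappa>_neg: "x \<in> gset A a \<Longrightarrow> \<ominus>\<^bsub>Z\<^esub> \<kappa> x = \<kappa> (- x)"
  unfolding \<kappa>_def using chart_neg [OF chart_Z \<psi>_W] by (simp add: linear_neg [OF \<psi>_linear])

lemma \<kappa>_lie: assumes "x \<in> gset A a" "y \<in> gset A a" shows "lie Z (\<kappa> x) (\<kappa> y) = \<kappa> (brk A a x y)"
proof -
  obtain S X T Y where xy: "x = (S, X)" "y = (T, Y)" "S \<in> lset A a" "T \<in> lset A a" using assms by (auto simp: gset_def)
  have "\<psi> x \<in> Cent" "\<psi> y \<in> Cent" using \<psi>_W assms by (auto simp: W_def)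
  then have "lie Z (\<kappa> x) (\<kappa> y) = \<kappa>0 (commutator (\<psi> x) (\<psi> y))" by (simp add: \<kappa>_def Z_simps)
  also have "\<dots> = \<kappa> (brk A a x y)" unfolding xy(1,2) \<kappa>_def \<psi>_bracket [OF xy(3,4)] by (rule \<kappa>0_shift)
  finally show ?thesis .
qed

lemma zero_lset: "0 \<in> lset A a" by (rule subspace_0 [OF subspace_lset])

lemma gset_iff: "(S, X) \<in> gset A a \<longleftrightarrow> S \<in> lset A a" by (simp add: gset_def)

lemma lie_span_Z: "lie_span Z (range (m_coset j a A d)) = \<kappa> ` (lset A a \<times> {0})"
proof -
  let ?C = "{(Acur A a X Y, acur A a X Y) | X Y. True}"
  have "{lie Z x y | x y. x \<in> range (m_coset j a A d) \<and> y \<in> range (m_coset j a A d)} = {lie Z (\<kappa> (0, X)) (\<kappa> (0, Y)) |X Y. True}"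
    by (auto simp: m_coset_\<kappa>)
  also have "\<dots> = \<kappa>0 ` (\<lambda>S. \<psi> (S, 0)) ` ?C"
  proof -
    have "lie Z (\<kappa> (0, X)) (\<kappa> (0, Y)) = \<kappa>0 (\<psi> ((Acur A a X Y, acur A a X Y), 0))" for X Y
      by (subst \<kappa>_lie) (simp_all add: gset_iff zero_lset brk_simps cur_def \<kappa>_def)
    then show ?thesis by auto
  qed
  finally have eq: "{lie Z x y | x y. x \<in> range (m_coset j a A d) \<and> y \<in> range (m_coset j a A d)} = \<kappa>0 ` (\<lambda>S. \<psi> (S, 0)) ` ?C" .
  have lin: "linear (\<lambda>S. \<psi> (S, 0))"
    using linear_compose [OF _ \<psi>_linear, of "\<lambda>S. (S, 0)"] by (simp add: o_def linear_iff)
  have "lie_span Z (range (m_coset j a A d)) = \<kappa>0 ` span ((\<lambda>S. \<psi> (S, 0)) ` ?C)"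
    unfolding lie_span_def eq
    by (rule chart_span [OF chart_Z]) (use cur_lset [of A a] in \<open>auto simp: cur_def gset_iff intro!: \<psi>_W\<close>)
  also have "\<dots> = \<kappa>0 ` (\<lambda>S. \<psi> (S, 0)) ` lset A a" by (simp only: linear_span_image [OF lin] lset_def)
  also have "\<dots> = \<kappa> ` (lset A a \<times> {0})" by (auto simp: \<kappa>_def)
  finally show ?thesis .
qed

lemma assoc_carrier: "set_add Z (range (m_coset j a A d)) (lie_span Z (range (m_coset j a A d))) = \<kappa> ` gset A a"
proof -
  have "set_add Z (range (m_coset j a A d)) (lie_span Z (range (m_coset j a A d)))
    = {\<kappa> (0, X) \<oplus>\<^bsub>Z\<^esub> \<kappa> (S, 0) | X S. S \<in> lset A a}"
    unfolding lie_span_Z by (auto simp: set_add_def set_mult_def m_coset_\<kappa>)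
  also have "\<dots> = \<kappa> ` gset A a" by (auto simp: \<kappa>_ops gset_def)
  finally show ?thesis .
qed

lemma assoc_canonical: "canonical A a (assoc_qsh j a A d) \<kappa>"
proof -
  let ?T = "assoc_qsh j a A d" and ?m = "range (m_coset j a A d)" and ?l = "lie_span Z (range (m_coset j a A d))"
  have alg: "alg ?T = Z\<lparr>carrier := \<kappa> ` gset A a\<rparr>"
    by (simp add: assoc_qsh_def Let_def assoc_carrier)
  have "chart (alg ?T) \<kappa> (gset A a)"
    unfolding chart_def alg
    by (auto simp: subspace_gset \<kappa>_ops bij_betw_def inj_on_def \<kappa>_inj)
  moreover have "invol ?T (\<kappa> (S, X)) = \<kappa> (S, - X)" if S: "S \<in> lset A a" for S X
  proof -
    have "invol ?T (\<kappa> (S, X)) = (THE w. \<exists>x\<in>?m. \<exists>y\<in>?l. \<kappa> (S, X) = x \<oplus>\<^bsub>Z\<^esub> y \<and> w = (\<ominus>\<^bsub>Z\<^esub> x) \<oplus>\<^bsub>Z\<^esub> y)"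
      by (simp add: assoc_qsh_def Let_def)
    also have "\<dots> = \<kappa> (S, - X)"
    proof (rule the_equality)
      have n: "\<ominus>\<^bsub>Z\<^esub> \<kappa> (0, Y) = \<kappa> (0, - Y)" for Y using \<kappa>_neg [of "(0, Y)"] by (simp add: gset_iff zero_lset)
      show "\<exists>x\<in>?m. \<exists>y\<in>?l. \<kappa> (S, X) = x \<oplus>\<^bsub>Z\<^esub> y \<and> \<kappa> (S, - X) = (\<ominus>\<^bsub>Z\<^esub> x) \<oplus>\<^bsub>Z\<^esub> y"
      proof (intro bexI conjI)
        show "\<kappa> (S, X) = \<kappa> (0, X) \<oplus>\<^bsub>Z\<^esub> \<kappa> (S, 0)" "\<kappa> (S, - X) = (\<ominus>\<^bsub>Z\<^esub> \<kappa> (0, X)) \<oplus>\<^bsub>Z\<^esub> \<kappa> (S, 0)"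
          by (simp_all add: \<kappa>_ops n)
        show "\<kappa> (0, X) \<in> ?m" using m_coset_\<kappa> [of X] by (simp add: image_eqI [of _ _ X])
        show "\<kappa> (S, 0) \<in> ?l" unfolding lie_span_Z using S by simp
      qed
      \<comment> \<open>Injectivity of \<open>\<kappa>\<close> on the model makes the decomposition
        unique, so the definite description in \<open>assoc_qsh\<close> is justified.\<close>
      fix w assume "\<exists>x\<in>?m. \<exists>y\<in>?l. \<kappa> (S, X) = x \<oplus>\<^bsub>Z\<^esub> y \<and> w = (\<ominus>\<^bsub>Z\<^esub> x) \<oplus>\<^bsub>Z\<^esub> y"
      then obtain x y where x: "x \<in> ?m" and y: "y \<in> ?l" and xy: "\<kappa> (S, X) = x \<oplus>\<^bsub>Z\<^esub> y" "w = (\<ominus>\<^bsub>Z\<^esub> x) \<oplus>\<^bsub>Z\<^esub> y"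
        by blast
      obtain X' where X': "x = \<kappa> (0, X')" using x m_coset_\<kappa> by auto
      obtain S' where S': "S' \<in> lset A a" "y = \<kappa> (S', 0)" using y unfolding lie_span_Z by blast
      have "\<kappa> (S, X) = \<kappa> (S', X')" using xy(1) by (simp add: X' S' \<kappa>_ops)
      then have "(S, X) = (S', X')" using \<kappa>_inj S S' gset_iff by metis
      then show "w = \<kappa> (S, - X)" using xy(2) by (simp add: X' S' n \<kappa>_ops)
    qed
    finally show ?thesis .
  qed
  ultimately show ?thesis unfolding canonical_def by (simp add: alg \<kappa>_lie)
qed

text \<open>The bottom left entry of \<open>\<psi>_bracket\<close>, to which only the multiple of
  \<open>\<tau>\<close> contributes.\<close>

lemma assoc_form: "form (assoc_qsh j a A d) (\<kappa> (0, X)) (\<kappa> (0, Y)) = - 2 * qRe (h X Y)"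
proof -
  have LF: "commutator (m_elem j a A X) (m_elem j a A Y) $ Last $ First = of_real (- 2 * qRe (h X Y))" for X Y
    using arg_cong [OF \<psi>_bracket [OF zero_lset zero_lset, of X Y], of "\<lambda>M. M $ Last $ First"]
    by (simp only: \<psi>_m vector_add_component vector_scaleR_component \<tau>_LF) (simp add: \<psi>_def sblk_LF quat_eq_iff quat_mult_sel)
  have inj: "m_coset j a A d X = m_coset j a A d Y \<longleftrightarrow> X = Y" for X Y
    using \<kappa>_inj [of "(0, X)" "(0, Y)"] by (simp add: m_coset_\<kappa> gset_iff zero_lset)
  have "form (assoc_qsh j a A d) (m_coset j a A d X) (m_coset j a A d Y) = (THE r. (of_real r :: quat) = of_real (- 2 * qRe (h X Y)))"
    by (simp add: assoc_qsh_def Let_def LF inj)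
  also have "\<dots> = - 2 * qRe (h X Y)" by (rule the_equality) (simp_all only: of_real_eq_iff)
  finally show ?thesis by (simp add: m_coset_\<kappa>)
qed

lemma assoc_qstr: "qstr (assoc_qsh j a A d)
  = {J \<in> extensional (range (\<lambda>X. \<kappa> (0, X))). \<exists>q\<in>sp1. \<forall>X. J (\<kappa> (0, X)) = \<kappa> (0, X \<cdot> q)}"
  by (simp add: assoc_qsh_def Let_def m_coset_\<kappa> [abs_def])

lemmas assoc_tila = canonical_qsh [OF assoc_canonical assoc_qstr assoc_form]

lemma m_elem_centralizer: "m_elem j a A X \<in> centralizer j (tau a A d)"
  using \<psi>_W [of "(0, X)"] by (simp add: gset_iff zero_lset \<psi>_m W_def Cent_def \<tau>_def)

lemma assoc_m_part: "m_part (assoc_qsh j a A d)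
  = (\<lambda>M. span {tau a A d} +>\<^bsub>matrix_lie (centralizer j (tau a A d))\<^esub> M) ` range (m_elem j a A)"
proof -
  have "m_part (assoc_qsh j a A d) = range (m_coset j a A d)"
    using assoc_tila(4) by (simp add: m_coset_\<kappa> [abs_def])
  then show ?thesis by (simp add: m_coset_def [abs_def] image_image)
qed

end

section \<open>Conjugacy classes\<close>

text \<open>Inversion of \<open>s0 + T s1\<close> in the quaternions with a central square root
  \<open>T\<close> of \<open>d\<close> adjoined. Multiplied by \<open>qcnj s0 + T qcnj s1\<close> it
  becomes \<open>P + T M\<close> with real \<open>P\<close> and \<open>M\<close>, whose inverse is
  \<open>P - T M\<close> divided by \<open>P^2 - d M^2\<close>.\<close>

lemma double_number_inverse:
  fixes s0 s1 :: quat and d :: real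
  defines "P \<equiv> (norm s0)\<^sup>2 + d * (norm s1)\<^sup>2" and "M \<equiv> 2 * inner s0 s1"
  assumes "P\<^sup>2 \<noteq> d * M\<^sup>2"
  shows "\<exists>r0 r1. s0 * r0 + d *\<^sub>R (s1 * r1) = 1 \<and> s0 * r1 + s1 * r0 = 0
    \<and> r0 * s0 + d *\<^sub>R (r1 * s1) = 1 \<and> r0 * s1 + r1 * s0 = 0"
proof -
  define \<Delta> where "\<Delta> = P\<^sup>2 - d * M\<^sup>2"
  have \<Delta>: "\<Delta> \<noteq> 0" using assms by (simp add: \<Delta>_def)
  have n: "s0 * qcnj s0 + d *\<^sub>R (s1 * qcnj s1) = P *\<^sub>R 1" "qcnj s0 * s0 + d *\<^sub>R (qcnj s1 * s1) = P *\<^sub>R 1"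
    by (simp_all add: P_def qcnj_mult_self of_real_def scaleR_add_left)
  have i: "s0 * qcnj s1 + s1 * qcnj s0 = M *\<^sub>R 1" "qcnj s0 * s1 + qcnj s1 * s0 = M *\<^sub>R 1"
    by (simp_all add: M_def qcomp inner_quat_def algebra_simps)
  define r0 where "r0 = P *\<^sub>R qcnj s0 - (d * M) *\<^sub>R qcnj s1"
  define r1 where "r1 = P *\<^sub>R qcnj s1 - M *\<^sub>R qcnj s0"
  have "s0 * r0 + d *\<^sub>R (s1 * r1) = P *\<^sub>R (s0 * qcnj s0 + d *\<^sub>R (s1 * qcnj s1)) - (d * M) *\<^sub>R (s0 * qcnj s1 + s1 * qcnj s0)"
    "r0 * s0 + d *\<^sub>R (r1 * s1) = P *\<^sub>R (qcnj s0 * s0 + d *\<^sub>R (qcnj s1 * s1)) - (d * M) *\<^sub>R (qcnj s0 * s1 + qcnj s1 * s0)"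
    "s0 * r1 + s1 * r0 = P *\<^sub>R (s0 * qcnj s1 + s1 * qcnj s0) - M *\<^sub>R (s0 * qcnj s0 + d *\<^sub>R (s1 * qcnj s1))"
    "r0 * s1 + r1 * s0 = P *\<^sub>R (qcnj s0 * s1 + qcnj s1 * s0) - M *\<^sub>R (qcnj s0 * s0 + d *\<^sub>R (qcnj s1 * s1))"
    by (simp_all add: r0_def r1_def algebra_simps)
  then have r: "s0 * r0 + d *\<^sub>R (s1 * r1) = \<Delta> *\<^sub>R 1" "r0 * s0 + d *\<^sub>R (r1 * s1) = \<Delta> *\<^sub>R 1"
    "s0 * r1 + s1 * r0 = 0" "r0 * s1 + r1 * s0 = 0"
    unfolding n i by (simp_all add: \<Delta>_def power2_eq_square algebra_simps)
  have "s0 * (r0 /\<^sub>R \<Delta>) + d *\<^sub>R (s1 * (r1 /\<^sub>R \<Delta>)) = (s0 * r0 + d *\<^sub>R (s1 * r1)) /\<^sub>R \<Delta>"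
    "(r0 /\<^sub>R \<Delta>) * s0 + d *\<^sub>R ((r1 /\<^sub>R \<Delta>) * s1) = (r0 * s0 + d *\<^sub>R (r1 * s1)) /\<^sub>R \<Delta>"
    "s0 * (r1 /\<^sub>R \<Delta>) + s1 * (r0 /\<^sub>R \<Delta>) = (s0 * r1 + s1 * r0) /\<^sub>R \<Delta>"
    "(r0 /\<^sub>R \<Delta>) * s1 + (r1 /\<^sub>R \<Delta>) * s0 = (r0 * s1 + r1 * s0) /\<^sub>R \<Delta>"
    by (simp_all add: scaleR_add_right)
  then show ?thesis unfolding r using \<Delta> by (intro exI [of _ "r0 /\<^sub>R \<Delta>"] exI [of _ "r1 /\<^sub>R \<Delta>"]) simp
qed

text \<open>If every unit \<open>q\<close> failed, then for \<open>d > 0\<close> all units would be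
  among two quaternions. For \<open>d \<le> 0\<close> the square on the left could not be positive,
  and comparing \<open>q\<close> with \<open>- q\<close> would force \<open>\<alpha> = 0\<close>,
  then \<open>d = 0\<close> or \<open>\<beta> = 0\<close>, and finally \<open>1 = 0\<close>.\<close>

lemma generic_unit:
  fixes \<alpha> \<beta> :: quat and d :: real
  shows "\<exists>q. norm q = 1 \<and> ((norm (q - \<alpha>))\<^sup>2 + d * (norm \<beta>)\<^sup>2)\<^sup>2 \<noteq> d * (2 * inner (q - \<alpha>) \<beta>)\<^sup>2"
proof (rule ccontr)
  assume "\<not> ?thesis"
  then have bad: "((norm (q - \<alpha>))\<^sup>2 + d * (norm \<beta>)\<^sup>2)\<^sup>2 = d * (2 * inner (q - \<alpha>) \<beta>)\<^sup>2" if "norm q = 1" for q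
    using that by blast
  show False
  proof (cases "d > 0")
    case True
    define c where "c = sqrt d"
    have c: "d = c * c" using True by (simp add: c_def)
    have "q = \<alpha> + c *\<^sub>R \<beta> \<or> q = \<alpha> - c *\<^sub>R \<beta>" if "norm q = 1" for q
    proof -
      \<comment> \<open>For positive \<open>d\<close> the two real square roots of \<open>d\<close>
        can be substituted for \<open>T\<close>, and the quantity is a product of two squared
        norms.\<close>
      have "((norm (q - \<alpha>))\<^sup>2 + d * (norm \<beta>)\<^sup>2)\<^sup>2 - d * (2 * inner (q - \<alpha>) \<beta>)\<^sup>2
        = (norm (q - \<alpha> - c *\<^sub>R \<beta>))\<^sup>2 * (norm (q - \<alpha> + c *\<^sub>R \<beta>))\<^sup>2"
        unfolding power2_norm_eq_inner c
        by (simp add: inner_add_left inner_add_right inner_diff_left inner_diff_right power2_eq_square algebra_simps inner_commute)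
      then have "norm (q - \<alpha> - c *\<^sub>R \<beta>) = 0 \<or> norm (q - \<alpha> + c *\<^sub>R \<beta>) = 0" using bad [OF that] by simp
      then show ?thesis by (auto simp: algebra_simps)
    qed
    from this [of 1] this [of "-1"] this [of qi] show False
      by (auto simp: quat_eq_iff norm_quat_def)
  next
    case False
    have p: "1 + (norm \<alpha>)\<^sup>2 + d * (norm \<beta>)\<^sup>2 = 2 * inner q \<alpha>" "d = 0 \<or> inner (q - \<alpha>) \<beta> = 0" if "norm q = 1" for q
    proof -
      have "((norm (q - \<alpha>))\<^sup>2 + d * (norm \<beta>)\<^sup>2)\<^sup>2 \<le> 0"
        unfolding bad [OF that] using False by (simp add: mult_nonpos_nonneg)
      then have z: "(norm (q - \<alpha>))\<^sup>2 + d * (norm \<beta>)\<^sup>2 = 0" by simp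
      have "inner q q = 1" using that by (simp add: norm_eq_1)
      then show "1 + (norm \<alpha>)\<^sup>2 + d * (norm \<beta>)\<^sup>2 = 2 * inner q \<alpha>"
        using z by (simp add: power2_norm_eq_inner inner_diff_left inner_diff_right inner_commute)
      show "d = 0 \<or> inner (q - \<alpha>) \<beta> = 0" using bad [OF that] z by simp
    qed
    have u: "norm (1 :: quat) = 1" "norm qi = 1" "norm qj = 1" "norm qk = 1" by (simp_all add: norm_quat_def)
    have "inner q \<alpha> = 0" if "norm q = 1" for q using p(1) [of q] p(1) [of "- q"] that by simp
    from this [OF u(1)] this [OF u(2)] this [OF u(3)] this [OF u(4)]
    have \<alpha>: "\<alpha> = 0" by (simp add: inner_quat_def quat_eq_iff)
    show False
    proof (cases "d = 0")
      case True
      then show False using p(1) [OF u(1)] by (simp add: \<alpha>)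
    next
      case False
      then have "inner q \<beta> = 0" if "norm q = 1" for q using p(2) [OF that] by (simp add: \<alpha>)
      from this [OF u(1)] this [OF u(2)] this [OF u(3)] this [OF u(4)]
      have "\<beta> = 0" by (simp add: inner_quat_def quat_eq_iff)
      then show False using p(1) [OF u(1)] by (simp add: \<alpha>)
    qed
  qed
qed

text \<open>With the values \<open>F(U, T V) + T F(U, V)\<close>, where \<open>T\<close> is regarded as a central square root of \<open>d\<close>
  adjoined to the quaternions, \<open>F\<close> becomes a hermitian form, and \<open>S\<close> is the quasi-reflection
  \<open>x \<mapsto> x - u \<sigma>' (u, x)\<close> with \<open>u = e - e' q\<close> and \<open>\<sigma>'\<close> inverse to \<open>(u, e)\<close>. The unit \<open>q\<close> is chosen
  such that \<open>(u, e)\<close> is invertible.\<close>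

lemma quasi_reflection:
  fixes F T :: "quat^'m^'m" and e e' :: "quat^'m"
  assumes F: "\<And>U V. hf F U V = - qcnj (hf F V U)" and FT: "\<And>U V. hf F (T *v U) V = - hf F U (T *v V)"
    and TT: "\<And>U. T *v (T *v U) = d *\<^sub>R U"
    and e: "hf F e e = 0" "hf F e (T *v e) = 1" and e': "hf F e' e' = 0" "hf F e' (T *v e') = 1"
  shows "\<exists>S q. norm q = 1 \<and> S *v e = e' \<cdot> q \<and> S ** T = T ** S \<and> (\<forall>U V. hf F (S *v U) (S *v V) = hf F U V)"
proof -
  define \<alpha> where "\<alpha> = hf F e' (T *v e)"
  define \<beta> where "\<beta> = hf F e' e"
  obtain q where q: "norm q = 1"
    "((norm (q - \<alpha>))\<^sup>2 + d * (norm \<beta>)\<^sup>2)\<^sup>2 \<noteq> d * (2 * inner (q - \<alpha>) \<beta>)\<^sup>2"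
    using generic_unit by blast
  define u where "u = e - e' \<cdot> q"
  define s0 where "s0 = hf F u (T *v e)"
  define s1 where "s1 = hf F u e"
  have s: "s0 = qcnj q * (q - \<alpha>)" "s1 = - (qcnj q * \<beta>)"
    by (simp_all add: s0_def s1_def u_def hf_add hf_scale e \<alpha>_def \<beta>_def right_diff_distrib unit_cancel q(1))
  have nq: "norm (qcnj q) = 1"
    using q(1) by (simp add: norm_quat_def)
  have ns: "norm s0 = norm (q - \<alpha>)" "norm s1 = norm \<beta>" by (simp_all add: s norm_mult nq)
  have "inner (qcnj q * x) (qcnj q * y) = qRe (qcnj x * (q * qcnj q) * y)" for x y
    by (simp add: inner_quat_def quat_mult_sel algebra_simps)
  then have in_q: "inner (qcnj q * x) (qcnj q * y) = inner x y" for x y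
    by (simp add: unit_cancel q(1)) (simp add: inner_quat_def quat_mult_sel)
  have "inner s0 s1 = - inner (q - \<alpha>) \<beta>" by (simp only: s inner_minus_right in_q)
  then have "((norm s0)\<^sup>2 + d * (norm s1)\<^sup>2)\<^sup>2 \<noteq> d * (2 * inner s0 s1)\<^sup>2"
    using q(2) by (simp add: ns)
  then obtain r0 r1 where r: "s0 * r0 + d *\<^sub>R (s1 * r1) = 1" "s0 * r1 + s1 * r0 = 0"
    "r0 * s0 + d *\<^sub>R (r1 * s1) = 1" "r0 * s1 + r1 * s0 = 0"
    using double_number_inverse by blast
  \<comment> \<open>\<open>k0 x + T (k1 x)\<close> is \<open>\<sigma>' (u, x)\<close> with
    \<open>\<sigma>' = r0 + T r1\<close>.\<close>
  define k0 where "k0 x = r0 * hf F u (T *v x) + d *\<^sub>R (r1 * hf F u x)" for x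
  define k1 where "k1 x = r0 * hf F u x + r1 * hf F u (T *v x)" for x
  have "\<exists>S. \<forall>x. x - u \<cdot> k0 x - (T *v u) \<cdot> k1 x = S *v x"
    by (rule Hlinear_matrix) (simp_all add: k0_def k1_def matrix_vector_right_distrib hf_add hf_scale mv_vscale
        vscale_distrib vscale_assoc scaleR_add_right algebra_simps)
  then obtain S where S: "\<And>x. S *v x = x - u \<cdot> k0 x - (T *v u) \<cdot> k1 x" by metis
  have ke: "k0 e = 1" "k1 e = 0" using r by (simp_all add: k0_def k1_def s0_def s1_def)
  have Se: "S *v e = e' \<cdot> q" by (simp add: S ke) (simp add: u_def)
  have kT: "k0 (T *v x) = d *\<^sub>R k1 x" "k1 (T *v x) = k0 x" for x
    by (simp_all add: k0_def k1_def TT hf_scaleR scaleR_add_right)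
  have ST: "S ** T = T ** S"
    by (rule matrix_eqI) (simp add: S kT TT mv_vscale vscale_scaleR matrix_vector_mult_diff_distrib flip: matrix_vector_mul_assoc)
  have ee: "hf F (e' \<cdot> q) (e' \<cdot> q) = 0" "hf F (e' \<cdot> q) (T *v (e' \<cdot> q)) = 1"
    by (simp_all add: hf_scale mv_vscale e' unit_cancel q(1))
  have eu: "hf F e (T *v u) = qcnj s0" "hf F e u = - qcnj s1"
  proof -
    have "hf F e (T *v u) = - hf F (T *v e) u" by (simp add: FT)
    then show "hf F e (T *v u) = qcnj s0" by (simp add: F [of "T *v e" u] s0_def)
    show "hf F e u = - qcnj s1" unfolding s1_def by (rule F)
  qed
  \<comment> \<open>The extended form has the same value at \<open>e\<close> and at
    \<open>e' \<cdot> q\<close>, so its value at \<open>(u, u)\<close> is the sum of those at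
    \<open>(u, e)\<close> and \<open>(e, u)\<close>. This makes the quasi-reflection an
    isometry.\<close>
  have uu: "hf F u (T *v u) = s0 + qcnj s0" "hf F u u = s1 - qcnj s1"
  proof -
    have m: "T *v u = T *v e - T *v (e' \<cdot> q)" by (simp add: u_def matrix_vector_mult_diff_distrib)
    have "hf F (e' \<cdot> q) (T *v u) = hf F e (T *v u) - hf F u (T *v u)" "hf F (e' \<cdot> q) u = hf F e u - hf F u u"
      by (simp_all add: u_def hf_add)
    moreover have "hf F (e' \<cdot> q) (T *v u) = hf F e (T *v e) - s0 - hf F (e' \<cdot> q) (T *v (e' \<cdot> q))"
      "hf F (e' \<cdot> q) u = hf F e e - s1 - hf F (e' \<cdot> q) (e' \<cdot> q)"
      unfolding s0_def s1_def m by (simp_all add: u_def hf_add)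
    ultimately show "hf F u (T *v u) = s0 + qcnj s0" "hf F u u = s1 - qcnj s1"
      unfolding eu e ee by (simp_all add: algebra_simps)
  qed
  have Tu: "hf F (T *v u) u = - (s0 + qcnj s0)" "hf F (T *v u) (T *v u) = - d *\<^sub>R (s1 - qcnj s1)"
    by (simp_all add: FT uu TT hf_scaleR)
  have Y: "hf F u (T *v y) = s0 * k0 y + d *\<^sub>R (s1 * k1 y)" "hf F u y = s0 * k1 y + s1 * k0 y" for y
  proof -
    have "s0 * k0 y + d *\<^sub>R (s1 * k1 y) = (s0 * r0 + d *\<^sub>R (s1 * r1)) * hf F u (T *v y) + d *\<^sub>R ((s0 * r1 + s1 * r0) * hf F u y)"
      "s0 * k1 y + s1 * k0 y = (s0 * r0 + d *\<^sub>R (s1 * r1)) * hf F u y + (s0 * r1 + s1 * r0) * hf F u (T *v y)"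
      by (simp_all add: k0_def k1_def algebra_simps)
    then show "hf F u (T *v y) = s0 * k0 y + d *\<^sub>R (s1 * k1 y)" "hf F u y = s0 * k1 y + s1 * k0 y"
      by (simp_all add: r)
  qed
  have "hf F (S *v x) (S *v y) = hf F x y" for x y
  proof -
    have "hf F x (T *v u) = - hf F (T *v x) u" by (simp add: FT)
    then have "hf F x (T *v u) = qcnj (hf F u (T *v x))" by (simp add: F [of "T *v x" u])
    then have X: "hf F x (T *v u) = qcnj (k0 x) * qcnj s0 + d *\<^sub>R (qcnj (k1 x) * qcnj s1)"
      by (simp only: Y(1)) (simp add: qcnj_mult)
    have X': "hf F x u = - (qcnj (k1 x) * qcnj s0 + qcnj (k0 x) * qcnj s1)"
      unfolding F [of x u] Y(2) by (simp add: qcnj_mult)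
    have Ty: "hf F (T *v u) y = - (s0 * k0 y + d *\<^sub>R (s1 * k1 y))" by (simp only: FT Y(1))
    show ?thesis
      unfolding S hf_add hf_scale X X' Y(2) [of y] Ty uu Tu by (simp add: algebra_simps)
  qed
  then show ?thesis using q(1) Se ST by blast
qed

section \<open>The group SO*(2n+4) and conjugacy of oriented lines\<close>

context skew_form begin

abbreviation Fh :: "quat^('n ext) \<Rightarrow> quat^('n ext) \<Rightarrow> quat" where "Fh \<equiv> hf (F_mat j)"

lemma Fh_bvec: "Fh (bvec x Z y) (bvec x' Z' y') = qcnj x * y' + h Z Z' - qcnj y * x'"
  by (simp add: hf_def [of "F_mat j"] F_mat_def block_mv sum_ext hf_def)

lemma Fh_skew: "Fh U V = - qcnj (Fh V U)"
proof -
  obtain x Z y x' Z' y' where "U = bvec x Z y" "V = bvec x' Z' y'" using bvec_exists by metis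
  then show ?thesis by (simp add: Fh_bvec qcnj_mult h_cnj)
qed

lemma SO_star_ext_iff: "g \<in> SO_star_ext j \<longleftrightarrow> (\<forall>U V. Fh (g *v U) (g *v V) = Fh U V)"
proof -
  have e: "hf (adj g ** F_mat j ** g) U V = Fh (g *v U) (g *v V)" for U V
    unfolding hf_mult [of "adj g ** F_mat j"] by (rule hf_adj_mult)
  show ?thesis unfolding SO_star_ext_def by (auto simp flip: e intro: hf_eqI)
qed

lemma SO_star_ext_inv:
  assumes g: "g \<in> SO_star_ext j"
  shows "g ** matrix_inv g = mat 1" "matrix_inv g ** g = mat 1" "matrix_inv g \<in> SO_star_ext j"
proof -
  have "U = 0" if "g *v U = 0" for U
  proof -
    obtain x Z y where U: "U = bvec x Z y" using bvec_exists by blast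
    have "Fh U V = 0" for V using g that by (metis SO_star_ext_iff hf_0(1))
    then have 0: "qcnj x * y' + h Z Z' - qcnj y * x' = 0" for x' Z' y' by (metis U Fh_bvec)
    have "Z = 0" by (rule h_nondeg) (use 0 [of 0 _ 0] in simp)
    moreover have "x = 0" "y = 0" using 0 [of 1 0 0] 0 [of 0 0 1] by simp_all
    ultimately show "U = 0" by (simp add: U bvec_ops)
  qed
  then have "invertible g" by (simp add: invertible_iff_inj)
  note i = matrix_inv_quat [OF this]
  show "g ** matrix_inv g = mat 1" "matrix_inv g ** g = mat 1" by (rule i)+
  have "g *v (matrix_inv g *v U) = U" for U by (simp add: matrix_vector_mul_assoc i)
  then show "matrix_inv g \<in> SO_star_ext j" using g unfolding SO_star_ext_iff by metis
qed

text \<open>Conjugation by \<open>k\<close> on the first line agrees with conjugation by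
  \<open>k g^(-1)\<close> on the second up to the factor \<open>s\<close>. Being positive,
  \<open>s\<close> preserves the line as well as the ray.\<close>

lemma conj_class_eqI:
  assumes g: "g \<in> SO_star_ext j" and s: "s > 0" and eq: "g ** \<tau>1 = s *\<^sub>R (\<tau>2 ** g)"
  shows "conj_class j (oriented_line \<tau>1) \<subseteq> conj_class j (oriented_line \<tau>2)"
proof
  fix P assume "P \<in> conj_class j (oriented_line \<tau>1)"
  then obtain k where k: "k \<in> SO_star_ext j" "P = (conj_by k ` span {\<tau>1}, conj_by k ` {r *\<^sub>R \<tau>1 | r. r > 0})"
    by (auto simp: conj_class_def oriented_line_def)
  define g' where "g' = matrix_inv g"
  have g': "g ** g' = mat 1" "g' ** g = mat 1" "g' \<in> SO_star_ext j" using SO_star_ext_inv [OF g] by (simp_all add: g'_def)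
  define l where "l = k ** g'"
  have l: "l \<in> SO_star_ext j" using k(1) g'(3) by (simp add: l_def SO_star_ext_iff flip: matrix_vector_mul_assoc)
  have "matrix_inv l = g ** matrix_inv k"
  proof -
    have "l ** (g ** matrix_inv k) = mat 1"
      unfolding l_def using g'(2) SO_star_ext_inv(1) [OF k(1)]
      by (metis matrix_mul_assoc matrix_mul_rid)
    then have "matrix_inv l ** (l ** (g ** matrix_inv k)) = matrix_inv l" by simp
    then show ?thesis using SO_star_ext_inv(2) [OF l] by (simp add: matrix_mul_assoc)
  qed
  then have cl: "conj_by l M = conj_by k (g' ** M ** g)" for M by (simp add: conj_by_def l_def matrix_mul_assoc)
  have "g' ** \<tau>2 ** g = g' ** (\<tau>2 ** g)" by (simp add: matrix_mul_assoc)
  also have "\<dots> = (1/s) *\<^sub>R (g' ** (s *\<^sub>R (\<tau>2 ** g)))" using s by (simp add: matrix_scaleR_mult)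
  also have "\<dots> = (1/s) *\<^sub>R \<tau>1" unfolding eq [symmetric] by (simp add: matrix_mul_assoc g')
  finally have c2: "g' ** (r *\<^sub>R \<tau>2) ** g = (r / s) *\<^sub>R \<tau>1" for r by (simp add: matrix_scaleR_mult)
  have "conj_by k ` {r *\<^sub>R \<tau>1 | r. Q r} = conj_by l ` {r *\<^sub>R \<tau>2 | r. Q r}" if Q: "\<And>r. Q (r * s) \<longleftrightarrow> Q r" for Q
  proof (intro equalityI subsetI)
    fix x assume "x \<in> conj_by k ` {r *\<^sub>R \<tau>1 | r. Q r}"
    then obtain r where "Q r" "x = conj_by k (r *\<^sub>R \<tau>1)" by blast
    then have "x = conj_by l ((r * s) *\<^sub>R \<tau>2)" "Q (r * s)" using s Q by (simp_all add: cl c2)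
    then show "x \<in> conj_by l ` {r *\<^sub>R \<tau>2 | r. Q r}" by blast
  next
    fix x assume "x \<in> conj_by l ` {r *\<^sub>R \<tau>2 | r. Q r}"
    then obtain r where "Q r" "x = conj_by l (r *\<^sub>R \<tau>2)" by blast
    then have "x = conj_by k ((r / s) *\<^sub>R \<tau>1)" "Q (r / s)" using s Q [of "r / s"] by (simp_all add: cl c2)
    then show "x \<in> conj_by k ` {r *\<^sub>R \<tau>1 | r. Q r}" by blast
  qed
  from this [of "\<lambda>r. True"] this [of "\<lambda>r. r > 0"]
  have "P = (conj_by l ` span {\<tau>2}, conj_by l ` {r *\<^sub>R \<tau>2 | r. r > 0})"
    using s by (simp add: k(2) span_singleton full_SetCompr_eq zero_less_mult_iff)
  then show "P \<in> conj_class j (oriented_line \<tau>2)"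
    using l by (auto simp: conj_class_def oriented_line_def)
qed

text \<open>The oriented line of \<open>\<tau>2\<close> belongs to its own class, so it is a
  conjugate of the other one. Matching the rays makes the factor positive.\<close>

lemma conj_class_eqD:
  assumes "conj_class j (oriented_line \<tau>1) = conj_class j (oriented_line \<tau>2)"
  shows "\<exists>g\<in>SO_star_ext j. \<exists>s>0. g ** \<tau>1 = s *\<^sub>R (\<tau>2 ** g)"
proof -
  have i: "(mat 1 :: quat^('n ext)^('n ext)) \<in> SO_star_ext j" by (simp add: SO_star_ext_iff)
  have "matrix_inv (mat 1 :: quat^('n ext)^('n ext)) = mat 1" using SO_star_ext_inv(1) [OF i] by simp
  then have "conj_by (mat 1 :: quat^('n ext)^('n ext)) = (\<lambda>M. M)" by (simp add: conj_by_def fun_eq_iff)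
  then have "oriented_line \<tau>2 = (conj_by (mat 1) ` fst (oriented_line \<tau>2), conj_by (mat 1) ` snd (oriented_line \<tau>2))"
    by simp
  then have "oriented_line \<tau>2 \<in> conj_class j (oriented_line \<tau>2)"
    unfolding conj_class_def mem_Collect_eq by (intro exI [of _ "mat 1"] conjI i)
  then obtain g where g: "g \<in> SO_star_ext j"
    "oriented_line \<tau>2 = (conj_by g ` fst (oriented_line \<tau>1), conj_by g ` snd (oriented_line \<tau>1))"
    unfolding assms [symmetric] unfolding conj_class_def mem_Collect_eq by (elim exE conjE) (rule that, assumption+)
  have "\<tau>1 \<in> snd (oriented_line \<tau>1)" by (auto simp: oriented_line_def intro!: exI [of _ 1])
  then have "conj_by g \<tau>1 \<in> snd (oriented_line \<tau>2)" unfolding g(2) by simp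
  then obtain s where s: "s > 0" "conj_by g \<tau>1 = s *\<^sub>R \<tau>2" by (auto simp: oriented_line_def)
  have "g ** \<tau>1 = conj_by g \<tau>1 ** g"
    using SO_star_ext_inv(2) [OF g(1)] by (simp add: conj_by_def flip: matrix_mul_assoc)
  then have "g ** \<tau>1 = s *\<^sub>R (\<tau>2 ** g)" by (simp add: s(2) matrix_scaleR_mult)
  then show ?thesis using g(1) s(1) by blast
qed

text \<open>Conjugacy of pairs under SO*(2n) and Sp(1) up to a positive factor, the common yardstick
  for families and for conjugacy classes.\<close>

definition equivalent :: "quat^'n^'n \<Rightarrow> quat \<Rightarrow> quat^'n^'n \<Rightarrow> quat \<Rightarrow> bool" where
  "equivalent A1 a1 A2 a2 \<longleftrightarrow> (\<exists>g p s. isometry g \<and> norm p = 1 \<and> s > 0 \<and>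
     A1 ** g = s *\<^sub>R (g ** A2) \<and> a1 * p = s *\<^sub>R (p * a2))"

lemma isometry_one: "isometry (mat 1)"
  by (simp add: isometry_def)

text \<open>The form pairs the first with the last coordinate, so the factors \<open>t\<close> and
  \<open>1/t\<close> compensate, and so do the unit and its conjugate.\<close>

lemma SO_star_ext_block:
  assumes g: "isometry g" and p: "norm p = 1" and t: "t > 0"
  shows "\<exists>G\<in>SO_star_ext j. \<forall>x Z y. G *v bvec x Z y = bvec (t *\<^sub>R (p * x)) (g *v Z) ((1/t) *\<^sub>R (p * y))"
proof -
  define f where "f V = bvec (t *\<^sub>R (p * V $ First)) (g *v (\<chi> i. V $ Mid i)) ((1/t) *\<^sub>R (p * V $ Last))" for V :: "quat^('n ext)"
  have c: "(\<chi> i. bvec x Z y $ Mid i) = Z" for x y and Z :: "quat^'n" by (simp add: vec_eq_iff)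
  have f: "f (bvec x Z y) = bvec (t *\<^sub>R (p * x)) (g *v Z) ((1/t) *\<^sub>R (p * y))" for x Z y
    by (simp add: f_def c)
  have "f (U + V) = f U + f V" for U V
  proof -
    obtain x Z y x' Z' y' where "U = bvec x Z y" "V = bvec x' Z' y'" using bvec_exists by metis
    then show ?thesis by (simp add: bvec_ops(1) f distrib_left scaleR_add_right matrix_vector_right_distrib)
  qed
  moreover have "f (U \<cdot> q) = f U \<cdot> q" for U q
  proof -
    obtain x Z y where "U = bvec x Z y" using bvec_exists by metis
    then show ?thesis by (simp add: bvec_ops(5) f mult.assoc mv_vscale)
  qed
  ultimately obtain G where G: "\<And>V. f V = G *v V" using Hlinear_matrix [of f] by blast
  have "Fh (G *v U) (G *v V) = Fh U V" for U V
  proof -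
    obtain x Z y x' Z' y' where "U = bvec x Z y" "V = bvec x' Z' y'" using bvec_exists by metis
    then show ?thesis using g t
      by (simp add: f Fh_bvec isometry_def qcnj_mult mult.assoc unit_cancel p flip: G)
  qed
  then have "G \<in> SO_star_ext j" by (simp add: SO_star_ext_iff)
  moreover have "\<forall>x Z y. G *v bvec x Z y = bvec (t *\<^sub>R (p * x)) (g *v Z) ((1/t) *\<^sub>R (p * y))"
    using f by (simp flip: G)
  ultimately show ?thesis by blast
qed

end

lemma (in symmetric_pair) tau_mv: "tau a A d *v bvec x U y = bvec (a * x + d *\<^sub>R y) (A *v U) (x + a * y)"
  using \<tau>_mv by (simp add: \<tau>_def)

lemma (in symmetric_pair) scaled: "symmetric_pair j (r *\<^sub>R A) (r *\<^sub>R a) (r\<^sup>2 * d)"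
  by unfold_locales (simp_all add: so_star_closed A a bop_scaleR bop_add square power2_eq_square)

text \<open>If \<open>a\<close> does not vanish, replacing \<open>X\<close> by \<open>X q\<close> in the matrix equation gives \<open>A X (q a - a q) = 0\<close>.\<close>

lemma (in symmetric_pair) a_nonzero: assumes "a \<noteq> 0" shows "A = 0"
proof -
  define r where "r = (norm a)\<^sup>2"
  have "- (a * a) = of_real r" using qcnj_mult_self(1) [of a] a unfolding r_def [symmetric] by (simp add: sp1_cnj)
  then have aa: "a * a = - of_real r" by (metis minus_minus)
  have eq: "A *v (A *v X) - 2 *\<^sub>R ((A *v X) \<cdot> a) = (d + r) *\<^sub>R X" for X
    using square [of X] by (simp add: bop_def vscale_distrib mv_vscale vscale_assoc vscale_scaleR scaleR_2 aa
        matrix_vector_mult_diff_distrib scaleR_add_left algebra_simps)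
  have "\<exists>q. q * a - a * q \<noteq> 0"
  proof (rule ccontr)
    assume "\<not> ?thesis"
    then have "q * a - a * q = 0" for q by blast
    from this [of qi] this [of qj] this [of qk] have "qI a = 0 \<and> qJ a = 0 \<and> qK a = 0"
      by (simp add: qcomp)
    then show False using a assms by (simp add: sp1_def quat_eq_iff)
  qed
  then obtain q where q: "q * a - a * q \<noteq> 0" by blast
  have "A *v X = 0" for X
  proof -
    have 1: "(A *v (A *v X)) \<cdot> q - 2 *\<^sub>R ((A *v X) \<cdot> (q * a)) = (d + r) *\<^sub>R (X \<cdot> q)"
      using eq [of "X \<cdot> q"] by (simp add: mv_vscale vscale_assoc)
    have 2: "(A *v (A *v X)) \<cdot> q - 2 *\<^sub>R ((A *v X) \<cdot> (a * q)) = (d + r) *\<^sub>R (X \<cdot> q)"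
      using arg_cong [OF eq [of X], of "\<lambda>Y. Y \<cdot> q"] by (simp add: vscale_distrib vscale_assoc vscale_scaleR)
    have "2 *\<^sub>R ((A *v X) \<cdot> (q * a)) = 2 *\<^sub>R ((A *v X) \<cdot> (a * q))"
      using trans [OF 1 2 [symmetric]] by (simp only: diff_conv_add_uminus add_left_cancel neg_equal_iff_equal)
    then have "(A *v X) \<cdot> (q * a - a * q) = 0" by (simp add: vscale_distrib)
    then show ?thesis using q by simp
  qed
  then show ?thesis by (intro matrix_eqI) simp
qed

context skew_form begin

text \<open>Both quaternions are conjugate to positive multiples of i.\<close>

lemma sp1_conjugate:
  assumes "a \<in> sp1" "a \<noteq> 0" "b \<in> sp1" "b \<noteq> 0"
  shows "\<exists>p s. norm p = 1 \<and> s > 0 \<and> a * p = s *\<^sub>R (p * b)"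
proof -
  have norm1: "\<exists>p s. norm p = 1 \<and> s > 0 \<and> c * p = s *\<^sub>R (p * qi)" if c: "c \<in> sp1" "c \<noteq> 0" for c :: quat
  proof -
    obtain p where p: "qcnj p * c * p = qi" using conj_to_qi [OF c] by blast
    have "qi \<noteq> 0" by (simp add: quat_eq_iff)
    then have p0: "norm p \<noteq> 0" using p by auto
    have "p * qi = (p * qcnj p) * (c * p)" by (simp add: mult.assoc flip: p)
    also have "\<dots> = (norm p)\<^sup>2 *\<^sub>R (c * p)" by (simp only: qcnj_mult_self of_real_mult_quat)
    finally have "c * p = (1 / (norm p)\<^sup>2) *\<^sub>R (p * qi)" using p0 by simp
    then show ?thesis using p0
      by (intro exI [of _ "p /\<^sub>R norm p"] exI [of _ "1 / (norm p)\<^sup>2"]) (simp add: mult.commute)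
  qed
  obtain p s where p: "norm p = 1" "s > 0" "a * p = s *\<^sub>R (p * qi)" using norm1 assms by blast
  obtain q r where q: "norm q = 1" "r > 0" "b * q = r *\<^sub>R (q * qi)" using norm1 assms by blast
  have "qcnj q * (b * q) * qcnj q = r *\<^sub>R (qi * qcnj q)" by (simp add: q(3) unit_cancel q(1))
  then have "qcnj q * b = r *\<^sub>R (qi * qcnj q)" by (simp add: mult.assoc unit_cancel q(1))
  then have "qi * qcnj q = (1/r) *\<^sub>R (qcnj q * b)" using q(2) by simp
  then have "a * (p * qcnj q) = (s / r) *\<^sub>R (p * qcnj q * b)"
    by (simp add: p(3) mult.assoc flip: mult.assoc [of a])
  moreover have "norm (qcnj q) = norm q" by (simp add: norm_quat_def)
  ultimately show ?thesis using p q
    by (intro exI [of _ "p * qcnj q"] exI [of _ "s / r"]) (simp add: norm_mult)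
qed

lemma intertwiner_equivalent:
  assumes p1: "symmetric_pair j A1 a1 d1" and p2: "symmetric_pair j A2 a2 d2"
    and G: "G \<in> SO_star_ext j" and eq: "G ** tau a2 A2 d2 = tau a1 A1 d1 ** G"
  shows "equivalent A1 a1 A2 a2"
proof -
  interpret T1: symmetric_pair j A1 a1 d1 by (rule p1)
  interpret T2: symmetric_pair j A2 a2 d2 by (rule p2)
  let ?T1 = "tau a1 A1 d1" and ?T2 = "tau a2 A2 d2"
  have FG: "Fh (G *v U) (G *v V) = Fh U V" for U V using G by (simp add: SO_star_ext_iff)
  have GT: "G *v (?T2 *v V) = ?T1 *v (G *v V)" for V using eq by (simp add: matrix_vector_mul_assoc)
  obtain G' where G': "\<And>V. G *v (G' *v V) = V" "\<And>V. G' *v (G *v V) = V"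
    using SO_star_ext_inv(1,2) [OF G] by (metis matrix_vector_mul_assoc matrix_vector_mul_lid)
  have axis: "axis undefined 1 \<noteq> (0 :: quat^'n)" by (simp add: axis_eq_0_iff)
  \<comment> \<open>If \<open>a\<close> were nonzero, \<open>A\<close> would be zero. A scalar
    square would then be zero on the middle block, whereas its bottom left entry is
    \<open>2 a\<close>.\<close>
  have scalar: "a = 0" if "symmetric_pair j A a d" "\<And>V. tau a A d *v (tau a A d *v V) = c *\<^sub>R V" for A a d c
  proof (rule ccontr)
    assume a: "a \<noteq> 0"
    interpret T: symmetric_pair j A a d by (rule that(1))
    have "A = 0" using T.a_nonzero a by blast
    then have "c = 0" using that(2) [of "bvec 0 (axis undefined 1) 0"] axis unfolding T.tau_mv by (simp add: bvec_ops)
    then have "a + a = 0" using that(2) [of "bvec 1 0 0"] by (simp add: T.tau_mv bvec_ops)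
    then have "2 *\<^sub>R a = 0" by (simp add: scaleR_2)
    then show False using a by simp
  qed
  have sq: "tau 0 A d *v (tau 0 A d *v V) = d *\<^sub>R V" if "symmetric_pair j A 0 d" for A d V
  proof -
    interpret T: symmetric_pair j A 0 d by (rule that)
    obtain x Z y where "V = bvec x Z y" using bvec_exists by blast
    then show ?thesis using T.square by (simp add: T.tau_mv bvec_ops bop_def)
  qed
  show ?thesis
  proof (cases "a1 = 0 \<or> a2 = 0")
    case False
    obtain p s where "norm p = 1" "s > 0" "a1 * p = s *\<^sub>R (p * a2)"
      using sp1_conjugate [OF T1.a _ T2.a] False by blast
    moreover have "A1 = 0" "A2 = 0" using False T1.a_nonzero T2.a_nonzero by auto
    ultimately show ?thesis unfolding equivalent_def using isometry_one by (intro exI [of _ "mat 1"]) auto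
  next
    case True
    \<comment> \<open>Having a scalar square is invariant under conjugation, so one vanishing
      quaternion makes the other vanish.\<close>
    have a: "a1 = 0 \<and> a2 = 0"
    proof (cases "a1 = 0")
      case a1: True
      have "?T1 *v (?T1 *v V) = d1 *\<^sub>R V" for V using sq p1 a1 by simp
      then have "G *v (?T2 *v (?T2 *v V)) = G *v (d1 *\<^sub>R V)" for V by (simp add: GT mv_scaleR)
      then have "?T2 *v (?T2 *v V) = d1 *\<^sub>R V" for V by (metis G'(2))
      then show ?thesis using scalar [OF p2] a1 by blast
    next
      case False
      then have a2: "a2 = 0" using True by blast
      have "?T2 *v (?T2 *v V) = d2 *\<^sub>R V" for V using sq p2 a2 by simp
      then have "?T1 *v (?T1 *v (G *v V)) = d2 *\<^sub>R (G *v V)" for V by (simp add: mv_scaleR flip: GT)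
      then have "?T1 *v (?T1 *v V) = d2 *\<^sub>R V" for V by (metis G'(1))
      then show ?thesis using scalar [OF p1] a2 by blast
    qed
    then have a1: "a1 = 0" and a2: "a2 = 0" by auto
    have m1: "?T1 *v bvec x U y = bvec (d1 *\<^sub>R y) (A1 *v U) x" and m2: "?T2 *v bvec x U y = bvec (d2 *\<^sub>R y) (A2 *v U) x"
      for x U y unfolding T1.tau_mv T2.tau_mv by (simp_all add: a1 a2)
    have FT: "Fh (?T1 *v U) V = - Fh U (?T1 *v V)" for U V
    proof -
      obtain x Z y x' Z' y' where "U = bvec x Z y" "V = bvec x' Z' y'" using bvec_exists by metis
      then show ?thesis by (simp add: m1 Fh_bvec h_so_star [OF T1.A])
    qed
    define e :: "quat^('n ext)" where "e = bvec 1 0 0"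
    have Te: "?T1 *v e = bvec 0 0 1" "?T2 *v e = bvec 0 0 1" by (simp_all add: e_def m1 m2)
    have e: "Fh e e = 0" "Fh e (?T1 *v e) = 1" "Fh e (?T2 *v e) = 1" unfolding Te by (simp_all add: e_def Fh_bvec)
    have Ge: "Fh (G *v e) (G *v e) = 0" "Fh (G *v e) (?T1 *v (G *v e)) = 1"
      by (simp_all only: FG e flip: GT)
    have TT: "?T1 *v (?T1 *v U) = d1 *\<^sub>R U" for U using sq p1 a1 by simp
    obtain S q where S: "norm q = 1" "S *v (G *v e) = e \<cdot> q" "S ** ?T1 = ?T1 ** S"
      "\<And>U V. Fh (S *v U) (S *v V) = Fh U V"
      \<comment> \<open>The quasi-reflection brings \<open>G *v e\<close> back to the line of
        \<open>e\<close>.\<close>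
      using quasi_reflection [OF Fh_skew FT TT Ge e(1,2)] by blast
    define H where "H V = S *v (G *v V)" for V
    have FH: "Fh (H U) (H V) = Fh U V" for U V by (simp add: H_def S(4) FG)
    have HT: "H (?T2 *v V) = ?T1 *v H V" for V
      using arg_cong [OF S(3), of "\<lambda>M. M *v (G *v V)"] by (simp add: H_def GT flip: matrix_vector_mul_assoc)
    \<comment> \<open>Commuting with \<open>\<tau>\<close>, the corrected map \<open>H\<close> also
      preserves the line of the last basis vector, which is the image of \<open>e\<close>. It
      therefore preserves the middle block, their orthogonal complement, and its restriction there
      is the desired isometry.\<close>
    have He: "H e = bvec q 0 0" by (simp add: H_def S(2)) (simp add: e_def bvec_ops)
    have HTe: "H (bvec 0 0 1) = bvec 0 0 q" using HT [of e] by (simp add: He Te(2) m1)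
    have "\<exists>Y. H (bvec 0 Z 0) = bvec 0 Y 0" for Z
    proof -
      obtain x Y y where Y: "H (bvec 0 Z 0) = bvec x Y y" using bvec_exists by blast
      have "Fh (H e) (bvec x Y y) = 0" "Fh (H (bvec 0 0 1)) (bvec x Y y) = 0"
        unfolding Y [symmetric] FH by (simp_all add: e_def Fh_bvec)
      then have "qcnj q * y = 0" "qcnj q * x = 0" unfolding He HTe by (simp_all add: Fh_bvec)
      then show ?thesis using S(1) Y by auto
    qed
    then obtain f where f: "\<And>Z. H (bvec 0 Z 0) = bvec 0 (f Z) 0" by metis
    have "f (X + Y) = f X + f Y" for X Y
    proof -
      have "H (bvec 0 X 0 + bvec 0 Y 0) = H (bvec 0 X 0) + H (bvec 0 Y 0)" by (simp add: H_def matrix_vector_right_distrib)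
      then show ?thesis by (simp add: bvec_ops(1) f)
    qed
    moreover have "f (X \<cdot> r) = f X \<cdot> r" for X r
    proof -
      have "H (bvec 0 X 0 \<cdot> r) = H (bvec 0 X 0) \<cdot> r" by (simp add: H_def mv_vscale)
      then show ?thesis by (simp add: bvec_ops(5) f)
    qed
    ultimately obtain g where g: "\<And>X. f X = g *v X" using Hlinear_matrix [of f] by blast
    have "isometry g"
      unfolding isometry_def
    proof (intro allI)
      fix X Y show "h (g *v X) (g *v Y) = h X Y"
        using FH [of "bvec 0 X 0" "bvec 0 Y 0"] by (simp add: f g Fh_bvec)
    qed
    moreover have "A1 ** g = g ** A2"
    proof (rule matrix_eqI)
      fix X show "(A1 ** g) *v X = (g ** A2) *v X"
        using HT [of "bvec 0 X 0"] by (simp add: m1 m2 f g flip: matrix_vector_mul_assoc)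
    qed
    ultimately show ?thesis unfolding equivalent_def
      by (intro exI [of _ g] exI [of _ 1] exI [of _ "1 :: real"]) (simp add: a1 a2)
  qed
qed

text \<open>The element is block diagonal with blocks \<open>sqrt s\<close> times \<open>p\<close>,
  \<open>g\<close> and \<open>p\<close> divided by \<open>sqrt s\<close>. The quotient of the two
  outer factors is \<open>s\<close>, as the entry 1 of both \<open>\<tau>\<close> demands.\<close>

lemma block_intertwiner:
  assumes p1: "symmetric_pair j A1 a1 d1" and p2: "symmetric_pair j A2 a2 d2"
    and g: "isometry g" and p: "norm p = 1" and s: "s > 0"
    and A: "A1 ** g = s *\<^sub>R (g ** A2)" and a: "a1 * p = s *\<^sub>R (p * a2)"
  shows "\<exists>G\<in>SO_star_ext j. tau a1 A1 d1 ** G = s *\<^sub>R (G ** tau a2 A2 d2)"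
proof -
  interpret T1: symmetric_pair j A1 a1 d1 by (rule p1)
  interpret T2: symmetric_pair j A2 a2 d2 by (rule p2)
  obtain g' where g': "\<And>X. g *v (g' *v X) = X" "\<And>X. g' *v (g *v X) = X" using isometry_inv [OF g] by metis
  have "A1 ** g = g ** (s *\<^sub>R A2)" "a1 * p = p * (s *\<^sub>R a2)" using A a by (simp_all add: matrix_scaleR_mult)
  note b = bop_isometry [OF g p this]
  define X :: "quat^'n" where "X = axis undefined 1"
  have X: "X \<noteq> 0" by (simp add: X_def axis_eq_0_iff)
  \<comment> \<open>Since \<open>d\<close> is the scalar square of \<open>bop\<close>, the relation
    between the pairs forces \<open>d1 = s^2 d2\<close>.\<close>
  have "d1 *\<^sub>R ((g *v X) \<cdot> qcnj p) = bop A1 a1 (bop A1 a1 ((g *v X) \<cdot> qcnj p))" by (rule T1.square [symmetric])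
  also have "\<dots> = (s\<^sup>2 * d2) *\<^sub>R ((g *v X) \<cdot> qcnj p)"
    unfolding b bop_scaleR bop_add T2.square by (simp add: mv_scaleR vscale_scaleR power2_eq_square)
  finally have "(d1 - s\<^sup>2 * d2) *\<^sub>R ((g *v X) \<cdot> qcnj p) = 0" by (simp only: scaleR_diff_left) simp
  moreover have "g *v X \<noteq> 0" using X g'(2) [of X] by (metis matrix_vector_mult_0_right)
  moreover have "p \<noteq> 0" using p by auto
  ultimately have d: "d1 = s\<^sup>2 * d2" by simp
  have ss: "s = sqrt s * sqrt s" "sqrt s > 0" using s by simp_all
  obtain G where G: "G \<in> SO_star_ext j"
    "\<And>x Z y. G *v bvec x Z y = bvec (sqrt s *\<^sub>R (p * x)) (g *v Z) ((1 / sqrt s) *\<^sub>R (p * y))"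
    using SO_star_ext_block [OF g p ss(2)] by blast
  have s1: "s * (1 / sqrt s) = sqrt s" using s by (simp add: real_div_sqrt)
  have s2: "s\<^sup>2 * d2 * (1 / sqrt s) = s * (sqrt s * d2)" using s by (simp add: real_div_sqrt power2_eq_square field_simps)
  have ap: "a1 * (p * z) = s *\<^sub>R (p * (a2 * z))" for z by (simp add: a flip: mult.assoc)
  have Ag: "A1 *v (g *v Z) = s *\<^sub>R (g *v (A2 *v Z))" for Z
    using A by (metis matrix_vector_mul_assoc scaleR_mv)
  have "tau a1 A1 d1 *v (G *v bvec x Z y) = s *\<^sub>R (G *v (tau a2 A2 d2 *v bvec x Z y))" for x Z y
  proof -
    have "a1 * (sqrt s *\<^sub>R (p * x)) + d1 *\<^sub>R ((1 / sqrt s) *\<^sub>R (p * y)) = s *\<^sub>R (sqrt s *\<^sub>R (p * (a2 * x + d2 *\<^sub>R y)))"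
      using s2 by (simp add: ap d distrib_left scaleR_add_right mult.commute del: times_divide_eq_right)
    moreover have "sqrt s *\<^sub>R (p * x) + a1 * ((1 / sqrt s) *\<^sub>R (p * y)) = s *\<^sub>R ((1 / sqrt s) *\<^sub>R (p * (x + a2 * y)))"
    proof -
      have "a1 * ((1 / sqrt s) *\<^sub>R (p * y)) = (1 / sqrt s) *\<^sub>R (a1 * (p * y))" by simp
      also have "\<dots> = (s * (1 / sqrt s)) *\<^sub>R (p * (a2 * y))" unfolding ap by (simp only: scaleR_scaleR mult.commute)
      finally show ?thesis by (simp only: s1 scaleR_scaleR distrib_left scaleR_add_right)
    qed
    ultimately show ?thesis unfolding T1.tau_mv T2.tau_mv G(2) bvec_ops bvec_inject using Ag by simp
  qed
  then have "tau a1 A1 d1 ** G = s *\<^sub>R (G ** tau a2 A2 d2)"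
    by (intro ext_matrix_eqI) (simp add: scaleR_mv flip: matrix_vector_mul_assoc)
  then show ?thesis using G(1) by blast
qed

theorem conj_class_eq_iff:
  assumes p1: "symmetric_pair j A1 a1 d1" and p2: "symmetric_pair j A2 a2 d2"
  shows "conj_class j (oriented_line (tau a1 A1 d1)) = conj_class j (oriented_line (tau a2 A2 d2)) \<longleftrightarrow> equivalent A1 a1 A2 a2"
proof
  assume "conj_class j (oriented_line (tau a1 A1 d1)) = conj_class j (oriented_line (tau a2 A2 d2))"
  from conj_class_eqD [OF this [symmetric]]
  obtain G s where G: "G \<in> SO_star_ext j" and s: "s > 0" and eq: "G ** tau a2 A2 d2 = s *\<^sub>R (tau a1 A1 d1 ** G)" by blast
  \<comment> \<open>The multiple \<open>s \<tau>\<close> has the wrong bottom left entry. A diagonal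
    element conjugates it to the normalised matrix of the scaled pair, to which
    \<open>intertwiner_equivalent\<close> applies.\<close>
  note sc = symmetric_pair.scaled [OF p1, of s]
  have "(s *\<^sub>R A1) ** mat 1 = s *\<^sub>R (mat 1 ** A1)" "(s *\<^sub>R a1) * 1 = s *\<^sub>R (1 * a1)" by simp_all
  from block_intertwiner [OF sc p1 isometry_one norm_one s this]
  obtain H where H: "H \<in> SO_star_ext j" "tau (s *\<^sub>R a1) (s *\<^sub>R A1) (s\<^sup>2 * d1) ** H = s *\<^sub>R (H ** tau a1 A1 d1)"
    by blast
  have "(H ** G) ** tau a2 A2 d2 = H ** (s *\<^sub>R (tau a1 A1 d1 ** G))" by (simp only: eq flip: matrix_mul_assoc)
  also have "\<dots> = s *\<^sub>R (H ** tau a1 A1 d1) ** G" by (simp add: matrix_scaleR_mult matrix_mul_assoc)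
  also have "\<dots> = tau (s *\<^sub>R a1) (s *\<^sub>R A1) (s\<^sup>2 * d1) ** (H ** G)" by (simp only: matrix_mul_assoc flip: H(2))
  finally have HG: "(H ** G) ** tau a2 A2 d2 = tau (s *\<^sub>R a1) (s *\<^sub>R A1) (s\<^sup>2 * d1) ** (H ** G)" .
  have "H ** G \<in> SO_star_ext j" using H(1) G by (simp add: SO_star_ext_iff flip: matrix_vector_mul_assoc)
  from intertwiner_equivalent [OF sc p2 this HG]
  obtain g p r where g: "isometry g" "norm p = 1" "r > 0"
    and A: "(s *\<^sub>R A1) ** g = r *\<^sub>R (g ** A2)" and a: "(s *\<^sub>R a1) * p = r *\<^sub>R (p * a2)"
    unfolding equivalent_def by blast
  have "A1 ** g = (1/s) *\<^sub>R ((s *\<^sub>R A1) ** g)" "a1 * p = (1/s) *\<^sub>R ((s *\<^sub>R a1) * p)"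
    using s by (simp_all add: matrix_scaleR_mult)
  then have "A1 ** g = (r / s) *\<^sub>R (g ** A2)" "a1 * p = (r / s) *\<^sub>R (p * a2)" unfolding A a by simp_all
  then show "equivalent A1 a1 A2 a2" unfolding equivalent_def using g s
    by (intro exI [of _ g] exI [of _ p] exI [of _ "r / s"]) simp
next
  assume "equivalent A1 a1 A2 a2"
  then obtain g p s where "isometry g" "norm p = 1" and s: "s > 0"
    and "A1 ** g = s *\<^sub>R (g ** A2)" "a1 * p = s *\<^sub>R (p * a2)"
    unfolding equivalent_def by blast
  then obtain G where G: "G \<in> SO_star_ext j" "tau a1 A1 d1 ** G = s *\<^sub>R (G ** tau a2 A2 d2)"
    using block_intertwiner [OF p1 p2] by blast
  have eq1: "G ** tau a2 A2 d2 = (1/s) *\<^sub>R (tau a1 A1 d1 ** G)" using G(2) s by simp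
  define G' where "G' = matrix_inv G"
  have G': "G ** G' = mat 1" "G' ** G = mat 1" "G' \<in> SO_star_ext j" using SO_star_ext_inv [OF G(1)] by (simp_all add: G'_def)
  have "G' ** tau a1 A1 d1 = G' ** (tau a1 A1 d1 ** G) ** G'" by (simp add: G' flip: matrix_mul_assoc)
  also have "\<dots> = s *\<^sub>R (tau a2 A2 d2 ** G')" unfolding G(2) by (simp add: matrix_scaleR_mult matrix_mul_assoc G')
  finally have eq2: "G' ** tau a1 A1 d1 = s *\<^sub>R (tau a2 A2 d2 ** G')" .
  have s1: "1 / s > 0" using s by simp
  have c1: "conj_class j (oriented_line (tau a1 A1 d1)) \<subseteq> conj_class j (oriented_line (tau a2 A2 d2))"
    by (rule conj_class_eqI [OF G'(3) s eq2])
  have c2: "conj_class j (oriented_line (tau a2 A2 d2)) \<subseteq> conj_class j (oriented_line (tau a1 A1 d1))"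
    by (rule conj_class_eqI [OF G(1) s1 eq1])
  show "conj_class j (oriented_line (tau a1 A1 d1)) = conj_class j (oriented_line (tau a2 A2 d2))"
    by (rule equalityI [OF c1 c2])
qed

end

section \<open>The bijection\<close>

context symmetric_pair begin

lemma admissible: "admissible j a A d"
  unfolding admissible_def
proof (intro conjI allI A a)
  fix X
  have "bop A a (bop A a X) = (A ** A) *v X - 2 *\<^sub>R ((A *v X) \<cdot> a) + X \<cdot> a\<^sup>2"
    by (simp add: bop_def vscale_distrib mv_vscale vscale_assoc power2_eq_square scaleR_2
        matrix_vector_mult_diff_distrib flip: matrix_vector_mul_assoc)
  then show "X \<cdot> of_real d + 2 *\<^sub>R ((A *v X) \<cdot> a) - X \<cdot> a\<^sup>2 - (A ** A) *v X = 0"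
    using square [of X] by (simp add: vscale_scaleR)
qed

text \<open>\<open>families\<close> ranges over triples on \<open>nat \<Rightarrow> real\<close>, so
  the model is copied there by its Euclidean coordinates.\<close>

lemma model_exists:
  "\<exists>(T :: (nat \<Rightarrow> real) qsh) u. qsh_tila T \<and> m_dim T = 4 * CARD('n) \<and> framed A a T u"
proof -
  obtain b :: "nat \<Rightarrow> 'n qmodel" where b: "bij_betw b {0..<card (Basis :: 'n qmodel set)} Basis"
    using ex_bij_betw_nat_finite finite_Basis by blast
  define \<iota> :: "'n qmodel \<Rightarrow> nat \<Rightarrow> real" where "\<iota> x k = inner x (b k)" for x k
  have inj: "inj \<iota>"
  proof (rule injI, rule euclidean_eqI)
    fix x y i :: "'n qmodel" assume eq: "\<iota> x = \<iota> y" and i: "i \<in> Basis"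
    then obtain k where "i = b k" using b by (auto simp: bij_betw_def)
    then show "inner x i = inner y i" using fun_cong [OF eq, of k] by (simp add: \<iota>_def)
  qed
  define \<iota>' where "\<iota>' = inv_into UNIV \<iota>"
  have \<iota>': "\<iota>' (\<iota> x) = x" for x using inj by (simp add: \<iota>'_def)
  define T :: "(nat \<Rightarrow> real) qsh" where
    "T = \<lparr>alg = \<lparr>carrier = \<iota> ` gset A a, mult = undefined, one = undefined, zero = \<iota> 0,
        add = \<lambda>x y. \<iota> (\<iota>' x + \<iota>' y), smult = \<lambda>r x. \<iota> (r *\<^sub>R \<iota>' x), lie = \<lambda>x y. \<iota> (brk A a (\<iota>' x) (\<iota>' y))\<rparr>,
      invol = \<lambda>x. \<iota> (fst (\<iota>' x), - snd (\<iota>' x)),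
      qstr = {J \<in> extensional (range (\<lambda>X. \<iota> (0, X))). \<exists>q\<in>sp1. \<forall>X. J (\<iota> (0, X)) = \<iota> (0, X \<cdot> q)},
      form = \<lambda>x y. - 2 * qRe (h (snd (\<iota>' x)) (snd (\<iota>' y)))\<rparr>"
  have "canonical A a T \<iota>"
    unfolding canonical_def chart_def T_def
    using inj by (auto simp: \<iota>' subspace_gset bij_betw_def intro: inj_on_subset)
  moreover have "qstr T = {J \<in> extensional (range (\<lambda>X. \<iota> (0, X))). \<exists>q\<in>sp1. \<forall>X. J (\<iota> (0, X)) = \<iota> (0, X \<cdot> q)}"
    "form T (\<iota> (0, X)) (\<iota> (0, Y)) = - 2 * qRe (h X Y)" for X Y
    by (simp_all add: T_def \<iota>')
  ultimately show ?thesis using canonical_qsh [of T \<iota>] by blast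
qed

end

section \<open>Families expressed through frames\<close>

context skew_form begin

text \<open>By \<open>iso_class_framed\<close> this is the isomorphism class of any triple with a
  frame for (A, a), which therefore depends on the pair only.\<close>

definition frame_class :: "quat^'n^'n \<Rightarrow> quat \<Rightarrow> (nat \<Rightarrow> real) qsh set" where
  "frame_class A a = {T. qsh_tila T \<and> (\<exists>u. framed A a T u)}"

definition frame_family :: "quat^'n^'n \<Rightarrow> quat \<Rightarrow> (nat \<Rightarrow> real) qsh set set" where
  "frame_family A a = {frame_class (s *\<^sub>R A) (s *\<^sub>R a) | s. s > 0}"

lemma iso_class_framed:
  assumes sp: "symmetric_pair j A a d" and t: "tila (alg T) (invol T)" and fr: "framed A a T u"
  shows "iso_class T = frame_class A a"
proof (intro equalityI subsetI)
  fix T' assume "T' \<in> iso_class T"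
  then have T': "qsh_tila T'" "qsh_iso T' T" by (auto simp: iso_class_def)
  then have "tila (alg T') (invol T')" by (simp add: qsh_tila_def)
  from frame_pullback [OF this t T'(2) fr] show "T' \<in> frame_class A a" using T'(1) by (simp add: frame_class_def)
next
  fix T' assume "T' \<in> frame_class A a"
  then obtain u' where T': "qsh_tila T'" "framed A a T' u'" by (auto simp: frame_class_def)
  then have "tila (alg T') (invol T')" by (simp add: qsh_tila_def)
  from symmetric_pair.iso_of_frames [OF sp this t T'(2) fr]
  show "T' \<in> iso_class T" using T'(1) by (simp add: iso_class_def)
qed

lemma family_framed:
  assumes sp: "symmetric_pair j A a d" and t: "tila (alg T) (invol T)" and fr: "framed A a T u"
  shows "one_param_family T = frame_family A a"
proof -
  \<comment> \<open>Multiplying the form by \<open>exp (2 * t)\<close> is division by the square of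
    \<open>exp (- t)\<close>, so \<open>frame_scale\<close> multiplies the pair by
    \<open>exp (- 2 * t)\<close>; these factors exhaust the positive reals.\<close>
  have cl: "iso_class (T\<lparr>form := \<lambda>x y. exp (2 * t) * form T x y\<rparr>) = frame_class (exp (- 2 * t) *\<^sub>R A) (exp (- 2 * t) *\<^sub>R a)" for t
  proof -
    have e: "(exp (- t))\<^sup>2 = exp (- 2 * t)" by (simp add: exp_double [symmetric])
    have f: "(\<lambda>x y. form T x y / exp (- 2 * t)) = (\<lambda>x y. exp (2 * t) * form T x y)"
      by (simp add: exp_minus field_simps)
    have "framed (exp (- 2 * t) *\<^sub>R A) (exp (- 2 * t) *\<^sub>R a) (T\<lparr>form := \<lambda>x y. exp (2 * t) * form T x y\<rparr>) (\<lambda>X. u (exp (- t) *\<^sub>R X))"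
      using frame_scale [OF fr, of "exp (- t)"] unfolding e f by simp
    then show ?thesis
      using symmetric_pair.scaled [OF sp, of "exp (- 2 * t)"] assms(2) by (intro iso_class_framed) auto
  qed
  have "\<exists>t. s = exp (- 2 * t)" if "s > 0" for s :: real
    by (rule exI [of _ "- ln s / 2"]) (use that in simp)
  then show ?thesis unfolding one_param_family_def frame_family_def cl
    by (intro equalityI subsetI) (force, blast)
qed

lemma frame_class_eqI:
  assumes p1: "symmetric_pair j A1 a1 d1" and p2: "symmetric_pair j A2 a2 d2"
    and "isometry g" "norm p = 1" "A1 ** g = g ** A2" "a1 * p = p * a2"
  shows "frame_class A1 a1 = frame_class A2 a2"
proof -
  obtain T :: "(nat \<Rightarrow> real) qsh" and u where T: "qsh_tila T" "framed A1 a1 T u"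
    using symmetric_pair.model_exists [OF p1] by blast
  then have t: "tila (alg T) (invol T)" by (simp add: qsh_tila_def)
  show ?thesis
    using iso_class_framed [OF p1 t T(2)] iso_class_framed [OF p2 t frame_isometry [OF assms(3-6) T(2)]] by simp
qed

text \<open>A common member of two classes has a frame for each pair, and \<open>two_frames\<close>
  compares them. The scaling inside a family accounts for the positive factor.\<close>

lemma frame_family_eq_iff:
  assumes p1: "symmetric_pair j A1 a1 d1" and p2: "symmetric_pair j A2 a2 d2"
  shows "frame_family A1 a1 = frame_family A2 a2 \<longleftrightarrow> equivalent A1 a1 A2 a2"
proof
  assume eq: "frame_family A1 a1 = frame_family A2 a2"
  have "frame_class (1 *\<^sub>R A1) (1 *\<^sub>R a1) \<in> frame_family A1 a1"
    unfolding frame_family_def mem_Collect_eq by (intro exI [of _ 1] conjI refl) simp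
  then have "frame_class A1 a1 \<in> frame_family A2 a2" by (simp add: eq)
  then obtain s where s: "s > 0" "frame_class A1 a1 = frame_class (s *\<^sub>R A2) (s *\<^sub>R a2)"
    unfolding frame_family_def by blast
  obtain T :: "(nat \<Rightarrow> real) qsh" and u where T: "qsh_tila T" "framed A1 a1 T u"
    using symmetric_pair.model_exists [OF p1] by blast
  then have "T \<in> frame_class A1 a1" unfolding frame_class_def by blast
  then have "T \<in> frame_class (s *\<^sub>R A2) (s *\<^sub>R a2)" by (simp only: s(2))
  then obtain v where v: "framed (s *\<^sub>R A2) (s *\<^sub>R a2) T v" unfolding frame_class_def by blast
  note sc = symmetric_pair.scaled [OF p2, of s]
  obtain g p where "isometry g" "norm p = 1" "A1 ** g = g ** (s *\<^sub>R A2)" "a1 * p = p * (s *\<^sub>R a2)"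
    using two_frames [OF symmetric_pair.A [OF p1] symmetric_pair.a [OF p1] symmetric_pair.A [OF sc] symmetric_pair.a [OF sc] T(2) v]
    by blast
  then show "equivalent A1 a1 A2 a2"
    unfolding equivalent_def using s(1) by (intro exI [of _ g] exI [of _ p] exI [of _ s]) (simp add: matrix_scaleR_mult)
next
  assume "equivalent A1 a1 A2 a2"
  then obtain g p s where g: "isometry g" "norm p = 1" and s: "s > 0"
    and A: "A1 ** g = s *\<^sub>R (g ** A2)" and a: "a1 * p = s *\<^sub>R (p * a2)"
    unfolding equivalent_def by blast
  have c: "frame_class (r *\<^sub>R A1) (r *\<^sub>R a1) = frame_class ((r * s) *\<^sub>R A2) ((r * s) *\<^sub>R a2)" for r
    by (rule frame_class_eqI [OF symmetric_pair.scaled [OF p1] symmetric_pair.scaled [OF p2] g])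
      (simp_all add: matrix_scaleR_mult A a)
  show "frame_family A1 a1 = frame_family A2 a2"
  proof (intro equalityI subsetI)
    fix C assume "C \<in> frame_family A1 a1"
    then obtain r where "r > 0" "C = frame_class (r *\<^sub>R A1) (r *\<^sub>R a1)" by (auto simp: frame_family_def)
    then show "C \<in> frame_family A2 a2" unfolding frame_family_def c using s mult_pos_pos by blast
  next
    fix C assume "C \<in> frame_family A2 a2"
    then obtain r where r: "r > 0" "C = frame_class (r *\<^sub>R A2) (r *\<^sub>R a2)" by (auto simp: frame_family_def)
    then have "C = frame_class ((r / s) *\<^sub>R A1) ((r / s) *\<^sub>R a1)" unfolding c using s by simp
    moreover have "r / s > 0" using r s by simp
    ultimately show "C \<in> frame_family A1 a1" unfolding frame_family_def by blast
  qed
qed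

text \<open>One inclusion is the existence of frames, the other the existence of a model for each
  admissible pair.\<close>

lemma families_eq:
  assumes "CARD('n) > 1"
  shows "families CARD('n) = {frame_family A a | a A d. admissible j a A d}"
proof (intro equalityI subsetI)
  fix C assume "C \<in> families CARD('n)"
  then obtain T :: "(nat \<Rightarrow> real) qsh" where T: "C = one_param_family T" "qsh_tila T" "m_dim T = 4 * CARD('n)"
    by (auto simp: families_def)
  obtain u A a d where u: "symmetric_pair j A a d" "framed A a T u" using frame_exists [OF assms T(2,3)] by blast
  have "tila (alg T) (invol T)" using T(2) by (simp add: qsh_tila_def)
  from family_framed [OF u(1) this u(2)] have "C = frame_family A a" by (simp only: T(1))
  then show "C \<in> {frame_family A a | a A d. admissible j a A d}"
    using symmetric_pair.admissible [OF u(1)] by blast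
next
  fix C assume "C \<in> {frame_family A a | a A d. admissible j a A d}"
  then obtain A a d where C: "C = frame_family A a" "admissible j a A d" by blast
  note sp = admissible_symmetric_pair [OF C(2)]
  obtain T :: "(nat \<Rightarrow> real) qsh" and u where T: "qsh_tila T" "m_dim T = 4 * CARD('n)" "framed A a T u"
    using symmetric_pair.model_exists [OF sp] by blast
  have "tila (alg T) (invol T)" using T(1) by (simp add: qsh_tila_def)
  from family_framed [OF sp this T(3)] have "C = one_param_family T" by (simp only: C(1))
  then show "C \<in> families CARD('n)" unfolding families_def using T by blast
qed

end

lemma bij_betw_equal_fibres:
  assumes "\<And>x y. x \<in> D \<Longrightarrow> y \<in> D \<Longrightarrow> f x = f y \<longleftrightarrow> g x = g y"
  shows "\<exists>\<Phi>. bij_betw \<Phi> (f ` D) (g ` D) \<and> (\<forall>x\<in>D. \<Phi> (f x) = g x)"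
proof -
  define \<Phi> where "\<Phi> y = g (inv_into D f y)" for y
  have \<Phi>: "\<Phi> (f x) = g x" if "x \<in> D" for x
    unfolding \<Phi>_def using that by (subst assms [symmetric]) (auto intro: inv_into_into f_inv_into_f)
  have "inj_on \<Phi> (f ` D)" by (rule inj_onI) (use assms \<Phi> in auto)
  moreover have "\<Phi> ` f ` D = g ` D" using \<Phi> by (auto simp: image_image)
  ultimately show ?thesis using \<Phi> by (auto simp: bij_betw_def)
qed

theorem proposition5p1:
  fixes j :: "quat^'n^'n"
  assumes "CARD('n) > 1"
    and "adj j = - j" and "invertible j"
  shows "(\<exists>\<Phi>. bij_betw \<Phi> (families CARD('n)) (subalgebra_classes j) \<and>
            (\<forall>a A d. admissible j a A d \<longrightarrow>
               one_param_family (assoc_qsh j a A d) \<in> families CARD('n) \<and>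
               \<Phi> (one_param_family (assoc_qsh j a A d)) = conj_class j (oriented_line (tau a A d)))) \<and>
         (\<forall>a A d. admissible j a A d \<longrightarrow>
            tau a A d \<in> so_star_ext j \<and>
            range (m_elem j a A) \<subseteq> centralizer j (tau a A d) \<and>
            qsh_tila (assoc_qsh j a A d) \<and>
            m_dim (assoc_qsh j a A d) = 4 * CARD('n) \<and>
            m_part (assoc_qsh j a A d) =
              (\<lambda>M. span {tau a A d} +>\<^bsub>matrix_lie (centralizer j (tau a A d))\<^esub> M) ` range (m_elem j a A))"
proof
  interpret skew_form j by unfold_locales (fact assms)+
  let ?D = "{(a, A, d). admissible j a A d}"
  let ?f = "\<lambda>(a, A, d). frame_family A a" and ?g = "\<lambda>(a, A, d). conj_class j (oriented_line (tau a A d))"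
  have sp: "symmetric_pair j A a d" if "admissible j a A d" for a A d
    using that by (rule admissible_symmetric_pair)
  \<comment> \<open>Families and conjugacy classes are both images of the set of admissible triples.
    The two maps have the same fibres, as equality means \<open>equivalent\<close> for either of
    them.\<close>
  have "?f x = ?f y \<longleftrightarrow> ?g x = ?g y" if "x \<in> ?D" "y \<in> ?D" for x y
  proof -
    obtain a A d b B e where xy: "x = (a, A, d)" "y = (b, B, e)" by (metis prod_cases3)
    with that have ad: "admissible j a A d" "admissible j b B e" by simp_all
    show ?thesis
      unfolding xy prod.case frame_family_eq_iff [OF sp [OF ad(1)] sp [OF ad(2)]]
        conj_class_eq_iff [OF sp [OF ad(1)] sp [OF ad(2)]] ..
  qed
  then obtain \<Phi> where \<Phi>: "bij_betw \<Phi> (?f ` ?D) (?g ` ?D)" "\<forall>x\<in>?D. \<Phi> (?f x) = ?g x"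
    using bij_betw_equal_fibres [of ?D ?f ?g] by blast
  have fD: "?f ` ?D = families CARD('n)" unfolding families_eq [OF assms(1)] by (auto simp: image_iff)
  have gD: "?g ` ?D = subalgebra_classes j" unfolding subalgebra_classes_def by (auto simp: image_iff)
  have fam: "one_param_family (assoc_qsh j a A d) = frame_family A a" if "admissible j a A d" for a A d
  proof -
    interpret S: symmetric_pair j A a d by (rule sp [OF that])
    show ?thesis
      using family_framed [OF sp [OF that] _ S.assoc_tila(2)] S.assoc_tila(1) by (simp add: qsh_tila_def)
  qed
  have "one_param_family (assoc_qsh j a A d) \<in> families CARD('n) \<and>
      \<Phi> (one_param_family (assoc_qsh j a A d)) = conj_class j (oriented_line (tau a A d))"
    if "admissible j a A d" for a A d
    unfolding fam [OF that] families_eq [OF assms(1)] using \<Phi>(2) that by auto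
  then show "\<exists>\<Phi>. bij_betw \<Phi> (families CARD('n)) (subalgebra_classes j) \<and>
      (\<forall>a A d. admissible j a A d \<longrightarrow>
         one_param_family (assoc_qsh j a A d) \<in> families CARD('n) \<and>
         \<Phi> (one_param_family (assoc_qsh j a A d)) = conj_class j (oriented_line (tau a A d)))"
    using \<Phi>(1) unfolding fD gD by blast
  show "\<forall>a A d. admissible j a A d \<longrightarrow>
      tau a A d \<in> so_star_ext j \<and>
      range (m_elem j a A) \<subseteq> centralizer j (tau a A d) \<and>
      qsh_tila (assoc_qsh j a A d) \<and>
      m_dim (assoc_qsh j a A d) = 4 * CARD('n) \<and>
      m_part (assoc_qsh j a A d) =
        (\<lambda>M. span {tau a A d} +>\<^bsub>matrix_lie (centralizer j (tau a A d))\<^esub> M) ` range (m_elem j a A)"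
  proof (intro allI impI)
    fix a A d assume "admissible j a A d"
    then interpret S: symmetric_pair j A a d by (rule sp)
    show "tau a A d \<in> so_star_ext j \<and>
      range (m_elem j a A) \<subseteq> centralizer j (tau a A d) \<and>
      qsh_tila (assoc_qsh j a A d) \<and>
      m_dim (assoc_qsh j a A d) = 4 * CARD('n) \<and>
      m_part (assoc_qsh j a A d) =
        (\<lambda>M. span {tau a A d} +>\<^bsub>matrix_lie (centralizer j (tau a A d))\<^esub> M) ` range (m_elem j a A)"
      using S.\<tau>_so_star_ext S.m_elem_centralizer S.assoc_tila(1,3) S.assoc_m_part
      unfolding S.\<tau>_def by blast
  qed
qed

end
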